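(* Let $n\geq m\geq 1$ and $n\geq 2$ be integers, and let $g\geq 0$, $h\geq 1$. The hairy graph homology $H_d\big(\mathrm{HGC}_{m,n}^{g\text{-loop},\,h\text{-hairs}}\big)$ is concentrated in the range (i.e., is zero for all $d$ outside the range) $$(n-m-2)(g+h-1)+(m-1)g+1\ \leq\ d\ \leq\ (n-m-2)(g+h-1)+mg+1 .$$
   Context: **Hairy graph complex.** $\mathrm{HGC}_{m,n}$ consists of formal $\mathbb{Q}$-linear series of isomorphism classes of connected graphs with (unlabelled) internal vertices of valence $\geq 3$ and $h\geq 1$ external legs ("hairs"); tadpoles and multiple edges are allowed, and the single edge with two hair ends and no internal vertex is allowed. A graph with $e$ edges (hairs counted as edges), $v$ internal vertices and $h$ hairs has homological degree $(n-1)e-nv-m(h-1)$. Graphs carry an orientation: an ordering, up to Koszul sign, of the set of edges (degree $n-1$), internal vertices (degree $-n$) and hair ends (degree $-m$), together with a direction of each edge, reversal giving the sign $(-1)^n$. The differential (degree $-1$) is the sum over internal vertices of all ways of splitting the vertex into two vertices, each of valence $\geq 3$, joined by an edge. $\mathrm{HGC}_{m,n}^{g\text{-loop},\,h\text{-hairs}}$ is the subcomplex spanned by graphs with first Betti number (loop number) $g$ and with $h$ hairs; it is preserved by the differential. *)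

theory Defs
  imports
    Complex_Main
    "HOL-Library.Poly_Mapping"
    "HOL-Combinatorics.Permutations"
    "HOL-Algebra.Elementary_Groups"
begin

section \<open>Hairy graphs\<close>

datatype hvertex = Internal nat | Hair nat

text \<open>
  \<open>HGraph v h es\<close> is a graph with internal vertices \<open>Internal 0, \<dots>, Internal (v - 1)\<close>, hair ends
  \<open>Hair 0, \<dots>, Hair (h - 1)\<close> and the directed edges \<open>es\<close>. The numbering of the edges (by list
  position), of the internal vertices and of the hair ends and the directions of the edges are the
  orientation data: such a graph stands for the oriented graph with orientation element
  \[ e_0 \wedge e_1 \wedge \dots \wedge v_0 \wedge v_1 \wedge \dots \wedge a_0 \wedge a_1 \wedge \dots \]
  where the edges \<open>e_k\<close> have degree \<open>n - 1\<close>, the internal vertices \<open>v_i\<close> degree \<open>- n\<close> and the hair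
  ends \<open>a_j\<close> degree \<open>- m\<close>. Dependence on the labels is removed by the subspace \<open>relations\<close> below.
\<close>

datatype hgraph =
  HGraph (num_internal: nat) (num_hairs: nat) (edges: "(hvertex \<times> hvertex) list")

definition vertices :: "hgraph \<Rightarrow> hvertex set" where
  "vertices G = Internal ` {..<num_internal G} \<union> Hair ` {..<num_hairs G}"

text \<open>
  The half-edge \<open>(k, False)\<close> is the source end and \<open>(k, True)\<close> the target end of the \<open>k\<close>-th edge;
  a tadpole contributes both of its half-edges to the vertex it is attached to.
\<close>

definition half_edges_at :: "hgraph \<Rightarrow> hvertex \<Rightarrow> (nat \<times> bool) set" where
  "half_edges_at G x =
     {(k, b). k < length (edges G) \<and> (if b then snd (edges G ! k) else fst (edges G ! k)) = x}"

definition valence :: "hgraph \<Rightarrow> hvertex \<Rightarrow> nat" where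
  "valence G x = card (half_edges_at G x)"

definition connected_hgraph :: "hgraph \<Rightarrow> bool" where
  "connected_hgraph G \<longleftrightarrow>
     (\<forall>x \<in> vertices G. \<forall>y \<in> vertices G. (x, y) \<in> (set (edges G) \<union> (set (edges G))\<inverse>)\<^sup>*)"

text \<open>
  Tadpoles, multiple edges and the single edge \<open>HGraph 0 2 [(Hair 0, Hair 1)]\<close> are allowed.
\<close>

definition is_hairy_graph :: "hgraph \<Rightarrow> bool" where
  "is_hairy_graph G \<longleftrightarrow>
     num_hairs G \<ge> 1 \<and>
     (\<forall>(x, y) \<in> set (edges G). x \<in> vertices G \<and> y \<in> vertices G) \<and>
     (\<forall>i < num_internal G. valence G (Internal i) \<ge> 3) \<and>
     (\<forall>j < num_hairs G. valence G (Hair j) = 1) \<and>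
     connected_hgraph G"

text \<open>The first Betti number of a connected graph; the hair ends count as univalent vertices.\<close>

definition loop_number :: "hgraph \<Rightarrow> int" where
  "loop_number G = int (length (edges G)) - int (card (vertices G)) + 1"

definition hdegree :: "int \<Rightarrow> int \<Rightarrow> hgraph \<Rightarrow> int" where
  "hdegree m n G =
     (n - 1) * int (length (edges G)) - n * int (num_internal G) - m * (int (num_hairs G) - 1)"

definition hairy_graphs :: "int \<Rightarrow> int \<Rightarrow> nat \<Rightarrow> nat \<Rightarrow> int \<Rightarrow> hgraph set" where
  "hairy_graphs m n g h d =
     {G. is_hairy_graph G \<and> loop_number G = int g \<and> num_hairs G = h \<and> hdegree m n G = d}"

section \<open>Rational chains\<close>

text \<open>
  For fixed loop number and number of hairs there are only finitely many labelled hairy graphs, so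
  formal series of graphs are the same as finite linear combinations.
\<close>

type_synonym hchain = "hgraph \<Rightarrow>\<^sub>0 rat"

definition chain_scale :: "rat \<Rightarrow> hchain \<Rightarrow> hchain" where
  "chain_scale c x = Poly_Mapping.map ((*) c) x"

lemma lookup_chain_scale: "Poly_Mapping.lookup (chain_scale c x) G = c * Poly_Mapping.lookup x G"
  by (simp add: chain_scale_def Poly_Mapping.map.rep_eq when_def)

global_interpretation hchain: vector_space chain_scale
  by unfold_locales
    (auto intro!: poly_mapping_eqI simp: lookup_chain_scale lookup_add algebra_simps)

definition hchains :: "int \<Rightarrow> int \<Rightarrow> nat \<Rightarrow> nat \<Rightarrow> int \<Rightarrow> hchain set" where
  "hchains m n g h d = {x. Poly_Mapping.keys x \<subseteq> hairy_graphs m n g h d}"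

section \<open>Orientations\<close>

primrec relabel :: "(nat \<Rightarrow> nat) \<Rightarrow> (nat \<Rightarrow> nat) \<Rightarrow> hvertex \<Rightarrow> hvertex" where
  "relabel q r (Internal i) = Internal (q i)"
| "relabel q r (Hair j) = Hair (r j)"

definition flip_edges :: "nat set \<Rightarrow> ('a \<times> 'a) list \<Rightarrow> ('a \<times> 'a) list" where
  "flip_edges F es = map (\<lambda>k. if k \<in> F then prod.swap (es ! k) else es ! k) [0..<length es]"

text \<open>
  Renumber the edges by \<open>p\<close>, the internal vertices by \<open>q\<close> and the hair ends by \<open>r\<close>, then reverse
  the edges at the positions in \<open>F\<close>.
\<close>

definition reorient ::
  "(nat \<Rightarrow> nat) \<Rightarrow> (nat \<Rightarrow> nat) \<Rightarrow> (nat \<Rightarrow> nat) \<Rightarrow> nat set \<Rightarrow> hgraph \<Rightarrow> hgraph" where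
  "reorient p q r F G = HGraph (num_internal G) (num_hairs G)
     (flip_edges F (permute_list p (map (map_prod (relabel q r) (relabel q r)) (edges G))))"

text \<open>The Koszul sign of a permutation, of sign \<open>s\<close>, of elements that all have degree \<open>k\<close>.\<close>

definition koszul_sign :: "int \<Rightarrow> int \<Rightarrow> rat" where
  "koszul_sign k s = (if even k then 1 else of_int s)"

definition orientation_sign ::
  "int \<Rightarrow> int \<Rightarrow> (nat \<Rightarrow> nat) \<Rightarrow> (nat \<Rightarrow> nat) \<Rightarrow> (nat \<Rightarrow> nat) \<Rightarrow> nat set \<Rightarrow> rat" where
  "orientation_sign m n p q r F =
     koszul_sign (n - 1) (sign p) * koszul_sign (- n) (sign q) * koszul_sign (- m) (sign r)
     * koszul_sign n ((- 1) ^ card F)"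

definition relations :: "int \<Rightarrow> int \<Rightarrow> nat \<Rightarrow> nat \<Rightarrow> int \<Rightarrow> hchain set" where
  "relations m n g h d = hchain.span
     {Poly_Mapping.single (reorient p q r F G) 1
        - Poly_Mapping.single G (orientation_sign m n p q r F) | p q r F G.
      G \<in> hairy_graphs m n g h d \<and>
      p permutes {..<length (edges G)} \<and> q permutes {..<num_internal G} \<and>
      r permutes {..<num_hairs G} \<and> F \<subseteq> {..<length (edges G)}}"

section \<open>Vertex splitting\<close>

text \<open>
  The half-edges in \<open>S\<close> are moved from the vertex \<open>Internal i\<close> to a new vertex, numbered last; the
  connecting edge is numbered first and points to the new vertex. So the orientation of the result
  is \<open>e \<and> (old edges) \<and> (old internal vertices) \<and> (new vertex) \<and> (hair ends)\<close>, where the remaining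
  part of the split vertex takes the place of the old vertex. Exchanging the roles of the two parts
  reverses \<open>e\<close> and exchanges two vertices of degree \<open>- n\<close>, so the signs cancel. Placing the new
  elements elsewhere changes the differential only by a sign depending on the numbers of edges and
  vertices.
\<close>

definition split_vertex :: "nat \<Rightarrow> (nat \<times> bool) set \<Rightarrow> hgraph \<Rightarrow> hgraph" where
  "split_vertex i S G =
     (let w = Internal (num_internal G); es = edges G in
      HGraph (Suc (num_internal G)) (num_hairs G)
        ((Internal i, w) #
         map (\<lambda>k. (if (k, False) \<in> S then w else fst (es ! k),
                   if (k, True) \<in> S then w else snd (es ! k))) [0..<length es]))"

text \<open>Together with the connecting edge, both new vertices have valence at least three.\<close>

definition splittings :: "hgraph \<Rightarrow> nat \<Rightarrow> (nat \<times> bool) set set" where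
  "splittings G i =
     {S. S \<subseteq> half_edges_at G (Internal i) \<and>
         card S + 1 \<ge> 3 \<and> card (half_edges_at G (Internal i) - S) + 1 \<ge> 3}"

text \<open>
  A way of splitting is an unordered partition of the half-edges into two parts; the sum over the
  subsets \<open>S\<close> counts each of them twice, whence the factor \<open>1 / 2\<close>.
\<close>

definition diff_graph :: "hgraph \<Rightarrow> hchain" where
  "diff_graph G =
     (\<Sum>i < num_internal G. \<Sum>S \<in> splittings G i. Poly_Mapping.single (split_vertex i S G) (1 / 2))"

definition diff_chain :: "hchain \<Rightarrow> hchain" where
  "diff_chain x = (\<Sum>G \<in> Poly_Mapping.keys x. chain_scale (Poly_Mapping.lookup x G) (diff_graph G))"

section \<open>The hairy graph complex and its homology\<close>

text \<open>
  Quotients are formed as quotients of the underlying additive groups of rational vector spaces,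
  which gives the additive groups of the quotient vector spaces.
\<close>

definition hchain_group :: "int \<Rightarrow> int \<Rightarrow> nat \<Rightarrow> nat \<Rightarrow> int \<Rightarrow> hchain monoid" where
  "hchain_group m n g h d = \<lparr>carrier = hchains m n g h d, mult = (+), one = 0\<rparr>"

text \<open>The degree \<open>d\<close> part of the part of loop number \<open>g\<close> with \<open>h\<close> hairs.\<close>

definition HGC :: "int \<Rightarrow> int \<Rightarrow> nat \<Rightarrow> nat \<Rightarrow> int \<Rightarrow> hchain set monoid" where
  "HGC m n g h d = hchain_group m n g h d Mod relations m n g h d"

text \<open>
  The map from degree \<open>d\<close> to degree \<open>d - 1\<close> induced by \<open>diff_chain\<close>. The cosets in the union
  coincide, since \<open>diff_chain\<close> maps relations to relations.
\<close>

definition HGC_diff ::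
  "int \<Rightarrow> int \<Rightarrow> nat \<Rightarrow> nat \<Rightarrow> int \<Rightarrow> hchain set \<Rightarrow> hchain set" where
  "HGC_diff m n g h d X =
     (\<Union>x \<in> X. relations m n g h (d - 1) #>\<^bsub>hchain_group m n g h (d - 1)\<^esub> diff_chain x)"

definition HGC_cycles :: "int \<Rightarrow> int \<Rightarrow> nat \<Rightarrow> nat \<Rightarrow> int \<Rightarrow> hchain set set" where
  "HGC_cycles m n g h d =
     kernel (HGC m n g h d) (HGC m n g h (d - 1)) (HGC_diff m n g h d)"

definition HGC_boundaries :: "int \<Rightarrow> int \<Rightarrow> nat \<Rightarrow> nat \<Rightarrow> int \<Rightarrow> hchain set set" where
  "HGC_boundaries m n g h d = HGC_diff m n g h (d + 1) ` carrier (HGC m n g h (d + 1))"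

definition HGC_homology ::
  "int \<Rightarrow> int \<Rightarrow> nat \<Rightarrow> nat \<Rightarrow> int \<Rightarrow> hchain set set monoid" where
  "HGC_homology m n g h d =
     ((HGC m n g h d)\<lparr>carrier := HGC_cycles m n g h d\<rparr>) Mod HGC_boundaries m n g h d"

end

theory Submission
  imports Defs
begin

text \<open>
  Let \<open>v\<close> be the number of internal vertices of the graphs of degree \<open>d\<close> and \<open>t = g + h - 1\<close>, so that
  a graph has \<open>v + t\<close> edges and \<open>d\<close> determines \<open>v\<close>. Below the range the valence condition leaves no
  graphs, and the degrees above the range are those with \<open>v + 1 < t\<close>. There we show that the dual
  complex of cochains, functions on graphs that change by the orientation sign under isomorphisms,
  is exact at \<open>v\<close>; a rational functional vanishing on the boundaries but not on a given cycle would
  otherwise be a coboundary. Cochains on graphs with distinguishable hairs suffice, by averaging over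
  the permutations of the hairs.

  Exactness is proved by induction on \<open>v\<close> for graphs some of whose vertices are frozen, that is,
  excluded from splitting. Convex classes of graphs are filtered by functions that are monotone under
  splitting. Let \<open>x\<close> be the vertex carrying a marked leg. If there are two legs, the half-edges at
  \<open>x\<close> that are not connected through the rest of the graph to the second leg can be split off or
  contracted together, which pairs off the graphs; the graphs outside this pairing are filtered by
  the valence of \<open>x\<close>, and freezing \<open>x\<close> then reduces \<open>v\<close>. If there is one leg, a marked non-bridge
  edge plays the role of the second leg, unless \<open>x\<close> can be frozen at once.
\<close>


section \<open>Signs, named graphs and the splitting differential\<close>

text \<open>The bound \<open>v + 1 < t\<close> is what the induction consumes. Freezing
  \<open>x\<close> takes it out of the count and turns its edges to the rest into legs. The marked
  leg stops counting too, so \<open>t\<close> is unchanged unless one more leg sits at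
  \<open>x\<close>; then \<open>t\<close> also drops by one, and the bound survives. The obstacle is
  that freezing \<open>x\<close> may disconnect the remainder; the pairing disposes of all graphs
  where this happens. No leg is canonical, but over the rationals one can average over all choices,
  provided that splitting does not change the set of choices. The set of legs is constant. The set
  of internal edges is not, since splitting creates new ones; but non-bridges stay non-bridges, so
  their set is constant once their number is fixed. This is why the second mark is a non-bridge when
  there is one leg only. Functions on graphs with arbitrary names are used instead of cosets of
  chains: well-definedness becomes a single equivariance condition, and passing to a subquotient
  complex is multiplication by an indicator function.\<close>

text \<open>For \<open>f\<close> injective on \<open>A\<close> this is the sign of \<open>f\<close>
  once \<open>A\<close> and its image are both listed in increasing order. Names can thus be
  arbitrary natural numbers, and no numbering by an initial segment has to be maintained when edges
  and vertices come and go.\<close>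

definition pair_sign :: "(nat \<Rightarrow> nat) \<Rightarrow> nat set \<Rightarrow> rat" where
  "pair_sign f A = (\<Prod>p \<in> {p \<in> A \<times> A. fst p < snd p}. if f (fst p) < f (snd p) then 1 else - 1)"

lemma pair_sign_empty [simp]: "pair_sign f {} = 1"
  by (simp add: pair_sign_def)

lemma pair_sign_insert:
  assumes "finite A" and "a \<notin> A" and "inj_on f (insert a A)"
  shows "pair_sign f (insert a A)
    = pair_sign f A * (\<Prod>j \<in> A. if (j < a) = (f j < f a) then 1 else - 1)"
proof -
  let ?g = "\<lambda>p. if f (fst p) < f (snd p) then 1 else - 1 :: rat"
  let ?P = "{p \<in> A \<times> A. fst p < snd p}"
  let ?N = "(\<lambda>j. if j < a then (j, a) else (a, j)) ` A"
  have eq: "{p \<in> insert a A \<times> insert a A. fst p < snd p} = ?P \<union> ?N"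
    using assms(2) by (fastforce simp: not_less le_less image_iff split: if_splits)
  have "finite ?P"
    using assms(1) by simp
  moreover have "?P \<inter> ?N = {}"
    using assms(2) by (auto split: if_splits)
  ultimately have "pair_sign f (insert a A) = prod ?g ?P * prod ?g ?N"
    unfolding pair_sign_def eq using assms(1) by (subst prod.union_disjoint) auto
  moreover have "prod ?g ?N = (\<Prod>j \<in> A. if (j < a) = (f j < f a) then 1 else - 1)"
  proof (subst prod.reindex)
    show "inj_on (\<lambda>j. if j < a then (j, a) else (a, j)) A"
      by (auto simp: inj_on_def split: if_splits)
    have "f j \<noteq> f a" if "j \<in> A" for j
      using assms(2,3) that by (auto simp: inj_on_def)
    then show "prod (?g \<circ> (\<lambda>j. if j < a then (j, a) else (a, j))) A
      = (\<Prod>j \<in> A. if (j < a) = (f j < f a) then 1 else - 1)"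
      using assms(2) by (intro prod.cong) (auto, metis nat_neq_iff)
  qed
  ultimately show ?thesis
    by (simp add: pair_sign_def)
qed

lemma pair_sign_cong: "(\<And>x. x \<in> A \<Longrightarrow> f x = g x) \<Longrightarrow> pair_sign f A = pair_sign g A"
  unfolding pair_sign_def by (intro prod.cong) auto

lemma pair_sign_mono_on:
  assumes "\<And>i j. i \<in> A \<Longrightarrow> j \<in> A \<Longrightarrow> i < j \<Longrightarrow> f i < f j"
  shows "pair_sign f A = 1"
  unfolding pair_sign_def using assms by (intro prod.neutral) auto

text \<open>A pair contributes whether its order is kept, and order comparisons multiply along a
  composition. By induction over \<open>A\<close>, the pairs with the new element split off from
  both sides.\<close>

lemma pair_sign_comp:
  assumes "finite A" and "inj_on f A" and "inj_on g (f ` A)"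
  shows "pair_sign (\<lambda>x. g (f x)) A = pair_sign g (f ` A) * pair_sign f A"
  using assms
proof (induction A rule: finite_induct)
  case (insert a A)
  have 1: "inj_on (\<lambda>x. g (f x)) (insert a A)"
    using insert.prems by (auto simp: inj_on_def)
  have 2: "f a \<notin> f ` A" "inj_on g (insert (f a) (f ` A))"
    using insert.prems insert.hyps by auto
  have 3: "inj_on f A" "inj_on g (f ` A)"
    using insert.prems by (auto simp: inj_on_def)
  show ?case
    using insert.IH[OF 3] insert.hyps insert.prems 2
    by (simp add: pair_sign_insert[OF insert.hyps 1] pair_sign_insert prod.reindex
        prod.distrib[symmetric] ac_simps cong: prod.cong)
      (intro disjI2 prod.cong refl, auto)
qed simp

lemma pair_sign_square: "pair_sign f A * pair_sign f A = 1"
  by (auto simp: pair_sign_def prod.distrib[symmetric] intro!: prod.neutral)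

text \<open>Any third element \<open>j\<close> meets both \<open>a\<close> and \<open>b\<close>, and
  the two factors agree, so they cancel; only the pair of \<open>a\<close> and \<open>b\<close> is
  left.\<close>

lemma pair_sign_transpose:
  assumes "finite A" and "a \<in> A" and "b \<in> A" and "a \<noteq> b"
  shows "pair_sign (Transposition.transpose a b) A = - 1"
proof -
  define B where "B = A - {a, b}"
  have A: "A = insert a (insert b B)" and B: "finite B" "a \<notin> B" "b \<notin> B"
    using assms by (auto simp: B_def)
  let ?t = "Transposition.transpose a b"
  have "pair_sign ?t B = 1"
    using B by (intro pair_sign_mono_on) (auto simp: transpose_def)
  moreover have "pair_sign ?t (insert b B)
      = pair_sign ?t B * (\<Prod>j \<in> B. if (j < b) = (?t j < ?t b) then 1 else - 1)"
    using B by (intro pair_sign_insert inj_on_subset[OF inj_transpose]) auto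
  moreover have "pair_sign ?t (insert a (insert b B)) = pair_sign ?t (insert b B)
      * (\<Prod>j \<in> insert b B. if (j < a) = (?t j < ?t a) then 1 else - 1)"
    using B assms(4) by (intro pair_sign_insert inj_on_subset[OF inj_transpose]) auto
  moreover have "(\<Prod>j \<in> insert b B. if (j < a) = (?t j < ?t a) then 1 else - 1) =
      - (\<Prod>j \<in> B. if (j < a) = (?t j < ?t a) then 1 else - 1 :: rat)"
    using B assms(4) by (subst prod.insert) auto
  moreover have "(\<Prod>j \<in> B. if (j < b) = (?t j < ?t b) then 1 else - 1) =
      (\<Prod>j \<in> B. if (j < a) = (?t j < ?t a) then 1 else - 1 :: rat)"
    using B by (intro prod.cong) (auto simp: transpose_def)
  moreover have "(\<Prod>j \<in> B. if P j then 1 else - 1) * (\<Prod>j \<in> B. if P j then 1 else - 1) = (1::rat)" for P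
    by (auto simp: prod.distrib[symmetric] intro!: prod.neutral)
  ultimately show ?thesis
    unfolding A by simp
qed

text \<open>
  Graphs whose edges and vertices are named by arbitrary natural numbers: \<open>gI\<close> is the incidence,
  the vertices in \<open>gF\<close> are frozen (never split), and the edges in \<open>gM\<close> are marked.
\<close>

record ngraph =
  gE :: "nat set"
  gV :: "nat set"
  gI :: "nat \<times> bool \<Rightarrow> nat"
  gF :: "nat list"
  gM :: "nat list"

section \<open>Half-edges, splitting and isomorphisms of named graphs\<close>

definition opp :: "nat \<times> bool \<Rightarrow> nat \<times> bool" where
  "opp h = (fst h, \<not> snd h)"

lemma opp_simps [simp]: "opp (opp h) = h" "fst (opp h) = fst h" "opp h \<noteq> h" "h \<noteq> opp h"
  by (auto simp: opp_def prod_eq_iff)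

definition half_edges :: "ngraph \<Rightarrow> nat \<Rightarrow> (nat \<times> bool) set" where
  "half_edges G z = {h. fst h \<in> gE G \<and> gI G h = z}"

text \<open>\<open>gF\<close> plays two roles. A hair end is listed in \<open>gF\<close> only, while
  a frozen vertex stays in \<open>gV\<close> as well and so continues to carry its orientation
  factor. Either kind is exempt from splitting and from the valence condition in
  \<open>stable\<close>.\<close>

definition inner :: "ngraph \<Rightarrow> nat set" where
  "inner G = gV G - set (gF G)"

definition names :: "ngraph \<Rightarrow> nat set" where
  "names G = gV G \<union> set (gF G)"

definition well_formed :: "ngraph \<Rightarrow> bool" where
  "well_formed G \<longleftrightarrow> finite (gE G) \<and> finite (gV G) \<and> (\<forall>h. fst h \<in> gE G \<longrightarrow> gI G h \<in> names G) \<and>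
     set (gM G) \<subseteq> gE G"

definition split_at :: "ngraph \<Rightarrow> nat \<Rightarrow> (nat \<times> bool) set \<Rightarrow> nat \<Rightarrow> nat \<Rightarrow> ngraph" where
  "split_at G i S e w = G\<lparr>gE := insert e (gE G), gV := insert w (gV G),
     gI := (\<lambda>h. if fst h = e then (if snd h then w else i) else if h \<in> S then w else gI G h)\<rparr>"

definition splits :: "ngraph \<Rightarrow> nat \<Rightarrow> (nat \<times> bool) set set" where
  "splits G i = {S. S \<subseteq> half_edges G i \<and> 2 \<le> card S \<and> 2 \<le> card (half_edges G i - S)}"

definition fresh :: "ngraph \<Rightarrow> nat \<Rightarrow> nat \<Rightarrow> bool" where
  "fresh G e w \<longleftrightarrow> e \<notin> gE G \<and> w \<notin> names G"

text \<open>\<open>F\<close> is the set of edges whose direction is reversed. Since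
  \<open>gF\<close> and \<open>gM\<close> are matched as lists, hair ends, frozen vertices and marks
  are distinguishable: no isomorphism permutes them.\<close>

definition graph_iso ::
  "(nat \<Rightarrow> nat) \<Rightarrow> (nat \<Rightarrow> nat) \<Rightarrow> nat set \<Rightarrow> ngraph \<Rightarrow> ngraph \<Rightarrow> bool" where
  "graph_iso p r F G G' \<longleftrightarrow> well_formed G \<and> inj_on p (gE G) \<and> inj_on r (names G) \<and> F \<subseteq> gE G \<and>
     gE G' = p ` gE G \<and> gV G' = r ` gV G \<and> gF G' = map r (gF G) \<and> gM G' = map p (gM G) \<and>
     (\<forall>h. fst h \<in> gE G \<longrightarrow> gI G' (p (fst h), snd h \<noteq> (fst h \<in> F)) = r (gI G h))"

definition hmap :: "(nat \<Rightarrow> nat) \<Rightarrow> nat set \<Rightarrow> nat \<times> bool \<Rightarrow> nat \<times> bool" where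
  "hmap p F h = (p (fst h), snd h \<noteq> (fst h \<in> F))"

lemma split_simps [simp]:
  "gE (split_at G i S e w) = insert e (gE G)"
  "gV (split_at G i S e w) = insert w (gV G)"
  "gF (split_at G i S e w) = gF G"
  "gM (split_at G i S e w) = gM G"
  "names (split_at G i S e w) = insert w (names G)"
  "gI (split_at G i S e w) h =
     (if fst h = e then (if snd h then w else i) else if h \<in> S then w else gI G h)"
  by (auto simp: split_at_def names_def)

lemma half_edges_finite: "well_formed G \<Longrightarrow> finite (half_edges G z)"
proof -
  assume "well_formed G"
  then have "finite (gE G \<times> (UNIV :: bool set))"
    by (simp add: well_formed_def)
  then show ?thesis
    by (rule rev_finite_subset) (auto simp: half_edges_def)
qed

lemma wf_finite: "well_formed G \<Longrightarrow> finite (gE G)" "well_formed G \<Longrightarrow> finite (gV G)" "well_formed G \<Longrightarrow> finite (names G)"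
    "well_formed G \<Longrightarrow> finite (inner G)"
  by (auto simp: well_formed_def names_def inner_def)

lemma well_formed_gI: "well_formed G \<Longrightarrow> fst h \<in> gE G \<Longrightarrow> gI G h \<in> names G"
  unfolding well_formed_def by blast

lemma finite_splits: "well_formed G \<Longrightarrow> finite (splits G i)"
  using half_edges_finite[of G i] by (auto simp: splits_def)

lemma wf_split: "well_formed G \<Longrightarrow> i \<in> names G \<Longrightarrow> well_formed (split_at G i S e w)"
  by (auto simp: well_formed_def)

lemma inner_split: "fresh G e w \<Longrightarrow> inner (split_at G i S e w) = insert w (inner G)"
  by (auto simp: inner_def fresh_def names_def)

lemma inner_names: "i \<in> inner G \<Longrightarrow> i \<in> names G"
  by (auto simp: inner_def names_def)

lemma iso_gI: "graph_iso p r F G G' \<Longrightarrow> fst h \<in> gE G \<Longrightarrow> gI G' (hmap p F h) = r (gI G h)"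
  by (simp add: graph_iso_def hmap_def)

lemma iso_names: "graph_iso p r F G G' \<Longrightarrow> names G' = r ` names G"
  by (auto simp: graph_iso_def names_def)

lemma iso_inner: "graph_iso p r F G G' \<Longrightarrow> inner G' = r ` inner G"
  by (auto simp: graph_iso_def names_def inner_def inj_on_def)

lemma hmap_image:
  assumes "graph_iso p r F G G'" "fst h' \<in> gE G'"
  obtains h where "fst h \<in> gE G" "h' = hmap p F h"
proof -
  obtain k where "k \<in> gE G" "fst h' = p k"
    using assms by (auto simp: graph_iso_def)
  then show thesis
    using that[of "(k, snd h' \<noteq> (k \<in> F))"] by (auto simp: hmap_def prod_eq_iff)
qed

lemma iso_wf:
  assumes "graph_iso p r F G G'"
  shows "well_formed G'"
proof -
  have "gI G' h' \<in> names G'" if h': "fst h' \<in> gE G'" for h'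
  proof -
    obtain h where "fst h \<in> gE G" "h' = hmap p F h"
      using hmap_image[OF assms h'] .
    then show ?thesis
      using iso_gI[OF assms, of h] iso_names[OF assms] well_formed_gI[of G h] assms
      by (simp add: graph_iso_def)
  qed
  then show ?thesis
    using assms by (auto simp: graph_iso_def well_formed_def)
qed

lemma hmap_inj:
  assumes "graph_iso p r F G G'" "fst h \<in> gE G" "fst h' \<in> gE G" "hmap p F h = hmap p F h'"
  shows "h = h'"
proof -
  have "fst h = fst h'"
    using assms by (auto simp: graph_iso_def hmap_def inj_on_def)
  then show ?thesis
    using assms(4) by (auto simp: hmap_def prod_eq_iff)
qed

lemma hmap_inj_on: "graph_iso p r F G G' \<Longrightarrow> inj_on (hmap p F) (half_edges G z)"
proof (rule inj_onI)
  fix h h' assume "graph_iso p r F G G'" "h \<in> half_edges G z" "h' \<in> half_edges G z"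
    "hmap p F h = hmap p F h'"
  then show "h = h'"
    unfolding half_edges_def mem_Collect_eq by (intro hmap_inj[of p r F G G' h h']) blast+
qed

lemma iso_half_edges:
  assumes "graph_iso p r F G G'" "z \<in> names G"
  shows "half_edges G' (r z) = hmap p F ` half_edges G z"
proof (intro equalityI subsetI)
  fix h' assume h': "h' \<in> half_edges G' (r z)"
  then obtain h where h: "fst h \<in> gE G" "h' = hmap p F h"
    using hmap_image[OF assms(1), of h'] unfolding half_edges_def mem_Collect_eq by blast
  then have "r (gI G h) = r z"
    using h' iso_gI[OF assms(1), of h] by (simp add: half_edges_def)
  moreover have "gI G h \<in> names G"
    using h assms(1) by (simp add: graph_iso_def well_formed_gI)
  ultimately have "gI G h = z"
    using assms by (auto simp: graph_iso_def inj_on_def)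
  then show "h' \<in> hmap p F ` half_edges G z"
    using h by (auto simp: half_edges_def)
next
  fix h' assume "h' \<in> hmap p F ` half_edges G z"
  then obtain h where h: "fst h \<in> gE G" "gI G h = z" "h' = hmap p F h"
    by (auto simp: half_edges_def)
  have "fst h' \<in> gE G'"
    using h assms(1) by (auto simp: graph_iso_def hmap_def)
  then show "h' \<in> half_edges G' (r z)"
    using h iso_gI[OF assms(1), of h] by (auto simp: half_edges_def)
qed

lemma iso_splits:
  assumes "graph_iso p r F G G'" "z \<in> names G"
  shows "splits G' (r z) = (`) (hmap p F) ` splits G z"
proof -
  let ?f = "hmap p F"
  have inj: "inj_on ?f (half_edges G z)"
    by (rule hmap_inj_on[OF assms(1)])
  have "S' \<in> splits G' (r z) \<longleftrightarrow> S' \<in> (`) ?f ` splits G z" for S'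
  proof
    assume "S' \<in> splits G' (r z)"
    then have S': "S' \<subseteq> ?f ` half_edges G z" "2 \<le> card S'" "2 \<le> card (?f ` half_edges G z - S')"
      by (auto simp: splits_def iso_half_edges[OF assms])
    then obtain S where S: "S \<subseteq> half_edges G z" "S' = ?f ` S"
      by (metis subset_imageE)
    have "?f ` half_edges G z - ?f ` S = ?f ` (half_edges G z - S)"
      using inj_on_image_set_diff[OF inj, of "half_edges G z" S] S by auto
    then have "2 \<le> card S" "2 \<le> card (half_edges G z - S)"
      using S' S inj card_image[of ?f S] card_image[of ?f "half_edges G z - S"]
      by (auto simp: inj_on_subset inj_on_diff)
    then show "S' \<in> (`) ?f ` splits G z"
      using S by (auto simp: splits_def)
  next
    assume "S' \<in> (`) ?f ` splits G z"
    then obtain S where S: "S \<subseteq> half_edges G z" "2 \<le> card S" "2 \<le> card (half_edges G z - S)" "S' = ?f ` S"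
      by (auto simp: splits_def)
    have "?f ` half_edges G z - ?f ` S = ?f ` (half_edges G z - S)"
      using inj_on_image_set_diff[OF inj, of "half_edges G z" S] S by auto
    then show "S' \<in> splits G' (r z)"
      using S inj card_image[of ?f S] card_image[of ?f "half_edges G z - S"]
      by (auto simp: splits_def iso_half_edges[OF assms] inj_on_subset inj_on_diff)
  qed
  then show ?thesis by blast
qed

lemma iso_split:
  assumes "graph_iso p r F G G'" "i \<in> names G" "S \<subseteq> half_edges G i" "fresh G e w" "fresh G' e' w'"
  shows "graph_iso (p(e := e')) (r(w := w')) F (split_at G i S e w) (split_at G' (r i) (hmap p F ` S) e' w')"
proof -
  have e: "e \<notin> gE G" "e' \<notin> p ` gE G" and w: "w \<notin> names G" "w' \<notin> r ` names G"
    using assms(1,4,5) iso_names[OF assms(1)] by (auto simp: fresh_def graph_iso_def)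
  have eF: "e \<notin> F" and eM: "e \<notin> set (gM G)"
    using assms(1) e by (auto simp: graph_iso_def well_formed_def)
  have wV: "w \<notin> gV G" "w \<notin> set (gF G)" "w \<noteq> i"
    using w assms(2) by (auto simp: names_def)
  have mem: "hmap p F h \<in> hmap p F ` S \<longleftrightarrow> h \<in> S" if "fst h \<in> gE G" for h
    using assms(3) that by (auto simp: half_edges_def dest: hmap_inj[OF assms(1)])
  have inc: "gI (split_at G' (r i) (hmap p F ` S) e' w') (hmap (p(e := e')) F h) =
     (r(w := w')) (gI (split_at G i S e w) h)" if h: "fst h \<in> insert e (gE G)" for h
  proof (cases "fst h = e")
    case True
    then show ?thesis
      using eF wV by (auto simp: hmap_def)
  next
    case False
    then have hE: "fst h \<in> gE G" using h by simp
    then have n: "gI G h \<in> names G"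
      using assms(1) by (simp add: graph_iso_def well_formed_gI)
    have "hmap (p(e := e')) F h = hmap p F h"
      using False by (auto simp: hmap_def)
    moreover have "fst (hmap p F h) \<noteq> e'"
      using e hE by (auto simp: hmap_def)
    ultimately show ?thesis
      using False mem[OF hE] iso_gI[OF assms(1) hE] n w by auto
  qed
  show ?thesis
    unfolding graph_iso_def
  proof (intro conjI allI impI)
    show "well_formed (split_at G i S e w)"
      using assms(1,2) by (intro wf_split) (auto simp: graph_iso_def)
    show "inj_on (p(e := e')) (gE (split_at G i S e w))"
      using assms(1) e by (auto simp: graph_iso_def inj_on_def)
    show "inj_on (r(w := w')) (names (split_at G i S e w))"
      using assms(1) w by (auto simp: graph_iso_def inj_on_def)
    show "gI (split_at G' (r i) (hmap p F ` S) e' w') ((p(e := e')) (fst h), snd h \<noteq> (fst h \<in> F)) =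
      (r(w := w')) (gI (split_at G i S e w) h)" if "fst h \<in> gE (split_at G i S e w)" for h
      using inc[of h] that unfolding hmap_def by simp
    show "gF (split_at G' (r i) (hmap p F ` S) e' w') = map (r(w := w')) (gF (split_at G i S e w))"
      using assms(1) wV by (auto simp: graph_iso_def)
    show "gM (split_at G' (r i) (hmap p F ` S) e' w') = map (p(e := e')) (gM (split_at G i S e w))"
      using assms(1) eM by (auto simp: graph_iso_def)
  qed (use assms(1) e wV in \<open>auto simp: graph_iso_def\<close>)
qed

lemma iso_id: "well_formed G \<Longrightarrow> graph_iso id id {} G G"
  by (auto simp: graph_iso_def)

lemma hmap_id [simp]: "hmap id {} = id"
  by (auto simp: hmap_def)

lemma iso_trans:
  assumes "graph_iso p r F G G'" "graph_iso p' r' F' G' G''"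
  shows "graph_iso (p' \<circ> p) (r' \<circ> r) {k \<in> gE G. (k \<in> F) \<noteq> (p k \<in> F')} G G''"
proof -
  let ?D = "{k \<in> gE G. (k \<in> F) \<noteq> (p k \<in> F')}"
  have img: "gE G' = p ` gE G" "gV G' = r ` gV G" "names G' = r ` names G"
    using assms(1) iso_names by (auto simp: graph_iso_def)
  show ?thesis
    unfolding graph_iso_def
  proof (intro conjI allI impI)
    show "inj_on (p' \<circ> p) (gE G)" "inj_on (r' \<circ> r) (names G)"
      using assms img by (auto simp: graph_iso_def intro: comp_inj_on)
    show "gI G'' ((p' \<circ> p) (fst h), snd h \<noteq> (fst h \<in> ?D)) = (r' \<circ> r) (gI G h)"
      if "fst h \<in> gE G" for h
    proof -
      have "((p' \<circ> p) (fst h), snd h \<noteq> (fst h \<in> ?D)) = hmap p' F' (hmap p F h)"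
        using that by (auto simp: hmap_def)
      moreover have "fst (hmap p F h) \<in> gE G'"
        using that img by (simp add: hmap_def)
      ultimately show ?thesis
        using iso_gI[OF assms(1) that] iso_gI[OF assms(2)] by simp
    qed
  qed (use assms img in \<open>auto simp: graph_iso_def\<close>)
qed

lemma iso_sym:
  assumes "graph_iso p r F G G'"
  shows "graph_iso (inv_into (gE G) p) (inv_into (names G) r) (p ` F) G' G"
proof -
  have inj: "inj_on p (gE G)" "inj_on r (names G)" and F: "F \<subseteq> gE G"
    and M: "set (gM G) \<subseteq> gE G"
    using assms by (auto simp: graph_iso_def well_formed_def)
  let ?p = "inv_into (gE G) p" and ?r = "inv_into (names G) r"
  have p: "?p (p k) = k" if "k \<in> gE G" for k
    using inj that by simp
  have r: "?r (r k) = k" if "k \<in> names G" for k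
    using inj that by simp
  have F': "p k \<in> p ` F \<longleftrightarrow> k \<in> F" if "k \<in> gE G" for k
    by (rule inj_on_image_mem_iff[OF inj(1) that F])
  show ?thesis
    unfolding graph_iso_def
  proof (intro conjI allI impI)
    show "well_formed G'" by (rule iso_wf[OF assms])
    show "inj_on ?p (gE G')" "inj_on ?r (names G')"
      using assms iso_names[OF assms] by (auto simp: graph_iso_def inj_on_inv_into)
    show "p ` F \<subseteq> gE G'"
      using assms by (auto simp: graph_iso_def)
    show "gE G = ?p ` gE G'"
      using assms p by (auto simp: graph_iso_def image_image)
    show "gV G = ?r ` gV G'"
      using assms r by (auto simp: graph_iso_def image_image names_def)
    show "gF G = map ?r (gF G')"
      using assms r by (auto simp: graph_iso_def names_def o_def intro!: map_idI[symmetric])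
    show "gM G = map ?p (gM G')"
      using assms p M by (auto simp: graph_iso_def o_def intro!: map_idI[symmetric])
    show "gI G (?p (fst h'), snd h' \<noteq> (fst h' \<in> p ` F)) = ?r (gI G' h')" if h': "fst h' \<in> gE G'" for h'
    proof -
      obtain h where h: "fst h \<in> gE G" "h' = hmap p F h"
        using hmap_image[OF assms h'] .
      have "(?p (fst h'), snd h' \<noteq> (fst h' \<in> p ` F)) = h"
        using h p F' by (auto simp: hmap_def prod_eq_iff)
      moreover have "gI G h \<in> names G"
        using assms h by (simp add: graph_iso_def well_formed_gI)
      ultimately show ?thesis
        using h iso_gI[OF assms h(1)] r by simp
    qed
  qed
qed

section \<open>Cochains with orientation signs and their differential\<close>

locale parity =
  fixes ev :: bool
begin

text \<open>The parameter \<open>ev\<close> stands for evenness of \<open>n\<close>. For even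
  \<open>n\<close> only the edges have odd degree; for odd \<open>n\<close> the internal vertices
  have, and each reversed edge gives a sign. Hair ends do not enter, because isomorphisms preserve
  their order; the parity of \<open>m\<close> matters only in the averaging over the hairs.\<close>

definition iso_sign :: "(nat \<Rightarrow> nat) \<Rightarrow> (nat \<Rightarrow> nat) \<Rightarrow> nat set \<Rightarrow> ngraph \<Rightarrow> rat" where
  "iso_sign p r F G = (if ev then pair_sign p (gE G) else pair_sign r (gV G) * (- 1) ^ card F)"

text \<open>The sign of moving the new edge \<open>e\<close> to the front, respectively the new
  vertex \<open>w\<close> to the end. These are the places that \<open>split_vertex\<close> assigns
  to them.\<close>

definition coef :: "ngraph \<Rightarrow> nat \<Rightarrow> nat \<Rightarrow> rat" where
  "coef G e w = (if ev then \<Prod>j \<in> gE G. if e < j then 1 else - 1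
                 else \<Prod>j \<in> gV G. if j < w then 1 else - 1)"

lemma coef_square: "coef G e w * coef G e w = 1"
  by (auto simp: coef_def prod.distrib[symmetric] intro!: prod.neutral)

lemma iso_sign_square: "iso_sign p r F G * iso_sign p r F G = 1"
  using pair_sign_square[of p "gE G"] pair_sign_square[of r "gV G"]
  by (auto simp: iso_sign_def power_mult_distrib[symmetric] algebra_simps)

text \<open>The pairs that contain the new edge or vertex record whether it lies on the same side of
  an old one before and after the map. This is a product of one sign for each of the two graphs,
  which gives the two coefficients.\<close>

lemma iso_sign_split:
  assumes "graph_iso p r F G G'" "fresh G e w" "fresh G' e' w'"
  shows "iso_sign (p(e := e')) (r(w := w')) F (split_at G i S e w)
    = iso_sign p r F G * coef G e w * coef G' e' w'"
proof -
  have e: "e \<notin> gE G" "e' \<notin> p ` gE G" and w: "w \<notin> names G" "w' \<notin> r ` names G"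
    and fin: "finite (gE G)" "finite (gV G)"
    and inj: "inj_on p (gE G)" "inj_on r (names G)"
    and img: "gE G' = p ` gE G" "gV G' = r ` gV G"
    using assms iso_names[OF assms(1)] by (auto simp: fresh_def graph_iso_def well_formed_def)
  have wV: "w \<notin> gV G" "w' \<notin> r ` gV G" and injV: "inj_on r (gV G)"
    using w inj by (auto simp: names_def inj_on_def)
  have 1: "pair_sign (p(e := e')) (insert e (gE G)) = pair_sign p (gE G) *
     ((\<Prod>j \<in> gE G. if e < j then 1 else - 1) * (\<Prod>j \<in> p ` gE G. if e' < j then 1 else - 1))"
  proof -
    have "inj_on (p(e := e')) (insert e (gE G))"
      using inj e by (auto simp: inj_on_def)
    moreover have "pair_sign (p(e := e')) (gE G) = pair_sign p (gE G)"
      using e by (intro pair_sign_cong) auto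
    moreover have "(\<Prod>j \<in> gE G. if (j < e) = ((p(e := e')) j < (p(e := e')) e) then 1 else - 1) =
       (\<Prod>j \<in> gE G. if e < j then 1 else - 1) * (\<Prod>j \<in> gE G. if e' < p j then 1 else - 1 :: rat)"
    proof (subst prod.distrib[symmetric], rule prod.cong[OF refl])
      fix j assume j: "j \<in> gE G"
      then have "j \<noteq> e" "p j \<noteq> e'" using e by auto
      then show "(if (j < e) = ((p(e := e')) j < (p(e := e')) e) then 1 else - 1) =
        (if e < j then 1 else - 1) * (if e' < p j then 1 else - 1 :: rat)"
        by (auto simp: not_less le_less)
    qed
    ultimately show ?thesis
      using e inj fin by (simp add: pair_sign_insert prod.reindex)
  qed
  have 2: "pair_sign (r(w := w')) (insert w (gV G)) = pair_sign r (gV G) *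
     ((\<Prod>j \<in> gV G. if j < w then 1 else - 1) * (\<Prod>j \<in> r ` gV G. if j < w' then 1 else - 1))"
  proof -
    have "inj_on (r(w := w')) (insert w (gV G))"
      using injV wV by (auto simp: inj_on_def)
    moreover have "pair_sign (r(w := w')) (gV G) = pair_sign r (gV G)"
      using wV by (intro pair_sign_cong) auto
    moreover have "(\<Prod>j \<in> gV G. if (j < w) = ((r(w := w')) j < (r(w := w')) w) then 1 else - 1) =
       (\<Prod>j \<in> gV G. if j < w then 1 else - 1) * (\<Prod>j \<in> gV G. if r j < w' then 1 else - 1 :: rat)"
    proof (subst prod.distrib[symmetric], rule prod.cong[OF refl])
      fix j assume j: "j \<in> gV G"
      then have "j \<noteq> w" using wV by auto
      then show "(if (j < w) = ((r(w := w')) j < (r(w := w')) w) then 1 else - 1) =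
        (if j < w then 1 else - 1) * (if r j < w' then 1 else - 1 :: rat)"
        by (auto simp: not_less le_less)
    qed
    ultimately show ?thesis
      using wV injV fin by (simp add: pair_sign_insert prod.reindex)
  qed
  show ?thesis
    using 1 2 by (simp add: iso_sign_def coef_def img)
qed

lemma iso_sign_trans:
  assumes "graph_iso p r F G G'" "graph_iso p' r' F' G' G''"
  shows "iso_sign (p' \<circ> p) (r' \<circ> r) {k \<in> gE G. (k \<in> F) \<noteq> (p k \<in> F')} G =
    iso_sign p r F G * iso_sign p' r' F' G'"
proof -
  have fin: "finite (gE G)" "finite (gV G)" and inj: "inj_on p (gE G)" "inj_on r (gV G)"
    "inj_on p' (p ` gE G)" "inj_on r' (r ` gV G)"
    and img: "gE G' = p ` gE G" "gV G' = r ` gV G" and FF: "F \<subseteq> gE G" "F' \<subseteq> p ` gE G"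
    using assms by (auto simp: graph_iso_def well_formed_def names_def intro: inj_on_subset)
  define H where "H = {k \<in> gE G. p k \<in> F'}"
  have H: "F' = p ` H" "inj_on p H" "finite H" "finite F"
    using FF inj fin by (auto simp: H_def inj_on_def intro: finite_subset)
  have D: "{k \<in> gE G. (k \<in> F) \<noteq> (p k \<in> F')} = (F - H) \<union> (H - F)"
    using FF by (auto simp: H_def)
  have "(- 1 :: rat) ^ card ((F - H) \<union> (H - F)) = (- 1) ^ card F * (- 1) ^ card H"
  proof -
    have "card ((F - H) \<union> (H - F)) = card (F - H) + card (H - F)"
      using H by (intro card_Un_disjoint) auto
    moreover have "card F = card (F - H) + card (F \<inter> H)" "card H = card (H - F) + card (F \<inter> H)"
      using H card_Diff_subset_Int[of F H] card_Diff_subset_Int[of H F]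
        card_mono[of F "F \<inter> H"] card_mono[of H "F \<inter> H"] by (auto simp: Int_commute)
    ultimately show ?thesis
      by (simp add: power_add power_mult_distrib[symmetric] algebra_simps)
  qed
  moreover have "card F' = card H"
    using H by (simp add: card_image)
  ultimately show ?thesis
    using pair_sign_comp[OF fin(1) inj(1,3)] pair_sign_comp[OF fin(2) inj(2,4)]
    unfolding iso_sign_def D img comp_def by simp
qed

definition equivariant :: "(ngraph \<Rightarrow> rat) \<Rightarrow> bool" where
  "equivariant f \<longleftrightarrow> (\<forall>p r F G G'. graph_iso p r F G G' \<longrightarrow> f G' = iso_sign p r F G * f G)"

lemma equivariantD: "equivariant f \<Longrightarrow> graph_iso p r F G G' \<Longrightarrow> f G' = iso_sign p r F G * f G"
  by (auto simp: equivariant_def)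

definition split_term :: "(ngraph \<Rightarrow> rat) \<Rightarrow> ngraph \<Rightarrow> nat \<Rightarrow> (nat \<times> bool) set \<Rightarrow> nat \<Rightarrow> nat \<Rightarrow> rat" where
  "split_term f G i S e w = coef G e w * f (split_at G i S e w)"

lemma split_term_iso:
  assumes "equivariant f" "graph_iso p r F G G'" "i \<in> names G" "S \<subseteq> half_edges G i"
    "fresh G e w" "fresh G' e' w'"
  shows "split_term f G' (r i) (hmap p F ` S) e' w' = iso_sign p r F G * split_term f G i S e w"
proof -
  have "f (split_at G' (r i) (hmap p F ` S) e' w') =
    iso_sign p r F G * coef G e w * coef G' e' w' * f (split_at G i S e w)"
    using equivariantD[OF assms(1) iso_split[OF assms(2-6)]] iso_sign_split[OF assms(2,5,6)] by simp
  then show ?thesis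
    using coef_square[of G' e' w'] by (simp add: split_term_def algebra_simps)
qed

text \<open>The case of the identity isomorphism. It makes the arbitrary choices
  \<open>new_edge\<close> and \<open>new_vertex\<close> harmless, and later proofs pick the names
  that suit them.\<close>

lemma split_term_indep:
  assumes "equivariant f" "well_formed G" "i \<in> names G" "S \<subseteq> half_edges G i" "fresh G e w" "fresh G e' w'"
  shows "split_term f G i S e' w' = split_term f G i S e w"
proof -
  have "pair_sign id A = 1" for A
    by (rule pair_sign_mono_on) simp
  then show ?thesis
    using split_term_iso[OF assms(1) iso_id[OF assms(2)] assms(3-6)] by (simp add: iso_sign_def)
qed

definition new_edge :: "ngraph \<Rightarrow> nat" where
  "new_edge G = (SOME e. e \<notin> gE G)"

definition new_vertex :: "ngraph \<Rightarrow> nat" where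
  "new_vertex G = (SOME w. w \<notin> names G)"

lemma fresh_new: "well_formed G \<Longrightarrow> fresh G (new_edge G) (new_vertex G)"
  unfolding fresh_def new_edge_def new_vertex_def
  by (metis (mono_tags, lifting) ex_new_if_finite infinite_UNIV_nat someI_ex wf_finite(1,3))

definition d_at :: "(ngraph \<Rightarrow> rat) \<Rightarrow> ngraph \<Rightarrow> nat \<Rightarrow> rat" where
  "d_at f G i = (\<Sum>S \<in> splits G i. split_term f G i S (new_edge G) (new_vertex G))"

text \<open>The transpose of the splitting differential without the factor \<open>1 / 2\<close>:
  every way of splitting a vertex is counted twice, through \<open>S\<close> and through its
  complement. Exactness is not affected by this factor.\<close>

definition d :: "(ngraph \<Rightarrow> rat) \<Rightarrow> ngraph \<Rightarrow> rat" where
  "d f G = (\<Sum>i \<in> inner G. d_at f G i)"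

lemma splits_subset: "S \<in> splits G i \<Longrightarrow> S \<subseteq> half_edges G i"
  by (simp add: splits_def)

lemma d_at_fresh:
  assumes "equivariant f" "well_formed G" "i \<in> names G" "fresh G e w"
  shows "d_at f G i = (\<Sum>S \<in> splits G i. split_term f G i S e w)"
  unfolding d_at_def using assms
  by (intro sum.cong refl split_term_indep fresh_new) (auto simp: splits_def)

lemma d_at_iso:
  assumes "equivariant f" "graph_iso p r F G G'" "i \<in> names G"
  shows "d_at f G' (r i) = iso_sign p r F G * d_at f G i"
proof -
  have wf: "well_formed G" "well_formed G'"
    using assms iso_wf by (auto simp: graph_iso_def)
  have "inj_on ((`) (hmap p F)) (splits G i)"
    by (rule inj_on_subset[OF inj_on_image_Pow[OF hmap_inj_on[OF assms(2)]]]) (auto simp: splits_def)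
  then have "d_at f G' (r i) =
      (\<Sum>S \<in> splits G i. split_term f G' (r i) (hmap p F ` S) (new_edge G') (new_vertex G'))"
    unfolding d_at_def iso_splits[OF assms(2,3)] by (simp add: sum.reindex o_def)
  also have "\<dots> = (\<Sum>S \<in> splits G i. iso_sign p r F G * split_term f G i S (new_edge G) (new_vertex G))"
    using wf by (intro sum.cong refl split_term_iso[OF assms] fresh_new) (auto simp: splits_def)
  finally show ?thesis
    by (simp add: d_at_def sum_distrib_left)
qed

lemma equivariant_d: "equivariant f \<Longrightarrow> equivariant (d f)"
  unfolding equivariant_def[of "d f"]
proof (intro allI impI)
  fix p r F G G' assume f: "equivariant f" and graph_iso: "graph_iso p r F G G'"
  have "inj_on r (inner G)"
    using graph_iso by (auto simp: graph_iso_def inj_on_def inner_def names_def)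
  then show "d f G' = iso_sign p r F G * d f G"
    using d_at_iso[OF f graph_iso] inner_names[of _ G]
    by (simp add: d_def iso_inner[OF graph_iso] sum.reindex o_def sum_distrib_left)
qed

end

section \<open>Interchanging the two parts of a splitting, and the square of the
  differential\<close>

lemma split_complement_iso:
  assumes "well_formed G" "i \<in> inner G" "S \<subseteq> half_edges G i" "fresh G e w"
  shows "graph_iso id (Transposition.transpose i w) {e}
    (split_at G i S e w) (split_at G i (half_edges G i - S) e w)"
proof -
  let ?t = "Transposition.transpose i w" and ?B = "half_edges G i"
  have e: "e \<notin> gE G" and w: "w \<notin> gV G" "w \<notin> set (gF G)" "w \<noteq> i"
    and i: "i \<in> gV G" "i \<notin> set (gF G)"
    using assms(2,4) by (auto simp: fresh_def names_def inner_def)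
  have inc: "gI (split_at G i (?B - S) e w) (id (fst h), snd h \<noteq> (fst h \<in> {e})) =
      ?t (gI (split_at G i S e w) h)" if "fst h \<in> insert e (gE G)" for h
  proof (cases "fst h = e")
    case True
    then show ?thesis using w by auto
  next
    case False
    then have h: "fst h \<in> gE G" using that by simp
    have n: "gI G h \<noteq> w"
      using well_formed_gI[OF assms(1) h] w by (auto simp: names_def)
    show ?thesis
    proof (cases "h \<in> ?B")
      case True
      then have "gI G h = i" by (simp add: half_edges_def)
      then show ?thesis using False True by auto
    next
      case B: False
      then have "gI G h \<noteq> i" "h \<notin> S" using h assms(3) by (auto simp: half_edges_def)
      then show ?thesis using False B n by (auto simp: transpose_def)
    qed
  qed
  show ?thesis
    unfolding graph_iso_def
  proof (intro conjI allI impI)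
    show "well_formed (split_at G i S e w)"
      using assms by (intro wf_split inner_names) auto
    show "inj_on ?t (names (split_at G i S e w))"
      by (rule inj_on_subset[OF inj_transpose]) simp
    show "gV (split_at G i (?B - S) e w) = ?t ` gV (split_at G i S e w)"
      using i w by (auto simp: transpose_def image_iff)
    show "gF (split_at G i (?B - S) e w) = map ?t (gF (split_at G i S e w))"
      using i w by (auto intro!: map_idI[symmetric] simp: transpose_def)
    show "gI (split_at G i (?B - S) e w) (id (fst h), snd h \<noteq> (fst h \<in> {e})) =
      ?t (gI (split_at G i S e w) h)" if "fst h \<in> gE (split_at G i S e w)" for h
      using inc that by simp
  qed auto
qed

lemma half_edges_split_other:
  assumes "well_formed G" "fresh G e w" "S \<subseteq> half_edges G i" "z \<noteq> i" "z \<noteq> w"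
  shows "half_edges (split_at G i S e w) z = half_edges G z"
  using assms by (auto simp: half_edges_def fresh_def)

lemma half_edges_split_old:
  assumes "well_formed G" "i \<in> names G" "fresh G e w" "S \<subseteq> half_edges G i"
  shows "half_edges (split_at G i S e w) i = insert (e, False) (half_edges G i - S)"
  using assms by (auto simp: half_edges_def fresh_def split: if_splits)

lemma half_edges_split_new:
  assumes "well_formed G" "i \<in> names G" "fresh G e w" "S \<subseteq> half_edges G i"
  shows "half_edges (split_at G i S e w) w = insert (e, True) S"
proof -
  have "w \<noteq> i" and *: "\<And>h. fst h \<in> gE G \<Longrightarrow> gI G h \<noteq> w"
    using assms well_formed_gI[OF assms(1)] by (auto simp: fresh_def)
  then show ?thesis
    using assms(3,4) by (auto simp: half_edges_def fresh_def split: if_splits)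
qed

lemma splits_complement:
  assumes "S \<in> splits G i"
  shows "half_edges G i - S \<in> splits G i" "half_edges G i - (half_edges G i - S) = S"
  using assms by (auto simp: splits_def double_diff)

context parity
begin

text \<open>For even \<open>n\<close> the map fixes all edges. For odd \<open>n\<close> the exchange
  of two vertices and the reversal of \<open>e\<close> cancel.\<close>

lemma split_complement_sign:
  assumes "well_formed G" "i \<in> inner G" "fresh G e w"
  shows "iso_sign id (Transposition.transpose i w) {e} (split_at G i S e w) = 1"
proof -
  have "pair_sign id A = 1" for A
    by (rule pair_sign_mono_on) simp
  moreover have "pair_sign (Transposition.transpose i w) (insert w (gV G)) = - 1"
    using assms by (intro pair_sign_transpose) (auto simp: well_formed_def inner_def fresh_def names_def)
  ultimately show ?thesis
    by (simp add: iso_sign_def)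
qed

lemma split_term_complement:
  assumes "equivariant f" "well_formed G" "i \<in> inner G" "S \<subseteq> half_edges G i" "fresh G e w"
  shows "split_term f G i (half_edges G i - S) e w = split_term f G i S e w"
  using equivariantD[OF assms(1) split_complement_iso[OF assms(2-5)]]
    split_complement_sign[OF assms(2,3,5)] by (simp add: split_term_def)

text \<open>Two edges and two vertices are exchanged at the same time. For either parity exactly one
  of the two transpositions is visible to the orientation, whence the minus sign. It is the origin
  of the cancellations in the square of \<open>d\<close>.\<close>

lemma swap_names_sign:
  assumes "equivariant f" "well_formed G" "gE G' = gE G" "gV G' = gV G" "gF G' = gF G" "gM G' = gM G"
    "e \<in> gE G" "e' \<in> gE G" "e \<noteq> e'" "w \<in> gV G" "w' \<in> gV G" "w \<noteq> w'"
    "w \<notin> set (gF G)" "w' \<notin> set (gF G)" "e \<notin> set (gM G)" "e' \<notin> set (gM G)"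
    "\<And>h. fst h \<in> gE G \<Longrightarrow> gI G' (Transposition.transpose e e' (fst h), snd h) =
      Transposition.transpose w w' (gI G h)"
  shows "f G' = - f G"
proof -
  let ?p = "Transposition.transpose e e'" and ?r = "Transposition.transpose w w'"
  have "graph_iso ?p ?r {} G G'"
    unfolding graph_iso_def
  proof (intro conjI allI impI)
    show "inj_on ?p (gE G)" "inj_on ?r (names G)"
      by (rule inj_on_subset[OF inj_transpose], simp)+
    show "gE G' = ?p ` gE G" "gV G' = ?r ` gV G"
      using assms(3,4,7,8,10,11) by (auto simp: transpose_def image_iff)
    show "gF G' = map ?r (gF G)" "gM G' = map ?p (gM G)"
      using assms(5,6,13-16) by (auto intro!: map_idI[symmetric] simp: transpose_def)
  qed (use assms in auto)
  moreover have "iso_sign ?p ?r {} G = - 1"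
    using assms by (simp add: iso_sign_def pair_sign_transpose well_formed_def)
  ultimately show ?thesis
    using equivariantD[OF assms(1)] by fastforce
qed

lemma antisymmetric_sum:
  fixes X :: "'b \<Rightarrow> 'b \<Rightarrow> rat"
  assumes "\<And>a b. a \<in> A \<Longrightarrow> b \<in> A \<Longrightarrow> R a b \<Longrightarrow> X b a = - X a b" "\<And>a b. R a b = R b a"
  shows "(\<Sum>a \<in> A. \<Sum>b \<in> {b \<in> A. R a b}. X a b) = 0"
proof (cases "finite A")
  case True
  have "(\<Sum>a \<in> A. \<Sum>b \<in> {b \<in> A. R a b}. X a b) = (\<Sum>b \<in> A. \<Sum>a \<in> {a \<in> A. R a b}. X a b)"
    using True by (rule sum.swap_restrict) (rule True)
  also have "\<dots> = (\<Sum>b \<in> A. \<Sum>a \<in> {a \<in> A. R b a}. - X b a)"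
  proof (intro sum.cong refl)
    show "{a \<in> A. R a b} = {a \<in> A. R b a}" for b
      using assms(2) by blast
    show "X a b = - X b a" if "b \<in> A" "a \<in> {a \<in> A. R b a}" for a b
      using assms(1)[of b a] that by blast
  qed
  finally show ?thesis
    by (simp add: sum_negf)
qed simp

text \<open>A double splitting is given by disjoint sets of half-edges \<open>S\<close> and
  \<open>T\<close>, and performing the two in the other order exchanges the names of the new edges
  and of the new vertices. The work is to bring the terms in which one vertex is split twice into
  this symmetric form.\<close>

lemma d_d:
  assumes f: "equivariant f" and wf: "well_formed G"
  shows "d (d f) G = 0"
proof -
  define e w where "e = new_edge G" and "w = new_vertex G"
  have fr: "fresh G e w"
    using fresh_new[OF wf] by (simp add: e_def w_def)
  obtain e' where e': "e' \<notin> insert e (gE G)"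
    using ex_new_if_finite[OF infinite_UNIV_nat] wf_finite[OF wf] by (metis finite_insert)
  obtain w' where w': "w' \<notin> insert w (names G)"
    using ex_new_if_finite[OF infinite_UNIV_nat] wf_finite[OF wf] by (metis finite_insert)
  let ?G1 = "\<lambda>i S. split_at G i S e w"
  have fr1: "fresh (?G1 i S) e' w'" for i S
    using e' w' by (auto simp: fresh_def)
  have wf1: "well_formed (?G1 i S)" if "i \<in> inner G" for i S
    using wf that by (intro wf_split inner_names)
  define c where "c = coef G e w"
  define X where "X i S j T = c * split_term f (?G1 i S) j T e' w'" for i S j T
  have B: "S \<subseteq> half_edges G i" if "S \<in> splits G i" for i S
    using that by (simp add: splits_def)
  have finB: "finite (half_edges G i)" for i
    by (rule half_edges_finite[OF wf])
  have w: "w \<notin> inner G" "w \<notin> names G"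
    using fr by (auto simp: inner_def fresh_def names_def)
  have swap: "X j T i S = - X i S j T"
    if ij: "i \<in> inner G" "j \<in> inner G" and ST: "S \<subseteq> half_edges G i" "T \<subseteq> half_edges G j" "S \<inter> T = {}"
    for i j S T
  proof -
    let ?H = "split_at (?G1 i S) j T e' w'" and ?H' = "split_at (?G1 j T) i S e' w'"
    have ne: "i \<noteq> w" "i \<noteq> w'" "j \<noteq> w" "j \<noteq> w'" "w \<noteq> w'" "e \<noteq> e'" "e \<notin> gE G" "e' \<notin> gE G"
      using ij e' w' fr inner_names[of _ G] by (auto simp: fresh_def)
    have "f ?H' = - f ?H"
    proof (rule swap_names_sign[OF f, where e = e and e' = e' and w = w and w' = w'])
      show "well_formed ?H"
        using ij by (intro wf_split wf1) (auto simp: inner_names)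
      show "w \<notin> set (gF ?H)" "w' \<notin> set (gF ?H)"
        using w w' by (auto simp: names_def)
      show "e \<notin> set (gM ?H)" "e' \<notin> set (gM ?H)"
        using ne wf by (auto simp: well_formed_def)
      show "gI ?H' (Transposition.transpose e e' (fst h), snd h) = Transposition.transpose w w' (gI ?H h)"
        if hE: "fst h \<in> gE ?H" for h
      proof -
        consider "fst h = e" | "fst h = e'" | "fst h \<in> gE G" "fst h \<noteq> e" "fst h \<noteq> e'"
          using hE ne by auto
        then show ?thesis
        proof cases
          case 1
          then have "h \<notin> T" using ST ne by (auto simp: half_edges_def)
          with 1 ne show ?thesis by (auto simp: transpose_def)
        next
          case 2
          then have "(e, snd h) \<notin> S" using ST ne by (auto simp: half_edges_def)
          with 2 ne show ?thesis by (auto simp: transpose_def)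
        next
          case 3
          then have "gI G h \<noteq> w" "gI G h \<noteq> w'"
            using well_formed_gI[OF wf, of h] w w' by auto
          with 3 ne ST show ?thesis by (auto simp: transpose_def)
        qed
      qed
    qed (use ne e' w' in auto)
    moreover have "coef (?G1 i S) e' w' = coef (?G1 j T) e' w'"
      by (simp add: coef_def)
    ultimately show ?thesis
      by (simp add: X_def split_term_def)
  qed
  have cs: "c * d_at f (?G1 i S) j = (\<Sum>T \<in> splits (?G1 i S) j. X i S j T)"
    if "i \<in> inner G" "j \<in> names (?G1 i S)" for i S j
    unfolding X_def sum_distrib_left[symmetric]
    by (subst d_at_fresh[OF f wf1[OF that(1)] that(2) fr1]) simp
  have dec: "c * d f (?G1 i S) = (\<Sum>j \<in> inner G - {i}. \<Sum>T \<in> splits G j. X i S j T)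
      + c * d_at f (?G1 i S) i + c * d_at f (?G1 i S) w" if i: "i \<in> inner G" "S \<in> splits G i" for i S
  proof -
    have "inner (?G1 i S) = insert w (insert i (inner G - {i}))"
      using inner_split[OF fr] i by auto
    moreover have "w \<noteq> i"
      using w i by auto
    ultimately have "c * d f (?G1 i S) = c * (\<Sum>j \<in> inner G - {i}. d_at f (?G1 i S) j)
      + c * d_at f (?G1 i S) i + c * d_at f (?G1 i S) w"
      unfolding d_def using w wf_finite(4)[OF wf] by (simp add: algebra_simps del: insert_Diff_single)
    moreover have "c * d_at f (?G1 i S) j = (\<Sum>T \<in> splits G j. X i S j T)"
      if "j \<in> inner G - {i}" for j
    proof -
      have "half_edges (?G1 i S) j = half_edges G j"
        using that w by (intro half_edges_split_other[OF wf fr B[OF i(2)]]) auto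
      then have "splits (?G1 i S) j = splits G j"
        by (simp add: splits_def)
      then show ?thesis
        using cs[OF i(1), of j S] that by (simp add: inner_names)
    qed
    ultimately show ?thesis
      by (simp add: sum_distrib_left)
  qed
  \<comment> \<open>Complementing \<open>S\<close> carries a second splitting at the new vertex to
    one at the old vertex, so only the latter have to be treated.\<close>
  have new: "(\<Sum>S \<in> splits G i. c * d_at f (?G1 i S) w) = (\<Sum>S \<in> splits G i. c * d_at f (?G1 i S) i)"
    if i: "i \<in> inner G" for i
  proof -
    have eq: "d_at f (?G1 i (half_edges G i - S)) i = d_at f (?G1 i S) w" if "S \<in> splits G i" for S
      using d_at_iso[OF f split_complement_iso[OF wf i B[OF that] fr], of w]
        split_complement_sign[OF wf i fr] by simp
    have "bij_betw (\<lambda>S. half_edges G i - S) (splits G i) (splits G i)"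
      using splits_complement
      by (intro bij_betw_byWitness[where f' = "\<lambda>S. half_edges G i - S"]) blast+
    then have "(\<Sum>S \<in> splits G i. c * d_at f (?G1 i (half_edges G i - S)) i)
        = (\<Sum>S \<in> splits G i. c * d_at f (?G1 i S) i)"
      by (rule sum.reindex_bij_betw)
    then show ?thesis
      using eq by simp
  qed
  have old: "(\<Sum>S \<in> splits G i. c * d_at f (?G1 i S) i) = 0" if i: "i \<in> inner G" for i
  proof -
    let ?B = "half_edges G i"
    \<comment> \<open>Three parts arise: \<open>S\<close>, \<open>T\<close> and a remainder at
      \<open>i\<close>. The remainder also carries ends of both connecting edges and therefore only
      has to be nonempty. In this form the condition is symmetric in \<open>S\<close> and
      \<open>T\<close>.\<close>
    define D where "D = {S. S \<subseteq> ?B \<and> 2 \<le> card S}"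
    define R where "R S T \<longleftrightarrow> S \<inter> T = {} \<and> S \<union> T \<noteq> ?B" for S T :: "(nat \<times> bool) set"
    have in_names: "i \<in> names G"
      using i by (rule inner_names)
    \<comment> \<open>The old connecting edge may be assumed to stay at \<open>i\<close>:
      complementing \<open>T\<close> exchanges the two cases, which accounts for the factor
      \<open>2\<close>.\<close>
    have half: "c * d_at f (?G1 i S) i = 2 * (\<Sum>T \<in> {T \<in> D. R S T}. X i S i T)" if S: "S \<in> splits G i" for S
    proof -
      let ?B' = "half_edges (?G1 i S) i" and ?x = "(e, False)"
      have B': "?B' = insert ?x (?B - S)" and x: "?x \<notin> ?B"
        using half_edges_split_old[OF wf in_names fr B[OF S]] fr by (auto simp: fresh_def half_edges_def)
      have finB': "finite ?B'"
        using B' finB by simp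
      let ?P = "{T \<in> splits (?G1 i S) i. ?x \<notin> T}" and ?N = "{T \<in> splits (?G1 i S) i. ?x \<in> T}"
      have "bij_betw (\<lambda>T. ?B' - T) ?P ?N"
      proof (rule bij_betw_byWitness[where f' = "\<lambda>T. ?B' - T"])
        have "?x \<in> ?B'"
          using B' by simp
        then show "(\<lambda>T. ?B' - T) ` ?P \<subseteq> ?N" "(\<lambda>T. ?B' - T) ` ?N \<subseteq> ?P"
          using splits_complement(1) by blast+
      qed (use splits_complement(2) in blast)+
      then have "(\<Sum>T \<in> ?N. X i S i T) = (\<Sum>T \<in> ?P. X i S i (?B' - T))"
        by (rule sum.reindex_bij_betw[symmetric])
      also have "\<dots> = (\<Sum>T \<in> ?P. X i S i T)"
        unfolding X_def using i inner_split[OF fr, of i S]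
        by (intro sum.cong arg_cong[where f = "(*) c"] split_term_complement[OF f wf1 _ _ fr1] refl)
          (auto simp: splits_def)
      finally have N: "(\<Sum>T \<in> ?N. X i S i T) = (\<Sum>T \<in> ?P. X i S i T)" .
      have "splits (?G1 i S) i = ?P \<union> ?N"
        by auto
      then have "(\<Sum>T \<in> splits (?G1 i S) i. X i S i T) = (\<Sum>T \<in> ?P. X i S i T) + (\<Sum>T \<in> ?N. X i S i T)"
        using finite_splits[OF wf1[OF i]] by (subst sum.union_disjoint[symmetric]) auto
      then have "c * d_at f (?G1 i S) i = 2 * (\<Sum>T \<in> ?P. X i S i T)"
        using cs[OF i, of i S] in_names N by simp
      moreover have "?P = {T \<in> D. R S T}"
      proof -
        have "T \<in> ?P \<longleftrightarrow> T \<in> D \<and> R S T" for T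
        proof (cases "T \<subseteq> ?B - S")
          case True
          have fin: "finite (?B - S - T)"
            using finB by simp
          have "?B' - T = insert ?x (?B - S - T)"
            using True x B' by auto
          then have "card (?B' - T) = Suc (card (?B - S - T))"
            using fin x by simp
          moreover have "card (?B - S - T) = 0 \<longleftrightarrow> S \<union> T = ?B"
            using fin True B[OF S] by auto
          ultimately show ?thesis
            using True x B' by (auto simp: splits_def D_def R_def)
        next
          case False
          then show ?thesis
            using x B' by (auto simp: splits_def D_def R_def)
        qed
        then show ?thesis by blast
      qed
      ultimately show ?thesis by simp
    qed
    \<comment> \<open>A set \<open>S\<close> that leaves fewer than two half-edges admits no
      \<open>T\<close>. So the outer sum may run over all of \<open>D\<close>, and the double sum
      becomes symmetric.\<close>
    have zero: "{T \<in> D. R S T} = {}" if "S \<in> D" "S \<notin> splits G i" for S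
    proof -
      have "card (?B - S) < 2"
        using that by (auto simp: D_def splits_def)
      moreover have "card T \<le> card (?B - S)" if "T \<in> D" "R S T" for T
        using that finB by (intro card_mono) (auto simp: D_def R_def)
      ultimately show ?thesis
        by (fastforce simp: D_def)
    qed
    have finD: "finite D"
      using finB by (simp add: D_def)
    have "(\<Sum>S \<in> splits G i. c * d_at f (?G1 i S) i) = 2 * (\<Sum>S \<in> splits G i. \<Sum>T \<in> {T \<in> D. R S T}. X i S i T)"
      using half by (simp add: sum_distrib_left)
    also have "(\<Sum>S \<in> splits G i. \<Sum>T \<in> {T \<in> D. R S T}. X i S i T) = (\<Sum>S \<in> D. \<Sum>T \<in> {T \<in> D. R S T}. X i S i T)"
    proof (intro sum.mono_neutral_left finD ballI)
      show "splits G i \<subseteq> D"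
        by (auto simp: D_def splits_def)
      show "(\<Sum>T \<in> {T \<in> D. R S T}. X i S i T) = 0" if "S \<in> D - splits G i" for S
      proof -
        have "{T \<in> D. R S T} = {}"
          using zero that by blast
        then show ?thesis
          by (simp only: sum.empty)
      qed
    qed
    also have "\<dots> = 0"
      using i by (intro antisymmetric_sum swap) (auto simp: D_def R_def)
    finally show ?thesis by simp
  qed
  have "d (d f) G = (\<Sum>i \<in> inner G. \<Sum>S \<in> splits G i. c * d f (?G1 i S))"
    unfolding d_def[of "d f"] d_at_def[of "d f"] split_term_def c_def e_def w_def ..
  also have "\<dots> = (\<Sum>i \<in> inner G. \<Sum>S \<in> splits G i. \<Sum>j \<in> inner G - {i}. \<Sum>T \<in> splits G j. X i S j T)
     + (\<Sum>i \<in> inner G. \<Sum>S \<in> splits G i. c * d_at f (?G1 i S) i)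
     + (\<Sum>i \<in> inner G. \<Sum>S \<in> splits G i. c * d_at f (?G1 i S) w)"
    using dec by (simp add: sum.distrib cong: sum.cong)
  also have "\<dots> = (\<Sum>i \<in> inner G. \<Sum>S \<in> splits G i. \<Sum>j \<in> inner G - {i}. \<Sum>T \<in> splits G j. X i S j T)"
    using old new by simp
  also have "\<dots> = (\<Sum>i \<in> inner G. \<Sum>j \<in> {j \<in> inner G. i \<noteq> j}. \<Sum>S \<in> splits G i. \<Sum>T \<in> splits G j. X i S j T)"
  proof (rule sum.cong[OF refl])
    fix i
    have "inner G - {i} = {j \<in> inner G. i \<noteq> j}" by auto
    then show "(\<Sum>S \<in> splits G i. \<Sum>j \<in> inner G - {i}. \<Sum>T \<in> splits G j. X i S j T) =
      (\<Sum>j \<in> {j \<in> inner G. i \<noteq> j}. \<Sum>S \<in> splits G i. \<Sum>T \<in> splits G j. X i S j T)"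
      by (simp add: sum.swap[of _ "splits G i"])
  qed
  also have "\<dots> = 0"
  proof (rule antisymmetric_sum)
    fix i j assume ij: "i \<in> inner G" "j \<in> inner G" "i \<noteq> j"
    have "X j T i S = - X i S j T" if "S \<in> splits G i" "T \<in> splits G j" for S T
      using ij B[OF that(1)] B[OF that(2)] by (intro swap) (auto simp: half_edges_def)
    then show "(\<Sum>S \<in> splits G j. \<Sum>T \<in> splits G i. X j S i T) =
      - (\<Sum>S \<in> splits G i. \<Sum>T \<in> splits G j. X i S j T)"
      by (subst sum.swap) (simp add: sum_negf)
  qed auto
  finally show ?thesis .
qed

end

section \<open>Exactness on classes of graphs\<close>

definition invariant :: "(ngraph \<Rightarrow> 'a) \<Rightarrow> bool" where
  "invariant f \<longleftrightarrow> (\<forall>p r F G G'. graph_iso p r F G G' \<longrightarrow> f G' = f G)"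

definition step :: "ngraph \<Rightarrow> ngraph \<Rightarrow> bool" where
  "step G G' \<longleftrightarrow> (\<exists>i S e w. i \<in> inner G \<and> S \<in> splits G i \<and> fresh G e w \<and>
     G' = split_at G i S e w)"

text \<open>Functions supported on such a class form a subquotient of the cochain complex: two
  successive splittings between members cannot leave the class in between.\<close>

definition convex_class :: "(ngraph \<Rightarrow> bool) \<Rightarrow> bool" where
  "convex_class P \<longleftrightarrow> (\<forall>G G1 G2. P G \<and> step G G1 \<and> step G1 G2 \<and> P G2 \<longrightarrow> P G1)"

definition graph_class :: "(ngraph \<Rightarrow> bool) \<Rightarrow> bool" where
  "graph_class P \<longleftrightarrow> invariant P \<and> (\<forall>G. P G \<longrightarrow> well_formed G)"

definition restr :: "(ngraph \<Rightarrow> bool) \<Rightarrow> (ngraph \<Rightarrow> rat) \<Rightarrow> ngraph \<Rightarrow> rat" where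
  "restr P f G = (if P G then f G else 0)"

lemma invariantD: "invariant f \<Longrightarrow> graph_iso p r F G G' \<Longrightarrow> f G' = f G"
  unfolding invariant_def by blast

lemma invariantI: "(\<And>p r F G G'. graph_iso p r F G G' \<Longrightarrow> f G' = f G) \<Longrightarrow> invariant f"
  unfolding invariant_def by blast

lemma invariant_predI:
  assumes "\<And>p r F G G'. graph_iso p r F G G' \<Longrightarrow> P G \<Longrightarrow> P G'"
  shows "invariant P"
  using assms iso_sym unfolding invariant_def by blast

lemma convex_class_level:
  fixes f :: "ngraph \<Rightarrow> int"
  assumes "convex_class P" "\<And>G G'. P G \<Longrightarrow> P G' \<Longrightarrow> step G G' \<Longrightarrow> f G \<le> f G'"
  shows "convex_class (\<lambda>G. P G \<and> f G = c)"
  unfolding convex_class_def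
proof (intro allI impI, elim conjE)
  fix G G1 G2 assume *: "P G" "f G = c" "step G G1" "step G1 G2" "P G2" "f G2 = c"
  then have "P G1" using assms(1) unfolding convex_class_def by blast
  with * assms(2)[of G G1] assms(2)[of G1 G2] show "P G1 \<and> f G1 = c" by auto
qed

lemma card_inner_split: "well_formed G \<Longrightarrow> fresh G e w \<Longrightarrow>
    card (inner (split_at G i S e w)) = Suc (card (inner G))"
  using wf_finite(4) by (auto simp: inner_split) (auto simp: fresh_def inner_def names_def)

lemma card_inner_step: "step G G' \<Longrightarrow> well_formed G \<Longrightarrow> card (inner G') = Suc (card (inner G))"
  unfolding step_def using card_inner_split by blast

context parity
begin

lemma equivariant_restr:
  assumes "invariant P" "equivariant f"
  shows "equivariant (restr P f)"
  using assms invariantD[OF assms(1)] by (auto simp: equivariant_def restr_def)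

lemma equivariant_add: "equivariant f \<Longrightarrow> equivariant g \<Longrightarrow> equivariant (\<lambda>G. f G + g G)"
  by (simp add: equivariant_def distrib_left)

lemma equivariant_diff: "equivariant f \<Longrightarrow> equivariant g \<Longrightarrow> equivariant (\<lambda>G. f G - g G)"
  by (simp add: equivariant_def right_diff_distrib)

lemma d_cong:
  assumes "well_formed G" "\<And>G'. step G G' \<Longrightarrow> f G' = g G'"
  shows "d f G = d g G"
  unfolding d_def d_at_def split_term_def
proof (intro sum.cong refl)
  fix i S assume "i \<in> inner G" "S \<in> splits G i"
  then have "step G (split_at G i S (new_edge G) (new_vertex G))"
    unfolding step_def using fresh_new[OF assms(1)] by blast
  then show "coef G (new_edge G) (new_vertex G) * f (split_at G i S (new_edge G) (new_vertex G)) =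
    coef G (new_edge G) (new_vertex G) * g (split_at G i S (new_edge G) (new_vertex G))"
    using assms(2) by simp
qed

lemma d_zero [simp]: "d (\<lambda>G. 0) G = 0"
  by (simp add: d_def d_at_def split_term_def)

lemma d_eq_0:
  assumes "well_formed G" "\<And>G'. step G G' \<Longrightarrow> f G' = 0"
  shows "d f G = 0"
  using d_cong[OF assms(1), of f "\<lambda>_. 0"] assms(2) by simp

lemma d_add: "d (\<lambda>G. f G + g G) G = d f G + d g G"
  by (simp add: d_def d_at_def split_term_def sum.distrib distrib_left)

lemma d_diff: "d (\<lambda>G. f G - g G) G = d f G - d g G"
  by (simp add: d_def d_at_def split_term_def sum_subtractf right_diff_distrib)

lemma d_restr_add: "d (restr P (\<lambda>G. f G + g G)) G = d (restr P f) G + d (restr P g) G"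
  unfolding d_add[symmetric] by (rule arg_cong[where f = "\<lambda>h. d h G"]) (auto simp: restr_def)

lemma d_restr_diff: "d (restr P (\<lambda>G. f G - g G)) G = d (restr P f) G - d (restr P g) G"
  unfolding d_diff[symmetric] by (rule arg_cong[where f = "\<lambda>h. d h G"]) (auto simp: restr_def)

text \<open>At a splitting \<open>G1\<close> outside \<open>P\<close>, convexity forbids any further
  splitting back into \<open>P\<close>. The inner differential vanishes there anyway, and
  \<open>d_d\<close> applies.\<close>

lemma d_restr_d_restr:
  assumes "graph_class P" "convex_class P" "equivariant f" "P G"
  shows "d (restr P (d (restr P f))) G = 0"
proof -
  have wf: "well_formed G" using assms by (auto simp: graph_class_def)
  have "d (restr P (d (restr P f))) G = d (d (restr P f)) G"
  proof (rule d_cong[OF wf])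
    fix G1 assume s: "step G G1"
    show "restr P (d (restr P f)) G1 = d (restr P f) G1"
    proof (cases "P G1")
      case False
      have "well_formed G1"
        using s wf by (auto simp: step_def intro: wf_split inner_names)
      moreover have "\<not> P G2" if "step G1 G2" for G2
        using False s assms(2,4) that unfolding convex_class_def by blast
      ultimately have "d (restr P f) G1 = 0"
        by (intro d_eq_0) (simp_all add: restr_def)
      with False show ?thesis by (simp add: restr_def)
    qed (simp add: restr_def)
  qed
  also have "\<dots> = 0"
    using assms by (intro d_d equivariant_restr wf) (auto simp: graph_class_def)
  finally show ?thesis .
qed

text \<open>Since \<open>d f\<close> at a graph involves \<open>f\<close> at graphs with one more
  inner vertex, a cocycle on graphs with \<open>v\<close> inner vertices is tested on graphs with
  \<open>v - 1\<close> of them, and its primitive lives on those with \<open>v + 1\<close>. Frozen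
  vertices are not inner, which is why freezing shifts the degree.\<close>

definition exact :: "(ngraph \<Rightarrow> bool) \<Rightarrow> nat \<Rightarrow> bool" where
  "exact P v \<longleftrightarrow> (\<forall>f. equivariant f \<longrightarrow>
     (\<forall>G. P G \<and> Suc (card (inner G)) = v \<longrightarrow> d (restr P f) G = 0) \<longrightarrow>
     (\<exists>g. equivariant g \<and> (\<forall>G. P G \<and> card (inner G) = v \<longrightarrow> d (restr P g) G = f G)))"

lemma exactD:
  assumes "exact P v" "equivariant f"
    "\<And>G. P G \<Longrightarrow> Suc (card (inner G)) = v \<Longrightarrow> d (restr P f) G = 0"
  shows "\<exists>g. equivariant g \<and> (\<forall>G. P G \<and> card (inner G) = v \<longrightarrow> d (restr P g) G = f G)"
  using assms unfolding exact_def by blast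

lemma exactI:
  assumes "\<And>f. equivariant f \<Longrightarrow> (\<And>G. P G \<Longrightarrow> Suc (card (inner G)) = v \<Longrightarrow> d (restr P f) G = 0) \<Longrightarrow>
     \<exists>g. equivariant g \<and> (\<forall>G. P G \<and> card (inner G) = v \<longrightarrow> d (restr P g) G = f G)"
  shows "exact P v"
  using assms unfolding exact_def by blast

section \<open>Exactness from filtrations and from direct summands\<close>

text \<open>The usual argument for a bounded filtration with exact graded pieces: the differential
  at a graph looks only at graphs of the same or a higher value of \<open>f\<close>, so a primitive
  can be corrected level by level, from the highest value down.\<close>

lemma exact_filtration:
  fixes f :: "ngraph \<Rightarrow> int"
  assumes P: "graph_class P" "convex_class P"
    and f: "\<And>p r F G G'. graph_iso p r F G G' \<Longrightarrow> P G \<Longrightarrow> f G' = f G"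
    and mono: "\<And>G G'. P G \<Longrightarrow> P G' \<Longrightarrow> step G G' \<Longrightarrow> f G \<le> f G'"
    and bounds: "\<And>G. P G \<Longrightarrow> card (inner G) = v \<Longrightarrow> lo \<le> f G \<and> f G \<le> hi"
    and ex: "\<And>c. exact (\<lambda>G. P G \<and> f G = c) v"
  shows "exact P v"
proof (rule exactI)
  fix u assume u: "equivariant u" and
    du: "\<And>G. P G \<Longrightarrow> Suc (card (inner G)) = v \<Longrightarrow> d (restr P u) G = 0"
  have wf: "\<And>G. P G \<Longrightarrow> well_formed G" and invP: "invariant P"
    using P by (auto simp: graph_class_def)
  \<comment> \<open>After \<open>j\<close> rounds the primitive is correct above the value
    \<open>hi - j\<close>. For \<open>j = 0\<close> this is an empty condition, because
    \<open>hi\<close> is an upper bound.\<close>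
  have "\<exists>g. equivariant g \<and> (\<forall>G. P G \<and> card (inner G) = v \<and> hi - int j < f G \<longrightarrow> d (restr P g) G = u G)" for j
  proof (induction j)
    case 0
    have "equivariant (\<lambda>G. 0)" by (simp add: equivariant_def)
    then show ?case using bounds by fastforce
  next
    case (Suc j)
    then obtain g where g: "equivariant g"
      "\<And>G. P G \<Longrightarrow> card (inner G) = v \<Longrightarrow> hi - int j < f G \<Longrightarrow> d (restr P g) G = u G"
      by blast
    define c where "c = hi - int j"
    let ?Q = "\<lambda>G. P G \<and> f G = c"
    have invQ: "invariant ?Q"
      using invariantD[OF invP] f by (intro invariant_predI) auto
    let ?u = "\<lambda>G. u G - d (restr P g) G"
    have equ: "equivariant ?u"
      by (intro equivariant_diff u equivariant_d equivariant_restr invP g)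
    \<comment> \<open>The error of the current primitive vanishes above level \<open>c\<close>, so
      cutting it down to level \<open>c\<close> does not change its differential at graphs of that
      level.\<close>
    have "d (restr ?Q ?u) G = 0" if G: "?Q G" "Suc (card (inner G)) = v" for G
    proof -
      have "d (restr ?Q ?u) G = d (restr P ?u) G"
      proof (rule d_cong)
        show "well_formed G" using wf G by blast
        fix G' assume s: "step G G'"
        show "restr ?Q ?u G' = restr P ?u G'"
        proof (cases "P G'")
          case True
          have "card (inner G') = v"
            using card_inner_step[OF s] wf G by simp
          moreover have "c \<le> f G'" using mono[OF _ True s] G by auto
          ultimately show ?thesis
            using True g(2)[of G'] by (auto simp: restr_def c_def)
        qed (simp add: restr_def)
      qed
      also have "\<dots> = 0"
        unfolding d_restr_diff using du[of G] d_restr_d_restr[OF P g(1), of G] G by simp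
      finally show ?thesis .
    qed
    then obtain g' where g': "equivariant g'"
      "\<And>G. ?Q G \<Longrightarrow> card (inner G) = v \<Longrightarrow> d (restr ?Q g') G = ?u G"
      using exactD[OF ex equ] by blast
    have rr: "restr P (restr ?Q g') = restr ?Q g'"
      by (auto simp: restr_def)
    have "d (restr P (\<lambda>G. g G + restr ?Q g' G)) G = u G"
      if G: "P G" "card (inner G) = v" "hi - int (Suc j) < f G" for G
    proof (cases "f G = c")
      case True
      then show ?thesis
        using g'(2)[of G] G by (simp add: d_restr_add rr)
    next
      case False
      then have "c < f G" using G by (simp add: c_def)
      have "d (restr ?Q g') G = 0"
      proof (rule d_eq_0[OF wf[OF G(1)]])
        fix G' assume "step G G'"
        then show "restr ?Q g' G' = 0"
          using mono[of G G'] G(1) \<open>c < f G\<close> by (auto simp: restr_def)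
      qed
      moreover have "d (restr P g) G = u G"
        using g(2)[of G] G \<open>c < f G\<close> by (simp add: c_def)
      ultimately show ?thesis
        by (simp add: d_restr_add rr)
    qed
    moreover have "equivariant (\<lambda>G. g G + restr ?Q g' G)"
      by (intro equivariant_add equivariant_restr g g' invQ)
    ultimately show ?case by blast
  qed
  from this[of "nat (hi - lo + 1)"] obtain g where g: "equivariant g"
    "\<And>G. P G \<Longrightarrow> card (inner G) = v \<Longrightarrow> hi - int (nat (hi - lo + 1)) < f G \<Longrightarrow> d (restr P g) G = u G"
    by blast
  have "d (restr P g) G = u G" if "P G" "card (inner G) = v" for G
    using g(2)[OF that] bounds[OF that] by linarith
  with g(1) show "\<exists>g. equivariant g \<and> (\<forall>G. P G \<and> card (inner G) = v \<longrightarrow> d (restr P g) G = u G)"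
    by blast
qed

text \<open>No splitting inside \<open>P\<close> connects members of \<open>Q\<close> with other
  graphs, so the complex of \<open>P\<close> is a direct sum. A cocycle is extended by zero, and the
  primitive is restricted again.\<close>

lemma exact_restrict:
  assumes P: "graph_class P"
    and Q: "\<And>p r F G G'. graph_iso p r F G G' \<Longrightarrow> P G \<Longrightarrow> Q G' = Q G"
    and ex: "exact P v"
    and const: "\<And>G G'. P G \<Longrightarrow> P G' \<Longrightarrow> step G G' \<Longrightarrow> Q G' = Q G"
  shows "exact (\<lambda>G. P G \<and> Q G) v"
proof (rule exactI)
  let ?R = "\<lambda>G. P G \<and> Q G"
  fix u assume u: "equivariant u" and
    du: "\<And>G. ?R G \<Longrightarrow> Suc (card (inner G)) = v \<Longrightarrow> d (restr ?R u) G = 0"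
  have wf: "\<And>G. P G \<Longrightarrow> well_formed G" and invP: "invariant P"
    using P by (auto simp: graph_class_def)
  have invR: "invariant ?R"
    using invariantD[OF invP] Q by (intro invariant_predI) auto
  have equ: "equivariant (restr ?R u)"
    by (intro equivariant_restr invR u)
  have rr: "restr P (restr ?R u) = restr ?R u"
    by (auto simp: restr_def)
  have "d (restr P (restr ?R u)) G = 0" if G: "P G" "Suc (card (inner G)) = v" for G
  proof (cases "Q G")
    case True
    then show ?thesis unfolding rr using du G by simp
  next
    case False
    then have "restr ?R u G' = 0" if "step G G'" for G'
      using const[OF G(1) _ that] by (auto simp: restr_def)
    then show ?thesis
      unfolding rr by (intro d_eq_0 wf G)
  qed
  then obtain g where g: "equivariant g"
    "\<And>G. P G \<Longrightarrow> card (inner G) = v \<Longrightarrow> d (restr P g) G = restr ?R u G"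
    using exactD[OF ex equ] by blast
  have "d (restr ?R g) G = u G" if G: "?R G" "card (inner G) = v" for G
  proof -
    have "restr ?R g G' = restr P g G'" if "step G G'" for G'
      using const[OF _ _ that] G by (simp add: restr_def)
    then have "d (restr ?R g) G = d (restr P g) G"
      using G by (intro d_cong wf) auto
    then show ?thesis using g(2)[of G] G by (simp add: restr_def)
  qed
  with g(1) show "\<exists>g. equivariant g \<and> (\<forall>G. ?R G \<and> card (inner G) = v \<longrightarrow> d (restr ?R g) G = u G)"
    by blast
qed

end

section \<open>Marking an edge, freezing a vertex, contracting an edge\<close>

lemma opp_Pair [simp]: "opp (k, b) = (k, \<not> b)"
  by (simp add: opp_def)

lemma update_simps [simp]:
  "gE (G\<lparr>gM := ms\<rparr>) = gE G" "gE (G\<lparr>gF := xs\<rparr>) = gE G"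
  "names (G\<lparr>gM := ms\<rparr>) = names G" "inner (G\<lparr>gM := ms\<rparr>) = inner G"
  "half_edges (G\<lparr>gM := ms\<rparr>) z = half_edges G z" "half_edges (G\<lparr>gF := xs\<rparr>) z = half_edges G z"
  "splits (G\<lparr>gM := ms\<rparr>) z = splits G z" "splits (G\<lparr>gF := xs\<rparr>) z = splits G z"
  "fresh (G\<lparr>gM := ms\<rparr>) e w = fresh G e w"
  by (auto simp: names_def inner_def half_edges_def splits_def fresh_def)

lemma split_update:
  "split_at (G\<lparr>gM := ms\<rparr>) i S e w = (split_at G i S e w)\<lparr>gM := ms\<rparr>"
  "split_at (G\<lparr>gF := xs\<rparr>) i S e w = (split_at G i S e w)\<lparr>gF := xs\<rparr>"
  by (simp_all add: split_at_def fun_eq_iff cong: if_cong)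

text \<open>Marks and frozen vertices are kept as stacks: a new one is put in front, and the older
  ones keep their order. Choices from earlier rounds of the induction thus remain in the graph
  without interfering with the current ones.\<close>

definition unmark :: "ngraph \<Rightarrow> ngraph" where
  "unmark G = G\<lparr>gM := tl (gM G)\<rparr>"

definition mark :: "nat \<Rightarrow> ngraph \<Rightarrow> ngraph" where
  "mark k G = G\<lparr>gM := k # gM G\<rparr>"

definition thaw :: "ngraph \<Rightarrow> ngraph" where
  "thaw G = G\<lparr>gF := tl (gF G)\<rparr>"

definition freeze :: "nat \<Rightarrow> ngraph \<Rightarrow> ngraph" where
  "freeze x G = G\<lparr>gF := x # gF G\<rparr>"

lemma unmark_mark [simp]: "unmark (mark k G) = G" "thaw (freeze x G) = G"
  "gM (mark k G) = k # gM G" "gF (freeze x G) = x # gF G"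
  by (simp_all add: unmark_def mark_def thaw_def freeze_def)

lemma iso_unmark: "graph_iso p r F G G' \<Longrightarrow> graph_iso p r F (unmark G) (unmark G')"
  by (cases "gM G") (auto simp: graph_iso_def unmark_def well_formed_def names_def)

lemma iso_mark:
  "graph_iso p r F G G' \<Longrightarrow> k \<in> gE G \<Longrightarrow> graph_iso p r F (mark k G) (mark (p k) G')"
  by (auto simp: graph_iso_def mark_def well_formed_def names_def)

text \<open>Membership in \<open>gV\<close> distinguishes a frozen vertex from a hair end. Taking a
  hair end off \<open>gF\<close> would delete its name and leave its edge without an end.\<close>

lemma names_thaw: "gF G \<noteq> [] \<Longrightarrow> hd (gF G) \<in> gV G \<Longrightarrow> names (thaw G) = names G"
  by (cases "gF G") (auto simp: thaw_def names_def)

lemma names_freeze: "x \<in> gV G \<Longrightarrow> names (freeze x G) = names G"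
  by (auto simp: freeze_def names_def)

lemma well_formed_thaw:
  "gF G \<noteq> [] \<Longrightarrow> hd (gF G) \<in> gV G \<Longrightarrow> well_formed (thaw G) = well_formed G"
  using names_thaw[of G] by (simp add: well_formed_def) (simp add: thaw_def)

lemma well_formed_freeze: "x \<in> gV G \<Longrightarrow> well_formed (freeze x G) = well_formed G"
  using names_freeze[of x G] by (simp add: well_formed_def) (simp add: freeze_def)

lemma iso_thaw:
  assumes "graph_iso p r F G G'" "gF G \<noteq> []" "hd (gF G) \<in> gV G"
  shows "graph_iso p r F (thaw G) (thaw G')"
proof -
  have "names (thaw G) = names G" "well_formed (thaw G)"
    using assms names_thaw well_formed_thaw by (auto simp: graph_iso_def)
  then show ?thesis
    using assms by (simp add: graph_iso_def) (simp add: thaw_def map_tl)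
qed

lemma iso_freeze:
  assumes "graph_iso p r F G G'" "x \<in> gV G"
  shows "graph_iso p r F (freeze x G) (freeze (r x) G')"
proof -
  have "names (freeze x G) = names G" "well_formed (freeze x G)"
    using assms names_freeze well_formed_freeze by (auto simp: graph_iso_def)
  then show ?thesis
    using assms by (simp add: graph_iso_def) (simp add: freeze_def)
qed

text \<open>A half-edge rather than an edge is given, to determine which name survives: the end of
  \<open>h\<close> stays and the end of \<open>opp h\<close> is absorbed.\<close>

definition contract :: "ngraph \<Rightarrow> nat \<times> bool \<Rightarrow> ngraph" where
  "contract G h = G\<lparr>gE := gE G - {fst h}, gV := gV G - {gI G (opp h)},
     gI := (\<lambda>g. if gI G g = gI G (opp h) then gI G h else gI G g)\<rparr>"

lemma contract_simps [simp]:
  "gE (contract G h) = gE G - {fst h}"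
  "gV (contract G h) = gV G - {gI G (opp h)}"
  "gF (contract G h) = gF G" "gM (contract G h) = gM G"
  "gI (contract G h) g = (if gI G g = gI G (opp h) then gI G h else gI G g)"
  by (auto simp: contract_def)

definition contractible :: "ngraph \<Rightarrow> nat \<times> bool \<Rightarrow> bool" where
  "contractible G h \<longleftrightarrow> well_formed G \<and> fst h \<in> gE G \<and> fst h \<notin> set (gM G) \<and>
     gI G h \<in> inner G \<and> gI G (opp h) \<in> inner G \<and> gI G h \<noteq> gI G (opp h)"

lemma contract_names:
  "contractible G h \<Longrightarrow> names (contract G h) = names G - {gI G (opp h)}"
  "contractible G h \<Longrightarrow> inner (contract G h) = inner G - {gI G (opp h)}"
  by (auto simp: contractible_def names_def inner_def)

lemma wf_contract: "contractible G h \<Longrightarrow> well_formed (contract G h)"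
proof -
  assume h: "contractible G h"
  then have wf: "well_formed G" and x: "gI G h \<in> names G" "gI G h \<noteq> gI G (opp h)"
    and M: "fst h \<notin> set (gM G)"
    by (auto simp: contractible_def inner_names)
  have "gI (contract G h) g \<in> names (contract G h)" if "fst g \<in> gE (contract G h)" for g
    using well_formed_gI[OF wf, of g] that x contract_names(1)[OF h] by auto
  moreover have "finite (gE G)" "finite (gV G)" "set (gM G) \<subseteq> gE G"
    using wf by (simp_all add: well_formed_def)
  ultimately show "well_formed (contract G h)"
    unfolding well_formed_def using M by (simp del: contract_simps(5)) blast
qed

lemma hmap_opp: "hmap p F (opp h) = opp (hmap p F h)"
  by (auto simp: hmap_def opp_def)

lemma contract_iso:
  assumes iso: "graph_iso p r F G G'" and h: "contractible G h"
  shows "graph_iso p r (F - {fst h}) (contract G h) (contract G' (hmap p F h))"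
proof -
  let ?y = "gI G (opp h)" and ?h' = "hmap p F h"
  have hE: "fst h \<in> gE G" "fst (opp h) \<in> gE G"
    using h by (auto simp: contractible_def)
  have y: "?y \<in> names G" "?y \<in> gV G" "?y \<notin> set (gF G)"
    using h by (auto simp: contractible_def inner_def names_def)
  have inj: "inj_on p (gE G)" "inj_on r (names G)"
    using iso by (auto simp: graph_iso_def)
  have y': "gI G' (opp ?h') = r ?y"
    using iso_gI[OF iso hE(2)] by (simp add: hmap_opp)
  have fst': "fst ?h' = p (fst h)"
    by (simp add: hmap_def)
  show ?thesis
    unfolding graph_iso_def
  proof (intro conjI allI impI)
    show "well_formed (contract G h)"
      by (rule wf_contract[OF h])
    show "inj_on p (gE (contract G h))" "inj_on r (names (contract G h))"
      using inj contract_names(1)[OF h] by (auto intro: inj_on_subset)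
    show "gE (contract G' ?h') = p ` gE (contract G h)"
      using iso hE inj_on_image_set_diff[OF inj(1), of "gE G" "{fst h}"]
      by (simp add: fst' graph_iso_def)
    show "gV (contract G' ?h') = r ` gV (contract G h)"
    proof -
      have "r ` (gV G - {?y}) = r ` gV G - r ` {?y}"
        using y by (intro inj_on_image_set_diff[OF inj(2)]) (auto simp: names_def)
      then show ?thesis
        using iso by (simp add: y' graph_iso_def)
    qed
    show "gI (contract G' ?h') (p (fst g), snd g \<noteq> (fst g \<in> F - {fst h})) = r (gI (contract G h) g)"
      if "fst g \<in> gE (contract G h)" for g
    proof -
      have g: "fst g \<in> gE G" "fst g \<noteq> fst h"
        using that by auto
      then have "(p (fst g), snd g \<noteq> (fst g \<in> F - {fst h})) = hmap p F g"
        by (auto simp: hmap_def)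
      moreover have "gI G g \<in> names G"
        using g h well_formed_gI by (auto simp: contractible_def)
      ultimately show ?thesis
        using iso_gI[OF iso g(1)] iso_gI[OF iso hE(1)] y' y(1) inj(2)
        by (auto simp: inj_on_def)
    qed
  qed (use iso in \<open>auto simp: graph_iso_def\<close>)
qed

text \<open>Splitting lets the connecting edge point to the new vertex, which is here the end of
  \<open>opp h\<close>. So the edge has to be reversed exactly if \<open>h\<close> is its target
  end.\<close>

lemma split_contract_iso:
  assumes h: "contractible G h"
  defines "y \<equiv> gI G (opp h)"
  shows "graph_iso id id (if snd h then {fst h} else {})
    (split_at (contract G h) (gI G h) (half_edges G y - {opp h}) (fst h) y) G"
proof -
  let ?H = "split_at (contract G h) (gI G h) (half_edges G y - {opp h}) (fst h) y"
  let ?F = "if snd h then {fst h} else {}"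
  have hE: "fst h \<in> gE G" "y \<in> gV G" and ne: "gI G h \<noteq> y"
    using h by (auto simp: contractible_def inner_def y_def)
  have inc: "gI G (id (fst g), snd g \<noteq> (fst g \<in> ?F)) = id (gI ?H g)" if g: "fst g \<in> gE ?H" for g
  proof (cases "fst g = fst h")
    case True
    then consider "(id (fst g), snd g \<noteq> (fst g \<in> ?F)) = opp h" "snd g" | "(id (fst g), snd g \<noteq> (fst g \<in> ?F)) = h" "\<not> snd g"
      by (cases h; cases g; cases "snd g") (auto simp: opp_def)
    then show ?thesis
      using True by cases (auto simp: y_def)
  next
    case False
    then have "g \<noteq> opp h" "g \<noteq> h"
      by auto
    moreover have "fst g \<in> gE G"
      using g False by auto
    ultimately show ?thesis
      using False ne by (auto simp: half_edges_def y_def)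
  qed
  show ?thesis
    unfolding graph_iso_def
  proof (intro conjI allI impI)
    show "well_formed ?H"
      using h wf_contract[OF h] contract_names(2)[OF h] inner_names[of "gI G h" "contract G h"]
      by (intro wf_split) (auto simp: contractible_def)
    show "?F \<subseteq> gE ?H" by auto
    show "gI G (id (fst g), snd g \<noteq> (fst g \<in> ?F)) = id (gI ?H g)" if "fst g \<in> gE ?H" for g
      by (rule inc[OF that])
  qed (use hE in \<open>auto simp: y_def\<close>)
qed

lemma contract_split_iso:
  assumes "well_formed G" "i \<in> inner G" "S \<subseteq> half_edges G i" "fresh G e w"
  shows "graph_iso id id {} G (contract (split_at G i S e w) (e, False))"
proof -
  have w: "w \<notin> gV G" "w \<noteq> i" "e \<notin> gE G"
    using assms by (auto simp: fresh_def names_def inner_def)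
  have "gI G h \<noteq> w" if "fst h \<in> gE G" for h
    using well_formed_gI[OF assms(1) that] assms(4) by (auto simp: fresh_def)
  moreover have "gI G h = i" if "h \<in> S" for h
    using that assms(3) by (auto simp: half_edges_def)
  ultimately have inc: "gI (contract (split_at G i S e w) (e, False)) h = gI G h"
    if "fst h \<in> gE G" for h
    using w that by auto
  show ?thesis
    unfolding graph_iso_def
  proof (intro conjI allI impI)
    show "gI (contract (split_at G i S e w) (e, False)) (id (fst h), snd h \<noteq> (fst h \<in> {})) = id (gI G h)"
      if "fst h \<in> gE G" for h
      using inc[OF that] by (simp del: contract_simps(5) split_simps(6))
  qed (use assms(1) w in auto)
qed

context parity
begin

lemma pair_sign_id [simp]: "pair_sign id A = 1"
  by (rule pair_sign_mono_on) simp

lemma coef_update [simp]: "coef (G\<lparr>gM := ms\<rparr>) e w = coef G e w" "coef (G\<lparr>gF := xs\<rparr>) e w = coef G e w"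
  by (simp_all add: coef_def)

lemma new_update [simp]: "new_edge (G\<lparr>gM := ms\<rparr>) = new_edge G" "new_edge (G\<lparr>gF := xs\<rparr>) = new_edge G"
    "new_vertex (G\<lparr>gM := ms\<rparr>) = new_vertex G"
  by (simp_all add: new_edge_def new_vertex_def)

lemma iso_sign_update [simp]:
  "iso_sign p r F (unmark G) = iso_sign p r F G" "iso_sign p r F (mark k G) = iso_sign p r F G"
  "iso_sign p r F (thaw G) = iso_sign p r F G" "iso_sign p r F (freeze x G) = iso_sign p r F G"
  by (simp_all add: iso_sign_def unmark_def mark_def thaw_def freeze_def)

lemma d_update_marks: "d f (G\<lparr>gM := ms\<rparr>) = d (\<lambda>H. f (H\<lparr>gM := ms\<rparr>)) G"
  by (simp add: d_def d_at_def split_term_def split_update)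

lemma d_sum: "finite A \<Longrightarrow> d (\<lambda>G. \<Sum>a\<in>A. f a G) G = (\<Sum>a\<in>A. d (f a) G)"
  by (induction A rule: finite_induct) (simp_all add: d_add)

lemma d_scale: "d (\<lambda>G. c * f G) G = c * d f G"
  by (simp add: d_def d_at_def split_term_def sum_distrib_left mult_ac)

text \<open>A cocycle is pulled back to the graphs with one more mark, a primitive is found there
  and averaged over the possible marks, which uses rational coefficients. That splitting inside
  \<open>P\<close> does not change the set of marks makes the average compatible with
  \<open>d\<close>.\<close>

lemma exact_mark:
  assumes P: "graph_class P"
    and Mk: "\<And>G. P G \<Longrightarrow> Mk G \<subseteq> gE G" "\<And>G. P G \<Longrightarrow> Mk G \<noteq> {}"
    and nat: "\<And>p r F G G'. graph_iso p r F G G' \<Longrightarrow> P G \<Longrightarrow> Mk G' = p ` Mk G"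
    and const: "\<And>G G'. P G \<Longrightarrow> P G' \<Longrightarrow> step G G' \<Longrightarrow> Mk G' = Mk G"
    and ex: "exact (\<lambda>G. gM G \<noteq> [] \<and> P (unmark G) \<and> hd (gM G) \<in> Mk (unmark G)) v"
  shows "exact P v"
proof (rule exactI)
  let ?P = "\<lambda>G. gM G \<noteq> [] \<and> P (unmark G) \<and> hd (gM G) \<in> Mk (unmark G)"
  fix u assume u: "equivariant u" and du: "\<And>G. P G \<Longrightarrow> Suc (card (inner G)) = v \<Longrightarrow> d (restr P u) G = 0"
  have wf: "\<And>G. P G \<Longrightarrow> well_formed G" and inv: "invariant P"
    using P by (auto simp: graph_class_def)
  have fin: "finite (Mk G)" if "P G" for G
    using finite_subset[OF Mk(1)[OF that] wf_finite(1)[OF wf[OF that]]] .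
  have wfm: "well_formed G" if "?P G" for G
  proof -
    have "well_formed (unmark G)" "hd (gM G) \<in> gE G"
      using that wf Mk(1)[of "unmark G"] by (auto simp: unmark_def)
    moreover have "set (gM G) = insert (hd (gM G)) (set (gM (unmark G)))"
      using that by (cases "gM G") (simp_all add: unmark_def)
    ultimately show ?thesis
      unfolding well_formed_def by (simp add: unmark_def)
  qed
  have inv': "invariant ?P"
  proof (rule invariant_predI)
    fix p r F G G' assume iso: "graph_iso p r F G G'" and G: "?P G"
    have "Mk (unmark G') = p ` Mk (unmark G)"
      using nat[OF iso_unmark[OF iso]] G by blast
    moreover have "gM G' = map p (gM G)"
      using iso by (simp add: graph_iso_def)
    ultimately show "?P G'"
      using G invariantD[OF inv iso_unmark[OF iso]] by (auto simp: hd_map)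
  qed
  define u' where "u' = restr ?P (\<lambda>G. u (unmark G))"
  have equ: "equivariant u'"
    unfolding equivariant_def
  proof (intro allI impI)
    fix p r F G G' assume iso: "graph_iso p r F G G'"
    show "u' G' = iso_sign p r F G * u' G"
      using equivariantD[OF u iso_unmark[OF iso]] invariantD[OF inv' iso]
      by (simp add: u'_def restr_def)
  qed
  have same: "restr ?P f (mark k H) = restr P (\<lambda>H. f (mark k H)) H"
    if "P G" "step G H" "k \<in> Mk G" for f G H k
  proof (cases "P H")
    case True
    then have "?P (mark k H)"
      using const[OF that(1) True that(2)] that(3) by simp
    with True show ?thesis by (simp add: restr_def)
  qed (simp add: restr_def)
  have mark_tl: "mark (hd (gM G)) (unmark G) = G" if "gM G \<noteq> []" for G
    using that by (simp add: mark_def unmark_def)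
  have step_marks: "gM H = gM G" if "step G H" for G H
    using that by (auto simp: step_def)
  have d_mark: "d (restr ?P f) (mark k G) = d (restr P (\<lambda>H. f (mark k H))) G"
    if "P G" "k \<in> Mk G" for f G k
  proof -
    have "d (restr ?P f) (mark k G) = d (\<lambda>H. restr ?P f (H\<lparr>gM := k # gM G\<rparr>)) G"
      by (simp add: mark_def d_update_marks)
    also have "\<dots> = d (restr P (\<lambda>H. f (mark k H))) G"
    proof (rule d_cong[OF wf[OF that(1)]])
      fix H assume s: "step G H"
      then have "H\<lparr>gM := k # gM G\<rparr> = mark k H"
        by (simp add: mark_def step_marks)
      then show "restr ?P f (H\<lparr>gM := k # gM G\<rparr>) = restr P (\<lambda>H. f (mark k H)) H"
        using same[OF that(1) s that(2)] by simp
    qed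
    finally show ?thesis .
  qed
  have "d (restr ?P u') G = 0" if G: "?P G" "Suc (card (inner G)) = v" for G
  proof -
    have "d (restr ?P u') G = d (restr P (\<lambda>H. u' (mark (hd (gM G)) H))) (unmark G)"
      using d_mark[of "unmark G" "hd (gM G)" u'] mark_tl[of G] G by simp
    also have "\<dots> = d (restr P u) (unmark G)"
    proof (rule d_cong)
      show "well_formed (unmark G)" using wf G by blast
      fix H assume s: "step (unmark G) H"
      show "restr P (\<lambda>H. u' (mark (hd (gM G)) H)) H = restr P u H"
        using same[OF _ s, of "hd (gM G)" "\<lambda>G. u (unmark G)"] G
        by (auto simp: u'_def restr_def split: if_splits)
    qed
    also have "\<dots> = 0"
      using G by (intro du) (auto simp: unmark_def)
    finally show ?thesis .
  qed
  then obtain g where g: "equivariant g"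
    "\<And>G. ?P G \<Longrightarrow> card (inner G) = v \<Longrightarrow> d (restr ?P g) G = u' G"
    using exactD[OF ex equ] by blast
  \<comment> \<open>Each mark yields \<open>u\<close> once, which the division by the number of
    marks compensates. Equivariance holds because isomorphisms permute the summands.\<close>
  define g' where "g' = restr P (\<lambda>G. (\<Sum>k\<in>Mk G. g (mark k G)) / of_nat (card (Mk G)))"
  have "equivariant g'"
    unfolding equivariant_def
  proof (intro allI impI)
    fix p r F G G' assume iso: "graph_iso p r F G G'"
    show "g' G' = iso_sign p r F G * g' G"
    proof (cases "P G")
      case True
      then have inj: "inj_on p (Mk G)"
        using inj_on_subset[OF _ Mk(1)[OF True], of p] iso by (simp add: graph_iso_def)
      have "g (mark (p k) G') = iso_sign p r F G * g (mark k G)" if "k \<in> Mk G" for k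
        using equivariantD[OF g(1) iso_mark[OF iso, of k]] that Mk(1)[OF True] by auto
      then show ?thesis
        using True invariantD[OF inv iso] inj
        by (simp add: g'_def restr_def nat[OF iso True] sum.reindex card_image sum_distrib_left)
    qed (use invariantD[OF inv iso] in \<open>simp add: g'_def restr_def\<close>)
  qed
  moreover have "d (restr P g') G = u G" if G: "P G" "card (inner G) = v" for G
  proof -
    let ?c = "1 / of_nat (card (Mk G)) :: rat"
    have "d (restr P g') G = d (\<lambda>H. ?c * (\<Sum>k\<in>Mk G. restr P (\<lambda>H. g (mark k H)) H)) G"
    proof (rule d_cong[OF wf[OF G(1)]])
      fix H assume s: "step G H"
      show "restr P g' H = ?c * (\<Sum>k\<in>Mk G. restr P (\<lambda>H. g (mark k H)) H)"
        using const[OF G(1) _ s] by (simp add: g'_def restr_def)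
    qed
    also have "\<dots> = ?c * (\<Sum>k\<in>Mk G. d (restr P (\<lambda>H. g (mark k H))) G)"
      using fin[OF G(1)] by (simp only: d_scale d_sum)
    also have "(\<Sum>k\<in>Mk G. d (restr P (\<lambda>H. g (mark k H))) G) = (\<Sum>k\<in>Mk G. u G)"
    proof (rule sum.cong[OF refl])
      fix k assume k: "k \<in> Mk G"
      have "?P (mark k G)"
        using k G by simp
      then show "d (restr P (\<lambda>H. g (mark k H))) G = u G"
        using d_mark[OF G(1) k, of g] g(2)[of "mark k G"] G(2)
        by (simp add: u'_def restr_def) (simp add: mark_def)
    qed
    also have "?c * \<dots> = u G"
      using fin[OF G(1)] Mk(2)[OF G(1)] by simp
    finally show ?thesis .
  qed
  ultimately show "\<exists>g. equivariant g \<and> (\<forall>G. P G \<and> card (inner G) = v \<longrightarrow> d (restr P g) G = u G)"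
    by blast
qed

text \<open>If the distinguished vertex is never split within the class, declaring it frozen changes
  neither the orientation nor the differential, only the number of vertices that are counted. Hence
  the shift from \<open>v\<close> to \<open>Suc v\<close>.\<close>

lemma exact_freeze:
  assumes P: "graph_class P"
    and X: "\<And>G. P G \<Longrightarrow> X G \<in> inner G"
    and nat: "\<And>p r F G G'. graph_iso p r F G G' \<Longrightarrow> P G \<Longrightarrow> X G' = r (X G)"
    and noX: "\<And>G i S e w. P G \<Longrightarrow> i \<in> inner G \<Longrightarrow> S \<in> splits G i \<Longrightarrow> fresh G e w \<Longrightarrow>
      P (split_at G i S e w) \<Longrightarrow> i \<noteq> X G \<and> X (split_at G i S e w) = X G"
    and ex: "exact (\<lambda>G. gF G \<noteq> [] \<and> hd (gF G) \<in> gV G \<and> P (thaw G) \<and> hd (gF G) = X (thaw G)) v"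
  shows "exact P (Suc v)"
proof (rule exactI)
  let ?P = "\<lambda>G. gF G \<noteq> [] \<and> hd (gF G) \<in> gV G \<and> P (thaw G) \<and> hd (gF G) = X (thaw G)"
  fix u assume u: "equivariant u" and
    du: "\<And>G. P G \<Longrightarrow> Suc (card (inner G)) = Suc v \<Longrightarrow> d (restr P u) G = 0"
  have wf: "\<And>G. P G \<Longrightarrow> well_formed G" and inv: "invariant P"
    using P by (auto simp: graph_class_def)
  have XV: "X G \<in> gV G" if "P G" for G
    using X[OF that] by (simp add: inner_def)
  have inv': "invariant ?P"
  proof (rule invariant_predI)
    fix p r F G G' assume iso: "graph_iso p r F G G'" and G: "?P G"
    have iso': "graph_iso p r F (thaw G) (thaw G')"
      using G by (intro iso_thaw[OF iso]) auto
    have "gF G' = map r (gF G)" "gV G' = r ` gV G"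
      using iso by (simp_all add: graph_iso_def)
    then show "?P G'"
      using G invariantD[OF inv iso'] nat[OF iso'] by (auto simp: hd_map)
  qed
  define u' where "u' = restr ?P (\<lambda>G. u (thaw G))"
  have equ: "equivariant u'"
    unfolding equivariant_def
  proof (intro allI impI)
    fix p r F G G' assume iso: "graph_iso p r F G G'"
    show "u' G' = iso_sign p r F G * u' G"
    proof (cases "?P G")
      case True
      then have "gF G \<noteq> []" "hd (gF G) \<in> gV G"
        by blast+
      then have "u (thaw G') = iso_sign p r F G * u (thaw G)"
        using equivariantD[OF u iso_thaw[OF iso]] by simp
      then show ?thesis
        using True invariantD[OF inv' iso] by (simp add: u'_def restr_def)
    qed (use invariantD[OF inv' iso] in \<open>auto simp: u'_def restr_def\<close>)
  qed
  have freeze: "?P (freeze (X G) G)" if "P G" for G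
    using XV[OF that] that by simp (simp add: freeze_def)
  have freeze_thaw: "freeze (X (thaw G)) (thaw G) = G" if "?P G" for G
    using that by (cases "gF G") (auto simp: freeze_def thaw_def)
  have same: "restr ?P f (H\<lparr>gF := X G # gF G\<rparr>) = restr P (\<lambda>H. f (freeze (X H) H)) H"
    if G: "P G" and H: "i \<in> inner G" "i \<noteq> X G" "S \<in> splits G i" "fresh G e w" "H = split_at G i S e w"
    for f G H i S e w
  proof (cases "P H")
    case True
    then have XH: "X H = X G"
      using noX[OF G H(1,3,4)] H(5) by simp
    have eq: "H\<lparr>gF := X G # gF G\<rparr> = freeze (X H) H"
      using XH H(5) by (simp add: freeze_def)
    show ?thesis
      using freeze[OF True] True unfolding eq restr_def by simp
  next
    case False
    have "thaw (H\<lparr>gF := X G # gF G\<rparr>) = H"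
      using H(5) by (simp add: thaw_def)
    with False show ?thesis by (simp add: restr_def)
  qed
  have d_freeze: "d (restr ?P f) (freeze (X G) G) = d (restr P (\<lambda>H. f (freeze (X H) H))) G"
    if G: "P G" for f G
  proof -
    let ?x = "X G" and ?r = "restr P (\<lambda>H. f (freeze (X H) H))"
    let ?G' = "freeze ?x G"
    have inner': "inner ?G' = inner G - {?x}"
      by (auto simp: inner_def freeze_def)
    have nv: "new_vertex ?G' = new_vertex G" "new_edge ?G' = new_edge G"
      using names_freeze[OF XV[OF G]] by (simp_all add: new_vertex_def new_edge_def) (simp add: freeze_def)
    have fr: "fresh G (new_edge G) (new_vertex G)"
      by (rule fresh_new[OF wf[OF G]])
    have "d (restr ?P f) ?G' = (\<Sum>i\<in>inner G - {?x}. d_at ?r G i)"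
      unfolding d_def inner'
    proof (rule sum.cong[OF refl])
      fix i assume i: "i \<in> inner G - {?x}"
      show "d_at (restr ?P f) ?G' i = d_at ?r G i"
        unfolding d_at_def split_term_def nv
      proof (rule sum.cong)
        show "splits ?G' i = splits G i" by (simp add: freeze_def)
        fix S assume S: "S \<in> splits G i"
        let ?H = "split_at G i S (new_edge G) (new_vertex G)"
        have "split_at ?G' i S (new_edge G) (new_vertex G) = ?H\<lparr>gF := ?x # gF G\<rparr>"
          by (simp add: freeze_def split_update)
        then show "coef ?G' (new_edge G) (new_vertex G) *
            restr ?P f (split_at ?G' i S (new_edge G) (new_vertex G)) =
          coef G (new_edge G) (new_vertex G) * ?r ?H"
          using same[OF G _ _ S fr refl, of f] i by (simp add: freeze_def coef_def)
      qed
    qed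
    \<comment> \<open>Splitting the distinguished vertex leaves the class, so its term in the
      differential is zero and may be added.\<close>
    also have "\<dots> = (\<Sum>i\<in>inner G. d_at ?r G i)"
    proof (rule sum.mono_neutral_left)
      show "finite (inner G)" by (rule wf_finite(4)[OF wf[OF G]])
      show "\<forall>i\<in>inner G - (inner G - {?x}). d_at ?r G i = 0"
      proof
        fix i assume i: "i \<in> inner G - (inner G - {?x})"
        have "?r (split_at G i S (new_edge G) (new_vertex G)) = 0" if "S \<in> splits G i" for S
          using noX[OF G _ that fr] i by (auto simp: restr_def)
        then show "d_at ?r G i = 0"
          by (simp add: d_at_def split_term_def)
      qed
    qed auto
    finally show ?thesis by (simp add: d_def)
  qed
  have card': "card (inner (freeze (X G) G)) = v \<longleftrightarrow> card (inner G) = Suc v"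
    "Suc (card (inner (freeze (X G) G))) = card (inner G)" if "P G" for G
  proof -
    have "inner (freeze (X G) G) = inner G - {X G}"
      by (auto simp: inner_def freeze_def)
    then show *: "Suc (card (inner (freeze (X G) G))) = card (inner G)"
      using X[OF that] wf_finite(4)[OF wf[OF that]] by (metis card.remove)
    then show "card (inner (freeze (X G) G)) = v \<longleftrightarrow> card (inner G) = Suc v"
      by auto
  qed
  have "d (restr ?P u') G = 0" if G: "?P G" "Suc (card (inner G)) = v" for G
  proof -
    let ?G = "thaw G"
    have PG: "P ?G" and eq: "freeze (X ?G) ?G = G"
      using G freeze_thaw by auto
    have "d (restr ?P u') G = d (restr P (\<lambda>H. u' (freeze (X H) H))) ?G"
      using d_freeze[OF PG, of u'] eq by simp
    also have "restr P (\<lambda>H. u' (freeze (X H) H)) = restr P u"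
    proof
      fix H show "restr P (\<lambda>H. u' (freeze (X H) H)) H = restr P u H"
        using freeze[of H] by (simp add: restr_def u'_def)
    qed
    also have "d (restr P u) ?G = 0"
      using card'(2)[OF PG] eq G by (intro du PG) simp
    finally show ?thesis .
  qed
  then obtain g where g: "equivariant g"
    "\<And>G. ?P G \<Longrightarrow> card (inner G) = v \<Longrightarrow> d (restr ?P g) G = u' G"
    using exactD[OF ex equ] by blast
  define g' where "g' = restr P (\<lambda>G. g (freeze (X G) G))"
  have "equivariant g'"
    unfolding equivariant_def
  proof (intro allI impI)
    fix p r F G G' assume iso: "graph_iso p r F G G'"
    show "g' G' = iso_sign p r F G * g' G"
    proof (cases "P G")
      case True
      then show ?thesis
        using equivariantD[OF g(1) iso_freeze[OF iso XV[OF True]]] invariantD[OF inv iso] nat[OF iso True]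
        by (simp add: g'_def restr_def)
    qed (use invariantD[OF inv iso] in \<open>simp add: g'_def restr_def\<close>)
  qed
  moreover have "d (restr P g') G = u G" if G: "P G" "card (inner G) = Suc v" for G
  proof -
    have "restr P g' = restr P (\<lambda>G. g (freeze (X G) G))"
      by (auto simp: g'_def restr_def)
    then have "d (restr P g') G = d (restr ?P g) (freeze (X G) G)"
      using d_freeze[OF G(1), of g] by simp
    also have "\<dots> = u' (freeze (X G) G)"
      using card'(1)[OF G(1)] G(2) by (intro g(2) freeze G(1)) simp
    also have "\<dots> = u G"
      using freeze[OF G(1)] by (simp add: u'_def restr_def)
    finally show ?thesis .
  qed
  ultimately show "\<exists>g. equivariant g \<and> (\<forall>G. P G \<and> card (inner G) = Suc v \<longrightarrow> d (restr P g) G = u G)"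
    by blast
qed

end

section \<open>Exactness from a pairing of graphs by splitting and contraction\<close>

context parity
begin

lemma coef_nonzero: "coef G e w \<noteq> 0"
  using coef_square[of G e w] by force

text \<open>Compensates for the direction of the contracted edge: for odd \<open>n\<close> reversing
  an edge changes the sign, and splitting always produces a source end at the remaining
  vertex.\<close>

definition dir :: "nat \<times> bool \<Rightarrow> rat" where
  "dir h = (if \<not> ev \<and> snd h then - 1 else 1)"

text \<open>Reinserting the contracted edge and vertex gives back the edge and vertex sets of
  \<open>G\<close>, so \<open>iso_sign_split\<close> compares the two signs. The factors
  \<open>dir\<close> account for a possible reversal of the contracted edge.\<close>

lemma iso_sign_contract:
  assumes iso: "graph_iso p r F G G'" and h: "contractible G h"
  shows "iso_sign p r (F - {fst h}) (contract G h) * coef (contract G h) (fst h) (gI G (opp h)) *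
      coef (contract G' (hmap p F h)) (p (fst h)) (r (gI G (opp h))) * dir h * dir (hmap p F h)
    = iso_sign p r F G"
proof -
  let ?e = "fst h" and ?y = "gI G (opp h)" and ?C = "contract G h" and ?h' = "hmap p F h"
  let ?C' = "contract G' ?h'" and ?F = "F - {fst h}"
  have e: "?e \<in> gE G" and y: "?y \<in> gV G"
    using h by (auto simp: contractible_def inner_def)
  have hE: "fst (opp h) \<in> gE G"
    using e by simp
  have y': "gI G' (opp ?h') = r ?y"
    using iso_gI[OF iso hE] by (simp add: hmap_opp)
  have fr: "fresh ?C ?e ?y"
    using contract_names(1)[OF h] by (simp add: fresh_def)
  have "r ?y \<notin> names ?C'" "p ?e \<notin> gE ?C'"
  proof -
    have "names ?C' = r ` (names G - {?y})"
      using iso_names[OF contract_iso[OF iso h]] contract_names(1)[OF h] by simp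
    moreover have "?y \<in> names G" "inj_on r (names G)"
      using y iso by (auto simp: names_def graph_iso_def)
    ultimately show "r ?y \<notin> names ?C'"
      by (auto simp: inj_on_def)
    show "p ?e \<notin> gE ?C'"
      by (simp add: hmap_def)
  qed
  then have fr': "fresh ?C' (p ?e) (r ?y)"
    by (simp add: fresh_def)
  \<comment> \<open>Signs depend only on the sets of edges and vertices, so the splitting may be
    taken at a dummy vertex with an empty set of half-edges.\<close>
  have "iso_sign (p(?e := p ?e)) (r(?y := r ?y)) ?F (split_at ?C 0 {} ?e ?y) =
      iso_sign p r ?F ?C * coef ?C ?e ?y * coef ?C' (p ?e) (r ?y)"
    by (rule iso_sign_split[OF contract_iso[OF iso h] fr fr'])
  moreover have "gE (split_at ?C 0 {} ?e ?y) = gE G" "gV (split_at ?C 0 {} ?e ?y) = gV G"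
    using e y by auto
  then have "iso_sign p r ?F (split_at ?C 0 {} ?e ?y) = iso_sign p r ?F G"
    by (simp only: iso_sign_def)
  ultimately have "iso_sign p r ?F ?C * coef ?C ?e ?y * coef ?C' (p ?e) (r ?y) = iso_sign p r ?F G"
    by simp
  moreover have "iso_sign p r ?F G * dir h * dir ?h' = iso_sign p r F G"
  proof (cases "?e \<in> F")
    case True
    have "finite F"
      using iso finite_subset by (auto simp: graph_iso_def well_formed_def)
    then have "card F = Suc (card ?F)"
      using True by (metis card.remove)
    then have pw: "(- 1 :: rat) ^ card F = - ((- 1) ^ card ?F)"
      by (simp only: power_Suc mult_minus1)
    show ?thesis
      unfolding iso_sign_def dir_def hmap_def pw using True by (cases ev; cases "snd h") simp_all
  next
    case False
    then show ?thesis
      by (auto simp: iso_sign_def dir_def hmap_def)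
  qed
  ultimately show ?thesis by (metis mult.assoc)
qed

text \<open>The graphs in \<open>U\<close> are matched with the others by a splitting that is unique
  up to complement and inverse to the contraction along \<open>hc\<close>; no other splitting stays
  in \<open>P\<close>. The complex is then a sum of pieces of length two with an isomorphism as
  differential, and a primitive is read off by contracting.\<close>

lemma exact_toggle:
  fixes U :: "ngraph \<Rightarrow> bool" and i0 :: "ngraph \<Rightarrow> nat"
    and S0 :: "ngraph \<Rightarrow> (nat \<times> bool) set" and hc :: "ngraph \<Rightarrow> nat \<times> bool"
  assumes P: "graph_class P"
    and U: "\<And>p r F G G'. graph_iso p r F G G' \<Longrightarrow> P G \<Longrightarrow> U G' = U G"
    and S0: "\<And>G. P G \<Longrightarrow> U G \<Longrightarrow> i0 G \<in> inner G \<and> S0 G \<in> splits G (i0 G)"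
    and split_iff: "\<And>G i S e w. P G \<Longrightarrow> U G \<Longrightarrow> i \<in> inner G \<Longrightarrow> S \<in> splits G i \<Longrightarrow> fresh G e w \<Longrightarrow>
      P (split_at G i S e w) \<longleftrightarrow> i = i0 G \<and> (S = S0 G \<or> S = half_edges G i - S0 G)"
    and split_U: "\<And>G e w. P G \<Longrightarrow> U G \<Longrightarrow> fresh G e w \<Longrightarrow>
      \<not> U (split_at G (i0 G) (S0 G) e w) \<and> hc (split_at G (i0 G) (S0 G) e w) = (e, False)"
    and no_split: "\<And>G G'. P G \<Longrightarrow> \<not> U G \<Longrightarrow> step G G' \<Longrightarrow> \<not> P G'"
    and con: "\<And>G. P G \<Longrightarrow> \<not> U G \<Longrightarrow> contractible G (hc G) \<and> P (contract G (hc G)) \<and>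
      U (contract G (hc G)) \<and> i0 (contract G (hc G)) = gI G (hc G) \<and>
      S0 (contract G (hc G)) = half_edges G (gI G (opp (hc G))) - {opp (hc G)}"
    and nat: "\<And>p r F G G'. graph_iso p r F G G' \<Longrightarrow> P G \<Longrightarrow> \<not> U G \<Longrightarrow> hc G' = hmap p F (hc G)"
  shows "exact P v"
proof (rule exactI)
  fix u assume u: "equivariant u" and du: "\<And>G. P G \<Longrightarrow> Suc (card (inner G)) = v \<Longrightarrow> d (restr P u) G = 0"
  have wf: "\<And>G. P G \<Longrightarrow> well_formed G" and inv: "invariant P"
    using P by (auto simp: graph_class_def)
  \<comment> \<open>Of all splittings only \<open>S0\<close> and its complement stay in
    \<open>P\<close>, and they contribute equally.\<close>
  have dU: "d (restr P f) G = 2 * split_term f G (i0 G) (S0 G) e w"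
    if G: "P G" "U G" and f: "equivariant f" and fr: "fresh G e w" for f G e w
  proof -
    let ?i = "i0 G" and ?S = "S0 G" and ?B = "half_edges G (i0 G)"
    have i: "?i \<in> inner G" and S: "?S \<in> splits G ?i"
      using S0[OF G] by blast+
    have eqf: "equivariant (restr P f)"
      by (intro equivariant_restr inv f)
    have at: "d_at (restr P f) G i = (\<Sum>S \<in> splits G i. split_term (restr P f) G i S e w)"
      if "i \<in> inner G" for i
      using that by (intro d_at_fresh eqf wf G fr inner_names)
    have "d (restr P f) G = (\<Sum>i \<in> {?i}. d_at (restr P f) G i)"
      unfolding d_def
    proof (rule sum.mono_neutral_right)
      show "\<forall>i \<in> inner G - {?i}. d_at (restr P f) G i = 0"
      proof
        fix i assume i: "i \<in> inner G - {?i}"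
        then have "split_term (restr P f) G i S e w = 0" if "S \<in> splits G i" for S
          using split_iff[OF G _ that fr] by (auto simp: split_term_def restr_def)
        then show "d_at (restr P f) G i = 0"
          using i at[of i] by simp
      qed
    qed (use i wf_finite(4)[OF wf[OF G(1)]] in auto)
    also have "\<dots> = (\<Sum>S \<in> {?S, ?B - ?S}. split_term (restr P f) G ?i S e w)"
      unfolding sum.insert[OF finite.emptyI empty_iff[THEN iffD1, THEN notI]] using at[OF i]
    proof (simp, intro sum.mono_neutral_right)
      show "finite (splits G ?i)" by (rule finite_splits[OF wf[OF G(1)]])
      show "{?S, ?B - ?S} \<subseteq> splits G ?i"
        using S splits_complement[OF S] by blast
      show "\<forall>T \<in> splits G ?i - {?S, ?B - ?S}. split_term (restr P f) G ?i T e w = 0"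
        using split_iff[OF G i _ fr] by (auto simp: split_term_def restr_def)
    qed
    also have "\<dots> = split_term (restr P f) G ?i ?S e w + split_term (restr P f) G ?i (?B - ?S) e w"
    proof -
      have "?S \<noteq> {}"
        using S by (auto simp: splits_def)
      then have "?S \<noteq> ?B - ?S" by blast
      then show ?thesis by simp
    qed
    also have "\<dots> = 2 * split_term (restr P f) G ?i ?S e w"
      using split_term_complement[OF eqf wf[OF G(1)] i splits_subset[OF S] fr] by simp
    also have "split_term (restr P f) G ?i ?S e w = split_term f G ?i ?S e w"
      using split_iff[OF G i S fr] by (simp add: split_term_def restr_def)
    finally show ?thesis .
  qed
  \<comment> \<open>The factor \<open>1 / 2\<close> undoes this double count, and the signs
    \<open>coef\<close> and \<open>dir\<close> are their own inverses.\<close>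
  define g where "g G = (if P G \<and> \<not> U G then 1 / 2 * coef (contract G (hc G)) (fst (hc G)) (gI G (opp (hc G)))
      * dir (hc G) * u (contract G (hc G)) else 0)" for G
  have "equivariant g"
    unfolding equivariant_def
  proof (intro allI impI)
    fix p r F G G' assume iso: "graph_iso p r F G G'"
    show "g G' = iso_sign p r F G * g G"
    proof (cases "P G \<and> \<not> U G")
      case True
      let ?h = "hc G" and ?h' = "hc G'"
      have h: "contractible G ?h"
        using con True by blast
      have h': "?h' = hmap p F ?h"
        using nat[OF iso] True by blast
      have G': "P G' \<and> \<not> U G'"
        using True U[OF iso] invariantD[OF inv iso] by blast
      have "fst (opp ?h) \<in> gE G"
        using h by (simp add: contractible_def)
      then have y': "gI G' (opp ?h') = r (gI G (opp ?h))"
        using iso_gI[OF iso, of "opp ?h"] by (simp add: h' hmap_opp)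
      have fst': "fst ?h' = p (fst ?h)"
        by (simp add: h' hmap_def)
      define a b s where "a = coef (contract G ?h) (fst ?h) (gI G (opp ?h))"
        and "b = coef (contract G' ?h') (p (fst ?h)) (r (gI G (opp ?h)))"
        and "s = iso_sign p r (F - {fst ?h}) (contract G ?h)"
      have sq: "b * b = 1" "dir ?h * dir ?h = 1" "a * a = 1" "dir ?h' * dir ?h' = 1"
        by (auto simp: a_def b_def coef_square dir_def)
      have rel: "s * a * b * dir ?h * dir ?h' = iso_sign p r F G"
        using iso_sign_contract[OF iso h] unfolding a_def b_def s_def h' .
      have "u (contract G' ?h') = s * u (contract G ?h)"
        using equivariantD[OF u contract_iso[OF iso h]] by (simp add: h' s_def)
      then have "g G' = 1 / 2 * b * dir ?h' * (s * u (contract G ?h))"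
        using G' by (simp add: g_def b_def y' fst')
      also have "\<dots> = (s * a * b * dir ?h * dir ?h') * (1 / 2 * a * dir ?h * u (contract G ?h))"
        using sq by (simp add: mult_ac)
      also have "\<dots> = iso_sign p r F G * g G"
        using True rel by (simp add: g_def a_def)
      finally show ?thesis .
    next
      case False
      then have "\<not> (P G' \<and> \<not> U G')"
        using U[OF iso] invariantD[OF inv iso] by blast
      with False show ?thesis by (auto simp: g_def)
    qed
  qed
  moreover have "d (restr P g) G = u G" if G: "P G" "card (inner G) = v" for G
  proof (cases "U G")
    case True
    let ?i = "i0 G" and ?S = "S0 G" and ?e = "new_edge G" and ?w = "new_vertex G"
    let ?H = "split_at G ?i ?S ?e ?w"
    have fr: "fresh G ?e ?w" by (rule fresh_new[OF wf[OF G(1)]])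
    have iS: "?i \<in> inner G" "?S \<in> splits G ?i"
      using S0[OF G(1) True] by blast+
    have H: "P ?H" "\<not> U ?H" "hc ?H = (?e, False)"
      using split_iff[OF G(1) True iS fr] split_U[OF G(1) True fr] by auto
    have "u (contract ?H (?e, False)) = u G"
      using equivariantD[OF u contract_split_iso[OF wf[OF G(1)] iS(1) splits_subset[OF iS(2)] fr]]
      by (simp add: iso_sign_def)
    moreover have "gI ?H (opp (?e, False)) = ?w"
      by simp
    moreover have "coef (contract ?H (?e, False)) ?e ?w = coef G ?e ?w"
    proof -
      have "insert ?e (gE G) - {?e} = gE G" "insert ?w (gV G) - {?w} = gV G"
        using fr by (auto simp: fresh_def names_def)
      then show ?thesis by (simp add: coef_def)
    qed
    ultimately have "g ?H = 1 / 2 * coef G ?e ?w * u G"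
      using H by (simp add: g_def dir_def)
    moreover have "d (restr P g) G = 2 * (coef G ?e ?w * g ?H)"
      using dU[OF G(1) True \<open>equivariant g\<close> fr] by (simp add: split_term_def)
    ultimately have "d (restr P g) G = (coef G ?e ?w * coef G ?e ?w) * u G"
      by simp
    then show ?thesis
      by (simp only: coef_square mult_1_left)
  next
    case False
    let ?h = "hc G"
    let ?C = "contract G ?h" and ?e = "fst ?h" and ?y = "gI G (opp ?h)"
    have h: "contractible G ?h" and C: "P ?C" "U ?C" "i0 ?C = gI G ?h" "S0 ?C = half_edges G ?y - {opp ?h}"
      using con[OF G(1) False] by blast+
    have fr: "fresh ?C ?e ?y"
      using contract_names(1)[OF h] by (simp add: fresh_def)
    have "card (inner G) = Suc (card (inner ?C))"
    proof -
      have "?y \<in> inner G" using h by (simp add: contractible_def)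
      then show ?thesis
        using contract_names(2)[OF h] wf_finite(4)[OF wf[OF G(1)]] by (metis card.remove)
    qed
    then have "d (restr P u) ?C = 0"
      using G C by (intro du) auto
    \<comment> \<open>A cocycle vanishes outside \<open>U\<close>: up to sign, its differential at
      the contraction is twice its value here.\<close>
    then have "u (split_at ?C (gI G ?h) (half_edges G ?y - {opp ?h}) ?e ?y) = 0"
      using dU[OF C(1,2) u fr] coef_nonzero[of ?C ?e ?y] C(3,4) by (simp add: split_term_def)
    then have "u G = 0"
      using equivariantD[OF u split_contract_iso[OF h]] by (simp only: mult_zero_right)
    moreover have "d (restr P g) G = 0"
      using no_split[OF G(1) False] by (intro d_eq_0 wf G) (simp add: restr_def)
    ultimately show ?thesis by simp
  qed
  ultimately show "\<exists>g. equivariant g \<and> (\<forall>G. P G \<and> card (inner G) = v \<longrightarrow> d (restr P g) G = u G)"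
    by blast
qed

end

section \<open>Connectivity and splittings\<close>

definition adj_closed :: "nat set \<Rightarrow> ngraph \<Rightarrow> nat set \<Rightarrow> nat set \<Rightarrow> bool" where
  "adj_closed D G Y U \<longleftrightarrow>
     (\<forall>h. fst h \<in> D \<longrightarrow> gI G h \<in> U \<longrightarrow> gI G (opp h) \<in> Y \<longrightarrow> gI G (opp h) \<in> U)"

text \<open>Connectedness is expressed through closed subsets instead of paths, since these can be
  transported directly along isomorphisms and splittings. The edge set \<open>D\<close> is a
  parameter so that deletion of an edge can be described. The empty set counts as connected.\<close>

definition conn_on :: "nat set \<Rightarrow> ngraph \<Rightarrow> nat set \<Rightarrow> bool" where
  "conn_on D G Y \<longleftrightarrow> (\<forall>U. U \<subseteq> Y \<longrightarrow> U \<noteq> {} \<longrightarrow> adj_closed D G Y U \<longrightarrow> U = Y)"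

lemma adj_closedD:
  "adj_closed D G Y U \<Longrightarrow> fst h \<in> D \<Longrightarrow> gI G h \<in> U \<Longrightarrow> gI G (opp h) \<in> Y \<Longrightarrow> gI G (opp h) \<in> U"
  unfolding adj_closed_def by blast

lemma adj_closedI:
  assumes "\<And>h. fst h \<in> D \<Longrightarrow> gI G h \<in> U \<Longrightarrow> gI G (opp h) \<in> Y \<Longrightarrow> gI G (opp h) \<in> U"
  shows "adj_closed D G Y U"
  unfolding adj_closed_def using assms by blast

lemma conn_onD:
  "conn_on D G Y \<Longrightarrow> U \<subseteq> Y \<Longrightarrow> U \<noteq> {} \<Longrightarrow> adj_closed D G Y U \<Longrightarrow> U = Y"
  unfolding conn_on_def by blast

lemma adj_closed_diff: "adj_closed D G Y U \<Longrightarrow> adj_closed D G Y (Y - U)"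
proof (rule adj_closedI)
  fix h assume c: "adj_closed D G Y U" and h: "fst h \<in> D" "gI G h \<in> Y - U" "gI G (opp h) \<in> Y"
  show "gI G (opp h) \<in> Y - U"
    using adj_closedD[OF c, of "opp h"] h by auto
qed

lemma iso_adj_closed:
  assumes iso: "graph_iso p r F G G'" and D: "D \<subseteq> gE G" and Y: "Y \<subseteq> names G" "U \<subseteq> Y"
  shows "adj_closed (p ` D) G' (r ` Y) (r ` U) \<longleftrightarrow> adj_closed D G Y U"
proof -
  have inj: "inj_on r (names G)" "inj_on p (gE G)"
    using iso by (auto simp: graph_iso_def)
  have mem: "r z \<in> r ` A \<longleftrightarrow> z \<in> A" if "z \<in> names G" "A \<subseteq> names G" for z A
    by (rule inj_on_image_mem_iff[OF inj(1) that])
  have n: "gI G h \<in> names G" if "fst h \<in> D" for h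
    using iso D that by (intro well_formed_gI) (auto simp: graph_iso_def)
  have tr: "gI G' (hmap p F h) = r (gI G h)" "gI G' (opp (hmap p F h)) = r (gI G (opp h))" if "fst h \<in> D" for h
    using iso_gI[OF iso, of h] iso_gI[OF iso, of "opp h"] D that by (auto simp: hmap_opp)
  have U: "U \<subseteq> names G" using Y by blast
  show ?thesis
  proof
    assume c: "adj_closed (p ` D) G' (r ` Y) (r ` U)"
    show "adj_closed D G Y U"
    proof (rule adj_closedI)
      fix h assume h: "fst h \<in> D" "gI G h \<in> U" "gI G (opp h) \<in> Y"
      have "gI G' (opp (hmap p F h)) \<in> r ` U"
        using h tr by (intro adj_closedD[OF c]) (auto simp: hmap_def)
      then show "gI G (opp h) \<in> U"
        using tr(2)[OF h(1)] mem[OF n[of "opp h"] U] h(1) by simp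
    qed
  next
    assume c: "adj_closed D G Y U"
    show "adj_closed (p ` D) G' (r ` Y) (r ` U)"
    proof (rule adj_closedI)
      fix h' assume h': "fst h' \<in> p ` D" "gI G' h' \<in> r ` U" "gI G' (opp h') \<in> r ` Y"
      then obtain k where k: "k \<in> D" "fst h' = p k" by blast
      define h where "h = (k, snd h' \<noteq> (k \<in> F))"
      have h: "fst h \<in> D" "h' = hmap p F h"
        using k by (auto simp: h_def hmap_def prod_eq_iff)
      have "gI G h \<in> U" "gI G (opp h) \<in> Y"
        using h' tr[OF h(1)] mem[OF n, of h U] mem[OF n, of "opp h" Y] h Y U by auto
      then show "gI G' (opp h') \<in> r ` U"
        using adj_closedD[OF c h(1)] tr(2)[OF h(1)] h(2) by simp
    qed
  qed
qed

lemma iso_connected_on: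
  assumes iso: "graph_iso p r F G G'" and D: "D \<subseteq> gE G" and Y: "Y \<subseteq> names G"
    and c: "conn_on D G Y"
  shows "conn_on (p ` D) G' (r ` Y)"
  unfolding conn_on_def
proof (intro allI impI)
  fix U' assume U': "U' \<subseteq> r ` Y" "U' \<noteq> {}" "adj_closed (p ` D) G' (r ` Y) U'"
  then obtain U where U: "U \<subseteq> Y" "U' = r ` U"
    by (meson subset_imageE)
  then have "adj_closed D G Y U"
    using iso_adj_closed[OF iso D Y] U' by simp
  then have "U = Y"
    using conn_onD[OF c U(1)] U' U by auto
  then show "U' = r ` Y" using U by simp
qed

section \<open>The component of an edge away from a vertex\<close>

text \<open>If both ends of an edge \<open>t\<close> are inner and different from \<open>x\<close>,
  they are joined by \<open>t\<close> itself. So for an edge of the graph this is one connected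
  component of the inner part without \<open>x\<close>, or empty if \<open>t\<close> has no inner
  end other than \<open>x\<close>.\<close>

definition component :: "ngraph \<Rightarrow> nat \<Rightarrow> nat \<Rightarrow> nat set" where
  "component G x t = \<Inter>{U. U \<subseteq> inner G - {x} \<and> adj_closed (gE G) G (inner G - {x}) U \<and>
     (\<forall>b. gI G (t, b) \<in> inner G - {x} \<longrightarrow> gI G (t, b) \<in> U)}"

lemma component_least:
  assumes "U \<subseteq> inner G - {x}" "adj_closed (gE G) G (inner G - {x}) U"
    "\<And>b. gI G (t, b) \<in> inner G - {x} \<Longrightarrow> gI G (t, b) \<in> U"
  shows "component G x t \<subseteq> U"
  unfolding component_def using assms by (intro Inter_lower) blast

lemma component_subset: "component G x t \<subseteq> inner G - {x}"
  by (rule component_least) (auto simp: adj_closed_def)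

lemma component_closed: "adj_closed (gE G) G (inner G - {x}) (component G x t)"
  unfolding adj_closed_def component_def by blast

lemma component_ends: "gI G (t, b) \<in> inner G - {x} \<Longrightarrow> gI G (t, b) \<in> component G x t"
  unfolding component_def by blast

lemma iso_component:
  assumes iso: "graph_iso p r F G G'" and x: "x \<in> inner G" and t: "t \<in> gE G"
  shows "component G' (r x) (p t) = r ` component G x t"
proof -
  let ?Y = "inner G - {x}"
  have inj: "inj_on r (names G)" and E: "gE G' = p ` gE G"
    using iso by (auto simp: graph_iso_def)
  have Yn: "?Y \<subseteq> names G" using inner_names by blast
  have mem: "r z \<in> r ` A \<longleftrightarrow> z \<in> A" if "z \<in> names G" "A \<subseteq> names G" for z A
    by (rule inj_on_image_mem_iff[OF inj that])
  have Y': "inner G' - {r x} = r ` ?Y"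
  proof -
    have "r ` ?Y = r ` inner G - r ` {x}"
      using x inner_names[of _ G] by (intro inj_on_image_set_diff[OF inj]) auto
    then show ?thesis by (simp add: iso_inner[OF iso])
  qed
  have ends': "gI G' (p t, b \<noteq> (t \<in> F)) = r (gI G (t, b))" "gI G (t, b) \<in> names G" for b
    using iso_gI[OF iso, of "(t, b)"] t iso well_formed_gI[of G "(t, b)"]
    by (auto simp: hmap_def graph_iso_def)
  show ?thesis
  proof
    have Kn: "component G x t \<subseteq> names G"
      using component_subset[of G x t] Yn by blast
    show "component G' (r x) (p t) \<subseteq> r ` component G x t"
    proof (rule component_least)
      show "r ` component G x t \<subseteq> inner G' - {r x}"
        unfolding Y' using component_subset by (rule image_mono)
      show "adj_closed (gE G') G' (inner G' - {r x}) (r ` component G x t)"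
        unfolding Y' E using component_closed component_subset
        by (subst iso_adj_closed[OF iso order_refl Yn])
      show "gI G' (p t, b) \<in> r ` component G x t" if "gI G' (p t, b) \<in> inner G' - {r x}" for b
      proof -
        let ?b = "b \<noteq> (t \<in> F)"
        have eq: "gI G' (p t, b) = r (gI G (t, ?b))"
          using ends'(1)[of ?b] by (cases "t \<in> F") simp_all
        then have "gI G (t, ?b) \<in> ?Y"
          using that mem[OF ends'(2) Yn] unfolding Y' by simp
        then show ?thesis
          unfolding eq by (intro imageI component_ends)
      qed
    qed
    show "r ` component G x t \<subseteq> component G' (r x) (p t)"
    proof -
      obtain U where U: "U \<subseteq> ?Y" "component G' (r x) (p t) = r ` U"
        using component_subset[of G' "r x" "p t"] unfolding Y' by (meson subset_imageE)
      have "component G x t \<subseteq> U"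
      proof (rule component_least[OF U(1)])
        show "adj_closed (gE G) G ?Y U"
          using component_closed[of G' "r x" "p t"] iso_adj_closed[OF iso order_refl Yn U(1)]
          unfolding Y' E U(2) by simp
        show "gI G (t, b) \<in> U" if "gI G (t, b) \<in> ?Y" for b
        proof -
          have "gI G' (p t, b \<noteq> (t \<in> F)) \<in> inner G' - {r x}"
            unfolding Y' ends'(1) using that by blast
          then have "r (gI G (t, b)) \<in> r ` U"
            using component_ends[of G' "p t" _ "r x"] unfolding ends'(1)[symmetric] U(2) by blast
          then show ?thesis
            using mem[OF ends'(2)] U(1) Yn by blast
        qed
      qed
      then show ?thesis unfolding U(2) by (rule image_mono)
    qed
  qed
qed

section \<open>Connectivity and components under one splitting\<close>

locale splitting =
  fixes G i S e w H
  assumes wf: "well_formed G" and i: "i \<in> inner G" and S: "S \<subseteq> half_edges G i" and fr: "fresh G e w"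
  defines "H \<equiv> split_at G i S e w"
begin

lemma e: "e \<notin> gE G" and w: "w \<notin> names G" "w \<notin> inner G" "w \<noteq> i"
  using fr i inner_names by (auto simp: fresh_def inner_def names_def)

lemma inner_H: "inner H = insert w (inner G)"
  unfolding H_def by (rule inner_split[OF fr])

lemma E_H: "gE H = insert e (gE G)"
  by (simp add: H_def)

lemma I_new [simp]: "gI H (e, True) = w" "gI H (e, False) = i"
  by (simp_all add: H_def)

lemma I_S: "h \<in> S \<Longrightarrow> gI H h = w" "h \<in> S \<Longrightarrow> gI G h = i" "h \<in> S \<Longrightarrow> fst h \<in> gE G"
  using S e by (auto simp: H_def half_edges_def)

lemma I_old: "fst h \<in> gE G \<Longrightarrow> h \<notin> S \<Longrightarrow> gI H h = gI G h"
  using e by (auto simp: H_def)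

lemma I_neq: "fst h \<in> gE G \<Longrightarrow> gI G h \<noteq> i \<Longrightarrow> gI H h = gI G h"
  using I_old I_S by metis

lemma I_not_w: "fst h \<in> gE G \<Longrightarrow> gI G h \<noteq> w"
  using well_formed_gI[OF wf] w by blast

lemma I_cases: "fst h \<in> gE G \<Longrightarrow> gI H h = gI G h \<or> gI H h = w \<and> gI G h = i"
  using I_old I_S by metis

lemma new_cases: "fst h = e \<Longrightarrow> h = (e, True) \<or> h = (e, False)"
  by (cases h) auto

lemma closed_new_edge:
  assumes "adj_closed D H Y U" "e \<in> D" "i \<in> Y" "w \<in> Y"
  shows "i \<in> U \<longleftrightarrow> w \<in> U"
  using adj_closedD[OF assms(1), of "(e, False)"] adj_closedD[OF assms(1), of "(e, True)"] assms(2-4) by auto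

text \<open>A closed set of the split graph contains \<open>i\<close> if and only if it contains
  \<open>w\<close>. Deleting \<open>w\<close>, or adding it when \<open>i\<close> is present,
  therefore translates between the closed sets of the two graphs.\<close>

lemma connected_split:
  assumes D: "D \<subseteq> gE G" and Y: "Y \<subseteq> inner G" "i \<in> Y"
  shows "conn_on (insert e D) H (insert w Y) \<longleftrightarrow> conn_on D G Y"
proof
  assume c: "conn_on D G Y"
  show "conn_on (insert e D) H (insert w Y)"
    unfolding conn_on_def
  proof (intro allI impI)
    fix U' assume U': "U' \<subseteq> insert w Y" "U' \<noteq> {}" "adj_closed (insert e D) H (insert w Y) U'"
    have iw: "i \<in> U' \<longleftrightarrow> w \<in> U'"
      using closed_new_edge[OF U'(3)] Y by auto
    have "U' - {w} = Y"
    proof (rule conn_onD[OF c])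
      show "U' - {w} \<subseteq> Y" using U' by blast
      show "U' - {w} \<noteq> {}" using U' iw w by blast
      show "adj_closed D G Y (U' - {w})"
      proof (rule adj_closedI)
        fix h assume h: "fst h \<in> D" "gI G h \<in> U' - {w}" "gI G (opp h) \<in> Y"
        have hE: "fst h \<in> gE G" "fst (opp h) \<in> gE G" using h D by auto
        have "gI H h \<in> U'"
          using I_cases[OF hE(1)] h iw by auto
        moreover have "gI H (opp h) \<in> insert w Y"
          using I_cases[OF hE(2)] h by auto
        ultimately have "gI H (opp h) \<in> U'"
          using adj_closedD[OF U'(3), of h] h by auto
        then show "gI G (opp h) \<in> U' - {w}"
          using I_cases[OF hE(2)] I_not_w[OF hE(2)] iw by auto
      qed
    qed
    then show "U' = insert w Y"
      using U' iw Y(2) by blast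
  qed
next
  assume c: "conn_on (insert e D) H (insert w Y)"
  have wY: "w \<notin> Y" using w Y by auto
  show "conn_on D G Y"
    unfolding conn_on_def
  proof (intro allI impI)
    fix U assume U: "U \<subseteq> Y" "U \<noteq> {}" "adj_closed D G Y U"
    define U' where "U' = (if i \<in> U then insert w U else U)"
    have "U' = insert w Y"
    proof (rule conn_onD[OF c])
      show "U' \<subseteq> insert w Y" "U' \<noteq> {}" using U by (auto simp: U'_def)
      show "adj_closed (insert e D) H (insert w Y) U'"
      proof (rule adj_closedI)
        fix h assume h: "fst h \<in> insert e D" "gI H h \<in> U'" "gI H (opp h) \<in> insert w Y"
        show "gI H (opp h) \<in> U'"
        proof (cases "fst h = e")
          case True
          then have "h = (e, True) \<or> h = (e, False)"
            by (rule new_cases)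
          moreover have "w \<in> U' \<longleftrightarrow> i \<in> U" "i \<in> U' \<longleftrightarrow> i \<in> U"
            using wY U(1) w by (auto simp: U'_def)
          ultimately show ?thesis
            using h(2) by fastforce
        next
          case False
          then have hE: "fst h \<in> gE G" "fst (opp h) \<in> gE G" and hD: "fst h \<in> D"
            using h D by auto
          have "gI G h \<in> U"
            using h(2) I_cases[OF hE(1)] I_not_w[OF hE(1)] wY U(1) by (auto simp: U'_def split: if_splits)
          moreover have "gI G (opp h) \<in> Y"
            using h(3) I_cases[OF hE(2)] I_not_w[OF hE(2)] Y by auto
          ultimately have "gI G (opp h) \<in> U"
            using adj_closedD[OF U(3) hD] by blast
          then show ?thesis
            using I_cases[OF hE(2)] by (auto simp: U'_def)
        qed
      qed
    qed
    then show "U = Y"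
      using wY U(1) Y by (auto simp: U'_def split: if_splits)
  qed
qed

lemma component_old:
  assumes x: "x \<in> inner G" "t \<in> gE G"
  shows "component G x t \<subseteq> component H x t"
proof -
  let ?K = "component H x t"
  have c: "adj_closed (gE H) H (inner H - {x}) ?K"
    by (rule component_closed)
  have iw: "i \<in> ?K \<longleftrightarrow> w \<in> ?K" if "i \<noteq> x"
    using closed_new_edge[OF c] that i w x E_H inner_H by auto
  have inn: "gI H h \<in> inner H - {x}" "gI H h \<in> ?K \<longleftrightarrow> gI G h \<in> ?K"
    if "fst h \<in> gE G" "gI G h \<in> inner G - {x}" for h
  proof -
    have "w \<noteq> x" using w x by blast
    then have "gI H h \<in> inner H - {x} \<and> (gI H h \<in> ?K \<longleftrightarrow> gI G h \<in> ?K)"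
      using I_cases[OF that(1)]
    proof (elim disjE conjE)
      assume "gI H h = gI G h"
      then show ?thesis using that(2) inner_H by simp
    next
      assume eq: "gI H h = w" "gI G h = i"
      then have "i \<noteq> x" using that(2) by simp
      with eq \<open>w \<noteq> x\<close> show ?thesis using iw inner_H by simp
    qed
    then show "gI H h \<in> inner H - {x}" "gI H h \<in> ?K \<longleftrightarrow> gI G h \<in> ?K" by blast+
  qed
  have "component G x t \<subseteq> ?K - {w}"
  proof (rule component_least)
    show "?K - {w} \<subseteq> inner G - {x}"
      using component_subset[of H x t] inner_H by auto
    show "adj_closed (gE G) G (inner G - {x}) (?K - {w})"
    proof (rule adj_closedI)
      fix h assume h: "fst h \<in> gE G" "gI G h \<in> ?K - {w}" "gI G (opp h) \<in> inner G - {x}"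
      have "gI G h \<in> inner G - {x}"
        using h(2) component_subset[of H x t] inner_H by auto
      then have "gI H (opp h) \<in> ?K"
        using h inn[of h] inn[of "opp h"] E_H by (intro adj_closedD[OF c]) auto
      then show "gI G (opp h) \<in> ?K - {w}"
        using inn(2)[of "opp h"] h I_not_w[of "opp h"] by auto
    qed
    show "gI G (t, b) \<in> ?K - {w}" if "gI G (t, b) \<in> inner G - {x}" for b
      using inn[of "(t, b)"] component_ends[of H t b x] that x I_not_w[of "(t, b)"] by auto
  qed
  then show ?thesis by blast
qed

lemma component_split_other:
  assumes x: "x \<in> inner G" "t \<in> gE G" and ix: "i \<noteq> x"
  shows "component H x t = (if i \<in> component G x t then insert w (component G x t) else component G x t)"
proof
  let ?K = "component G x t"
  let ?U = "if i \<in> ?K then insert w ?K else ?K"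
  have K: "?K \<subseteq> inner G - {x}"
    by (rule component_subset)
  have wx: "w \<noteq> x" "w \<notin> ?K" using x w K by auto
  have Uin: "gI H h \<in> ?U \<longleftrightarrow> gI G h \<in> ?K" "gI H h \<in> inner H - {x} \<longleftrightarrow> gI G h \<in> inner G - {x}"
    if "fst h \<in> gE G" for h
  proof -
    have "(gI H h \<in> ?U \<longleftrightarrow> gI G h \<in> ?K) \<and> (gI H h \<in> inner H - {x} \<longleftrightarrow> gI G h \<in> inner G - {x})"
      using I_cases[OF that]
    proof (elim disjE conjE)
      assume "gI H h = gI G h"
      then show ?thesis using I_not_w[OF that] inner_H by simp
    next
      assume "gI H h = w" "gI G h = i"
      then show ?thesis using wx i ix inner_H by simp
    qed
    then show "gI H h \<in> ?U \<longleftrightarrow> gI G h \<in> ?K"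
      "gI H h \<in> inner H - {x} \<longleftrightarrow> gI G h \<in> inner G - {x}" by blast+
  qed
  show "component H x t \<subseteq> ?U"
  proof (rule component_least)
    show "?U \<subseteq> inner H - {x}" using K inner_H wx by auto
    show "adj_closed (gE H) H (inner H - {x}) ?U"
    proof (rule adj_closedI)
      fix h assume h: "fst h \<in> gE H" "gI H h \<in> ?U" "gI H (opp h) \<in> inner H - {x}"
      show "gI H (opp h) \<in> ?U"
      proof (cases "fst h = e")
        case True
        then have "h = (e, True) \<or> h = (e, False)"
          by (rule new_cases)
        moreover have "w \<in> ?U \<longleftrightarrow> i \<in> ?K" "i \<in> ?U \<longleftrightarrow> i \<in> ?K"
          using wx w by auto
        ultimately show ?thesis
          using h(2) by fastforce
      next
        case False
        then have hE: "fst h \<in> gE G" "fst (opp h) \<in> gE G" using h E_H by auto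
        then show ?thesis
          using h Uin[OF hE(1)] Uin[OF hE(2)] adj_closedD[OF component_closed[of G x t] hE(1)] by blast
      qed
    qed
    show "gI H (t, b) \<in> ?U" if "gI H (t, b) \<in> inner H - {x}" for b
      using Uin[of "(t, b)"] that component_ends[of G t b x] x by auto
  qed
  have "w \<in> component H x t" if "i \<in> ?K"
    using closed_new_edge[OF component_closed[of H x t]] component_old[OF x] that ix i w wx E_H inner_H
    by auto
  then show "?U \<subseteq> component H x t"
    using component_old[OF x] by auto
qed

text \<open>No half-edge moved to \<open>w\<close> touches the component or the edge
  \<open>t\<close>, and the connecting edge ends at the excluded vertex \<open>i\<close>. So
  \<open>w\<close> does not join the component.\<close>

lemma component_split_root_disjoint:
  assumes t: "t \<in> gE G"
    and S: "\<And>h. h \<in> S \<Longrightarrow> fst h \<noteq> t \<and> gI G (opp h) \<notin> component G i t"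
  shows "component H i t = component G i t"
proof
  let ?K = "component G i t"
  have K: "?K \<subseteq> inner G - {i}" by (rule component_subset)
  have wK: "w \<notin> ?K" using w K by auto
  show "component H i t \<subseteq> ?K"
  proof (rule component_least)
    show "?K \<subseteq> inner H - {i}" using K inner_H by auto
    show "adj_closed (gE H) H (inner H - {i}) ?K"
    proof (rule adj_closedI)
      fix h assume h: "fst h \<in> gE H" "gI H h \<in> ?K" "gI H (opp h) \<in> inner H - {i}"
      have "fst h \<noteq> e"
      proof
        assume "fst h = e"
        then have "h = (e, True) \<or> h = (e, False)" by (rule new_cases)
        then show False using h(2) wK K by auto
      qed
      then have hE: "fst h \<in> gE G" "fst (opp h) \<in> gE G" using h E_H by auto
      have hG: "gI G h \<in> ?K"
        using h(2) I_cases[OF hE(1)] wK by auto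
      then have "opp h \<notin> S"
        using S[of "opp h"] by auto
      then have "gI H (opp h) = gI G (opp h)"
        using I_old[OF hE(2)] by simp
      then show "gI H (opp h) \<in> ?K"
        using adj_closedD[OF component_closed hE(1) hG] h(3) inner_H I_not_w[OF hE(2)] by auto
    qed
    show "gI H (t, b) \<in> ?K" if "gI H (t, b) \<in> inner H - {i}" for b
    proof -
      have "(t, b) \<notin> S" using S[of "(t, b)"] by auto
      then have "gI H (t, b) = gI G (t, b)" using I_old[of "(t, b)"] t by simp
      then show ?thesis
        using component_ends[of G t b i] that inner_H I_not_w[of "(t, b)"] t by auto
    qed
  qed
  show "?K \<subseteq> component H i t"
    by (rule component_old[OF i t])
qed

lemma component_split_root_meets:
  assumes t: "t \<in> gE G" and h: "h \<in> S" "fst h = t \<or> gI G (opp h) \<in> component G i t"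
  shows "w \<in> component H i t"
proof -
  have wi: "w \<in> inner H - {i}" using inner_H w by auto
  show ?thesis
    using h(2)
  proof
    assume "fst h = t"
    then have "gI H (t, snd h) = w" using I_S(1)[OF h(1)] by (cases h) auto
    then show ?thesis
      using component_ends[of H t "snd h" i] wi by simp
  next
    assume K: "gI G (opp h) \<in> component G i t"
    then have "gI G (opp h) \<noteq> i" using component_subset[of G i t] by auto
    then have "gI H (opp h) = gI G (opp h)"
      using I_neq[of "opp h"] I_S(3)[OF h(1)] by simp
    then have "gI H (opp h) \<in> component H i t"
      using K component_old[OF i t] by auto
    then show ?thesis
      using adj_closedD[OF component_closed, of "opp h" H i t] I_S[OF h(1)] wi E_H by simp
  qed
qed

end

section \<open>Legs, stable graphs and the half-edges at the root\<close>

text \<open>Edges without an inner end are dead. They stay in the graph, because the orientation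
  refers to all edges, but they no longer take part in the combinatorics.\<close>

definition live :: "ngraph \<Rightarrow> nat set" where
  "live G = {k \<in> gE G. \<exists>b. gI G (k, b) \<in> inner G}"

definition legs :: "ngraph \<Rightarrow> nat set" where
  "legs G = {k \<in> live G. \<exists>b. gI G (k, b) \<notin> inner G}"

text \<open>By connectedness, \<open>t\<close> is the number of legs plus the number of loops of the
  inner part minus one; for a hairy graph this is \<open>g + h - 1\<close>. Splitting adds one live
  edge and one inner vertex and so preserves \<open>t\<close>.\<close>

definition stable :: "nat \<Rightarrow> ngraph \<Rightarrow> bool" where
  "stable t G \<longleftrightarrow> well_formed G \<and> (\<forall>z \<in> inner G. 3 \<le> card (half_edges G z)) \<and> inner G \<noteq> {} \<and>
     conn_on (gE G) G (inner G) \<and> card (live G) = card (inner G) + t"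

text \<open>The Boolean index is true exactly if the target end is inner, so for a leg its inner end
  is selected.\<close>

definition root :: "ngraph \<Rightarrow> nat \<Rightarrow> nat" where
  "root G k = gI G (k, gI G (k, True) \<in> inner G)"

text \<open>The half-edges at \<open>x\<close> that \<open>x\<close> separates from the edge
  \<open>t\<close>: those of tadpoles, those leading to frozen vertices or hair ends, and those into
  other components. The leg \<open>k\<close> and the edge \<open>t\<close> are left out in any
  case.\<close>

definition rest :: "ngraph \<Rightarrow> nat \<Rightarrow> nat \<Rightarrow> nat \<Rightarrow> (nat \<times> bool) set" where
  "rest G x k t = {h \<in> half_edges G x. fst h \<noteq> k \<and> fst h \<noteq> t \<and> gI G (opp h) \<notin> component G x t}"

lemma iso_inner_iff:
  assumes "graph_iso p r F G G'" "fst h \<in> gE G"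
  shows "gI G' (hmap p F h) \<in> inner G' \<longleftrightarrow> gI G h \<in> inner G"
proof -
  have "inj_on r (names G)" "gI G h \<in> names G" "inner G \<subseteq> names G"
    using assms well_formed_gI inner_names by (auto simp: graph_iso_def)
  then show ?thesis
    using iso_gI[OF assms] iso_inner[OF assms(1)] inj_on_image_mem_iff by metis
qed

lemma ex_bool_flip: "(\<exists>b. P (b \<noteq> c)) \<longleftrightarrow> (\<exists>b. P b)" for P :: "bool \<Rightarrow> bool" and c :: bool
proof
  assume "\<exists>b. P b"
  then obtain b where "P b" ..
  then have "P ((b \<noteq> c) \<noteq> c)" by (cases c) simp_all
  then show "\<exists>b. P (b \<noteq> c)" ..
qed blast

lemma iso_edge_ends:
  assumes "graph_iso p r F G G'" "k \<in> gE G"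
  shows "(\<exists>b. P (gI G' (p k, b) \<in> inner G')) \<longleftrightarrow> (\<exists>b. P (gI G (k, b) \<in> inner G))"
proof -
  have "gI G' (p k, b \<noteq> (k \<in> F)) \<in> inner G' \<longleftrightarrow> gI G (k, b) \<in> inner G" for b
    using iso_inner_iff[OF assms(1), of "(k, b)"] assms(2) by (simp add: hmap_def)
  then have "(\<exists>b. P (gI G (k, b) \<in> inner G)) \<longleftrightarrow> (\<exists>b. P (gI G' (p k, b \<noteq> (k \<in> F)) \<in> inner G'))"
    by simp
  also have "\<dots> \<longleftrightarrow> (\<exists>b. P (gI G' (p k, b) \<in> inner G'))"
    by (rule ex_bool_flip)
  finally show ?thesis ..
qed

lemma iso_live:
  assumes "graph_iso p r F G G'"
  shows "live G' = p ` live G"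
proof -
  have "p k \<in> live G' \<longleftrightarrow> k \<in> live G" if "k \<in> gE G" for k
    using iso_edge_ends[OF assms that, of "\<lambda>x. x"] that assms by (simp add: live_def graph_iso_def)
  moreover have "live G' \<subseteq> p ` gE G" "live G \<subseteq> gE G"
    using assms by (auto simp: live_def graph_iso_def)
  ultimately show ?thesis by blast
qed

lemma iso_legs:
  assumes "graph_iso p r F G G'"
  shows "legs G' = p ` legs G"
proof -
  have *: "p k \<in> legs G' \<longleftrightarrow> k \<in> legs G" if "k \<in> gE G" for k
    using iso_edge_ends[OF assms that, of "\<lambda>x. x"] iso_edge_ends[OF assms that, of Not] that assms
    by (simp add: legs_def live_def graph_iso_def)
  have "legs G' \<subseteq> p ` gE G" "legs G \<subseteq> gE G"
    using assms by (auto simp: legs_def live_def graph_iso_def)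
  then show ?thesis using * by blast
qed

lemma legs_live: "legs G \<subseteq> live G" "live G \<subseteq> gE G"
  by (auto simp: legs_def live_def)

lemma root_inner: "k \<in> legs G \<Longrightarrow> root G k \<in> inner G"
  by (auto simp: legs_def live_def root_def) (metis (full_types))

lemma leg_root: "k \<in> legs G \<Longrightarrow> gI G (k, b) \<in> inner G \<Longrightarrow> gI G (k, b) = root G k"
  by (auto simp: legs_def live_def root_def) (metis (full_types))+

lemma leg_half_edge:
  assumes "k \<in> legs G"
  obtains b where "(k, b) \<in> half_edges G (root G k)" "gI G (k, \<not> b) \<notin> inner G"
    "\<And>b' z. z \<in> inner G \<Longrightarrow> (k, b') \<in> half_edges G z \<Longrightarrow> b' = b"
proof -
  obtain b where b: "gI G (k, b) \<in> inner G" "k \<in> gE G"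
    using assms by (auto simp: legs_def live_def)
  moreover have "gI G (k, \<not> b) \<notin> inner G"
  proof -
    obtain b' where b': "gI G (k, b') \<notin> inner G"
      using assms by (auto simp: legs_def)
    then have "b' \<noteq> b" using b by blast
    then have "b' = (\<not> b)" by simp
    then show ?thesis using b' by simp
  qed
  ultimately show thesis
    using leg_root[OF assms b(1)]
    by (intro that[of b]) (auto simp: half_edges_def, (metis (full_types))+)
qed

lemma iso_root:
  assumes iso: "graph_iso p r F G G'" and k: "k \<in> legs G"
  shows "root G' (p k) = r (root G k)"
proof -
  obtain b where b: "(k, b) \<in> half_edges G (root G k)"
    by (rule leg_half_edge[OF k])
  then have kE: "k \<in> gE G" "gI G (k, b) = root G k"
    by (auto simp: half_edges_def)
  have "gI G' (hmap p F (k, b)) \<in> inner G'"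
    using iso_inner_iff[OF iso, of "(k, b)"] kE root_inner[OF k] by simp
  moreover have "p k \<in> legs G'"
    using iso_legs[OF iso] k by blast
  ultimately have "gI G' (hmap p F (k, b)) = root G' (p k)"
    using leg_root[of "p k" G'] by (simp add: hmap_def)
  then show ?thesis
    using iso_gI[OF iso, of "(k, b)"] kE by simp
qed

lemma iso_card_inner: "graph_iso p r F G G' \<Longrightarrow> card (inner G') = card (inner G)"
  unfolding iso_inner[of p r F G G']
  by (rule card_image, rule inj_on_subset[of r "names G"]) (auto simp: graph_iso_def inner_names)

lemma iso_card_edges: "graph_iso p r F G G' \<Longrightarrow> A \<subseteq> gE G \<Longrightarrow> card (p ` A) = card A"
  by (rule card_image) (auto simp: graph_iso_def intro: inj_on_subset)

lemma iso_card_half_edges: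
  "graph_iso p r F G G' \<Longrightarrow> z \<in> names G \<Longrightarrow> card (half_edges G' (r z)) = card (half_edges G z)"
  by (simp add: iso_half_edges card_image hmap_inj_on)

lemma invariant_stable: "invariant (stable t)"
proof (rule invariant_predI)
  fix p r F G G' assume iso: "graph_iso p r F G G'" and G: "stable t G"
  have "conn_on (gE G') G' (inner G')"
    using iso_connected_on[OF iso order_refl, of "inner G"] G inner_names iso_inner[OF iso] iso
    by (auto simp: stable_def graph_iso_def)
  moreover have "card (live G') = card (live G)"
    using iso_live[OF iso] iso_card_edges[OF iso legs_live(2)] by simp
  moreover have "3 \<le> card (half_edges G' z)" if "z \<in> inner G'" for z
    using that iso_card_half_edges[OF iso] G inner_names[of _ G] unfolding iso_inner[OF iso]
    by (auto simp: stable_def)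
  ultimately show "stable t G'"
    using G iso_wf[OF iso] iso_card_inner[OF iso] iso_inner[OF iso] by (auto simp: stable_def)
qed

lemma iso_rest:
  assumes iso: "graph_iso p r F G G'" and x: "x \<in> inner G" "k \<in> gE G" "t \<in> gE G"
  shows "rest G' (r x) (p k) (p t) = hmap p F ` rest G x k t"
proof -
  have inj: "inj_on p (gE G)" "inj_on r (names G)"
    using iso by (auto simp: graph_iso_def)
  have K: "component G' (r x) (p t) = r ` component G x t" "component G x t \<subseteq> names G"
    using iso_component[OF iso x(1,3)] component_subset[of G x t] inner_names by blast+
  have "hmap p F h \<in> rest G' (r x) (p k) (p t) \<longleftrightarrow> h \<in> rest G x k t" if h: "h \<in> half_edges G x" for h
  proof -
    have hE: "fst h \<in> gE G" "fst (opp h) \<in> gE G" using h by (auto simp: half_edges_def)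
    have "gI G (opp h) \<in> names G"
      using hE iso well_formed_gI by (auto simp: graph_iso_def)
    then have "r (gI G (opp h)) \<in> r ` component G x t \<longleftrightarrow> gI G (opp h) \<in> component G x t"
      by (rule inj_on_image_mem_iff[OF inj(2) _ K(2)])
    moreover have "gI G' (opp (hmap p F h)) = r (gI G (opp h))"
      using iso_gI[OF iso hE(2)] by (simp add: hmap_opp)
    moreover have "hmap p F h \<in> half_edges G' (r x)"
      using iso_half_edges[OF iso] x inner_names h by blast
    moreover have "p (fst h) = p k \<longleftrightarrow> fst h = k" "p (fst h) = p t \<longleftrightarrow> fst h = t"
      using inj(1) hE x by (auto simp: inj_on_def)
    ultimately show ?thesis
      using h K(1) by (simp add: rest_def) (simp add: hmap_def)
  qed
  moreover have "rest G' (r x) (p k) (p t) \<subseteq> hmap p F ` half_edges G x"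
    using iso_half_edges[OF iso inner_names[OF x(1)]] by (auto simp: rest_def)
  moreover have "rest G x k t \<subseteq> half_edges G x"
    by (auto simp: rest_def)
  ultimately show ?thesis by blast
qed

context splitting
begin

lemma split_ends:
  assumes "k \<in> gE G"
  shows "gI H (k, b) \<in> inner H \<longleftrightarrow> gI G (k, b) \<in> inner G"
proof -
  have k: "fst (k, b) \<in> gE G" using assms by simp
  from I_cases[OF k] show ?thesis
  proof (elim disjE conjE)
    assume "gI H (k, b) = gI G (k, b)"
    then show ?thesis using I_not_w[OF k] inner_H by simp
  next
    assume "gI H (k, b) = w" "gI G (k, b) = i"
    then show ?thesis using i inner_H by simp
  qed
qed

lemma e_ends: "gI H (e, b) \<in> inner H"
  using i inner_H by (cases b) simp_all

lemma live_split: "live H = insert e (live G)"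
proof (rule Set.set_eqI)
  fix k show "k \<in> live H \<longleftrightarrow> k \<in> insert e (live G)"
    using e_ends by (cases "k = e"; cases "k \<in> gE G") (simp_all add: live_def E_H split_ends)
qed

lemma legs_split: "legs H = legs G"
proof (rule Set.set_eqI)
  fix k show "k \<in> legs H \<longleftrightarrow> k \<in> legs G"
    using e_ends e
    by (cases "k = e"; cases "k \<in> gE G") (simp_all add: legs_def live_def E_H split_ends)
qed

lemma wf_H: "well_formed H"
  unfolding H_def using wf i by (intro wf_split inner_names)

text \<open>Either part has at least two half-edges and gains an end of the connecting edge.
  Conversely a vertex that can be split has valence at least four, so stability passes back as
  well.\<close>

lemma stable_split:
  assumes "S \<in> splits G i"
  shows "stable t H \<longleftrightarrow> stable t G"
proof -
  have fin: "finite (half_edges G i)" "finite S" using half_edges_finite[OF wf] S finite_subset by auto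
  have cS: "2 \<le> card S" "2 \<le> card (half_edges G i - S)"
    using assms by (auto simp: splits_def)
  have ni: "i \<in> names G" using i by (rule inner_names)
  have "(e, False) \<notin> half_edges G i - S" "(e, True) \<notin> S"
    using e S by (auto simp: half_edges_def)
  then have "3 \<le> card (half_edges H i)" "3 \<le> card (half_edges H w)"
    unfolding H_def half_edges_split_old[OF wf ni fr S] half_edges_split_new[OF wf ni fr S]
    using fin cS by auto
  moreover have "3 \<le> card (half_edges G i)"
    using card_Diff_subset[OF fin(2) S] cS by linarith
  moreover have "half_edges H z = half_edges G z" if "z \<in> inner G" "z \<noteq> i" for z
    unfolding H_def using that w by (intro half_edges_split_other[OF wf fr S]) auto
  ultimately have "(\<forall>z \<in> inner H. 3 \<le> card (half_edges H z)) \<longleftrightarrow> (\<forall>z \<in> inner G. 3 \<le> card (half_edges G z))"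
    using i unfolding inner_H by (metis insert_iff)
  moreover have "conn_on (gE H) H (inner H) \<longleftrightarrow> conn_on (gE G) G (inner G)"
    unfolding inner_H E_H by (rule connected_split) (use i in auto)
  moreover have "card (live H) = Suc (card (live G))" "card (inner H) = Suc (card (inner G))"
    using live_split inner_H w e wf_finite[OF wf] finite_subset[OF legs_live(2)[of G]] legs_live(2)[of G]
    by (auto simp: card_insert_if)
  ultimately show ?thesis
    using wf wf_H i inner_H by (auto simp: stable_def)
qed

lemma root_split:
  assumes k: "k \<in> legs G" and "i = root G k \<Longrightarrow> k \<notin> fst ` S"
  shows "root H k = root G k"
proof -
  obtain b where b: "(k, b) \<in> half_edges G (root G k)"
    by (rule leg_half_edge[OF k])
  then have kE: "k \<in> gE G" "gI G (k, b) = root G k"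
    by (auto simp: half_edges_def)
  have "(k, b) \<notin> S"
    using assms(2) kE I_S(2) by (metis fst_conv image_eqI)
  then have "gI H (k, b) = root G k"
    using I_old[of "(k, b)"] kE by simp
  moreover have "k \<in> legs H" using k legs_split by simp
  ultimately show ?thesis
    using leg_root[of k H b] root_inner[OF k] inner_H by auto
qed

lemma rest_split_other:
  assumes x: "x \<in> inner G" "t \<in> gE G" and ix: "i \<noteq> x"
  shows "rest H x k t = rest G x k t"
proof -
  have "x \<noteq> w" using x w by auto
  then have hx: "half_edges H x = half_edges G x"
    unfolding H_def using ix by (intro half_edges_split_other[OF wf fr S]) auto
  have "gI H (opp h) \<in> component H x t \<longleftrightarrow> gI G (opp h) \<in> component G x t" if "h \<in> half_edges G x" for h
  proof -
    have hE: "fst (opp h) \<in> gE G" using that by (simp add: half_edges_def)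
    have wK: "w \<notin> component G x t" using component_subset[of G x t] w by auto
    from I_cases[OF hE] show ?thesis
    proof (elim disjE conjE)
      assume "gI H (opp h) = gI G (opp h)"
      then show ?thesis using I_not_w[OF hE] component_split_other[OF x ix] by simp
    next
      assume "gI H (opp h) = w" "gI G (opp h) = i"
      then show ?thesis using wK component_split_other[OF x ix] by simp
    qed
  qed
  then show ?thesis
    using hx by (auto simp: rest_def)
qed

text \<open>What is split off was already separated from \<open>t\<close>. So the connecting edge is
  separated from \<open>t\<close> as well and takes the place of \<open>S\<close>.\<close>

lemma rest_split_root_inside:
  assumes k: "k \<in> gE G" and t: "t \<in> gE G" and sub: "S \<subseteq> rest G i k t"
  shows "rest H i k t = insert (e, False) (rest G i k t - S)" "component H i t = component G i t"
proof -
  show K: "component H i t = component G i t"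
    using sub by (intro component_split_root_disjoint[OF t]) (auto simp: rest_def)
  have wK: "w \<notin> component G i t" "i \<notin> component G i t"
    using component_subset[of G i t] w by auto
  have B: "half_edges H i = insert (e, False) (half_edges G i - S)"
    unfolding H_def by (rule half_edges_split_old[OF wf inner_names[OF i] fr S])
  have "gI H (opp h) \<in> component G i t \<longleftrightarrow> gI G (opp h) \<in> component G i t" if "h \<in> half_edges G i" for h
  proof -
    have hE: "fst (opp h) \<in> gE G" using that by (simp add: half_edges_def)
    from I_cases[OF hE] show ?thesis
    proof (elim disjE conjE)
      assume "gI H (opp h) = w" "gI G (opp h) = i"
      then show ?thesis using wK by simp
    qed simp
  qed
  moreover have "e \<noteq> k" "e \<noteq> t" using e k t by auto
  ultimately show "rest H i k t = insert (e, False) (rest G i k t - S)"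
    unfolding rest_def K B using wK by auto
qed

text \<open>Some half-edge in \<open>S\<close> belongs to \<open>t\<close> or leads into its
  component, hence \<open>w\<close> joins the component. The connecting edge then leads to
  \<open>t\<close> and does not enter the new \<open>rest\<close>.\<close>

lemma rest_split_root_meets:
  assumes k: "k \<notin> fst ` S" and t: "t \<in> gE G" and sub: "\<not> S \<subseteq> rest G i k t"
  shows "rest H i k t \<subseteq> rest G i k t - S" "insert w (component G i t) \<subseteq> component H i t"
proof -
  obtain h where h: "h \<in> S" "h \<notin> rest G i k t" using sub by blast
  then have "fst h = t \<or> gI G (opp h) \<in> component G i t"
    using k S by (auto simp: rest_def)
  then have wK: "w \<in> component H i t"
    using component_split_root_meets[OF t h(1)] by blast
  then show K: "insert w (component G i t) \<subseteq> component H i t"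
    using component_old[OF i t] by blast
  have B: "half_edges H i = insert (e, False) (half_edges G i - S)"
    unfolding H_def by (rule half_edges_split_old[OF wf inner_names[OF i] fr S])
  show "rest H i k t \<subseteq> rest G i k t - S"
  proof
    fix h assume h: "h \<in> rest H i k t"
    have "h \<noteq> (e, False)"
      using h wK by (auto simp: rest_def)
    then have h': "h \<in> half_edges G i" "h \<notin> S"
      using h B by (auto simp: rest_def)
    have "gI G (opp h) \<notin> component G i t"
    proof
      assume a: "gI G (opp h) \<in> component G i t"
      then have "gI G (opp h) \<noteq> i" using component_subset[of G i t] by auto
      then have "gI H (opp h) = gI G (opp h)"
        using I_neq[of "opp h"] h' by (simp add: half_edges_def)
      then show False using h a K by (auto simp: rest_def)
    qed
    then show "h \<in> rest G i k t - S"
      using h h' by (auto simp: rest_def)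
  qed
qed

end

lemma splittingI:
  "well_formed G \<Longrightarrow> i \<in> inner G \<Longrightarrow> S \<in> splits G i \<Longrightarrow> fresh G e w \<Longrightarrow> splitting G i S e w"
  by (simp add: splitting_def splits_def)

text \<open>Replacing \<open>S\<close> by its complement, at the price of an isomorphism, one may
  assume that the leg \<open>k\<close> stays at the old vertex. Monotonicity under splitting then
  has to be checked only in this normal form.\<close>

lemma step_cases:
  assumes wf: "well_formed G" and st: "step G G'" and k: "k \<in> legs G"
  obtains i S e w p r F where "i \<in> inner G" "S \<in> splits G i" "fresh G e w"
    "i = root G k \<Longrightarrow> k \<notin> fst ` S" "graph_iso p r F (split_at G i S e w) G'"
proof -
  obtain i S e w where s: "i \<in> inner G" "S \<in> splits G i" "fresh G e w" "G' = split_at G i S e w"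
    using st unfolding step_def by blast
  have wf': "well_formed G'"
    unfolding s(4) using wf s(1) by (intro wf_split inner_names)
  show thesis
  proof (cases "k \<in> fst ` S")
    case False
    then show thesis
      using s wf' iso_id[OF wf'] by (intro that[of i S e w id id "{}"]) auto
  next
    case True
    let ?T = "half_edges G i - S"
    obtain b where b: "\<And>b' z. z \<in> inner G \<Longrightarrow> (k, b') \<in> half_edges G z \<Longrightarrow> b' = b"
      using leg_half_edge[OF k] by metis
    have "k \<notin> fst ` ?T"
    proof
      assume "k \<in> fst ` ?T"
      then obtain b1 where "(k, b1) \<in> ?T" by auto
      moreover obtain b2 where "(k, b2) \<in> S" using True by auto
      ultimately show False
        using b[OF s(1), of b1] b[OF s(1), of b2] parity.splits_subset[OF s(2)] by blast
    qed
    moreover have "graph_iso id (Transposition.transpose i w) {e} (split_at G i ?T e w) G'"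
      using split_complement_iso[OF wf s(1) _ s(3), of ?T] splits_complement(2)[OF s(2)] s(4) by simp
    ultimately show thesis
      using s splits_complement(1)[OF s(2)] by (intro that[of i ?T e w]) auto
  qed
qed

section \<open>A marked leg together with a second marked edge\<close>

text \<open>New marks go to the front, so index \<open>1\<close> holds the leg that was chosen
  before and index \<open>0\<close> the edge chosen after it. That edge is a second leg or a
  non-bridge, depending on the application.\<close>

definition marked :: "ngraph \<Rightarrow> bool" where
  "marked G \<longleftrightarrow> well_formed G \<and> 2 \<le> length (gM G) \<and> gM G ! 1 \<in> legs G \<and> gM G ! 0 \<in> live G \<and>
     gM G ! 0 \<noteq> gM G ! 1"

text \<open>A marked edge with an end outside the inner part is never contracted by the pairing. The
  condition is carried along for the marks of all earlier rounds.\<close>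

definition outer :: "ngraph \<Rightarrow> nat list \<Rightarrow> bool" where
  "outer G ks \<longleftrightarrow> (\<forall>k \<in> set ks. \<exists>b. gI G (k, b) \<notin> inner G)"

definition base :: "ngraph \<Rightarrow> nat" where
  "base G = root G (gM G ! 1)"

definition target :: "ngraph \<Rightarrow> nat set" where
  "target G = component G (base G) (gM G ! 0)"

definition side :: "ngraph \<Rightarrow> (nat \<times> bool) set" where
  "side G = rest G (base G) (gM G ! 1) (gM G ! 0)"

text \<open>Level \<open>0\<close> collects the graphs on which the pairing acts: at least two
  half-edges can be split off together, or there is a single one, leading to an inner vertex, and
  its edge can be contracted. On the other levels the side is empty or consists of one leg, and the
  base can be frozen.\<close>

definition level :: "ngraph \<Rightarrow> int" where
  "level G = (if side G = {} then 2
     else if \<exists>h. side G = {h} \<and> gI G (opp h) \<notin> inner G then 1 else 0)"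

text \<open>The correction by one makes this number equal for the two graphs of a pair: splitting
  off the side adds a vertex and leaves a side with one element.\<close>

definition excess :: "ngraph \<Rightarrow> int" where
  "excess G = int (card (inner G)) - (if card (side G) = 1 then 1 else 0)"

definition target_size :: "ngraph \<Rightarrow> int" where
  "target_size G = int (card (target G))"

lemma marked_facts:
  assumes "marked G"
  shows "base G \<in> inner G" "gM G ! 0 \<in> gE G" "gM G ! 1 \<in> gE G" "well_formed G"
    "target G \<subseteq> inner G - {base G}" "side G \<subseteq> half_edges G (base G)" "finite (side G)" "finite (target G)"
proof -
  show 1: "base G \<in> inner G"
    using assms root_inner by (simp add: marked_def base_def)
  show "gM G ! 0 \<in> gE G" "gM G ! 1 \<in> gE G" and wf: "well_formed G"
    using assms legs_live[of G] by (auto simp: marked_def)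
  show t: "target G \<subseteq> inner G - {base G}"
    by (simp add: target_def component_subset)
  show s: "side G \<subseteq> half_edges G (base G)"
    by (auto simp: side_def rest_def)
  show "finite (side G)" "finite (target G)"
    using half_edges_finite[OF wf] wf_finite(4)[OF wf] s t finite_subset by blast+
qed

lemma iso_marked:
  assumes iso: "graph_iso p r F G G'" and G: "marked G"
  shows "marked G'" "base G' = r (base G)" "target G' = r ` target G" "side G' = hmap p F ` side G"
proof -
  note f = marked_facts[OF G]
  have M: "gM G' = map p (gM G)" "2 \<le> length (gM G)"
    using iso G by (auto simp: graph_iso_def marked_def)
  have "0 < length (gM G)" "1 < length (gM G)"
    using M(2) by auto
  then have m: "gM G' ! 0 = p (gM G ! 0)" "gM G' ! 1 = p (gM G ! 1)"
    by (simp_all only: M(1) nth_map)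
  have "p (gM G ! 0) \<noteq> p (gM G ! 1)"
    using G f iso by (auto simp: graph_iso_def marked_def inj_on_def)
  then show "marked G'"
    using G iso_wf[OF iso] m M iso_live[OF iso] iso_legs[OF iso] by (auto simp: marked_def)
  show b: "base G' = r (base G)"
    using iso_root[OF iso] G unfolding base_def m by (simp add: marked_def)
  show "target G' = r ` target G"
    unfolding target_def b m using f by (intro iso_component[OF iso])
  show "side G' = hmap p F ` side G"
    unfolding side_def b m using f by (intro iso_rest[OF iso])
qed

lemma iso_marked_iff: "graph_iso p r F G G' \<Longrightarrow> marked G' = marked G"
  using iso_marked(1) iso_sym by blast

lemma iso_outer:
  assumes iso: "graph_iso p r F G G'" and ks: "set ks \<subseteq> gE G"
  shows "outer G' (map p ks) \<longleftrightarrow> outer G ks"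
proof -
  have "(\<exists>b. gI G' (p k, b) \<notin> inner G') \<longleftrightarrow> (\<exists>b. gI G (k, b) \<notin> inner G)" if "k \<in> set ks" for k
    using iso_edge_ends[OF iso, of k Not] ks that by blast
  then show ?thesis by (simp add: outer_def)
qed

lemma hmap_inj_side:
  assumes iso: "graph_iso p r F G G'" and G: "marked G"
  shows "inj_on (hmap p F) (side G)"
  using inj_on_subset[OF hmap_inj_on[OF iso] marked_facts(6)[OF G]] .

lemma iso_card_side:
  assumes "graph_iso p r F G G'" and "marked G"
  shows "card (side G') = card (side G)"
  unfolding iso_marked(4)[OF assms] by (rule card_image[OF hmap_inj_side[OF assms]])

lemma iso_level:
  assumes iso: "graph_iso p r F G G'" and G: "marked G"
  shows "level G' = level G"
proof -
  have S: "side G' = hmap p F ` side G"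
    by (rule iso_marked(4)[OF iso G])
  have h: "gI G' (opp (hmap p F h)) \<notin> inner G' \<longleftrightarrow> gI G (opp h) \<notin> inner G" if "h \<in> side G" for h
    using iso_inner_iff[OF iso, of "opp h"] that marked_facts(6)[OF G]
    by (auto simp: hmap_opp[symmetric] half_edges_def)
  have "(\<exists>h'. side G' = {h'} \<and> gI G' (opp h') \<notin> inner G') \<longleftrightarrow> (\<exists>h. side G = {h} \<and> gI G (opp h) \<notin> inner G)"
  proof
    assume "\<exists>h'. side G' = {h'} \<and> gI G' (opp h') \<notin> inner G'"
    then obtain h' where h': "side G' = {h'}" "gI G' (opp h') \<notin> inner G'" by blast
    then have "card (side G) = 1"
      using iso_card_side[OF iso G] by simp
    then obtain h1 where "side G = {h1}" by (metis card_1_singletonE)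
    then show "\<exists>h. side G = {h} \<and> gI G (opp h) \<notin> inner G"
      using h' S h[of h1] by auto
  next
    assume "\<exists>h. side G = {h} \<and> gI G (opp h) \<notin> inner G"
    then obtain h1 where "side G = {h1}" "gI G (opp h1) \<notin> inner G" by blast
    then show "\<exists>h'. side G' = {h'} \<and> gI G' (opp h') \<notin> inner G'"
      using S h[of h1] by auto
  qed
  then show ?thesis
    by (simp add: level_def S)
qed

lemma iso_excess: "graph_iso p r F G G' \<Longrightarrow> marked G \<Longrightarrow> excess G' = excess G"
  using iso_card_side iso_card_inner by (simp add: excess_def)

lemma iso_target_size:
  assumes iso: "graph_iso p r F G G'" and G: "marked G"
  shows "target_size G' = target_size G"
proof -
  have "inj_on r (target G)"
    using iso marked_facts(5)[OF G] inner_names by (auto simp: graph_iso_def intro: inj_on_subset)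
  then show ?thesis
    by (simp add: target_size_def iso_marked(3)[OF iso G] card_image)
qed

context splitting
begin

lemma marked_split: "marked H \<longleftrightarrow> marked G" if "set (gM G) \<subseteq> gE G"
proof -
  have "gM H = gM G" by (simp add: H_def)
  moreover have "gM G ! 0 \<noteq> e" if "2 \<le> length (gM G)"
  proof -
    have "gM G ! 0 \<in> set (gM G)" using that by (intro nth_mem) auto
    then show ?thesis using \<open>set (gM G) \<subseteq> gE G\<close> e by auto
  qed
  ultimately show ?thesis
    using wf wf_H by (auto simp: marked_def live_split legs_split)
qed

lemma outer_split:
  assumes "set ks \<subseteq> gE G"
  shows "outer H ks \<longleftrightarrow> outer G ks"
proof -
  have "gI H (k, b) \<in> inner H \<longleftrightarrow> gI G (k, b) \<in> inner G" if "k \<in> set ks" for k b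
    using split_ends assms that by blast
  then show ?thesis by (simp add: outer_def)
qed

context
  assumes G: "marked G" and good: "i = base G \<Longrightarrow> gM G ! 1 \<notin> fst ` S"
begin

lemma marked_H: "marked H"
  using G marked_split wf by (simp add: well_formed_def)

lemma base_split: "base H = base G"
  using root_split[of "gM G ! 1"] G good by (simp add: base_def marked_def) (simp add: H_def)

lemma split_other:
  assumes "i \<noteq> base G"
  shows "side H = side G"
    "target H = (if i \<in> target G then insert w (target G) else target G)"
proof -
  have M: "gM H = gM G" by (simp add: H_def)
  show "side H = side G"
    unfolding side_def base_split M using marked_facts[OF G] assms
    by (intro rest_split_other) auto
  show "target H = (if i \<in> target G then insert w (target G) else target G)"
    unfolding target_def base_split M using marked_facts[OF G] assms
    by (intro component_split_other) auto
qed

lemma split_inside: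
  assumes "i = base G" "S \<subseteq> side G"
  shows "side H = insert (e, False) (side G - S)" "target H = target G"
proof -
  have M: "gM H = gM G" by (simp add: H_def)
  show "side H = insert (e, False) (side G - S)" "target H = target G"
    using rest_split_root_inside[of "gM G ! 1" "gM G ! 0"] marked_facts[OF G] assms
    unfolding side_def target_def base_split M by auto
qed

lemma split_meets:
  assumes "i = base G" "\<not> S \<subseteq> side G"
  shows "side H \<subseteq> side G - S" "insert w (target G) \<subseteq> target H"
proof -
  have M: "gM H = gM G" by (simp add: H_def)
  show "side H \<subseteq> side G - S" "insert w (target G) \<subseteq> target H"
    using rest_split_root_meets[of "gM G ! 1" "gM G ! 0"] marked_facts[OF G] assms good
    unfolding side_def target_def base_split M by auto
qed

lemma side_opp:
  assumes "h \<in> half_edges G (base G)"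
  shows "gI H (opp h) \<in> inner H \<longleftrightarrow> gI G (opp h) \<in> inner G"
  using split_ends[of "fst h" "\<not> snd h"] assms by (simp add: half_edges_def opp_def)

text \<open>Splitting away from the base leaves the side as it is. Splitting off a subset of the
  side requires a side with two elements, hence level \<open>0\<close>; any other splitting at the
  base can only shrink the side.\<close>

lemma level_split_mono:
  assumes cS: "2 \<le> card S"
  shows "level G \<le> level H"
proof (cases "i = base G")
  case False
  have "gI H (opp h) \<in> inner H \<longleftrightarrow> gI G (opp h) \<in> inner G" if "h \<in> side G" for h
    using side_opp marked_facts(6)[OF G] that by blast
  then have "level H = level G"
    using split_other(1)[OF False] by (auto simp: level_def)
  then show ?thesis by simp
next
  case True
  show ?thesis
  proof (cases "S \<subseteq> side G")
    case inside: True
    then have "2 \<le> card (side G)"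
      using cS card_mono[OF marked_facts(7)[OF G] inside] by linarith
    then have "level G = 0"
      by (auto simp: level_def)
    then show ?thesis by (simp add: level_def)
  next
    case False
    have sub: "side H \<subseteq> side G"
      using split_meets(1)[OF True False] by blast
    show ?thesis
    proof (cases "\<exists>h. side G = {h} \<and> gI G (opp h) \<notin> inner G")
      case ext: True
      then obtain h where h: "side G = {h}" "gI G (opp h) \<notin> inner G" by blast
      then have "gI H (opp h) \<notin> inner H"
        using side_opp[of h] marked_facts(6)[OF G] by auto
      moreover have "side H = {} \<or> side H = {h}"
        using sub unfolding h(1) by blast
      ultimately show ?thesis
        using h by (auto simp: level_def)
    next
      case False
      then show ?thesis
        using sub by (auto simp: level_def)
    qed
  qed
qed

lemma target_split_mono: "target_size G \<le> target_size H"
proof -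
  have "target G \<subseteq> target H"
  proof (cases "i = base G")
    case True
    then show ?thesis
      using split_inside(2) split_meets(2) by (cases "S \<subseteq> side G") auto
  next
    case False
    then show ?thesis using split_other(2) by auto
  qed
  then show ?thesis
    using marked_facts(8)[OF marked_H] by (simp add: target_size_def card_mono)
qed

text \<open>Every splitting adds a vertex. This is compensated only if the side drops from at least
  two elements to one. A set \<open>S\<close> not contained in the side would enlarge the target,
  and a proper subset leaves two elements, so \<open>S\<close> must be the whole side.\<close>

lemma excess_split:
  assumes cS: "2 \<le> card S" and same: "target_size H = target_size G"
  shows "excess G \<le> excess H" "excess H = excess G \<longleftrightarrow> i = base G \<and> S = side G"
proof -
  have n: "card (inner H) = Suc (card (inner G))"
    using inner_H w wf_finite(4)[OF wf] by simp
  have x1: "(e, False) \<notin> side G"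
    using marked_facts(6)[OF G] e by (auto simp: half_edges_def)
  have fs: "finite (side G)" by (rule marked_facts(7)[OF G])
  have "(excess H = excess G + 1 \<and> \<not> (i = base G \<and> S = side G)) \<or> (excess H = excess G \<and> i = base G \<and> S = side G)"
  proof (cases "i = base G")
    case False
    then show ?thesis using split_other(1) n by (simp add: excess_def)
  next
    case True
    show ?thesis
    proof (cases "S \<subseteq> side G")
      case inside: True
      have big: "2 \<le> card (side G)"
        using cS card_mono[OF fs inside] by linarith
      show ?thesis
      proof (cases "S = side G")
        case eq: True
        then have "card (side H) = 1"
          using split_inside(1)[OF True inside] by simp
        then show ?thesis using True eq n big by (simp add: excess_def)
      next
        case False
        then have "side G - S \<noteq> {}" using inside by blast
        then have "1 \<le> card (side G - S)"
          using fs by (simp add: Suc_leI card_gt_0_iff)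
        moreover have "card (side H) = Suc (card (side G - S))"
          using split_inside(1)[OF True inside] fs x1 by simp
        ultimately show ?thesis using n big False by (simp add: excess_def)
      qed
    next
      case False
      have "card (insert w (target G)) \<le> card (target H)"
        using split_meets(2)[OF True False] marked_facts(8)[OF marked_H] by (rule card_mono[rotated])
      moreover have "w \<notin> target G"
        using marked_facts(5)[OF G] w by blast
      ultimately have "target_size G < target_size H"
        using marked_facts(8)[OF G] by (simp add: target_size_def)
      then show ?thesis using same by simp
    qed
  qed
  then show "excess G \<le> excess H" "excess H = excess G \<longleftrightarrow> i = base G \<and> S = side G"
    by auto
qed

end

end

text \<open>The part that stays at the base contains the marked leg and, by connectedness, another
  half-edge outside the side. These two make the splitting admissible.\<close>

lemma splits_side:
  assumes G: "marked G" and conn: "conn_on (gE G) G (inner G)" and big: "2 \<le> card (side G)"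
  shows "side G \<in> splits G (base G)" "gM G ! 1 \<notin> fst ` side G"
    "\<exists>h \<in> half_edges G (base G). fst h \<noteq> gM G ! 1 \<and> h \<notin> side G"
proof -
  let ?x = "base G" and ?l = "gM G ! 1" and ?t = "gM G ! 0"
  note f = marked_facts[OF G]
  show l: "?l \<notin> fst ` side G" by (auto simp: side_def rest_def)
  show ex: "\<exists>h \<in> half_edges G ?x. fst h \<noteq> ?l \<and> h \<notin> side G"
  proof (rule ccontr)
    assume none: "\<not> ?thesis"
    obtain b where b: "gI G (?t, b) \<in> inner G"
      using G by (auto simp: marked_def live_def)
    have "gI G (?t, b) \<noteq> ?x"
    proof
      assume "gI G (?t, b) = ?x"
      then have "(?t, b) \<in> half_edges G ?x" using f(2) by (simp add: half_edges_def)
      then show False using none G by (auto simp: side_def rest_def marked_def)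
    qed
    then have ne: "target G \<noteq> {}"
      using component_ends[of G ?t b ?x] b by (auto simp: target_def)
    \<comment> \<open>Without such a half-edge the target would be closed in the whole inner part
      although it misses the base.\<close>
    have "adj_closed (gE G) G (inner G) (target G)"
    proof (rule adj_closedI)
      fix h assume h: "fst h \<in> gE G" "gI G h \<in> target G" "gI G (opp h) \<in> inner G"
      have "gI G (opp h) \<noteq> ?x"
      proof
        assume "gI G (opp h) = ?x"
        then have o: "opp h \<in> half_edges G ?x" using h by (simp add: half_edges_def)
        then have "opp h \<notin> side G" using h by (auto simp: side_def rest_def target_def)
        then have "fst h = ?l" using none o by auto
        moreover have "?l \<in> legs G" using G by (simp add: marked_def)
        ultimately have "gI G h = ?x"
          using leg_root[of ?l G "snd h"] h(2) f(5) by (cases h) (auto simp: base_def)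
        then show False using h(2) f(5) by auto
      qed
      then show "gI G (opp h) \<in> target G"
        using adj_closedD[OF component_closed[of G ?x ?t] h(1)] h by (simp add: target_def)
    qed
    then have "target G = inner G"
      using conn_onD[OF conn] ne f(5) by blast
    then show False using f(1,5) by blast
  qed
  have leg: "?l \<in> legs G" using G by (simp add: marked_def)
  obtain b where b: "(?l, b) \<in> half_edges G ?x"
    unfolding base_def by (rule leg_half_edge[OF leg])
  obtain h where h: "h \<in> half_edges G ?x" "fst h \<noteq> ?l" "h \<notin> side G" using ex by blast
  have "(?l, b) \<notin> side G" using l by force
  moreover have "h \<noteq> (?l, b)" using h by auto
  ultimately have "card {h, (?l, b)} \<le> card (half_edges G ?x - side G)"
    using h b half_edges_finite[OF f(4)] by (intro card_mono) auto
  then have "2 \<le> card (half_edges G ?x - side G)"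
    using \<open>h \<noteq> (?l, b)\<close> by simp
  then show "side G \<in> splits G ?x"
    using big f(6) by (simp add: splits_def)
qed

section \<open>Pairing off the graphs of level zero\<close>

text \<open>The first mark is exempt from \<open>outer\<close>, since in the case of one leg it is
  an internal edge. It is safe from contraction all the same, because the side does not contain its
  half-edges.\<close>

definition core :: "nat \<Rightarrow> ngraph \<Rightarrow> bool" where
  "core t G \<longleftrightarrow> marked G \<and> stable t G \<and> outer G (tl (gM G)) \<and> level G = 0"

lemma leg_half_edge_unique:
  assumes "k \<in> legs G" "z \<in> inner G" "z' \<in> inner G"
    "(k, b) \<in> half_edges G z" "(k, b') \<in> half_edges G z'"
  shows "b = b'"
proof (rule leg_half_edge[OF assms(1)])
  fix c assume u: "\<And>b' z. z \<in> inner G \<Longrightarrow> (k, b') \<in> half_edges G z \<Longrightarrow> b' = c"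
  show "b = b'"
    using u[OF assms(2,4)] u[OF assms(3,5)] by simp
qed

lemma set_tl: "set (tl xs) \<subseteq> set xs"
  by (cases xs) auto

lemma marks_edges: "well_formed G \<Longrightarrow> set (gM G) \<subseteq> gE G" "well_formed G \<Longrightarrow> set (tl (gM G)) \<subseteq> gE G"
  using set_tl[of "gM G"] by (auto simp: well_formed_def)

lemma iso_outer_marks: "graph_iso p r F G G' \<Longrightarrow> outer G' (tl (gM G')) = outer G (tl (gM G))"
  using iso_outer[of p r F G G' "tl (gM G)"] marks_edges(2)[of G]
  by (simp add: graph_iso_def map_tl)

lemma iso_core: "graph_iso p r F G G' \<Longrightarrow> core t G' = core t G"
  unfolding core_def using iso_marked_iff invariantD[OF invariant_stable] iso_outer_marks iso_level by metis

lemma core_card_side: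
  assumes G: "core t G"
  shows "1 \<le> card (side G)"
proof -
  have "side G \<noteq> {}" "marked G"
    using G by (auto simp: core_def level_def)
  then show ?thesis
    using marked_facts(7)[of G] by (simp add: Suc_leI card_gt_0_iff)
qed

text \<open>Level \<open>0\<close> forces the other end of the half-edge to be inner. It differs
  from the base, as a tadpole would put both its half-edges into the side; and the edge is unmarked,
  as all marks but the first have an end that is not inner.\<close>

lemma core_single:
  assumes G: "core t G" and h: "side G = {h}"
  shows "contractible G h" "gI G h = base G" "gI G (opp h) \<notin> target G"
proof -
  let ?x = "base G"
  have m: "marked G" using G by (simp add: core_def)
  note f = marked_facts[OF m]
  have hx: "h \<in> half_edges G ?x" using f(6) h by auto
  then show x: "gI G h = ?x" by (simp add: half_edges_def)
  have hE: "fst h \<in> gE G" using hx by (simp add: half_edges_def)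
  have hs: "h \<in> side G" using h by simp
  then have ht: "fst h \<noteq> gM G ! 0" "fst h \<noteq> gM G ! 1" "gI G (opp h) \<notin> target G"
    by (auto simp: side_def rest_def target_def)
  then show "gI G (opp h) \<notin> target G" by blast
  have y: "gI G (opp h) \<in> inner G"
    using G h by (auto simp: core_def level_def split: if_splits)
  have "gI G (opp h) \<noteq> ?x"
  proof
    assume "gI G (opp h) = ?x"
    then have "opp h \<in> side G"
      using hE ht f(5) x by (auto simp: side_def rest_def half_edges_def target_def)
    then show False using h by auto
  qed
  moreover have "fst h \<notin> set (gM G)"
  proof
    assume "fst h \<in> set (gM G)"
    moreover have "set (gM G) \<subseteq> insert (gM G ! 0) (set (tl (gM G)))"
      by (cases "gM G") auto
    ultimately have "fst h \<in> set (tl (gM G))" using ht by blast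
    then obtain b where "gI G (fst h, b) \<notin> inner G"
      using G by (auto simp: core_def outer_def)
    moreover have "(fst h, b) = h \<or> (fst h, b) = opp h"
      by (cases h) auto
    ultimately show False using x y f(1) by auto
  qed
  ultimately show "contractible G h"
    using f hE x y by (simp add: contractible_def)
qed

lemma half_edges_contract:
  assumes h: "contractible G h"
  shows "half_edges (contract G h) (gI G h) =
     (half_edges G (gI G h) - {h}) \<union> (half_edges G (gI G (opp h)) - {opp h})"
proof -
  have "fst g = fst h \<longleftrightarrow> g = h \<or> g = opp h" for g
    by (cases g; cases h) auto
  moreover have "gI G h \<noteq> gI G (opp h)"
    using h by (simp add: contractible_def)
  ultimately show ?thesis
    by (auto simp: half_edges_def)
qed

lemma contract_is_split:
  assumes h: "contractible G h"
    and val: "3 \<le> card (half_edges G (gI G h))" "3 \<le> card (half_edges G (gI G (opp h)))"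
  defines "S \<equiv> half_edges G (gI G (opp h)) - {opp h}"
  shows "S \<in> splits (contract G h) (gI G h)" "fresh (contract G h) (fst h) (gI G (opp h))"
    "gI G h \<in> inner (contract G h)" "well_formed (contract G h)"
    "splitting (contract G h) (gI G h) S (fst h) (gI G (opp h))"
proof -
  let ?x = "gI G h" and ?y = "gI G (opp h)"
  have wf: "well_formed G" and ne: "?x \<noteq> ?y"
    using h by (auto simp: contractible_def)
  have hB: "h \<in> half_edges G ?x" "opp h \<in> half_edges G ?y"
    using h by (auto simp: contractible_def half_edges_def)
  have B: "half_edges (contract G h) ?x = (half_edges G ?x - {h}) \<union> S"
    unfolding S_def by (rule half_edges_contract[OF h])
  have "(half_edges G ?x - {h}) \<inter> S = {}"
    using ne by (auto simp: half_edges_def S_def)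
  then have "half_edges (contract G h) ?x - S = half_edges G ?x - {h}"
    unfolding B by blast
  moreover have "2 \<le> card S" "2 \<le> card (half_edges G ?x - {h})"
    using hB val half_edges_finite[OF wf] by (simp_all add: S_def)
  ultimately show 1: "S \<in> splits (contract G h) ?x"
    by (simp add: splits_def B)
  show 2: "fresh (contract G h) (fst h) ?y"
    using contract_names(1)[OF h] by (simp add: fresh_def)
  show 3: "?x \<in> inner (contract G h)"
    using contract_names(2)[OF h] h by (simp add: contractible_def)
  show 4: "well_formed (contract G h)" by (rule wf_contract[OF h])
  show "splitting (contract G h) ?x S (fst h) ?y"
    by (rule splittingI[OF 4 3 1 2])
qed

text \<open>The graph is a splitting of its contraction, so the lemmas on splittings are read
  backwards. The absorbed vertex lies outside the target, hence the set moved to it is part of the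
  side of the contraction. As the side of \<open>G\<close> has a single element, nothing else is
  left, and the set is that whole side.\<close>

lemma core_contract:
  assumes G: "core t G" and h: "side G = {h}"
  defines "C \<equiv> contract G h" and "y \<equiv> gI G (opp h)"
  shows "core t C" "base C = base G" "side C = half_edges G y - {opp h}" "2 \<le> card (side C)"
    "target_size C = target_size G" "excess C = excess G"
    "graph_iso id id (if snd h then {fst h} else {}) (split_at C (base C) (side C) (fst h) y) G"
    "fresh C (fst h) y"
proof -
  let ?x = "base G"
  have m: "marked G" and st: "stable t G" and out: "outer G (tl (gM G))"
    using G by (auto simp: core_def)
  note f = marked_facts[OF m]
  have con: "contractible G h" and x: "gI G h = ?x" and yK: "y \<notin> target G"
    using core_single[OF G h] by (auto simp: y_def)
  define S where "S = half_edges G y - {opp h}"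
  have yi: "y \<in> inner G" "y \<noteq> ?x"
    using con x by (auto simp: contractible_def y_def)
  have val: "3 \<le> card (half_edges G ?x)" "3 \<le> card (half_edges G y)"
    using st f(1) yi by (auto simp: stable_def)
  note cs = contract_is_split[OF con, unfolded x, folded y_def C_def, folded S_def, OF val]
  interpret splitting C ?x S "fst h" y "split_at C ?x S (fst h) y"
    using cs(5) by simp
  let ?H = "split_at C ?x S (fst h) y"
  have iso: "graph_iso id id (if snd h then {fst h} else {}) ?H G"
    using split_contract_iso[OF con] by (simp add: x C_def S_def y_def)
  have "set (gM C) \<subseteq> gE C"
    using cs(4) by (simp add: well_formed_def)
  then have mC: "marked C"
    using marked_split iso_marked_iff[OF iso] m by simp
  have gM: "gM C = gM G" by (simp add: C_def)
  have "gM C ! 1 \<notin> fst ` S"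
  proof
    assume "gM C ! 1 \<in> fst ` S"
    then obtain g where "g \<in> S" "fst g = gM C ! 1"
      by (metis imageE)
    then have g: "g \<in> half_edges G y" "fst g = gM G ! 1"
      unfolding gM S_def by simp_all
    then have "gI G (gM G ! 1, snd g) = y"
      by (metis (mono_tags, lifting) half_edges_def mem_Collect_eq prod.collapse)
    then show False
      using leg_root[of "gM G ! 1" G "snd g"] m yi by (simp add: marked_def base_def)
  qed
  then have good: "?x = base C \<Longrightarrow> gM C ! 1 \<notin> fst ` S" by blast
  have mH: "marked ?H"
    using iso_marked_iff[OF iso] m by simp
  show bC: "base C = ?x"
    using base_split[OF mC good] iso_marked(2)[OF iso mH] by simp
  have tH: "target ?H = target G"
    using iso_marked(3)[OF iso mH] by simp
  have inside: "S \<subseteq> side C"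
  proof (rule ccontr)
    assume "\<not> S \<subseteq> side C"
    then have "y \<in> target ?H"
      using split_meets(2)[OF mC good bC[symmetric]] by blast
    then show False using tH yK by simp
  qed
  have cH: "card (side ?H) = 1"
    using iso_card_side[OF iso mH] h by simp
  have "side ?H = insert (fst h, False) (side C - S)"
    by (rule split_inside(1)[OF mC good bC[symmetric] inside])
  moreover have "(fst h, False) \<notin> side C - S"
    using marked_facts(6)[OF mC] by (auto simp: half_edges_def C_def)
  moreover have "finite (side C - S)" using marked_facts(7)[OF mC] by blast
  ultimately have "side C - S = {}"
    using cH by simp
  then have sS: "side C = S" using inside by blast
  then show "side C = half_edges G y - {opp h}" by (simp add: S_def)
  have cS: "2 \<le> card S"
    using cs(1) by (simp add: splits_def)
  then show big: "2 \<le> card (side C)" using sS by simp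
  have stC: "stable t C"
    using stable_split[OF cs(1)] invariantD[OF invariant_stable iso] st by simp
  have "outer C (tl (gM C))"
    using outer_split[OF marks_edges(2)[OF cs(4)]] iso_outer_marks[OF iso] out by simp
  moreover have "level C = 0"
    using big by (auto simp: level_def)
  ultimately show "core t C"
    using mC stC by (simp add: core_def)
  have "target ?H = target C"
    by (rule split_inside(2)[OF mC good bC[symmetric] inside])
  then have ts: "target_size ?H = target_size C"
    by (simp add: target_size_def)
  then show "target_size C = target_size G"
    using iso_target_size[OF iso mH] by simp
  show "excess C = excess G"
    using excess_split(2)[OF mC good cS ts] iso_excess[OF iso mH] bC sS by simp
  show "graph_iso id id (if snd h then {fst h} else {}) (split_at C (base C) (side C) (fst h) y) G"
    using iso sS bC by simp
  show "fresh C (fst h) y" by (rule cs(2))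
qed

lemma core_split_side:
  assumes G: "core t G" and big: "2 \<le> card (side G)" and fr: "fresh G e w"
  defines "H \<equiv> split_at G (base G) (side G) e w"
  shows "core t H" "side H = {(e, False)}" "target_size H = target_size G" "excess H = excess G"
    "side G \<in> splits G (base G)"
proof -
  let ?S = "side G"
  have m: "marked G" and st: "stable t G" and out: "outer G (tl (gM G))"
    using G by (auto simp: core_def)
  note f = marked_facts[OF m]
  have conn: "conn_on (gE G) G (inner G)" using st by (simp add: stable_def)
  show sp: "?S \<in> splits G (base G)"
    by (rule splits_side(1)[OF m conn big])
  have good: "base G = base G \<Longrightarrow> gM G ! 1 \<notin> fst ` ?S"
    using splits_side(2)[OF m conn big] by blast
  interpret splitting G "base G" ?S e w H
    using splittingI[OF f(4,1) sp fr] H_def by simp_all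
  have cS: "2 \<le> card ?S" by (rule big)
  show s: "side H = {(e, False)}"
    using split_inside(1)[OF m good refl order_refl] by simp
  have "target H = target G"
    by (rule split_inside(2)[OF m good refl order_refl])
  then show ts: "target_size H = target_size G"
    by (simp add: target_size_def)
  show "excess H = excess G"
    using excess_split(2)[OF m good cS ts] by simp
  have "level H = 0"
    using s inner_H by (auto simp: level_def)
  moreover have "gM H = gM G" by (simp add: H_def)
  ultimately show "core t H"
    using marked_H[OF m good] stable_split[OF sp] st out outer_split[OF marks_edges(2)[OF f(4)]]
    by (simp add: core_def)
qed

lemma graph_class_core:
  assumes "\<And>p r F G G'. graph_iso p r F G G' \<Longrightarrow> core t G \<Longrightarrow> E G' = E G"
  shows "graph_class (\<lambda>G. core t G \<and> E G)"
  unfolding graph_class_def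
proof
  show "invariant (\<lambda>G. core t G \<and> E G)"
    using assms iso_core by (intro invariant_predI) blast
qed (auto simp: core_def stable_def)

context parity
begin

lemma core_step_mono:
  assumes G: "core t G" and st: "step G G'"
  shows "target_size G \<le> target_size G'"
    and "target_size G' = target_size G \<Longrightarrow> excess G \<le> excess G'"
proof -
  have m: "marked G" and wf: "well_formed G"
    using G by (auto simp: core_def stable_def)
  have leg: "gM G ! 1 \<in> legs G" using m by (simp add: marked_def)
  obtain i S e w p r F where s: "i \<in> inner G" "S \<in> splits G i" "fresh G e w"
    "i = root G (gM G ! 1) \<Longrightarrow> gM G ! 1 \<notin> fst ` S" "graph_iso p r F (split_at G i S e w) G'"
    by (rule step_cases[OF wf st leg]) blast
  interpret splitting G i S e w "split_at G i S e w"
    using splittingI[OF wf s(1-3)] by simp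
  let ?H = "split_at G i S e w"
  have good: "i = base G \<Longrightarrow> gM G ! 1 \<notin> fst ` S" using s(4) by (simp add: base_def)
  have cS: "2 \<le> card S" using s(2) by (simp add: splits_def)
  have mH: "marked ?H" by (rule marked_H[OF m good])
  have ts: "target_size G' = target_size ?H" and ex: "excess G' = excess ?H"
    using iso_target_size[OF s(5) mH] iso_excess[OF s(5) mH] by auto
  show "target_size G \<le> target_size G'"
    using target_split_mono[OF m good] ts by simp
  show "excess G \<le> excess G'" if "target_size G' = target_size G"
    using excess_split(1)[OF m good cS] that ts ex by simp
qed

text \<open>On graphs with fixed \<open>target_size\<close> and \<open>excess\<close> the only
  splitting left is that of the side, so \<open>exact_toggle\<close> applies. The extra condition
  \<open>E\<close> makes room for the two applications, which differ in the kind of the first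
  mark.\<close>

lemma exact_core:
  assumes inv: "\<And>p r F G G'. graph_iso p r F G G' \<Longrightarrow> core t G \<Longrightarrow> E G' = E G"
    and conv: "convex_class (\<lambda>G. core t G \<and> E G)"
    and toggle: "\<And>G e w. core t G \<Longrightarrow> 2 \<le> card (side G) \<Longrightarrow> fresh G e w \<Longrightarrow>
      E (split_at G (base G) (side G) e w) = E G"
  shows "exact (\<lambda>G. core t G \<and> E G) v"
proof -
  have m: "marked G" if "core t G" for G using that by (simp add: core_def)
  define P where "P b c G \<longleftrightarrow> (core t G \<and> E G) \<and> target_size G = b \<and> excess G = c" for b c G
  have toggles: "exact (P b c) v" for b c
  proof (rule exact_toggle[where U = "\<lambda>G. 2 \<le> card (side G)" and ?i0.0 = base and ?S0.0 = side
        and hc = "\<lambda>G. the_elem (side G)"])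
    show "graph_class (P b c)"
      unfolding P_def using inv iso_target_size iso_excess m
      by (subst conj_assoc, intro graph_class_core) metis
    fix G assume PG: "P b c G"
    then have G: "core t G" and mG: "marked G" and EG: "E G" using m by (auto simp: P_def)
    have conn: "conn_on (gE G) G (inner G)" and wf: "well_formed G"
      using G by (auto simp: core_def stable_def)
    note f = marked_facts[OF mG]
    show "(2 \<le> card (side G')) = (2 \<le> card (side G))" if "graph_iso p r F G G'" for p r F G'
      using iso_card_side[OF that mG] by simp
    show "base G \<in> inner G \<and> side G \<in> splits G (base G)" if "2 \<le> card (side G)"
      using f(1) splits_side(1)[OF mG conn that] by blast
    have main: "P b c (split_at G i S e w) \<longleftrightarrow> i = base G \<and> S = side G"
      if i: "i \<in> inner G" and Sp: "S \<in> splits G i" and fr: "fresh G e w"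
        and good: "i = base G \<Longrightarrow> gM G ! 1 \<notin> fst ` S" for i S e w
    proof -
      interpret splitting G i S e w "split_at G i S e w"
        using splittingI[OF wf i Sp fr] by simp
      have cS: "2 \<le> card S" using Sp by (simp add: splits_def)
      show ?thesis
      proof
        assume "P b c (split_at G i S e w)"
        then have "target_size (split_at G i S e w) = target_size G"
          "excess (split_at G i S e w) = excess G"
          using PG by (auto simp: P_def)
        then show "i = base G \<and> S = side G"
          using excess_split(2)[OF mG good cS] by simp
      next
        assume eq: "i = base G \<and> S = side G"
        then have big: "2 \<le> card (side G)" using cS by simp
        show "P b c (split_at G i S e w)"
          using core_split_side[OF G big fr] toggle[OF G big fr] PG eq by (simp add: P_def)
      qed
    qed
    show "P b c (split_at G i S e w) \<longleftrightarrow> i = base G \<and> (S = side G \<or> S = half_edges G i - side G)"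
      if big: "2 \<le> card (side G)" and i: "i \<in> inner G" and S: "S \<in> splits G i" and fr: "fresh G e w" for i S e w
    proof -
      have invP: "invariant (P b c)"
        using inv iso_core iso_target_size iso_excess m
        unfolding P_def by (intro invariant_predI) metis
      let ?l = "gM G ! 1" and ?T = "half_edges G i - S"
      have TT: "?T \<in> splits G i" "half_edges G i - ?T = S"
        using splits_complement[OF S] by blast+
      have "P b c (split_at G i ?T e w) = P b c (split_at G i S e w)"
        by (rule invariantD[OF invP split_complement_iso[OF wf i splits_subset[OF S] fr]])
      moreover have "?l \<notin> fst ` side G" "\<exists>b. (?l, b) \<in> half_edges G (base G)"
      proof -
        show "?l \<notin> fst ` side G" by (rule splits_side(2)[OF mG conn big])
        have "?l \<in> legs G" using mG by (simp add: marked_def)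
        then show "\<exists>b. (?l, b) \<in> half_edges G (base G)"
          unfolding base_def by (meson leg_half_edge)
      qed
      \<comment> \<open>At most one of the two parts carries the marked leg, so after complementing
        if necessary the criterion \<open>main\<close> is available.\<close>
      moreover have "?l \<notin> fst ` S \<or> ?l \<notin> fst ` ?T"
      proof (rule ccontr)
        assume "\<not> ?thesis"
        then obtain b1 b2 where b: "(?l, b1) \<in> S" "(?l, b2) \<in> ?T" by auto
        have "?l \<in> legs G" using mG by (simp add: marked_def)
        then have "b1 = b2"
          using b splits_subset[OF S] by (intro leg_half_edge_unique[OF _ i i]) blast+
        then show False using b by simp
      qed
      ultimately consider
        "P b c (split_at G i S e w) \<longleftrightarrow> i = base G \<and> S = side G" "i = base G \<Longrightarrow> ?l \<notin> fst ` S"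
        | "P b c (split_at G i S e w) \<longleftrightarrow> i = base G \<and> ?T = side G" "i = base G \<Longrightarrow> ?l \<notin> fst ` ?T"
        using main[OF i S fr] main[OF i TT(1) fr] by blast
      then show ?thesis
      proof cases
        case 1
        have "S \<noteq> half_edges G i - side G" if "i = base G"
        proof
          assume eq: "S = half_edges G i - side G"
          obtain b where "(?l, b) \<in> half_edges G (base G)"
            using \<open>\<exists>b. (?l, b) \<in> half_edges G (base G)\<close> by blast
          then have "(?l, b) \<in> S"
            using eq that \<open>?l \<notin> fst ` side G\<close> by force
          then show False using 1(2)[OF that] by force
        qed
        then show ?thesis using 1(1) by blast
      next
        case 2
        have "?T = side G \<longleftrightarrow> S = half_edges G i - side G" if "i = base G"
          using TT(2) f(6) that by (metis double_diff order_refl)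
        moreover have "S \<noteq> side G" if "i = base G"
        proof
          assume eq: "S = side G"
          obtain b where "(?l, b) \<in> half_edges G (base G)"
            using \<open>\<exists>b. (?l, b) \<in> half_edges G (base G)\<close> by blast
          then have "(?l, b) \<in> ?T"
            using eq that \<open>?l \<notin> fst ` side G\<close> by force
          then show False using 2(2)[OF that] by force
        qed
        ultimately show ?thesis using 2(1) by blast
      qed
    qed
    show "\<not> 2 \<le> card (side (split_at G (base G) (side G) e w)) \<and>
        the_elem (side (split_at G (base G) (side G) e w)) = (e, False)"
      if "2 \<le> card (side G)" "fresh G e w" for e w
      using core_split_side(2)[OF G that] by simp
    show "\<not> P b c G'" if small: "\<not> 2 \<le> card (side G)" and st: "step G G'" for G'
    proof
      assume PG': "P b c G'"
      have leg: "gM G ! 1 \<in> legs G" using mG by (simp add: marked_def)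
      obtain i S e w p r F where s: "i \<in> inner G" "S \<in> splits G i" "fresh G e w"
        "i = root G (gM G ! 1) \<Longrightarrow> gM G ! 1 \<notin> fst ` S" "graph_iso p r F (split_at G i S e w) G'"
        by (rule step_cases[OF wf st leg]) blast
      have invP: "invariant (P b c)"
        using inv iso_core iso_target_size iso_excess m
        unfolding P_def by (intro invariant_predI) metis
      have "S = side G"
        using main[OF s(1-3)] s(4) PG' invariantD[OF invP s(5)] by (simp add: base_def)
      then show False using small s(2) by (simp add: splits_def)
    qed
    have single: "\<exists>h. side G = {h}" if "\<not> 2 \<le> card (side G)"
    proof -
      have "card (side G) = 1" using core_card_side[OF G] that by linarith
      then show ?thesis by (metis card_1_singletonE)
    qed
    show "contractible G (the_elem (side G)) \<and> P b c (contract G (the_elem (side G))) \<and>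
      2 \<le> card (side (contract G (the_elem (side G)))) \<and>
      base (contract G (the_elem (side G))) = gI G (the_elem (side G)) \<and>
      side (contract G (the_elem (side G))) =
        half_edges G (gI G (opp (the_elem (side G)))) - {opp (the_elem (side G))}"
      if small: "\<not> 2 \<le> card (side G)"
    proof -
      obtain h where h: "side G = {h}" using single[OF small] by blast
      note cc = core_contract[OF G h]
      have "E (contract G h) = E (split_at (contract G h) (base (contract G h)) (side (contract G h)) (fst h) (gI G (opp h)))"
        by (rule toggle[OF cc(1,4,8), symmetric])
      also have "\<dots> = E G"
        using inv[OF cc(7)] core_split_side(1)[OF cc(1,4,8)] by simp
      finally have "P b c (contract G h)"
        using cc PG by (simp add: P_def)
      then show ?thesis
        using h cc core_single[OF G h] by simp
    qed
    show "the_elem (side G') = hmap p F (the_elem (side G))"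
      if iso: "graph_iso p r F G G'" and small: "\<not> 2 \<le> card (side G)" for p r F G'
    proof -
      obtain h where h: "side G = {h}" using single[OF small] by blast
      then show ?thesis using iso_marked(4)[OF iso mG] by simp
    qed
  qed
  have level2: "exact (\<lambda>G. (core t G \<and> E G) \<and> target_size G = b) v" for b
  \<comment> \<open>The lower bound \<open>-1\<close> allows for the correction in
    \<open>excess\<close>.\<close>
  proof (rule exact_filtration[where f = "excess" and lo = "-1" and hi = "int v"])
    show "graph_class (\<lambda>G. (core t G \<and> E G) \<and> target_size G = b)"
      using inv iso_target_size m by (subst conj_assoc, intro graph_class_core) metis
    show "convex_class (\<lambda>G. (core t G \<and> E G) \<and> target_size G = b)"
      using core_step_mono(1) by (intro convex_class_level conv) blast
    show "excess G' = excess G" if "graph_iso p r F G G'" "(core t G \<and> E G) \<and> target_size G = b" for p r F G G'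
      using that m iso_excess by blast
    show "excess G \<le> excess G'"
      if "(core t G \<and> E G) \<and> target_size G = b" "(core t G' \<and> E G') \<and> target_size G' = b" "step G G'" for G G'
      using that by (intro core_step_mono(2)[of t]) auto
    show "exact (\<lambda>G. ((core t G \<and> E G) \<and> target_size G = b) \<and> excess G = c) v" for c
      using toggles[of b c] by (simp add: P_def[abs_def])
  qed (auto simp: excess_def)
  show ?thesis
  proof (rule exact_filtration[where f = target_size and lo = 0 and hi = "int v"])
    show "graph_class (\<lambda>G. core t G \<and> E G)"
      using inv by (rule graph_class_core)
    show "target_size G \<le> target_size G'"
      if "core t G \<and> E G" "core t G' \<and> E G'" "step G G'" for G G'
      using that core_step_mono(1) by blast
    show "0 \<le> target_size G \<and> target_size G \<le> int v" if "core t G \<and> E G" "card (inner G) = v" for G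
    proof -
      have mG: "marked G" using that m by blast
      have "target G \<subseteq> inner G" using marked_facts(5)[OF mG] by blast
      then show ?thesis
        using card_mono[OF wf_finite(4)[OF marked_facts(4)[OF mG]]] that(2) by (simp add: target_size_def)
    qed
    show "target_size G' = target_size G" if "graph_iso p r F G G'" "core t G \<and> E G" for p r F G G'
      using that m iso_target_size by blast
  qed (use conv level2 in auto)
qed

end

section \<open>Freezing into graphs with at least two legs\<close>

text \<open>The class on which the induction over the number of vertices runs. Freezing the root of
  a graph that is not paired off leads here, for one leg as well as for several.\<close>

definition hub :: "nat \<Rightarrow> ngraph \<Rightarrow> bool" where
  "hub t G \<longleftrightarrow> stable t G \<and> 2 \<le> card (legs G) \<and> outer G (gM G)"

definition frozen :: "(ngraph \<Rightarrow> bool) \<Rightarrow> (ngraph \<Rightarrow> nat) \<Rightarrow> ngraph \<Rightarrow> bool" where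
  "frozen P X G \<longleftrightarrow> gF G \<noteq> [] \<and> hd (gF G) \<in> gV G \<and> P (thaw G) \<and> hd (gF G) = X (thaw G)"

lemma iso_outer_all: "graph_iso p r F G G' \<Longrightarrow> outer G' (gM G') = outer G (gM G)"
  using iso_outer[of p r F G G' "gM G"] marks_edges(1)[of G] by (simp add: graph_iso_def)

lemma iso_card_legs: "graph_iso p r F G G' \<Longrightarrow> card (legs G') = card (legs G)"
  using iso_legs iso_card_edges legs_live by (metis order_trans)

lemma graph_class_hub: "graph_class (hub t)"
  unfolding graph_class_def
proof
  show "invariant (hub t)"
    unfolding hub_def using iso_outer_all iso_card_legs invariantD[OF invariant_stable]
    by (intro invariantI) metis
qed (auto simp: hub_def stable_def)

lemma invariant_frozen:
  assumes inv: "invariant P" and nat: "\<And>p r F G G'. graph_iso p r F G G' \<Longrightarrow> P G \<Longrightarrow> X G' = r (X G)"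
  shows "invariant (frozen P X)"
proof (rule invariant_predI)
  fix p r F G G' assume iso: "graph_iso p r F G G'" and G: "frozen P X G"
  have iso': "graph_iso p r F (thaw G) (thaw G')"
    using G by (intro iso_thaw[OF iso]) (auto simp: frozen_def)
  have "gF G' = map r (gF G)" "gV G' = r ` gV G"
    using iso by (simp_all add: graph_iso_def)
  then show "frozen P X G'"
    using G invariantD[OF inv iso'] nat[OF iso'] by (auto simp: frozen_def hd_map)
qed

context parity
begin

lemma exact_empty: "(\<And>G. \<not> P G) \<Longrightarrow> exact P v"
  unfolding exact_def by blast

lemma exact_cong:
  assumes "exact P v" "\<And>G. P G \<longleftrightarrow> Q G"
  shows "exact Q v"
proof -
  have "P = Q" using assms(2) by (intro ext) simp
  then show ?thesis using assms(1) by simp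
qed

lemma exact_by_freeze:
  assumes P: "graph_class P"
    and X: "\<And>G. P G \<Longrightarrow> X G \<in> inner G"
    and nat: "\<And>p r F G G'. graph_iso p r F G G' \<Longrightarrow> P G \<Longrightarrow> X G' = r (X G)"
    and loc: "\<And>G i S e w x. well_formed G \<Longrightarrow> i \<in> inner G \<Longrightarrow> S \<in> splits G i \<Longrightarrow> fresh G e w \<Longrightarrow>
      x \<in> inner G \<Longrightarrow> i \<noteq> x \<Longrightarrow>
      (P (split_at G i S e w) \<and> X (split_at G i S e w) = x) = (P G \<and> X G = x)"
    and noX: "\<And>G i S e w. P G \<Longrightarrow> i \<in> inner G \<Longrightarrow> S \<in> splits G i \<Longrightarrow> fresh G e w \<Longrightarrow>
      P (split_at G i S e w) \<Longrightarrow> i \<noteq> X G"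
    and hub: "\<And>G. P G \<Longrightarrow> hub t (freeze (X G) G)"
    and ex: "exact (hub t) v"
  shows "exact P (Suc v)"
proof (rule exact_freeze[where X = X])
  show "graph_class P" by (rule P)
  show "X G \<in> inner G" if "P G" for G using that by (rule X)
  show "X G' = r (X G)" if "graph_iso p r F G G'" "P G" for p r F G G' using that by (rule nat)
  have wf: "\<And>G. P G \<Longrightarrow> well_formed G" and inv: "invariant P"
    using P by (auto simp: graph_class_def)
  show "i \<noteq> X G \<and> X (split_at G i S e w) = X G"
    if "P G" "i \<in> inner G" "S \<in> splits G i" "fresh G e w" "P (split_at G i S e w)" for G i S e w
    using noX[OF that] loc[OF wf[OF that(1)] that(2-4) X[OF that(1)]] that(1) by blast
  have const: "frozen P X G' = frozen P X G" if hub: "hub t G" and st: "step G G'" for G G'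
  proof -
    obtain i S e w where s: "i \<in> inner G" "S \<in> splits G i" "fresh G e w" "G' = split_at G i S e w"
      using st unfolding step_def by blast
    let ?T = "thaw G" and ?x = "hd (gF G)"
    have gF: "gF G' = gF G" and gV: "gV G' = insert w (gV G)" by (simp_all add: s(4))
    show ?thesis
    proof (cases "gF G \<noteq> [] \<and> ?x \<in> gV G")
      case False
      have "?x \<noteq> w" if "gF G \<noteq> []"
        using s(3) that by (auto simp: fresh_def names_def)
      then show ?thesis using False gF gV by (auto simp: frozen_def)
    next
      case True
      have T': "thaw G' = split_at ?T i S e w"
        by (simp add: thaw_def s(4) split_update)
      have wfT: "well_formed ?T"
        using well_formed_thaw[of G] True hub by (simp add: hub_def stable_def)
      have iT: "i \<in> inner ?T"
        using s(1) set_tl[of "gF G"] by (auto simp: inner_def thaw_def)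
      have ST: "S \<in> splits ?T i" using s(2) by (simp add: thaw_def)
      have frT: "fresh ?T e w"
        using s(3) names_thaw[of G] True by (simp add: fresh_def) (simp add: thaw_def)
      have ix: "i \<noteq> ?x" using s(1) True by (auto simp: inner_def)
      have xw: "?x \<noteq> w" using s(3) True by (auto simp: fresh_def names_def)
      have "(P (thaw G') \<and> X (thaw G') = ?x) = (P ?T \<and> X ?T = ?x)"
      proof (cases "?x \<in> inner ?T")
        case xin: True
        show ?thesis unfolding T' by (rule loc[OF wfT iT ST frT xin ix])
      next
        case False
        then have "\<not> (P ?T \<and> X ?T = ?x)" using X[of ?T] by metis
        moreover have "\<not> (P (thaw G') \<and> X (thaw G') = ?x)"
          using X[of "thaw G'"] False xw unfolding T' inner_split[OF frT] by auto
        ultimately show ?thesis by blast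
      qed
      then have "(P (thaw G') \<and> ?x = X (thaw G')) = (P ?T \<and> ?x = X ?T)"
        by (simp only: eq_commute[of ?x])
      then show ?thesis
        unfolding frozen_def gF gV using True by simp
    qed
  qed
  have inv_frozen: "invariant (frozen P X)"
    using inv by (rule invariant_frozen) (rule nat)
  have restricted: "exact (\<lambda>G. hub t G \<and> frozen P X G) v"
  proof (rule exact_restrict[OF graph_class_hub _ ex])
    show "frozen P X G' = frozen P X G" if "graph_iso p r F G G'" for p r F G G'
      by (rule invariantD[OF inv_frozen that])
    show "frozen P X G' = frozen P X G" if "hub t G" "step G G'" for G G'
      by (rule const[OF that])
  qed
  have "hub t G" if "frozen P X G" for G
  proof -
    have "freeze (X (thaw G)) (thaw G) = G"
      using that by (cases "gF G") (auto simp: frozen_def freeze_def thaw_def)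
    then show ?thesis using hub[of "thaw G"] that by (simp add: frozen_def)
  qed
  then have "(hub t G \<and> frozen P X G) = frozen P X G" for G by blast
  with restricted have "exact (frozen P X) v"
    by (rule exact_cong)
  then show "exact (\<lambda>G. gF G \<noteq> [] \<and> hd (gF G) \<in> gV G \<and> P (thaw G) \<and> hd (gF G) = X (thaw G)) v"
    by (simp add: frozen_def[abs_def])
qed

end

context splitting
begin

lemma base_split_cases:
  assumes G: "marked G"
  shows "base H = base G \<or> i = base G \<and> base H = w"
proof -
  let ?l = "gM G ! 1"
  have M: "gM H = gM G" by (simp add: H_def)
  have leg: "?l \<in> legs G" "?l \<in> legs H"
    using G legs_split by (auto simp: marked_def)
  obtain b where b: "gI G (?l, b) \<in> inner G" "?l \<in> gE G"
    using leg(1) by (auto simp: legs_def live_def)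
  have "gI G (?l, b) = base G"
    using leg_root[OF leg(1) b(1)] by (simp add: base_def)
  moreover have "gI H (?l, b) = base H"
    using leg_root[OF leg(2)] split_ends[OF b(2)] b(1) by (simp add: base_def M)
  ultimately show ?thesis
    using I_cases[of "(?l, b)"] b(2) by auto
qed

lemma level_split_other:
  assumes G: "marked G" and "i \<noteq> base G"
  shows "level H = level G"
proof -
  have good: "i = base G \<Longrightarrow> gM G ! 1 \<notin> fst ` S" using assms(2) by blast
  have "gI H (opp h) \<in> inner H \<longleftrightarrow> gI G (opp h) \<in> inner G" if "h \<in> side G" for h
    using side_opp[OF G good] marked_facts(6)[OF G] that by blast
  then show ?thesis
    using split_other(1)[OF G good assms(2)] by (auto simp: level_def)
qed

text \<open>Each part gives up at least two half-edges and receives one.\<close>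

lemma card_half_edges_split:
  assumes "S \<in> splits G i" "z = i \<or> z = w"
  shows "card (half_edges H z) < card (half_edges G i)"
proof -
  have fin: "finite (half_edges G i)" "finite S" using half_edges_finite[OF wf] S finite_subset by auto
  have cS: "2 \<le> card S" "2 \<le> card (half_edges G i - S)"
    using assms by (auto simp: splits_def)
  have ni: "i \<in> names G" using i by (rule inner_names)
  have "card (half_edges G i - S) = card (half_edges G i) - card S"
    by (rule card_Diff_subset[OF fin(2) S])
  moreover have "card (half_edges H z) \<le> Suc (card (half_edges G i - S)) \<or> card (half_edges H z) \<le> Suc (card S)"
    using assms(2) unfolding H_def half_edges_split_old[OF wf ni fr S, symmetric]
    using half_edges_split_old[OF wf ni fr S] half_edges_split_new[OF wf ni fr S]
      card_insert_le_m1 fin by (auto simp: card_insert_if)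
  moreover have "card (half_edges H z) \<le> Suc (card (half_edges G i - S))" if "z = i"
    using half_edges_split_old[OF wf ni fr S] fin that by (simp add: H_def card_insert_if)
  ultimately show ?thesis using cS by linarith
qed

end

section \<open>Graphs with two marked legs\<close>

definition two_legs :: "nat \<Rightarrow> ngraph \<Rightarrow> bool" where
  "two_legs t G \<longleftrightarrow> marked G \<and> stable t G \<and> outer G (gM G) \<and> gM G ! 0 \<in> legs G"

lemma iso_two_legs:
  assumes iso: "graph_iso p r F G G'" and G: "two_legs t G"
  shows "two_legs t G'"
proof -
  have m: "marked G" using G by (simp add: two_legs_def)
  have "0 < length (gM G)" using m by (auto simp: marked_def)
  then have "gM G' ! 0 = p (gM G ! 0)"
    using iso by (simp only: graph_iso_def nth_map)
  then show ?thesis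
    using G iso_marked(1)[OF iso m] invariantD[OF invariant_stable iso] iso_outer_all[OF iso] iso_legs[OF iso]
    by (auto simp: two_legs_def)
qed

lemma graph_class_two_legs: "graph_class (two_legs t)"
  unfolding graph_class_def using iso_two_legs
  by (auto intro: invariant_predI simp: two_legs_def stable_def)

lemma (in splitting) two_legs_split:
  assumes sp: "S \<in> splits G i"
  shows "two_legs t H \<longleftrightarrow> two_legs t G"
proof -
  have "gM H = gM G" by (simp add: H_def)
  then show ?thesis
    using marked_split[OF marks_edges(1)[OF wf]] stable_split[OF sp] outer_split[OF marks_edges(1)[OF wf]]
      legs_split by (simp add: two_legs_def)
qed

lemma finite_live: "well_formed G \<Longrightarrow> finite (live G)"
  by (meson finite_subset legs_live(2) wf_finite(1))

lemma half_edges_live: "z \<in> inner G \<Longrightarrow> half_edges G z \<subseteq> live G \<times> UNIV"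
  by (auto simp: half_edges_def live_def)

text \<open>Supplies the bound that the filtrations by the valence of the root require.\<close>

lemma card_half_edges_le:
  assumes "stable t G" "z \<in> inner G"
  shows "card (half_edges G z) \<le> 2 * (card (inner G) + t)"
proof -
  have "finite (live G)"
    using assms finite_live by (simp add: stable_def)
  then have "card (half_edges G z) \<le> card (live G \<times> (UNIV :: bool set))"
    using half_edges_live[OF assms(2)] by (intro card_mono) auto
  then show ?thesis
    using assms(1) by (simp add: stable_def card_cartesian_product)
qed

text \<open>On a level other than \<open>0\<close>, every half-edge at the base belongs to a marked
  leg, is the possible single leg in the side, or leads into the target. So the target is everything
  except the base, the remainder is connected, and the second leg turns out to be attached there.
  The live edges lost are the marked leg and that of the side, against one inner vertex lost; this
  gives the new \<open>t\<close>.\<close>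

lemma two_legs_freeze:
  assumes G: "two_legs t G" and lev: "level G \<noteq> 0" and t: "3 \<le> t"
  shows "hub (t - card (side G)) (freeze (base G) G)"
proof -
  let ?x = "base G" and ?l = "gM G ! 1" and ?t = "gM G ! 0"
  let ?Y = "inner G - {?x}" and ?Gf = "freeze (base G) G"
  have m: "marked G" and st: "stable t G" and out: "outer G (gM G)" and tleg: "?t \<in> legs G"
    using G by (auto simp: two_legs_def)
  note f = marked_facts[OF m]
  have lleg: "?l \<in> legs G" and lt: "?t \<noteq> ?l" using m by (auto simp: marked_def)
  have wf: "well_formed G" and val: "\<And>z. z \<in> inner G \<Longrightarrow> 3 \<le> card (half_edges G z)"
    and conn: "conn_on (gE G) G (inner G)" and lv: "card (live G) = card (inner G) + t"
    using st by (auto simp: stable_def)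
  have innerf: "inner ?Gf = ?Y" by (auto simp: inner_def freeze_def)
  have gIf: "gI ?Gf = gI G" "gE ?Gf = gE G" "gM ?Gf = gM G" by (simp_all add: freeze_def)
  have sideh: "gI G (opp h) \<notin> inner G" if "h \<in> side G" for h
    using lev that by (auto simp: level_def split: if_splits)
  have cside: "card (side G) \<le> 1"
    using lev by (auto simp: level_def split: if_splits)
  have lopp: "gI G (opp h) \<notin> inner G" if "h \<in> half_edges G ?x" "fst h = ?l" for h
  proof -
    obtain b where b: "gI G (?l, \<not> b) \<notin> inner G"
      "\<And>b' z. z \<in> inner G \<Longrightarrow> (?l, b') \<in> half_edges G z \<Longrightarrow> b' = b"
      using leg_half_edge[OF lleg] by metis
    have "h = (?l, snd h)" using that(2) by (simp add: prod_eq_iff)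
    then have "h = (?l, b)" using b(2)[OF f(1), of "snd h"] that(1) by simp
    then show ?thesis using b(1) by simp
  qed
  have topp: "gI G (opp h) \<notin> inner G" if "h \<in> half_edges G ?x" "fst h = ?t" for h
  proof -
    obtain b where b: "gI G (?t, \<not> b) \<notin> inner G"
      "\<And>b' z. z \<in> inner G \<Longrightarrow> (?t, b') \<in> half_edges G z \<Longrightarrow> b' = b"
      using leg_half_edge[OF tleg] by metis
    have "h = (?t, snd h)" using that(2) by (simp add: prod_eq_iff)
    then have "h = (?t, b)" using b(2)[OF f(1), of "snd h"] that(1) by simp
    then show ?thesis using b(1) by simp
  qed
  have to_target: "gI G (opp h) \<in> target G" if "h \<in> half_edges G ?x" "gI G (opp h) \<in> inner G" for h
    using that lopp[of h] topp[of h] sideh[of h] by (auto simp: side_def rest_def target_def)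
  have tin: "insert ?x (target G) = inner G"
  proof (rule conn_onD[OF conn])
    show "insert ?x (target G) \<subseteq> inner G" using f(1,5) by blast
    show "adj_closed (gE G) G (inner G) (insert ?x (target G))"
    proof (rule adj_closedI)
      fix h assume h: "fst h \<in> gE G" "gI G h \<in> insert ?x (target G)" "gI G (opp h) \<in> inner G"
      show "gI G (opp h) \<in> insert ?x (target G)"
      proof (cases "gI G h = ?x")
        case True
        then show ?thesis using to_target[of h] h by (simp add: half_edges_def)
      next
        case False
        then have "gI G h \<in> target G" using h(2) by blast
        then show ?thesis
          using adj_closedD[OF component_closed[of G ?x ?t] h(1)] h(3) by (auto simp: target_def)
      qed
    qed
  qed blast
  then have tY: "target G = ?Y" using f(5) by blast
  \<comment> \<open>If the base were the only inner vertex, the live edges would be the two marked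
    legs and at most one in the side, so that \<open>1 + t\<close> would be at most
    \<open>3\<close>.\<close>
  have Yne: "?Y \<noteq> {}"
  proof
    assume Y: "?Y = {}"
    then have iG: "inner G = {?x}" using f(1) by blast
    have "live G \<subseteq> {?l, ?t} \<union> fst ` side G"
    proof
      fix k assume k: "k \<in> live G"
      then obtain b where "gI G (k, b) = ?x" "k \<in> gE G"
        using iG by (auto simp: live_def)
      then have "(k, b) \<in> half_edges G ?x" by (simp add: half_edges_def)
      then have "k = ?l \<or> k = ?t \<or> (k, b) \<in> side G"
        using tY Y by (auto simp: side_def rest_def target_def)
      then show "k \<in> {?l, ?t} \<union> fst ` side G" by force
    qed
    then have "card (live G) \<le> card ({?l, ?t} \<union> fst ` side G)"
      using f(7) by (intro card_mono) auto
    also have "\<dots> \<le> card {?l, ?t} + card (fst ` side G)" by (rule card_Un_le)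
    also have "\<dots> \<le> 2 + 1"
      using cside card_image_le[OF f(7), of fst] by (intro add_mono) (auto simp: card_insert_if)
    finally show False using lv iG t by simp
  qed
  \<comment> \<open>A target without a starting point would be empty, but it contains all vertices
    other than the base. So the second leg is attached away from the base.\<close>
  have t_end: "\<exists>b. gI G (?t, b) \<in> ?Y"
  proof (rule ccontr)
    assume "\<not> ?thesis"
    then have "component G ?x ?t \<subseteq> {}"
      by (intro component_least) (auto simp: adj_closed_def)
    then show False using tY Yne by (simp add: target_def)
  qed
  have tx: "fst h \<noteq> ?t" if "h \<in> half_edges G ?x" for h
  proof
    assume a: "fst h = ?t"
    obtain b where b: "gI G (?t, b) \<in> ?Y" using t_end by blast
    have "h = (?t, snd h)" using a by (simp add: prod_eq_iff)
    then have "gI G (?t, snd h) = ?x"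
      using that by (metis (mono_tags, lifting) half_edges_def mem_Collect_eq)
    then have "gI G (?t, b) = ?x"
      using leg_root[OF tleg, of b] leg_root[OF tleg, of "snd h"] b f(1) by simp
    then show False using b by simp
  qed
  have connY: "conn_on (gE G) G ?Y"
    unfolding conn_on_def
  proof (intro allI impI)
    fix U assume U: "U \<subseteq> ?Y" "U \<noteq> {}" "adj_closed (gE G) G ?Y U"
    obtain b where b: "gI G (?t, b) \<in> ?Y" using t_end by blast
    have only: "gI G (?t, b') = gI G (?t, b)" if "gI G (?t, b') \<in> ?Y" for b'
      using leg_root[OF tleg] b that by (metis DiffD1)
    show "U = ?Y"
    proof (cases "gI G (?t, b) \<in> U")
      case True
      then have "component G ?x ?t \<subseteq> U"
        using only U by (intro component_least) auto
      then show ?thesis using tY U(1) by (auto simp: target_def)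
    next
      case False
      have "component G ?x ?t \<subseteq> ?Y - U"
      proof (rule component_least)
        show "adj_closed (gE G) G ?Y (?Y - U)" by (rule adj_closed_diff[OF U(3)])
        show "gI G (?t, b') \<in> ?Y - U" if "gI G (?t, b') \<in> ?Y" for b'
          using only[OF that] False that by simp
      qed blast
      then have "U = {}" using tY U(1) unfolding target_def by blast
      then show ?thesis using U(2) by blast
    qed
  qed
  have livef: "live ?Gf = live G - insert ?l (fst ` side G)"
  proof (rule Set.set_eqI)
    fix k
    have "k \<notin> live ?Gf" if "k = ?l \<or> k \<in> fst ` side G"
    proof -
      obtain h where h: "h \<in> half_edges G ?x" "fst h = k" "gI G (opp h) \<notin> inner G"
      proof (cases "k \<in> fst ` side G")
        case True
        then show ?thesis using that sideh f(6) by blast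
      next
        case False
        then have "k = ?l" using \<open>k = ?l \<or> k \<in> fst ` side G\<close> by blast
        obtain b where "(?l, b) \<in> half_edges G ?x"
          unfolding base_def by (rule leg_half_edge[OF lleg])
        then show ?thesis using that[of "(?l, b)"] lopp[of "(?l, b)"] \<open>k = ?l\<close> by simp
      qed
      have "gI G (k, b) \<notin> ?Y" for b
      proof -
        have "(k, b) = h \<or> (k, b) = opp h" using h(2) by (cases h) auto
        then show ?thesis using h by (auto simp: half_edges_def)
      qed
      then show ?thesis by (simp add: live_def innerf gIf)
    qed
    moreover have "k \<in> live ?Gf" if k: "k \<in> live G" "k \<noteq> ?l" "k \<notin> fst ` side G"
    proof (rule ccontr)
      assume no: "k \<notin> live ?Gf"
      have kE: "k \<in> gE G" using k(1) legs_live by blast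
      then have noY: "gI G (k, b) \<notin> ?Y" for b using no by (auto simp: live_def innerf gIf)
      obtain b where "gI G (k, b) \<in> inner G" using k(1) by (auto simp: live_def)
      then have "gI G (k, b) = ?x" using noY by blast
      then have hb: "(k, b) \<in> half_edges G ?x" using kE by (simp add: half_edges_def)
      then have "(k, b) \<in> side G"
        using k(2) tx[OF hb] noY[of "\<not> b"] tY by (auto simp: side_def rest_def target_def)
      then show False using k(3) by force
    qed
    moreover have "k \<in> live G" if "k \<in> live ?Gf"
      using that by (auto simp: live_def innerf gIf)
    ultimately show "k \<in> live ?Gf \<longleftrightarrow> k \<in> live G - insert ?l (fst ` side G)" by blast
  qed
  have cards: "card (live ?Gf) = card (inner ?Gf) + (t - card (side G))"
  proof -
    have "card (fst ` side G) = card (side G)"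
    proof (rule card_image)
      have "\<exists>h. side G \<subseteq> {h}"
        using lev by (auto simp: level_def split: if_splits)
      then show "inj_on fst (side G)" by (auto simp: inj_on_def)
    qed
    moreover have "?l \<notin> fst ` side G" by (auto simp: side_def rest_def)
    ultimately have "card (insert ?l (fst ` side G)) = Suc (card (side G))"
      using f(7) by simp
    moreover have "insert ?l (fst ` side G) \<subseteq> live G"
    proof -
      have "fst h \<in> live G" if "h \<in> side G" for h
        using half_edges_live[OF f(1)] f(6) that by force
      then show ?thesis using lleg legs_live by blast
    qed
    ultimately have "card (live ?Gf) = card (live G) - Suc (card (side G))"
      unfolding livef using f(7) by (subst card_Diff_subset) auto
    moreover have "card (inner ?Gf) = card (inner G) - 1" "1 \<le> card (inner G)"
      using f(1) wf_finite(4)[OF wf] unfolding innerf by (auto simp: Suc_le_eq card_gt_0_iff)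
    ultimately show ?thesis using lv cside t by linarith
  qed
  have "stable (t - card (side G)) ?Gf"
    unfolding stable_def
  proof (intro conjI ballI)
    show "well_formed ?Gf"
      using well_formed_freeze[of ?x G] wf f(1) by (simp add: inner_def)
    show "3 \<le> card (half_edges ?Gf z)" if "z \<in> inner ?Gf" for z
      using val[of z] that by (simp add: innerf) (simp add: freeze_def)
    show "inner ?Gf \<noteq> {}" using Yne innerf by simp
    show "conn_on (gE ?Gf) ?Gf (inner ?Gf)"
      using connY unfolding innerf gIf(2) by (simp add: conn_on_def adj_closed_def gIf(1))
    show "card (live ?Gf) = card (inner ?Gf) + (t - card (side G))" by (rule cards)
  qed
  moreover have "outer ?Gf (gM ?Gf)"
    using out by (auto simp: outer_def innerf gIf)
  moreover have "2 \<le> card (legs ?Gf)"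
  proof -
    obtain b0 where b0: "\<And>b' z. z \<in> inner G \<Longrightarrow> (?l, b') \<in> half_edges G z \<Longrightarrow> b' = b0"
      using leg_half_edge[OF lleg] by metis
    \<comment> \<open>By valence at least three, the base has a half-edge besides the marked leg and
      the side. Its edge becomes a leg when the base is frozen, and together with the second marked
      leg this makes two.\<close>
    have "\<exists>h \<in> half_edges G ?x. h \<notin> insert (?l, b0) (side G)"
    proof (rule ccontr)
      assume "\<not> ?thesis"
      then have "card (half_edges G ?x) \<le> card (insert (?l, b0) (side G))"
        using f(7) by (intro card_mono) auto
      also have "\<dots> \<le> Suc (card (side G))" using f(7) by (simp add: card_insert_if)
      finally show False using val[OF f(1)] cside by linarith
    qed
    then obtain h where h: "h \<in> half_edges G ?x" "h \<noteq> (?l, b0)" "h \<notin> side G" by blast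
    have hl: "fst h \<noteq> ?l"
    proof
      assume a: "fst h = ?l"
      then have eq: "(?l, snd h) = h" by (simp add: prod_eq_iff)
      then have "(?l, snd h) \<in> half_edges G ?x" using h(1) by simp
      then have "snd h = b0" by (rule b0[OF f(1)])
      then show False using eq h(2) by simp
    qed
    have "gI G (opp h) \<in> ?Y"
      using h(1,3) hl tx[OF h(1)] tY by (auto simp: side_def rest_def target_def)
    moreover have "gI G h \<notin> ?Y" "fst h \<in> gE G" using h(1) by (auto simp: half_edges_def)
    ultimately have "fst h \<in> legs ?Gf"
      unfolding legs_def live_def innerf gIf opp_def by (cases h) auto
    moreover have "?t \<in> legs ?Gf"
      using t_end f(2) tleg unfolding legs_def live_def innerf gIf by auto
    moreover have "fst h \<noteq> ?t" by (rule tx[OF h(1)])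
    moreover have "finite (legs ?Gf)"
      using legs_live[of ?Gf] wf_finite(1)[OF wf] unfolding gIf by (meson finite_subset)
    ultimately have "card {fst h, ?t} \<le> card (legs ?Gf)"
      by (intro card_mono) auto
    then show ?thesis using \<open>fst h \<noteq> ?t\<close> by simp
  qed
  ultimately show ?thesis by (simp add: hub_def)
qed

text \<open>Negated so that it grows under splitting. As long as its value is fixed the base cannot
  be split, which is what freezing requires.\<close>

definition hub_valence :: "ngraph \<Rightarrow> int" where
  "hub_valence G = - int (card (half_edges G (base G)))"

lemma iso_hub_valence:
  assumes iso: "graph_iso p r F G G'" and G: "marked G"
  shows "hub_valence G' = hub_valence G"
  using iso_card_half_edges[OF iso inner_names[OF marked_facts(1)[OF G]]] iso_marked(2)[OF iso G]
  by (simp add: hub_valence_def)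

lemma (in splitting) hub_valence_split:
  assumes G: "marked G" and sp: "S \<in> splits G i"
  shows "i \<noteq> base G \<Longrightarrow> hub_valence H = hub_valence G" "i = base G \<Longrightarrow> hub_valence G < hub_valence H"
proof -
  show "hub_valence H = hub_valence G" if ne: "i \<noteq> base G"
  proof -
    have "base H = base G" using base_split[OF G] ne by blast
    moreover have "base G \<noteq> w" using marked_facts(1)[OF G] w by blast
    then have "half_edges H (base G) = half_edges G (base G)"
      unfolding H_def using ne by (intro half_edges_split_other[OF wf fr S]) auto
    ultimately show ?thesis by (simp add: hub_valence_def)
  qed
  show "hub_valence G < hub_valence H" if "i = base G"
    using base_split_cases[OF G] card_half_edges_split[OF sp] that by (auto simp: hub_valence_def)
qed

lemma two_legs_step:
  assumes G: "two_legs t G" and st: "step G G'"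
  shows "two_legs t G'" "level G \<le> level G'" "hub_valence G \<le> hub_valence G'"
proof -
  have m: "marked G" and wf: "well_formed G" and leg: "gM G ! 1 \<in> legs G"
    using G by (auto simp: two_legs_def marked_def)
  obtain i S e w p r F where s: "i \<in> inner G" "S \<in> splits G i" "fresh G e w"
    "i = root G (gM G ! 1) \<Longrightarrow> gM G ! 1 \<notin> fst ` S" "graph_iso p r F (split_at G i S e w) G'"
    by (rule step_cases[OF wf st leg]) blast
  interpret splitting G i S e w "split_at G i S e w"
    using splittingI[OF wf s(1-3)] by simp
  let ?H = "split_at G i S e w"
  have good: "i = base G \<Longrightarrow> gM G ! 1 \<notin> fst ` S" using s(4) by (simp add: base_def)
  have cS: "2 \<le> card S" using s(2) by (simp add: splits_def)
  have mH: "marked ?H" by (rule marked_H[OF m good])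
  show "two_legs t G'"
    using two_legs_split[OF s(2)] G iso_two_legs[OF s(5)] by blast
  show "level G \<le> level G'"
    using level_split_mono[OF m good cS] iso_level[OF s(5) mH] by simp
  show "hub_valence G \<le> hub_valence G'"
    using hub_valence_split[OF m s(2)] iso_hub_valence[OF s(5) mH] by (cases "i = base G") auto
qed

lemma convex_classI: "(\<And>G G'. P G \<Longrightarrow> step G G' \<Longrightarrow> P G') \<Longrightarrow> convex_class P"
  by (auto simp: convex_class_def)

lemma two_legs_marked: "two_legs t G \<Longrightarrow> marked G"
  by (simp add: two_legs_def)

lemma convex_two_legs: "convex_class (two_legs t)"
  using two_legs_step(1) by (rule convex_classI)

lemma graph_class_two_legs_level: "graph_class (\<lambda>G. two_legs t G \<and> level G = c)"
  unfolding graph_class_def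
proof
  show "invariant (\<lambda>G. two_legs t G \<and> level G = c)"
    using iso_two_legs iso_level two_legs_marked by (intro invariant_predI) metis
qed (auto simp: two_legs_def stable_def)

lemma two_legs_side_card:
  assumes "two_legs t G" "level G = c" "c \<noteq> 0"
  shows "card (side G) = (if c = 1 then 1 else 0)"
  using assms by (auto simp: level_def split: if_splits)

context parity
begin

text \<open>The value of \<open>t\<close> after freezing depends on the level only, which is why the
  level is fixed before the valence. It drops by at most one while the number of vertices drops by
  one, so the bound in the induction hypothesis is met.\<close>

lemma exact_two_legs_frozen:
  assumes ex: "\<And>t. Suc v < t \<Longrightarrow> exact (hub t) v" and t: "Suc (Suc v) < t" and c: "c \<noteq> 0"
  shows "exact (\<lambda>G. (two_legs t G \<and> level G = c) \<and> hub_valence G = k) (Suc v)"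
proof (rule exact_by_freeze[where X = base])
  let ?P = "\<lambda>G. (two_legs t G \<and> level G = c) \<and> hub_valence G = k"
  have mk: "\<And>G. ?P G \<Longrightarrow> marked G" by (simp add: two_legs_def)
  show "graph_class ?P"
    unfolding graph_class_def
  proof
    show "invariant ?P"
      using iso_two_legs iso_level iso_hub_valence two_legs_marked by (intro invariant_predI) metis
  qed (auto simp: two_legs_def stable_def)
  show "base G \<in> inner G" if "?P G" for G
    by (rule marked_facts(1)[OF mk[OF that]])
  show "base G' = r (base G)" if "graph_iso p r F G G'" "?P G" for p r F G G'
    by (rule iso_marked(2)[OF that(1) mk[OF that(2)]])
  show "(?P (split_at G i S e w) \<and> base (split_at G i S e w) = x) = (?P G \<and> base G = x)"
    if h: "well_formed G" "i \<in> inner G" "S \<in> splits G i" "fresh G e w" "x \<in> inner G" "i \<noteq> x" for G i S e w x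
  proof -
    interpret splitting G i S e w "split_at G i S e w"
      using splittingI[OF h(1-4)] by simp
    let ?H = "split_at G i S e w"
    have xw: "x \<noteq> w" using h(5) w by blast
    have same: "?P ?H = ?P G \<and> base ?H = base G" if m: "marked G" and b: "i \<noteq> base G"
    proof -
      have good: "i = base G \<Longrightarrow> gM G ! 1 \<notin> fst ` S" using b by blast
      show ?thesis
        using two_legs_split[OF h(3)] level_split_other[OF m b] hub_valence_split(1)[OF m h(3) b]
          base_split[OF m good] by simp
    qed
    show ?thesis
    proof
      assume a: "?P ?H \<and> base ?H = x"
      then have m: "marked G"
        using mk[of ?H] marked_split[OF marks_edges(1)[OF h(1)]] by blast
      then have "i \<noteq> base G"
        using base_split_cases[OF m] a h(6) xw by metis
      then show "?P G \<and> base G = x" using same[OF m] a by simp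
    next
      assume a: "?P G \<and> base G = x"
      then show "?P ?H \<and> base ?H = x" using same[OF mk[of G]] h(6) by blast
    qed
  qed
  show "i \<noteq> base G"
    if h: "?P G" "i \<in> inner G" "S \<in> splits G i" "fresh G e w" "?P (split_at G i S e w)" for G i S e w
  proof
    assume b: "i = base G"
    have m: "marked G" and wf: "well_formed G"
      using mk[OF h(1)] by (auto simp: marked_def)
    interpret splitting G i S e w "split_at G i S e w"
      using splittingI[OF wf h(2-4)] by simp
    show False using hub_valence_split(2)[OF m h(3) b] h(1,5) by simp
  qed
  \<comment> \<open>At level \<open>1\<close> the side is a single leg, which dies together with the
    marked one.\<close>
  let ?t = "t - (if c = 1 then 1 else 0)"
  show "hub ?t (freeze (base G) G)" if "?P G" for G
    using two_legs_freeze[of t G] two_legs_side_card[of t G c] that t c by simp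
  show "exact (hub ?t) v"
    using t by (intro ex) auto
qed

text \<open>Level \<open>0\<close> is exact by the pairing. On the other levels the filtration by
  the valence of the base prepares for freezing it.\<close>

lemma exact_two_legs:
  assumes ex: "\<And>t. Suc v < t \<Longrightarrow> exact (hub t) v" and t: "Suc (Suc v) < t"
  shows "exact (two_legs t) (Suc v)"
proof (rule exact_filtration[where f = level and lo = 0 and hi = 2])
  show "graph_class (two_legs t)" by (rule graph_class_two_legs)
  show "convex_class (two_legs t)" by (rule convex_two_legs)
  show "level G' = level G" if "graph_iso p r F G G'" "two_legs t G" for p r F G G'
    using iso_level[OF that(1)] two_legs_marked[OF that(2)] by blast
  show "level G \<le> level G'" if "two_legs t G" "step G G'" for G G'
    by (rule two_legs_step(2)[OF that])
  show "0 \<le> level G \<and> level G \<le> 2" for G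
    by (simp add: level_def)
  fix c
  show "exact (\<lambda>G. two_legs t G \<and> level G = c) (Suc v)"
  proof (cases "c = 0")
    case True
    let ?E = "\<lambda>G. outer G (gM G) \<and> gM G ! 0 \<in> legs G"
    have eq: "(core t G \<and> ?E G) = (two_legs t G \<and> level G = 0)" for G
    proof -
      have "outer G (gM G) \<Longrightarrow> outer G (tl (gM G))"
        using set_tl[of "gM G"] by (auto simp: outer_def)
      then show ?thesis by (auto simp: core_def two_legs_def)
    qed
    have "exact (\<lambda>G. core t G \<and> ?E G) (Suc v)"
    proof (rule exact_core)
      show "?E G' = ?E G" if "graph_iso p r F G G'" "core t G" for p r F G G'
      proof -
        have "(core t G' \<and> ?E G') = (core t G \<and> ?E G)"
          unfolding eq by (rule invariantD[OF _ that(1)]) (use graph_class_two_legs_level in \<open>auto simp: graph_class_def\<close>)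
        then show ?thesis using that(2) iso_core[OF that(1)] by blast
      qed
      show "convex_class (\<lambda>G. core t G \<and> ?E G)"
        unfolding eq using two_legs_step(2) by (intro convex_class_level convex_two_legs) blast
      show "?E (split_at G (base G) (side G) e w) = ?E G"
        if h: "core t G" "2 \<le> card (side G)" "fresh G e w" for G e w
      proof -
        have m: "marked G" and wf: "well_formed G" using h(1) by (auto simp: core_def stable_def)
        interpret splitting G "base G" "side G" e w "split_at G (base G) (side G) e w"
          using splittingI[OF wf marked_facts(1)[OF m] core_split_side(5)[OF h] h(3)] by simp
        show ?thesis using outer_split[OF marks_edges(1)[OF wf]] legs_split by simp
      qed
    qed
    then show ?thesis
      unfolding True by (rule exact_cong) (rule eq)
  next
    case False
    show ?thesis
    proof (rule exact_filtration[where f = hub_valence and lo = "- 2 * (int (Suc v) + int t)" and hi = 0])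
      show "graph_class (\<lambda>G. two_legs t G \<and> level G = c)" by (rule graph_class_two_legs_level)
      show "convex_class (\<lambda>G. two_legs t G \<and> level G = c)"
        using two_legs_step(2) by (intro convex_class_level convex_two_legs) blast
      show "hub_valence G' = hub_valence G" if "graph_iso p r F G G'" "two_legs t G \<and> level G = c" for p r F G G'
        using iso_hub_valence[OF that(1)] two_legs_marked that(2) by blast
      show "hub_valence G \<le> hub_valence G'" if "two_legs t G \<and> level G = c" "step G G'" for G G'
        using two_legs_step(3) that by blast
      show "- 2 * (int (Suc v) + int t) \<le> hub_valence G \<and> hub_valence G \<le> 0"
        if "two_legs t G \<and> level G = c" "card (inner G) = Suc v" for G
      proof -
        have "stable t G" "base G \<in> inner G"
          using that marked_facts(1) by (auto simp: two_legs_def)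
        then show ?thesis
          using card_half_edges_le[of t G "base G"] that(2) by (simp add: hub_valence_def)
      qed
      show "exact (\<lambda>G. (two_legs t G \<and> level G = c) \<and> hub_valence G = k) (Suc v)" for k
        by (rule exact_two_legs_frozen[OF ex t False])
    qed
  qed
qed

end

section \<open>The induction for graphs with at least two legs\<close>

lemma legs_unmark: "legs (unmark G) = legs G" "live (unmark G) = live G"
  by (simp_all add: legs_def live_def unmark_def)

lemma stable_unmark: "set (gM G) \<subseteq> gE G \<Longrightarrow> stable t (unmark G) = stable t G"
proof -
  assume "set (gM G) \<subseteq> gE G"
  then have "well_formed (unmark G) = well_formed G"
    using set_tl[of "gM G"] by (auto simp: well_formed_def unmark_def)
  then show ?thesis
    by (simp add: stable_def legs_unmark) (simp add: unmark_def conn_on_def adj_closed_def)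
qed

lemma outer_unmark: "outer (unmark G) ks = outer G ks"
  by (simp add: outer_def unmark_def)

lemma leg_outer: "k \<in> legs G \<Longrightarrow> \<exists>b. gI G (k, b) \<notin> inner G"
  by (auto simp: legs_def)

text \<open>Intermediate between \<open>hub\<close> and \<open>two_legs\<close>: the legs are marked
  one at a time, and the second has to differ from the first.\<close>

definition hub1 :: "nat \<Rightarrow> ngraph \<Rightarrow> bool" where
  "hub1 t G \<longleftrightarrow> hub t G \<and> gM G \<noteq> [] \<and> hd (gM G) \<in> legs G"

lemma iso_hd_marks: "graph_iso p r F G G' \<Longrightarrow> gM G \<noteq> [] \<Longrightarrow> hd (gM G') = p (hd (gM G))"
  by (simp add: graph_iso_def hd_map)

lemma step_legs:
  assumes "step G G'" "well_formed G"
  shows "legs G' = legs G" "gM G' = gM G"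
proof -
  obtain i S e w where s: "i \<in> inner G" "S \<in> splits G i" "fresh G e w" "G' = split_at G i S e w"
    using assms(1) unfolding step_def by blast
  interpret splitting G i S e w "split_at G i S e w"
    using splittingI[OF assms(2) s(1-3)] by simp
  show "legs G' = legs G" "gM G' = gM G" using legs_split s(4) by simp_all
qed

lemma hub1_marks:
  assumes "gM G \<noteq> []" "hub t (unmark G)" "hd (gM G) \<in> legs (unmark G)"
  shows "hub1 t G"
proof -
  have M: "gM G = hd (gM G) # tl (gM G)" using assms(1) by simp
  have "hd (gM G) \<in> legs G" using assms(3) by (simp add: legs_unmark)
  moreover have "outer G (tl (gM G))"
    using assms(2) by (simp add: hub_def outer_unmark) (simp add: unmark_def)
  ultimately have out: "outer G (gM G)"
    using leg_outer[of "hd (gM G)" G] by (subst M) (simp add: outer_def)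
  have "set (tl (gM G)) \<subseteq> gE G"
    using assms(2) by (simp add: hub_def stable_def well_formed_def unmark_def)
  then have "set (gM G) \<subseteq> gE G"
    using legs_live[of G] \<open>hd (gM G) \<in> legs G\<close> by (subst M) auto
  then show ?thesis
    using assms out \<open>hd (gM G) \<in> legs G\<close> by (simp add: hub1_def hub_def legs_unmark stable_unmark)
qed

lemma hub1_unmark:
  assumes "hub1 t G"
  shows "hub t (unmark G)"
proof -
  have "set (gM G) \<subseteq> gE G" "outer G (tl (gM G))"
    using assms set_tl[of "gM G"]
    by (auto simp: hub1_def hub_def stable_def well_formed_def outer_def)
  moreover have "gM (unmark G) = tl (gM G)" by (simp add: unmark_def)
  ultimately show ?thesis
    using assms by (simp add: hub1_def hub_def legs_unmark stable_unmark outer_unmark)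
qed

lemma graph_class_hub1: "graph_class (hub1 t)"
  unfolding graph_class_def
proof
  show "invariant (hub1 t)"
  proof (rule invariant_predI)
    fix p r F G G' assume iso: "graph_iso p r F G G'" and G: "hub1 t G"
    have "hub t G'"
      using G graph_class_hub[of t] invariantD[OF _ iso, of "hub t"] by (simp add: hub1_def graph_class_def)
    moreover have "gM G' = map p (gM G)" using iso by (simp add: graph_iso_def)
    ultimately show "hub1 t G'"
      using G iso_hd_marks[OF iso] iso_legs[OF iso] by (auto simp: hub1_def)
  qed
qed (auto simp: hub1_def hub_def stable_def)

context parity
begin

text \<open>Marking two different legs reduces to \<open>two_legs\<close>, whose exactness uses the
  claim for one vertex less. A stable graph has an inner vertex, so there is nothing to prove for
  \<open>v = 0\<close>.\<close>

lemma exact_hub: "Suc v < t \<Longrightarrow> exact (hub t) v"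
proof (induction v arbitrary: t)
  case 0
  show ?case
    unfolding exact_def
  proof (intro allI impI)
    fix f assume "equivariant f"
    have "card (inner G) \<noteq> 0" if "hub t G" for G
      using that wf_finite(4) by (auto simp: hub_def stable_def)
    then show "\<exists>g. equivariant g \<and> (\<forall>G. hub t G \<and> card (inner G) = 0 \<longrightarrow> d (restr (hub t) g) G = f G)"
      using \<open>equivariant f\<close> by blast
  qed
next
  case (Suc v)
  have "exact (two_legs t) (Suc v)"
    by (rule exact_two_legs[OF Suc.IH Suc.prems])
  have wf: "well_formed G" if "hub t G" for G
    using that by (simp add: hub_def stable_def)
  show ?case
  proof (rule exact_mark[where Mk = legs])
    show "graph_class (hub t)" by (rule graph_class_hub)
    show "legs G \<subseteq> gE G" for G using legs_live by blast
    show "legs G \<noteq> {}" if "hub t G" for G using that by (auto simp: hub_def)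
    show "legs G' = p ` legs G" if "graph_iso p r F G G'" for p r F G G'
      by (rule iso_legs[OF that])
    show "legs G' = legs G" if "hub t G" "step G G'" for G G'
      by (rule step_legs(1)[OF that(2) wf[OF that(1)]])
    have h1: "hub1 t G = (gM G \<noteq> [] \<and> hub t (unmark G) \<and> hd (gM G) \<in> legs (unmark G))" for G
      using hub1_marks hub1_unmark by (auto simp: hub1_def legs_unmark)
    have "exact (hub1 t) (Suc v)"
    proof (rule exact_mark[where Mk = "\<lambda>G. legs G - {hd (gM G)}"])
      show "graph_class (hub1 t)" by (rule graph_class_hub1)
      show "legs G - {hd (gM G)} \<subseteq> gE G" for G using legs_live by blast
      show "legs G - {hd (gM G)} \<noteq> {}" if "hub1 t G" for G
      proof
        assume "legs G - {hd (gM G)} = {}"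
        then have "card (legs G) \<le> card {hd (gM G)}" by (intro card_mono) auto
        then show False using that by (simp add: hub1_def hub_def)
      qed
      show "legs G' - {hd (gM G')} = p ` (legs G - {hd (gM G)})"
        if iso: "graph_iso p r F G G'" and G: "hub1 t G" for p r F G G'
      proof -
        have "p ` (legs G - {hd (gM G)}) = p ` legs G - p ` {hd (gM G)}"
          using iso G legs_live by (intro inj_on_image_set_diff[of p "gE G"]) (auto simp: graph_iso_def hub1_def)
        then show ?thesis
          using iso_legs[OF iso] iso_hd_marks[OF iso] G by (simp add: hub1_def)
      qed
      show "legs G' - {hd (gM G')} = legs G - {hd (gM G)}" if "hub1 t G" "step G G'" for G G'
        using step_legs[OF that(2)] that(1) wf by (simp add: hub1_def)
      have eq: "two_legs t G = (gM G \<noteq> [] \<and> hub1 t (unmark G) \<and>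
          hd (gM G) \<in> legs (unmark G) - {hd (gM (unmark G))})" for G
      proof
        assume G: "two_legs t G"
        then have m: "marked G" by (simp add: two_legs_def)
        obtain a b ms where M: "gM G = a # b # ms"
          using m by (cases "gM G"; cases "tl (gM G)") (auto simp: marked_def)
        have "a \<in> legs G" "b \<in> legs G" "a \<noteq> b"
          using G m by (auto simp: two_legs_def marked_def M)
        moreover have "finite (legs G)"
          using m legs_live(1)[of G] finite_live[of G] finite_subset by (auto simp: marked_def)
        ultimately have "card {a, b} \<le> card (legs G)"
          by (intro card_mono) auto
        then have "hub t G"
          using G \<open>a \<noteq> b\<close> by (simp add: hub_def two_legs_def)
        then have "hub1 t G" using \<open>a \<in> legs G\<close> M by (simp add: hub1_def)
        then have "hub t (unmark G)" by (rule hub1_unmark)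
        then show "gM G \<noteq> [] \<and> hub1 t (unmark G) \<and> hd (gM G) \<in> legs (unmark G) - {hd (gM (unmark G))}"
          using \<open>a \<in> legs G\<close> \<open>b \<in> legs G\<close> \<open>a \<noteq> b\<close> M
          by (simp add: hub1_def legs_unmark) (simp add: unmark_def)
      next
        assume G: "gM G \<noteq> [] \<and> hub1 t (unmark G) \<and> hd (gM G) \<in> legs (unmark G) - {hd (gM (unmark G))}"
        then have u: "gM (unmark G) \<noteq> []" "hd (gM (unmark G)) \<in> legs G" by (auto simp: hub1_def legs_unmark)
        obtain a b ms where M: "gM G = a # b # ms"
          using u(1) G by (cases "gM G"; cases "tl (gM G)") (auto simp: unmark_def)
        have ab: "a \<in> legs G" "b \<in> legs G" "a \<noteq> b"
        proof -
          have "gM (unmark G) = b # ms" by (simp add: unmark_def M)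
          then show "a \<in> legs G" "b \<in> legs G" "a \<noteq> b"
            using G u M by (auto simp: legs_unmark)
        qed
        have "hub1 t G"
          using G by (intro hub1_marks) (auto simp: hub1_def)
        then show "two_legs t G"
          using ab M legs_live(1) by (auto simp: two_legs_def marked_def hub1_def hub_def stable_def)
      qed
      show "exact (\<lambda>G. gM G \<noteq> [] \<and> hub1 t (unmark G) \<and>
          hd (gM G) \<in> legs (unmark G) - {hd (gM (unmark G))}) (Suc v)"
        using \<open>exact (two_legs t) (Suc v)\<close> eq by (rule exact_cong)
    qed
    then show "exact (\<lambda>G. gM G \<noteq> [] \<and> hub t (unmark G) \<and> hd (gM G) \<in> legs (unmark G)) (Suc v)"
      by (rule exact_cong) (rule h1)
  qed
qed

end

section \<open>Graphs with exactly one leg\<close>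

definition one_leg :: "nat \<Rightarrow> ngraph \<Rightarrow> bool" where
  "one_leg t G \<longleftrightarrow> stable t G \<and> outer G (gM G) \<and> gM G \<noteq> [] \<and> legs G = {hd (gM G)}"

text \<open>What is needed to freeze the root at once: the remaining vertices form a nonempty
  connected graph, and without tadpoles at the root each half-edge other than the leg turns into a
  leg of its own.\<close>

definition solid :: "ngraph \<Rightarrow> nat \<Rightarrow> bool" where
  "solid G k \<longleftrightarrow> conn_on (gE G) G (inner G - {root G k}) \<and> inner G - {root G k} \<noteq> {} \<and>
     (\<forall>h \<in> half_edges G (root G k). gI G (opp h) \<noteq> root G k)"

text \<open>Candidates for the second mark when there is only one leg. The new edge of a splitting
  may or may not be a bridge, but old edges keep their status; so the set can only grow, and it is
  constant once its size is fixed.\<close>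

definition nonbridges :: "ngraph \<Rightarrow> nat set" where
  "nonbridges G = {k \<in> gE G. (\<forall>b. gI G (k, b) \<in> inner G) \<and> conn_on (gE G - {k}) G (inner G)}"

definition root_valence :: "ngraph \<Rightarrow> nat \<Rightarrow> int" where
  "root_valence G k = - int (card (half_edges G (root G k)))"

lemma connected_on_mono:
  "conn_on T G Y \<Longrightarrow> T \<subseteq> D \<Longrightarrow> conn_on D G Y"
  unfolding conn_on_def adj_closed_def by blast

text \<open>A spanning tree, obtained by growing a connected vertex set one vertex at a time; each
  new vertex costs one edge.\<close>

lemma spanning_edges:
  assumes conn: "conn_on D G Y" and Y: "finite Y" "Y \<noteq> {}"
  obtains T where "T \<subseteq> D" "finite T" "card T < card Y" "conn_on T G Y"
proof -
  have "\<exists>U T. U \<subseteq> Y \<and> card U = Suc n \<and> T \<subseteq> D \<and> finite T \<and> card T \<le> n \<and> conn_on T G U"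
    if "Suc n \<le> card Y" for n
    using that
  proof (induction n)
    case 0
    obtain y where "y \<in> Y" using Y by blast
    moreover have "conn_on {} G {y}" by (auto simp: conn_on_def)
    ultimately show ?case by (intro exI[of _ "{y}"] exI[of _ "{}"]) auto
  next
    case (Suc n)
    then obtain U T where U: "U \<subseteq> Y" "card U = Suc n" and T: "T \<subseteq> D" "finite T" "card T \<le> n" "conn_on T G U"
      by auto
    have fU: "finite U" using U Y finite_subset by blast
    have "U \<noteq> Y" "U \<noteq> {}" using U Suc.prems by auto
    then have "\<not> adj_closed D G Y U" using conn_onD[OF conn U(1)] by blast
    then obtain h where h: "fst h \<in> D" "gI G h \<in> U" "gI G (opp h) \<in> Y" "gI G (opp h) \<notin> U"
      unfolding adj_closed_def by blast
    let ?z = "gI G (opp h)"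
    have "conn_on (insert (fst h) T) G (insert ?z U)"
      unfolding conn_on_def
    proof (intro allI impI)
      fix V assume V: "V \<subseteq> insert ?z U" "V \<noteq> {}" "adj_closed (insert (fst h) T) G (insert ?z U) V"
      have "V \<inter> U \<noteq> {}"
      proof
        assume "V \<inter> U = {}"
        then have "?z \<in> V" using V by blast
        then have "gI G (opp (opp h)) \<in> V"
          using adj_closedD[OF V(3), of "opp h"] h by simp
        then show False using \<open>V \<inter> U = {}\<close> h(2) by auto
      qed
      moreover have "adj_closed T G U (V \<inter> U)"
        using V(3) unfolding adj_closed_def by blast
      ultimately have "V \<inter> U = U"
        using conn_onD[OF T(4), of "V \<inter> U"] by blast
      moreover have "?z \<in> V"
        using adj_closedD[OF V(3), of h] h \<open>V \<inter> U = U\<close> by auto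
      ultimately show "V = insert ?z U" using V(1) by blast
    qed
    moreover have "card (insert (fst h) T) \<le> Suc n" using T by (simp add: card_insert_if)
    moreover have "card (insert ?z U) = Suc (Suc n)" using fU h U by simp
    ultimately show ?case
      using U T h by (intro exI[of _ "insert ?z U"] exI[of _ "insert (fst h) T"]) auto
  qed
  moreover have "Suc (card Y - 1) = card Y" using Y by (simp add: card_gt_0_iff)
  ultimately obtain U T where U: "U \<subseteq> Y" "card U = card Y" and
    T: "T \<subseteq> D" "finite T" "card T \<le> card Y - 1" "conn_on T G U"
    by (metis order_refl)
  have "U = Y" using card_subset_eq[OF Y(1) U] .
  then show thesis
    using T \<open>Suc (card Y - 1) = card Y\<close> by (intro that[of T]) auto
qed

text \<open>With \<open>v\<close> inner vertices there are \<open>v + t\<close> live edges. One of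
  them is the leg, and a spanning tree uses up at most \<open>v - 1\<close>; any other live edge can
  be removed.\<close>

lemma nonbridges_nonempty:
  assumes st: "stable t G" and leg: "card (legs G) = 1" and t: "1 \<le> t"
  shows "nonbridges G \<noteq> {}"
proof -
  have wf: "well_formed G" and conn: "conn_on (gE G) G (inner G)" and ne: "inner G \<noteq> {}"
    and lv: "card (live G) = card (inner G) + t"
    using st by (auto simp: stable_def)
  obtain T where T: "T \<subseteq> gE G" "finite T" "card T < card (inner G)" "conn_on T G (inner G)"
    by (rule spanning_edges[OF conn wf_finite(4)[OF wf] ne])
  have "card (live G - legs G) = card (inner G) + t - 1"
    using finite_live[OF wf] finite_subset[OF legs_live(1) finite_live[OF wf]] legs_live(1) lv leg
    by (subst card_Diff_subset) auto
  then have "card T < card (live G - legs G)" using T t by linarith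
  then obtain k where k: "k \<in> live G - legs G" "k \<notin> T"
    using card_mono[OF T(2), of "live G - legs G"] by (meson not_less subsetI)
  have "conn_on (gE G - {k}) G (inner G)"
    using T k by (intro connected_on_mono[OF T(4)]) auto
  moreover have "k \<in> gE G" "\<forall>b. gI G (k, b) \<in> inner G"
    using k by (auto simp: legs_def live_def)
  ultimately show ?thesis by (auto simp: nonbridges_def)
qed

lemma nonbridges_subset: "nonbridges G \<subseteq> gE G" "nonbridges G \<subseteq> live G" "nonbridges G \<inter> legs G = {}"
  by (auto simp: nonbridges_def live_def legs_def)

lemma iso_nonbridges:
  assumes iso: "graph_iso p r F G G'"
  shows "nonbridges G' = p ` nonbridges G"
proof -
  have sub: "p ` nonbridges G \<subseteq> nonbridges G'" if iso: "graph_iso p r F G G'" for p r F G G'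
  proof
    fix k' assume "k' \<in> p ` nonbridges G"
    then obtain k where k: "k \<in> gE G" "\<forall>b. gI G (k, b) \<in> inner G" "conn_on (gE G - {k}) G (inner G)" "k' = p k"
      by (auto simp: nonbridges_def)
    have inj: "inj_on p (gE G)" and E: "gE G' = p ` gE G"
      using iso by (auto simp: graph_iso_def)
    have "p ` (gE G - {k}) = gE G' - {k'}"
      using k inj_on_image_set_diff[OF inj, of "gE G" "{k}"] by (simp add: E)
    moreover have "conn_on (p ` (gE G - {k})) G' (r ` inner G)"
      using inner_names by (intro iso_connected_on[OF iso _ _ k(3)]) auto
    moreover have "\<forall>b. gI G' (k', b) \<in> inner G'"
      using iso_edge_ends[OF iso k(1), of Not] k(2,4) by simp
    ultimately show "k' \<in> nonbridges G'"
      using k E by (simp add: nonbridges_def iso_inner[OF iso])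
  qed
  have "nonbridges G' \<subseteq> p ` nonbridges G"
  proof
    fix k' assume k': "k' \<in> nonbridges G'"
    then obtain k where k: "k \<in> gE G" "k' = p k"
      using iso by (auto simp: nonbridges_def graph_iso_def)
    have "inv_into (gE G) p k' = k"
      using iso k by (auto simp: graph_iso_def)
    then have "k \<in> nonbridges G"
      using sub[OF iso_sym[OF iso]] k' by blast
    then show "k' \<in> p ` nonbridges G" using k by blast
  qed
  then show ?thesis using sub[OF iso] by blast
qed

lemma iso_solid:
  assumes iso: "graph_iso p r F G G'" and k: "k \<in> legs G" and s: "solid G k"
  shows "solid G' (p k)"
proof -
  let ?x = "root G k"
  have x: "?x \<in> inner G" "?x \<in> names G" using root_inner[OF k] inner_names by blast+
  have inj: "inj_on r (names G)" and E: "gE G' = p ` gE G"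
    using iso by (auto simp: graph_iso_def)
  have rt: "root G' (p k) = r ?x" by (rule iso_root[OF iso k])
  have Y: "inner G' - {r ?x} = r ` (inner G - {?x})"
    using inj_on_image_set_diff[OF inj, of "inner G" "{?x}"] x inner_names[of _ G] iso_inner[OF iso] by auto
  have "conn_on (p ` gE G) G' (r ` (inner G - {?x}))"
    using s inner_names by (intro iso_connected_on[OF iso]) (auto simp: solid_def)
  moreover have "gI G' (opp h') \<noteq> r ?x" if h': "h' \<in> half_edges G' (r ?x)" for h'
  proof -
    obtain h where h: "h \<in> half_edges G ?x" "h' = hmap p F h"
      using h' unfolding iso_half_edges[OF iso x(2)] by blast
    have hE: "fst (opp h) \<in> gE G" using h by (simp add: half_edges_def)
    have "gI G (opp h) \<noteq> ?x" using s h by (simp add: solid_def)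
    moreover have "gI G (opp h) \<in> names G" using iso hE by (intro well_formed_gI) (simp_all add: graph_iso_def)
    ultimately have "r (gI G (opp h)) \<noteq> r ?x" by (simp add: inj_on_eq_iff[OF inj _ x(2)])
    then show ?thesis using iso_gI[OF iso hE] h(2) by (simp add: hmap_opp)
  qed
  moreover have "r ` (inner G - {?x}) \<noteq> {}"
    using s by (auto simp: solid_def)
  ultimately show ?thesis
    unfolding solid_def rt Y E by blast
qed

lemma iso_solid_iff:
  assumes iso: "graph_iso p r F G G'" and k: "k \<in> legs G"
  shows "solid G' (p k) = solid G k"
proof
  assume "solid G' (p k)"
  moreover have "p k \<in> legs G'" using iso_legs[OF iso] k by blast
  moreover have "k \<in> gE G" using k legs_live by blast
  then have "inv_into (gE G) p (p k) = k"
    using iso by (simp add: graph_iso_def)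
  ultimately show "solid G k"
    using iso_solid[OF iso_sym[OF iso], of "p k"] by simp
qed (rule iso_solid[OF iso k])

lemma iso_one_leg:
  assumes iso: "graph_iso p r F G G'" and G: "one_leg t G"
  shows "one_leg t G'"
proof -
  have "gM G' = map p (gM G)" using iso by (simp add: graph_iso_def)
  then show ?thesis
    using G invariantD[OF invariant_stable iso] iso_outer_all[OF iso] iso_legs[OF iso] iso_hd_marks[OF iso]
    by (auto simp: one_leg_def)
qed

lemma one_leg_facts:
  assumes "one_leg t G"
  shows "well_formed G" "hd (gM G) \<in> legs G" "stable t G" "root G (hd (gM G)) \<in> inner G"
  using assms root_inner[of "hd (gM G)" G] by (auto simp: one_leg_def stable_def)

lemma half_edges_not_leg:
  assumes legs: "legs G = {k}" and h: "h \<in> half_edges G z" "z \<in> inner G" "fst h \<noteq> k"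
  shows "gI G (opp h) \<in> inner G"
proof (rule ccontr)
  assume a: "gI G (opp h) \<notin> inner G"
  have "gI G (fst h, snd h) = z" "fst h \<in> gE G" using h(1) by (auto simp: half_edges_def)
  moreover have "gI G (fst h, \<not> snd h) \<notin> inner G" using a by (simp add: opp_def)
  ultimately have "fst h \<in> legs G"
    using h(2) unfolding legs_def live_def by blast
  then show False using legs h(3) by simp
qed

context splitting
begin

lemma nonbridges_split: "k \<in> gE G \<Longrightarrow> k \<in> nonbridges H \<longleftrightarrow> k \<in> nonbridges G"
proof -
  assume k: "k \<in> gE G"
  have "gE H - {k} = insert e (gE G - {k})" using k e E_H by auto
  then have "conn_on (gE H - {k}) H (inner H) \<longleftrightarrow> conn_on (gE G - {k}) G (inner G)"
    unfolding inner_H using connected_split[of "gE G - {k}" "inner G"] i by simp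
  then show ?thesis
    using k split_ends[OF k] by (simp add: nonbridges_def E_H)
qed

lemma root_split_cases:
  assumes k: "k \<in> legs G"
  shows "root H k = root G k \<or> i = root G k \<and> root H k = w"
proof -
  have leg: "k \<in> legs H" using k legs_split by simp
  obtain b where b: "gI G (k, b) \<in> inner G" "k \<in> gE G"
    using k by (auto simp: legs_def live_def)
  have "gI G (k, b) = root G k" by (rule leg_root[OF k b(1)])
  moreover have "gI H (k, b) = root H k"
    using leg_root[OF leg] split_ends[OF b(2)] b(1) by simp
  ultimately show ?thesis
    using I_cases[of "(k, b)"] b(2) by auto
qed

lemma one_leg_split:
  assumes sp: "S \<in> splits G i"
  shows "one_leg t H \<longleftrightarrow> one_leg t G"
proof -
  have "gM H = gM G" by (simp add: H_def)
  then show ?thesis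
    using stable_split[OF sp] outer_split[OF marks_edges(1)[OF wf]] legs_split by (simp add: one_leg_def)
qed

lemma root_valence_split:
  assumes k: "k \<in> legs G" and sp: "S \<in> splits G i"
  shows "i \<noteq> root G k \<Longrightarrow> root_valence H k = root_valence G k"
    "i = root G k \<Longrightarrow> root_valence G k < root_valence H k"
proof -
  show "root_valence H k = root_valence G k" if ne: "i \<noteq> root G k"
  proof -
    have "root H k = root G k" using root_split_cases[OF k] ne by blast
    moreover have "root G k \<noteq> w" using root_inner[OF k] w by blast
    then have "half_edges H (root G k) = half_edges G (root G k)"
      unfolding H_def using ne by (intro half_edges_split_other[OF wf fr S]) auto
    ultimately show ?thesis by (simp add: root_valence_def)
  qed
  show "root_valence G k < root_valence H k" if "i = root G k"
    using root_split_cases[OF k] card_half_edges_split[OF sp] that by (auto simp: root_valence_def)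
qed

lemma solid_split_other:
  assumes k: "k \<in> legs G" and ne: "i \<noteq> root G k"
  shows "solid H k \<longleftrightarrow> solid G k"
proof -
  let ?x = "root G k"
  have rt: "root H k = ?x" using root_split_cases[OF k] ne by blast
  have xw: "?x \<noteq> w" using root_inner[OF k] w by blast
  have Y: "inner H - {?x} = insert w (inner G - {?x})" using inner_H xw by auto
  have hx: "half_edges H ?x = half_edges G ?x"
    unfolding H_def using ne xw by (intro half_edges_split_other[OF wf fr S]) auto
  have "gI H (opp h) = ?x \<longleftrightarrow> gI G (opp h) = ?x" if "h \<in> half_edges G ?x" for h
  proof -
    have hE: "fst (opp h) \<in> gE G" using that by (simp add: half_edges_def)
    from I_cases[OF hE] show ?thesis
    proof (elim disjE conjE)
      assume "gI H (opp h) = w" "gI G (opp h) = i"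
      then show ?thesis using ne xw by simp
    qed simp
  qed
  moreover have "conn_on (gE H) H (inner H - {?x}) \<longleftrightarrow> conn_on (gE G) G (inner G - {?x})"
    unfolding Y E_H using i ne by (intro connected_split) auto
  moreover have "inner G - {?x} \<noteq> {}" using i ne by blast
  ultimately show ?thesis
    unfolding solid_def rt hx by (auto simp: Y)
qed

text \<open>The new vertex takes at least one half-edge \<open>h0\<close> from the root. As tadpoles
  are excluded, it leads to another inner vertex and so ties \<open>w\<close> to the connected
  remainder.\<close>

lemma solid_split_root:
  assumes legs: "legs G = {k}" and eq: "i = root G k" and good: "k \<notin> fst ` S" and sp: "S \<noteq> {}"
    and s: "solid G k"
  shows "solid H k"
proof -
  have k: "k \<in> legs G" using legs by simp
  have rt: "root H k = i" using root_split[OF k] good eq by simp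
  let ?Y = "inner G - {i}"
  have Y: "inner H - {i} = insert w ?Y" using inner_H w by auto
  have toY: "gI G (opp h) \<in> ?Y" "gI H (opp h) = gI G (opp h)" if h: "h \<in> half_edges G i" "fst h \<noteq> k" for h
  proof -
    show 1: "gI G (opp h) \<in> ?Y"
      using half_edges_not_leg[OF legs h(1) i h(2)] s h(1) eq by (auto simp: solid_def)
    show "gI H (opp h) = gI G (opp h)"
      using 1 h(1) by (intro I_neq) (auto simp: half_edges_def)
  qed
  obtain h0 where h0: "h0 \<in> S" using sp by blast
  have h0B: "h0 \<in> half_edges G i" "fst h0 \<noteq> k" using h0 S good by auto
  have conn: "conn_on (gE H) H (insert w ?Y)"
    unfolding conn_on_def
  proof (intro allI impI)
    fix U' assume U': "U' \<subseteq> insert w ?Y" "U' \<noteq> {}" "adj_closed (gE H) H (insert w ?Y) U'"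
    have h0E: "fst h0 \<in> gE H" "fst (opp h0) \<in> gE H" using I_S(3)[OF h0] E_H by auto
    have Uw: "gI G (opp h0) \<in> U'" if "w \<in> U'"
      using adj_closedD[OF U'(3) h0E(1)] I_S(1)[OF h0] toY[OF h0B] that by simp
    have wU: "w \<in> U'" if "gI G (opp h0) \<in> U'"
      using adj_closedD[OF U'(3) h0E(2)] I_S(1)[OF h0] toY[OF h0B] that by simp
    have "U' - {w} = ?Y"
    proof (rule conn_onD[of "gE G" G])
      show "conn_on (gE G) G ?Y" using s eq by (simp add: solid_def)
      show "U' - {w} \<subseteq> ?Y" using U' by blast
      have "gI G (opp h0) \<noteq> w" using toY(1)[OF h0B] w by auto
      then show "U' - {w} \<noteq> {}" using U'(2) Uw by blast
      show "adj_closed (gE G) G ?Y (U' - {w})"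
      proof (rule adj_closedI)
        fix h assume h: "fst h \<in> gE G" "gI G h \<in> U' - {w}" "gI G (opp h) \<in> ?Y"
        have "gI G h \<noteq> i" using h(2) U'(1) by blast
        then have "gI H h = gI G h" by (rule I_neq[OF h(1)])
        moreover have "gI H (opp h) = gI G (opp h)"
          using h by (intro I_neq) auto
        ultimately show "gI G (opp h) \<in> U' - {w}"
          using adj_closedD[OF U'(3), of h] h E_H I_not_w[of "opp h"] by auto
      qed
    qed
    moreover have "gI G (opp h0) \<in> U'" using calculation toY(1)[OF h0B] by blast
    ultimately show "U' = insert w ?Y" using wU U'(1) by blast
  qed
  have "gI H (opp h) \<noteq> i" if h: "h \<in> half_edges H i" for h
  proof (cases "h = (e, False)")
    case True
    then show ?thesis using w by simp
  next
    case False
    then have hG: "h \<in> half_edges G i"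
      using h half_edges_split_old[OF wf inner_names[OF i] fr S] by (simp add: H_def)
    have "gI G (opp h) \<noteq> i" using s hG eq by (simp add: solid_def)
    then show ?thesis using I_neq[of "opp h"] hG by (simp add: half_edges_def)
  qed
  then show ?thesis
    using conn unfolding solid_def rt Y by auto
qed

end

lemma one_leg_step:
  assumes G: "one_leg t G" and st: "step G G'"
  shows "one_leg t G'" "solid G (hd (gM G)) \<Longrightarrow> solid G' (hd (gM G'))"
    "root_valence G (hd (gM G)) \<le> root_valence G' (hd (gM G'))" "nonbridges G \<subseteq> nonbridges G'"
proof -
  note f = one_leg_facts[OF G]
  let ?k = "hd (gM G)"
  obtain i S e w p r F where s: "i \<in> inner G" "S \<in> splits G i" "fresh G e w"
    "i = root G ?k \<Longrightarrow> ?k \<notin> fst ` S" "graph_iso p r F (split_at G i S e w) G'"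
    by (rule step_cases[OF f(1) st f(2)]) blast
  interpret splitting G i S e w "split_at G i S e w"
    using splittingI[OF f(1) s(1-3)] by simp
  let ?H = "split_at G i S e w"
  have legs: "legs G = {?k}" using G by (simp add: one_leg_def)
  have M: "gM ?H = gM G" "gM G \<noteq> []" using G by (auto simp: one_leg_def)
  have hd': "hd (gM G') = p ?k" using iso_hd_marks[OF s(5)] M by simp
  have kH: "?k \<in> legs ?H" using f(2) legs_split by simp
  show "one_leg t G'"
    using one_leg_split[OF s(2)] G iso_one_leg[OF s(5)] by blast
  show "solid G' (hd (gM G'))" if sol: "solid G ?k"
  proof -
    have "S \<noteq> {}" using s(2) by (auto simp: splits_def)
    then have "solid ?H ?k"
      using solid_split_other[OF f(2)] solid_split_root[OF legs _ s(4)] sol by (cases "i = root G ?k") auto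
    then show ?thesis using iso_solid[OF s(5) kH] hd' by simp
  qed
  have "root_valence G' (hd (gM G')) = root_valence ?H ?k"
    using iso_root[OF s(5) kH] iso_card_half_edges[OF s(5) inner_names[OF root_inner[OF kH]]] hd'
    by (simp add: root_valence_def)
  then show "root_valence G ?k \<le> root_valence G' (hd (gM G'))"
    using root_valence_split[OF f(2) s(2)] by (cases "i = root G ?k") auto
  show "nonbridges G \<subseteq> nonbridges G'"
  proof -
    obtain j T e' w' where s': "j \<in> inner G" "T \<in> splits G j" "fresh G e' w'" "G' = split_at G j T e' w'"
      using st unfolding step_def by blast
    interpret alt: splitting G j T e' w' "split_at G j T e' w'"
      using splittingI[OF f(1) s'(1-3)] by simp
    show ?thesis using alt.nonbridges_split nonbridges_subset(1)[of G] s'(4) by blast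
  qed
qed

text \<open>Only the marked leg dies, along with one inner vertex, so \<open>t\<close> is unchanged.
  Valence at least three gives at least two new legs, on distinct edges because there is no
  tadpole.\<close>

lemma solid_freeze:
  assumes G: "one_leg t G" and s: "solid G (hd (gM G))"
  shows "hub t (freeze (root G (hd (gM G))) G)"
proof -
  let ?k = "hd (gM G)"
  let ?x = "root G ?k"
  let ?Gf = "freeze ?x G" and ?Y = "inner G - {?x}"
  note f = one_leg_facts[OF G]
  have legs: "legs G = {?k}" using G by (simp add: one_leg_def)
  have innerf: "inner ?Gf = ?Y" by (auto simp: inner_def freeze_def)
  have gIf: "gI ?Gf = gI G" "gE ?Gf = gE G" "gM ?Gf = gM G" by (simp_all add: freeze_def)
  obtain b0 where b0: "(?k, b0) \<in> half_edges G ?x" "gI G (?k, \<not> b0) \<notin> inner G"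
    using leg_half_edge[OF f(2)] by metis
  have toY: "gI G (opp h) \<in> ?Y" if h: "h \<in> half_edges G ?x" "fst h \<noteq> ?k" for h
    using half_edges_not_leg[OF legs h(1) f(4) h(2)] s h(1) by (auto simp: solid_def)
  have val: "\<And>z. z \<in> inner G \<Longrightarrow> 3 \<le> card (half_edges G z)" and lv: "card (live G) = card (inner G) + t"
    using f(3) by (auto simp: stable_def)
  have livef: "live ?Gf = live G - {?k}"
  proof (rule Set.set_eqI)
    fix k
    have "?k \<notin> live ?Gf"
    proof -
      have "gI G (?k, b) \<notin> ?Y" for b
        using b0 by (cases "b = b0") (auto simp: half_edges_def)
      then show ?thesis by (simp add: live_def innerf gIf)
    qed
    moreover have "k \<in> live ?Gf" if k: "k \<in> live G" "k \<noteq> ?k"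
    proof -
      obtain b where b: "gI G (k, b) \<in> inner G" "k \<in> gE G" using k by (auto simp: live_def)
      show ?thesis
      proof (cases "gI G (k, b) = ?x")
        case True
        then have "gI G (k, \<not> b) \<in> ?Y"
          using toY[of "(k, b)"] b k(2) by (simp add: half_edges_def)
        then show ?thesis using b(2) unfolding live_def innerf gIf by blast
      next
        case False
        then show ?thesis using b unfolding live_def innerf gIf by blast
      qed
    qed
    moreover have "k \<in> live G" if "k \<in> live ?Gf"
      using that by (auto simp: live_def innerf gIf)
    ultimately show "k \<in> live ?Gf \<longleftrightarrow> k \<in> live G - {?k}" by blast
  qed
  have "stable t ?Gf"
    unfolding stable_def
  proof (intro conjI ballI)
    show "well_formed ?Gf"
      using well_formed_freeze[of ?x G] f(1,4) by (simp add: inner_def)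
    show "3 \<le> card (half_edges ?Gf z)" if "z \<in> inner ?Gf" for z
      using val[of z] that by (simp add: innerf) (simp add: freeze_def)
    show "inner ?Gf \<noteq> {}" using s innerf by (simp add: solid_def)
    show "conn_on (gE ?Gf) ?Gf (inner ?Gf)"
      using s unfolding innerf gIf(2) by (simp add: solid_def conn_on_def adj_closed_def gIf(1))
    have "card (inner G) = Suc (card ?Y)"
      using f(4) wf_finite(4)[OF f(1)] by (metis card.remove)
    moreover have "card (live G) = Suc (card (live G - {?k}))"
      using f(2) legs_live finite_live[OF f(1)] by (metis card.remove subsetD)
    ultimately show "card (live ?Gf) = card (inner ?Gf) + t"
      using lv unfolding livef innerf by linarith
  qed
  moreover have "outer ?Gf (gM ?Gf)"
    using G by (auto simp: one_leg_def outer_def innerf gIf)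
  moreover have "2 \<le> card (legs ?Gf)"
  proof -
    let ?B = "half_edges G ?x"
    have finB: "finite ?B" by (rule half_edges_finite[OF f(1)])
    have inj: "inj_on fst ?B"
    proof (rule inj_onI)
      fix h h' assume h: "h \<in> ?B" "h' \<in> ?B" "fst h = fst h'"
      show "h = h'"
      proof (rule ccontr)
        assume "h \<noteq> h'"
        then have "h' = opp h" using h(3) by (cases h; cases h') auto
        then have "gI G (opp h) = ?x" using h(2) by (simp add: half_edges_def)
        then show False using s h(1) by (simp add: solid_def)
      qed
    qed
    have "fst ` ?B - {?k} \<subseteq> legs ?Gf"
    proof
      fix k assume "k \<in> fst ` ?B - {?k}"
      then obtain h where h: "h \<in> ?B" "fst h = k" "k \<noteq> ?k" by blast
      have "gI G (opp h) \<in> ?Y" using toY[OF h(1)] h by simp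
      moreover have "gI G h \<notin> ?Y" "fst h \<in> gE G" using h(1) by (auto simp: half_edges_def)
      ultimately show "k \<in> legs ?Gf"
        using h(2) unfolding legs_def live_def innerf gIf opp_def by (cases h) auto
    qed
    moreover have "finite (legs ?Gf)"
      using legs_live[of ?Gf] wf_finite(1)[OF f(1)] unfolding gIf by (meson finite_subset)
    ultimately have "card (fst ` ?B - {?k}) \<le> card (legs ?Gf)" by (rule card_mono[rotated])
    moreover have "card (fst ` ?B) - card {?k} \<le> card (fst ` ?B - {?k})"
      by (rule diff_card_le_card_Diff) simp
    ultimately show ?thesis
      using card_image[OF inj] val[OF f(4)] by simp
  qed
  ultimately show ?thesis by (simp add: hub_def)
qed

lemma graph_class_one_leg: "graph_class (one_leg t)"
  unfolding graph_class_def
  using iso_one_leg one_leg_facts(1) by (auto intro: invariant_predI)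

lemma convex_one_leg: "convex_class (one_leg t)"
  using one_leg_step(1) by (rule convex_classI)

definition solidity :: "ngraph \<Rightarrow> int" where
  "solidity G = (if solid G (hd (gM G)) then 1 else 0)"

lemma iso_solidity:
  assumes iso: "graph_iso p r F G G'" and G: "one_leg t G"
  shows "solidity G' = solidity G"
proof -
  have "gM G \<noteq> []" using G by (simp add: one_leg_def)
  then show ?thesis
    using iso_solid_iff[OF iso one_leg_facts(2)[OF G]] iso_hd_marks[OF iso]
    by (simp add: solidity_def)
qed

lemma iso_root_valence:
  assumes iso: "graph_iso p r F G G'" and G: "one_leg t G"
  shows "root_valence G' (hd (gM G')) = root_valence G (hd (gM G))"
    "root G' (hd (gM G')) = r (root G (hd (gM G)))"
proof -
  have "gM G \<noteq> []" using G by (simp add: one_leg_def)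
  then have "hd (gM G') = p (hd (gM G))" by (rule iso_hd_marks[OF iso])
  then show "root_valence G' (hd (gM G')) = root_valence G (hd (gM G))"
    "root G' (hd (gM G')) = r (root G (hd (gM G)))"
    using iso_root[OF iso one_leg_facts(2)[OF G]]
      iso_card_half_edges[OF iso inner_names[OF one_leg_facts(4)[OF G]]]
    by (simp_all add: root_valence_def)
qed

lemma solidity_step: "one_leg t G \<Longrightarrow> step G G' \<Longrightarrow> solidity G \<le> solidity G'"
  using one_leg_step(2) by (auto simp: solidity_def)

text \<open>With a single leg, no half-edge of the side can lead out of the inner part, so a level
  other than \<open>0\<close> means an empty side. Then root and target make up the whole inner
  part, and the target is connected, as the ends of the marked edge are joined by that edge.\<close>

lemma level_solid:
  assumes m: "marked G" and st: "stable t G" and legs: "legs G = {gM G ! 1}"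
    and nb: "gM G ! 0 \<in> nonbridges G" and t: "2 \<le> t" and lev: "level G \<noteq> 0"
  shows "solid G (gM G ! 1)"
proof -
  let ?x = "base G" and ?l = "gM G ! 1" and ?t = "gM G ! 0"
  let ?Y = "inner G - {?x}"
  note f = marked_facts[OF m]
  have lt: "?t \<noteq> ?l" using m by (simp add: marked_def)
  have lleg: "?l \<in> legs G" using legs by simp
  have conn: "conn_on (gE G) G (inner G)" and lv: "card (live G) = card (inner G) + t"
    using st by (auto simp: stable_def)
  have tin: "gI G (?t, b) \<in> inner G" for b
    using nb by (simp add: nonbridges_def)
  have notleg: "gI G (opp h) \<in> inner G" if "h \<in> half_edges G ?x" "fst h \<noteq> ?l" for h
    by (rule half_edges_not_leg[OF legs that(1) f(1) that(2)])
  have sideh: "gI G (opp h) \<notin> inner G" if "h \<in> side G" for h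
    using lev that by (auto simp: level_def split: if_splits)
  have "side G = {}"
  proof (rule ccontr)
    assume "side G \<noteq> {}"
    then obtain h where h: "h \<in> side G" by blast
    then have "h \<in> half_edges G ?x" "fst h \<noteq> ?l" by (auto simp: side_def rest_def)
    then show False using notleg sideh[OF h] by blast
  qed
  then have to_target: "fst h = ?t \<or> gI G (opp h) \<in> target G"
    if "h \<in> half_edges G ?x" "fst h \<noteq> ?l" for h
    using that unfolding side_def rest_def target_def by blast
  obtain bl where bl: "(?l, bl) \<in> half_edges G ?x" "gI G (?l, \<not> bl) \<notin> inner G"
    using leg_half_edge[OF lleg] unfolding base_def by metis
  have full: "insert ?x (target G) = inner G"
  proof (rule conn_onD[OF conn])
    show "insert ?x (target G) \<subseteq> inner G" using f(1,5) by blast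
    show "adj_closed (gE G) G (inner G) (insert ?x (target G))"
    proof (rule adj_closedI)
      fix h assume h: "fst h \<in> gE G" "gI G h \<in> insert ?x (target G)" "gI G (opp h) \<in> inner G"
      show "gI G (opp h) \<in> insert ?x (target G)"
      proof (cases "gI G h = ?x")
        case True
        then have hx: "h \<in> half_edges G ?x" using h(1) by (simp add: half_edges_def)
        have "fst h \<noteq> ?l"
        proof
          assume a: "fst h = ?l"
          then have eq: "(?l, snd h) = h" by (simp add: prod_eq_iff)
          then have "snd h = bl"
            using leg_half_edge_unique[OF lleg f(1,1), of "snd h" bl] hx bl(1) by simp
          then have "opp h = (?l, \<not> bl)" using a by (simp add: opp_def)
          then show False using bl(2) h(3) by simp
        qed
        then have "fst h = ?t \<or> gI G (opp h) \<in> target G" by (rule to_target[OF hx])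
        moreover have "gI G (opp h) \<in> insert ?x (target G)" if "fst h = ?t"
        proof -
          have "opp h = (?t, \<not> snd h)" using that by (simp add: opp_def)
          then show ?thesis
            using component_ends[of G ?t "\<not> snd h" ?x] tin by (auto simp: target_def)
        qed
        ultimately show ?thesis by blast
      next
        case False
        then have "gI G h \<in> target G" using h(2) by blast
        then show ?thesis
          using adj_closedD[OF component_closed[of G ?x ?t] h(1)] h(3) by (auto simp: target_def)
      qed
    qed
  qed blast
  then have tY: "target G = ?Y" using f(5) by blast
  \<comment> \<open>Were both ends of the marked edge at the root, the target would be empty and the
    root the only inner vertex. Only the marked edge and the leg would be live, against
    \<open>1 + t \<ge> 3\<close>.\<close>
  have t_end: "\<exists>b. gI G (?t, b) \<in> ?Y"
  proof (rule ccontr)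
    assume no: "\<not> ?thesis"
    then have "component G ?x ?t \<subseteq> {}"
      by (intro component_least) (auto simp: adj_closed_def)
    then have iG: "inner G = {?x}" using full by (simp add: target_def)
    have "live G \<subseteq> {?l, ?t}"
    proof
      fix k assume k: "k \<in> live G"
      then obtain b where "gI G (k, b) = ?x" "k \<in> gE G" using iG by (auto simp: live_def)
      then have "(k, b) \<in> half_edges G ?x" by (simp add: half_edges_def)
      then show "k \<in> {?l, ?t}" using to_target[of "(k, b)"] tY iG by auto
    qed
    then have "card (live G) \<le> card {?l, ?t}" by (intro card_mono) auto
    also have "\<dots> \<le> 2" by (simp add: card_insert_if)
    finally show False using lv iG t by simp
  qed
  have notad: "gI G (opp h) \<noteq> ?x" if h: "h \<in> half_edges G ?x" for h
  proof
    assume a: "gI G (opp h) = ?x"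
    have "fst h \<noteq> ?l"
    proof
      assume b: "fst h = ?l"
      have "(fst h, snd h) \<in> half_edges G ?x" "(fst h, \<not> snd h) \<in> half_edges G ?x"
        using a h by (auto simp: half_edges_def opp_def)
      then show False
        using leg_half_edge_unique[OF lleg f(1,1), of "snd h" "\<not> snd h"] b by simp
    qed
    then have "fst h = ?t" using to_target[OF h] a f(5) by auto
    moreover obtain b where "gI G (?t, b) \<in> ?Y" using t_end by blast
    moreover have "(fst h, b) = h \<or> (fst h, b) = opp h" by (cases h) auto
    ultimately show False using a h by (auto simp: half_edges_def)
  qed
  have "conn_on (gE G) G ?Y"
    unfolding conn_on_def
  proof (intro allI impI)
    fix U assume U: "U \<subseteq> ?Y" "U \<noteq> {}" "adj_closed (gE G) G ?Y U"
    obtain b where b: "gI G (?t, b) \<in> ?Y" using t_end by blast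
    have adj: "gI G (?t, b') \<in> V" if V: "adj_closed (gE G) G ?Y V" "gI G (?t, b) \<in> V" "gI G (?t, b') \<in> ?Y" for b' V
    proof (cases "b' = b")
      case False
      then have "opp (?t, b) = (?t, b')" by simp
      then show ?thesis using adj_closedD[OF V(1), of "(?t, b)"] V(2,3) f(2) by simp
    qed (use V in simp)
    show "U = ?Y"
    proof (cases "gI G (?t, b) \<in> U")
      case True
      then have "component G ?x ?t \<subseteq> U"
        using adj[OF U(3)] by (intro component_least[OF U(1,3)])
      then show ?thesis using tY U(1) unfolding target_def by blast
    next
      case False
      have "component G ?x ?t \<subseteq> ?Y - U"
      proof (rule component_least)
        show c: "adj_closed (gE G) G ?Y (?Y - U)" by (rule adj_closed_diff[OF U(3)])
        show "gI G (?t, b') \<in> ?Y - U" if "gI G (?t, b') \<in> ?Y" for b'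
          using adj[OF c _ that] False b by blast
      qed blast
      then have "U = {}" using tY U(1) unfolding target_def by blast
      then show ?thesis using U(2) by blast
    qed
  qed
  then show ?thesis
    using notad t_end unfolding solid_def base_def by blast
qed

text \<open>Removing the root leaves a connected graph, so the component of the marked edge is all
  of it, and nothing remains for the side.\<close>

lemma solid_level:
  assumes m: "marked G" and legs: "legs G = {gM G ! 1}" and s: "solid G (gM G ! 1)"
  shows "level G \<noteq> 0"
proof -
  let ?x = "base G" and ?l = "gM G ! 1" and ?t = "gM G ! 0"
  let ?Y = "inner G - {?x}"
  note f = marked_facts[OF m]
  have lt: "?t \<noteq> ?l" "?t \<in> live G" using m by (auto simp: marked_def)
  have toY: "gI G (opp h) \<in> ?Y" if h: "h \<in> half_edges G ?x" "fst h \<noteq> ?l" for h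
    using half_edges_not_leg[OF legs h(1) f(1) h(2)] s h(1) by (auto simp: solid_def base_def)
  obtain b where b: "gI G (?t, b) \<in> inner G" using lt(2) by (auto simp: live_def)
  have "\<exists>b. gI G (?t, b) \<in> ?Y"
  proof (cases "gI G (?t, b) = ?x")
    case True
    then have "gI G (?t, \<not> b) \<in> ?Y"
      using toY[of "(?t, b)"] lt(1) f(2) by (simp add: half_edges_def)
    then show ?thesis by blast
  qed (use b in blast)
  then have "target G \<noteq> {}" unfolding target_def using component_ends by fastforce
  moreover have "conn_on (gE G) G ?Y" using s by (simp add: solid_def base_def)
  ultimately have "target G = ?Y"
    unfolding target_def using component_closed component_subset by (intro conn_onD)
  then have "side G = {}"
    using toY by (auto simp: side_def rest_def target_def)
  then show ?thesis by (simp add: level_def)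
qed

text \<open>The new edge is the only link between what was split off and the base with its target,
  hence a bridge. So the pairing preserves the set of non-bridges, as \<open>exact_core\<close>
  requires when its condition \<open>E\<close> refers to them.\<close>

lemma toggle_nonbridges:
  assumes G: "core t G" and big: "2 \<le> card (side G)" and fr: "fresh G e w"
  shows "nonbridges (split_at G (base G) (side G) e w) = nonbridges G"
proof -
  let ?x = "base G" and ?H = "split_at G (base G) (side G) e w"
  have m: "marked G" and wf: "well_formed G" using G by (auto simp: core_def stable_def)
  note f = marked_facts[OF m]
  note sp = core_split_side(5)[OF G big fr]
  interpret splitting G ?x "side G" e w ?H
    using splittingI[OF wf f(1) sp fr] by simp
  have mH: "marked ?H" and sH: "side ?H = {(e, False)}"
    using core_split_side(1,2)[OF G big fr] by (auto simp: core_def)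
  have good: "?x = base G \<Longrightarrow> gM G ! 1 \<notin> fst ` side G"
    by (auto simp: side_def rest_def)
  have bH: "base ?H = ?x" by (rule base_split[OF m good])
  have tH: "target ?H = target G" by (rule split_inside(2)[OF m good refl order_refl])
  have M: "gM ?H = gM G" by simp
  note fH = marked_facts[OF mH]
  have lleg: "gM G ! 1 \<in> legs ?H" using mH by (simp add: marked_def)
  have rH: "root ?H (gM G ! 1) = ?x"
    using bH by (simp only: base_def split_simps)
  obtain bl where bl: "(gM G ! 1, bl) \<in> half_edges ?H ?x" "gI ?H (gM G ! 1, \<not> bl) \<notin> inner ?H"
    by (rule leg_half_edge[OF lleg, unfolded rH])
  note [simp del] = split_simps(6)
  have tgt: "target ?H = component ?H ?x (gM G ! 0)"
    by (simp only: target_def bH M)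
  have "e \<notin> nonbridges ?H"
  proof
    assume "e \<in> nonbridges ?H"
    then have conn: "conn_on (gE ?H - {e}) ?H (inner ?H)" by (simp add: nonbridges_def)
    \<comment> \<open>Without the new edge this set would be closed and yet miss the new vertex
      \<open>w\<close>.\<close>
    let ?U = "insert ?x (target ?H)"
    have "?U = inner ?H"
    proof (rule conn_onD[OF conn])
      show "?U \<subseteq> inner ?H" using fH(1,5) bH by auto
      show "adj_closed (gE ?H - {e}) ?H (inner ?H) ?U"
      proof (rule adj_closedI)
        fix h assume h: "fst h \<in> gE ?H - {e}" "gI ?H h \<in> ?U" "gI ?H (opp h) \<in> inner ?H"
        show "gI ?H (opp h) \<in> ?U"
        proof (cases "gI ?H h = ?x")
          case True
          then have hx: "h \<in> half_edges ?H ?x" using h(1) by (simp add: half_edges_def)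
          have "h \<notin> side ?H"
          proof
            assume "h \<in> side ?H"
            then have "fst h = e" unfolding sH by simp
            then show False using h(1) by blast
          qed
          moreover have "fst h \<noteq> gM G ! 1"
          proof
            assume a: "fst h = gM G ! 1"
            then have eq: "(gM G ! 1, snd h) = h" by (simp add: prod_eq_iff)
            have "snd h = bl"
              using leg_half_edge_unique[OF lleg, of ?x ?x "snd h" bl] hx bl(1) fH(1) bH eq by simp
            then have "opp h = (gM G ! 1, \<not> bl)" using a by (simp add: opp_def)
            then show False using bl(2) h(3) by simp
          qed
          ultimately have "fst h = gM G ! 0 \<or> gI ?H (opp h) \<in> target ?H"
            using hx bH M by (auto simp: side_def rest_def target_def)
          moreover have "gI ?H (opp h) \<in> ?U" if "fst h = gM G ! 0"
          proof -
            have "opp h = (gM G ! 0, \<not> snd h)" using that by (simp add: opp_def)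
            then show ?thesis
              using component_ends[of ?H "gM G ! 0" "\<not> snd h" ?x] h(3) unfolding tgt
              by (cases "gI ?H (opp h) = ?x") simp_all
          qed
          ultimately show ?thesis by blast
        next
          case False
          then have "gI ?H h \<in> target ?H" using h(2) by blast
          then show ?thesis
            using adj_closedD[OF component_closed[of ?H ?x "gM G ! 0"], of h] h unfolding tgt
            by (cases "gI ?H (opp h) = ?x") simp_all
        qed
      qed
    qed blast
    moreover have "w \<in> inner ?H" using inner_H by simp
    moreover have "w \<noteq> ?x" "w \<notin> target ?H" using w f(1,5) tH by auto
    ultimately show False by blast
  qed
  then have "nonbridges ?H \<subseteq> gE G"
    using nonbridges_subset(1)[of ?H] unfolding E_H by blast
  then show ?thesis
    using nonbridges_split nonbridges_subset(1)[of G] by blast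
qed

lemma unmark_simps:
  "nonbridges (unmark G) = nonbridges G" "solid (unmark G) = solid G" "gM (unmark G) = tl (gM G)"
  by (auto simp: unmark_def nonbridges_def solid_def root_def conn_on_def adj_closed_def fun_eq_iff)

text \<open>For a non-bridge as first mark, level \<open>0\<close> amounts to not being solid, by
  \<open>level_solid\<close> and \<open>solid_level\<close>. So the marked graphs are those treated
  by \<open>exact_core\<close>, with the remaining conditions as \<open>E\<close>.\<close>

lemma unsolid_core:
  assumes t: "2 \<le> t"
  shows "(core t G \<and> legs G = {gM G ! 1} \<and> gM G ! 0 \<in> nonbridges G \<and> int (card (nonbridges G)) = n) \<longleftrightarrow>
    (gM G \<noteq> [] \<and> ((one_leg t (unmark G) \<and> solidity (unmark G) = 0) \<and> int (card (nonbridges (unmark G))) = n) \<and>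
     hd (gM G) \<in> nonbridges (unmark G))"
proof
  assume G: "core t G \<and> legs G = {gM G ! 1} \<and> gM G ! 0 \<in> nonbridges G \<and> int (card (nonbridges G)) = n"
  then have m: "marked G" by (simp add: core_def)
  then obtain a b ms where M: "gM G = a # b # ms"
    by (cases "gM G"; cases "tl (gM G)") (auto simp: marked_def)
  have "\<not> solid G b"
    using solid_level[OF m] G by (auto simp: core_def M)
  moreover have "set (gM G) \<subseteq> gE G" using m by (simp add: marked_def well_formed_def)
  ultimately show "gM G \<noteq> [] \<and> ((one_leg t (unmark G) \<and> solidity (unmark G) = 0) \<and>
      int (card (nonbridges (unmark G))) = n) \<and> hd (gM G) \<in> nonbridges (unmark G)"
    using G by (auto simp: one_leg_def solidity_def unmark_simps M core_def stable_unmark outer_unmark legs_unmark)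
next
  assume G: "gM G \<noteq> [] \<and> ((one_leg t (unmark G) \<and> solidity (unmark G) = 0) \<and>
      int (card (nonbridges (unmark G))) = n) \<and> hd (gM G) \<in> nonbridges (unmark G)"
  then have "tl (gM G) \<noteq> []" by (auto simp: one_leg_def unmark_simps)
  then obtain a b ms where M: "gM G = a # b # ms"
    using G by (cases "gM G"; cases "tl (gM G)") auto
  have nb: "a \<in> nonbridges G" and legs: "legs G = {b}" and ns: "\<not> solid G b"
    and out: "outer G (b # ms)"
    using G by (auto simp: M unmark_simps one_leg_def legs_unmark solidity_def outer_unmark split: if_splits)
  have "set (b # ms) \<subseteq> gE G"
    using G by (simp add: one_leg_def stable_def well_formed_def M unmark_simps) (simp add: unmark_def)
  then have "set (gM G) \<subseteq> gE G" using nb nonbridges_subset(1) M by auto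
  then have st: "stable t G" using G by (simp add: one_leg_def stable_unmark)
  have "a \<noteq> b" using nb legs nonbridges_subset(3)[of G] by auto
  then have m: "marked G"
    using st nb legs nonbridges_subset(2) by (auto simp: marked_def M stable_def)
  have "level G = 0"
    using level_solid[OF m st _ _ t] legs nb ns by (auto simp: M)
  then show "core t G \<and> legs G = {gM G ! 1} \<and> gM G ! 0 \<in> nonbridges G \<and> int (card (nonbridges G)) = n"
    using m st out legs nb G by (simp add: core_def M unmark_simps)
qed

lemma core_step:
  assumes G: "core t G" and st: "step G G'"
  shows "marked G'" "stable t G'" "outer G' (tl (gM G'))" "level G \<le> level G'"
    "nonbridges G \<subseteq> nonbridges G'" "legs G' = legs G" "gM G' = gM G"
proof -
  have m: "marked G" and wf: "well_formed G" and stb: "stable t G" and out: "outer G (tl (gM G))"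
    using G by (auto simp: core_def stable_def)
  show "legs G' = legs G" "gM G' = gM G" by (rule step_legs[OF st wf])+
  obtain i S e w where s: "i \<in> inner G" "S \<in> splits G i" "fresh G e w" "G' = split_at G i S e w"
    using st unfolding step_def by blast
  interpret splitting G i S e w "split_at G i S e w"
    using splittingI[OF wf s(1-3)] by simp
  show "marked G'" "stable t G'" "outer G' (tl (gM G'))"
    using marked_split[OF marks_edges(1)[OF wf]] stable_split[OF s(2)] outer_split[OF marks_edges(2)[OF wf]] m stb out
    by (simp_all add: s(4))
  show "nonbridges G \<subseteq> nonbridges G'"
    using nonbridges_split nonbridges_subset(1)[of G] s(4) by blast
  have leg: "gM G ! 1 \<in> legs G" using m by (simp add: marked_def)
  obtain i' S' e' w' p r F where s': "i' \<in> inner G" "S' \<in> splits G i'" "fresh G e' w'"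
    "i' = root G (gM G ! 1) \<Longrightarrow> gM G ! 1 \<notin> fst ` S'" "graph_iso p r F (split_at G i' S' e' w') G'"
    by (rule step_cases[OF wf st leg]) blast
  interpret alt: splitting G i' S' e' w' "split_at G i' S' e' w'"
    using splittingI[OF wf s'(1-3)] by simp
  have good: "i' = base G \<Longrightarrow> gM G ! 1 \<notin> fst ` S'" using s'(4) by (simp add: base_def)
  have "2 \<le> card S'" using s'(2) by (simp add: splits_def)
  then show "level G \<le> level G'"
    using alt.level_split_mono[OF m good] iso_level[OF s'(5) alt.marked_H[OF m good]] by simp
qed

lemma nonbridges_eq:
  assumes "nonbridges G \<subseteq> nonbridges G'" "well_formed G'" "card (nonbridges G') = card (nonbridges G)"
  shows "nonbridges G' = nonbridges G"
  using card_subset_eq[OF finite_subset[OF nonbridges_subset(1) wf_finite(1)[OF assms(2)]] assms(1)] assms(3)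
  by simp

section \<open>Exactness for one leg and for all stable graphs with a leg\<close>

context parity
begin

lemma exact_0:
  assumes "\<And>G. P G \<Longrightarrow> stable t G"
  shows "exact P 0"
  unfolding exact_def
proof (intro allI impI)
  fix f assume f: "equivariant f"
  have "card (inner G) \<noteq> 0" if "P G" for G
    using assms[OF that] wf_finite(4) by (auto simp: stable_def)
  then show "\<exists>g. equivariant g \<and> (\<forall>G. P G \<and> card (inner G) = 0 \<longrightarrow> d (restr P g) G = f G)"
    using f by blast
qed

text \<open>At fixed valence the root is not split and can be frozen. Since \<open>t\<close> stays
  and the number of vertices drops, \<open>exact_hub\<close> is available.\<close>

lemma exact_solid:
  assumes t: "Suc (Suc v) < t"
  shows "exact (\<lambda>G. (one_leg t G \<and> solidity G = 1) \<and> root_valence G (hd (gM G)) = k) (Suc v)"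
proof (rule exact_by_freeze[where X = "\<lambda>G. root G (hd (gM G))"])
  let ?P = "\<lambda>G. (one_leg t G \<and> solidity G = 1) \<and> root_valence G (hd (gM G)) = k"
  let ?X = "\<lambda>G. root G (hd (gM G))"
  show "graph_class ?P"
    unfolding graph_class_def
  proof
    show "invariant ?P"
      using iso_one_leg iso_solidity iso_root_valence(1) by (intro invariant_predI) metis
  qed (auto dest: one_leg_facts(1))
  show "?X G \<in> inner G" if "?P G" for G
    using one_leg_facts(4) that by blast
  show "?X G' = r (?X G)" if "graph_iso p r F G G'" "?P G" for p r F G G'
    using iso_root_valence(2) that by blast
  show "(?P (split_at G i S e w) \<and> ?X (split_at G i S e w) = x) = (?P G \<and> ?X G = x)"
    if h: "well_formed G" "i \<in> inner G" "S \<in> splits G i" "fresh G e w" "x \<in> inner G" "i \<noteq> x" for G i S e w x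
  proof -
    interpret splitting G i S e w "split_at G i S e w"
      using splittingI[OF h(1-4)] by simp
    let ?H = "split_at G i S e w" and ?k = "hd (gM G)"
    have xw: "x \<noteq> w" using h(5) w by blast
    have M: "gM ?H = gM G" by simp
    have ol: "one_leg t ?H = one_leg t G" by (rule one_leg_split[OF h(3)])
    have same: "?P ?H = ?P G \<and> root ?H ?k = root G ?k" if g: "one_leg t G" and b: "i \<noteq> root G ?k"
      using solid_split_other[OF one_leg_facts(2)[OF g] b] root_valence_split(1)[OF one_leg_facts(2)[OF g] h(3) b]
        root_split_cases[OF one_leg_facts(2)[OF g]] b ol by (simp add: solidity_def)
    show ?thesis
    proof
      assume a: "?P ?H \<and> ?X ?H = x"
      then have g: "one_leg t G" using ol by blast
      have "i \<noteq> root G ?k"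
        using root_split_cases[OF one_leg_facts(2)[OF g]] a h(6) xw M by metis
      then show "?P G \<and> ?X G = x" using same[OF g] a M by simp
    next
      assume a: "?P G \<and> ?X G = x"
      then have "i \<noteq> root G ?k" "one_leg t G" using h(6) by blast+
      then show "?P ?H \<and> ?X ?H = x" using same a M by simp
    qed
  qed
  show "i \<noteq> ?X G"
    if h: "?P G" "i \<in> inner G" "S \<in> splits G i" "fresh G e w" "?P (split_at G i S e w)" for G i S e w
  proof
    assume b: "i = ?X G"
    have g: "one_leg t G" using h(1) by blast
    interpret splitting G i S e w "split_at G i S e w"
      using splittingI[OF one_leg_facts(1)[OF g] h(2-4)] by simp
    show False
      using root_valence_split(2)[OF one_leg_facts(2)[OF g] h(3) b] h(1,5) by simp
  qed
  show "hub t (freeze (?X G) G)" if "?P G" for G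
    using solid_freeze[of t G] that by (auto simp: solidity_def split: if_splits)
  show "exact (hub t) v"
    using t by (intro exact_hub) simp
qed

text \<open>Here the pairing alone gives exactness, in every degree \<open>v\<close>; no vertex is
  frozen. The bound on \<open>t\<close> excludes a single vertex with one tadpole.\<close>

lemma exact_unsolid:
  assumes t: "2 \<le> t"
  shows "exact (\<lambda>G. (one_leg t G \<and> solidity G = 0) \<and> int (card (nonbridges G)) = n) v"
proof (rule exact_mark[where Mk = nonbridges])
  let ?P = "\<lambda>G. (one_leg t G \<and> solidity G = 0) \<and> int (card (nonbridges G)) = n"
  have ic: "card (nonbridges G') = card (nonbridges G)" if "graph_iso p r F G G'" for p r F G G'
    using iso_nonbridges[OF that] iso_card_edges[OF that nonbridges_subset(1)] by simp
  show "graph_class ?P"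
    unfolding graph_class_def
  proof
    show "invariant ?P"
      using iso_one_leg iso_solidity ic by (intro invariant_predI) metis
  qed (auto dest: one_leg_facts(1))
  show "nonbridges G \<subseteq> gE G" for G by (rule nonbridges_subset)
  show "nonbridges G \<noteq> {}" if "?P G" for G
    using nonbridges_nonempty[of t G] that t by (auto simp: one_leg_def)
  show "nonbridges G' = p ` nonbridges G" if "graph_iso p r F G G'" for p r F G G'
    by (rule iso_nonbridges[OF that])
  show "nonbridges G' = nonbridges G" if "?P G" "?P G'" "step G G'" for G G'
    using nonbridges_eq one_leg_step(4) one_leg_facts(1) that by (metis of_nat_eq_iff)
  let ?E = "\<lambda>G. legs G = {gM G ! 1} \<and> gM G ! 0 \<in> nonbridges G \<and> int (card (nonbridges G)) = n"
  have "exact (\<lambda>G. core t G \<and> ?E G) v"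
  proof (rule exact_core)
    show "?E G' = ?E G" if iso: "graph_iso p r F G G'" and G: "core t G" for p r F G G'
    proof -
      have m: "marked G" using G by (simp add: core_def)
      note f = marked_facts[OF m]
      have "0 < length (gM G)" "1 < length (gM G)" using m by (auto simp: marked_def)
      then have M: "gM G' ! 0 = p (gM G ! 0)" "gM G' ! 1 = p (gM G ! 1)"
        using iso by (simp_all only: graph_iso_def nth_map)
      have inj: "inj_on p (gE G)" using iso by (simp add: graph_iso_def)
      have lE: "legs G \<subseteq> gE G" using legs_live by blast
      have "p ` legs G = p ` {gM G ! 1} \<longleftrightarrow> legs G = {gM G ! 1}"
        using f(3) by (intro inj_on_image_eq_iff[OF inj lE]) simp
      moreover have "p (gM G ! 0) \<in> p ` nonbridges G \<longleftrightarrow> gM G ! 0 \<in> nonbridges G"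
        by (rule inj_on_image_mem_iff[OF inj f(2) nonbridges_subset(1)])
      ultimately show ?thesis
        unfolding M iso_legs[OF iso] iso_nonbridges[OF iso] ic[OF iso, unfolded iso_nonbridges[OF iso]] by simp
    qed
    show "convex_class (\<lambda>G. core t G \<and> ?E G)"
      unfolding convex_class_def
    proof (intro allI impI)
      fix G G1 G2 assume a: "(core t G \<and> ?E G) \<and> step G G1 \<and> step G1 G2 \<and> (core t G2 \<and> ?E G2)"
      then have G: "core t G" and s1: "step G G1" and s2: "step G1 G2" by blast+
      note c1 = core_step[OF G s1]
      have wf1: "well_formed G1" using c1(2) by (simp add: stable_def)
      have leg: "gM G1 ! 1 \<in> legs G1" using c1(1) by (simp add: marked_def)
      obtain i S e w p r F where s: "i \<in> inner G1" "S \<in> splits G1 i" "fresh G1 e w"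
        "i = root G1 (gM G1 ! 1) \<Longrightarrow> gM G1 ! 1 \<notin> fst ` S" "graph_iso p r F (split_at G1 i S e w) G2"
        by (rule step_cases[OF wf1 s2 leg]) blast
      interpret splitting G1 i S e w "split_at G1 i S e w"
        using splittingI[OF wf1 s(1-3)] by simp
      have good: "i = base G1 \<Longrightarrow> gM G1 ! 1 \<notin> fst ` S" using s(4) by (simp add: base_def)
      have "2 \<le> card S" using s(2) by (simp add: splits_def)
      then have "level G1 \<le> level G2"
        using level_split_mono[OF c1(1) good] iso_level[OF s(5) marked_H[OF c1(1) good]] by simp
      then have "level G1 = 0"
        using a c1(4) by (auto simp: core_def)
      then have core1: "core t G1" using c1 by (simp add: core_def)
      have "well_formed G2" using a by (simp add: core_def stable_def)
      \<comment> \<open>The set of non-bridges can only grow along the two splittings, and it has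
        the same size at both ends.\<close>
      then have "nonbridges G2 = nonbridges G"
        using nonbridges_eq[of G G2] c1(5) core_step(5)[OF core1 s2] a by (metis of_nat_eq_iff order_trans)
      then have "nonbridges G1 = nonbridges G"
        using c1(5) core_step(5)[OF core1 s2] by blast
      then show "core t G1 \<and> ?E G1"
        using core1 a c1(6,7) by simp
    qed
    show "?E (split_at G (base G) (side G) e w) = ?E G"
      if h: "core t G" "2 \<le> card (side G)" "fresh G e w" for G e w
    proof -
      have m: "marked G" and wf: "well_formed G" using h(1) by (auto simp: core_def stable_def)
      interpret splitting G "base G" "side G" e w "split_at G (base G) (side G) e w"
        using splittingI[OF wf marked_facts(1)[OF m] core_split_side(5)[OF h] h(3)] by simp
      show ?thesis using toggle_nonbridges[OF h] legs_split by simp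
    qed
  qed
  then show "exact (\<lambda>G. gM G \<noteq> [] \<and> ?P (unmark G) \<and> hd (gM G) \<in> nonbridges (unmark G)) v"
    using unsolid_core[OF t, of _ n] by (rule exact_cong)
qed

text \<open>Splitting preserves solidity, which therefore gives a filtration in two steps. The solid
  part is exact by freezing, the other by pairing.\<close>

lemma exact_one_leg:
  assumes t: "Suc v < t"
  shows "exact (one_leg t) v"
proof (cases v)
  case 0
  then show ?thesis using exact_0[of "one_leg t" t] by (simp add: one_leg_def)
next
  case (Suc v')
  have finN: "int (card (nonbridges G)) \<le> int (v + t)" if "one_leg t G" "card (inner G) = v" for G
  proof -
    have "card (nonbridges G) \<le> card (live G)"
      by (rule card_mono[OF finite_live[OF one_leg_facts(1)[OF that(1)]] nonbridges_subset(2)])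
    then show ?thesis
      using one_leg_facts(3)[OF that(1)] that(2) by (simp add: stable_def)
  qed
  show ?thesis
  proof (rule exact_filtration[where f = solidity and lo = 0 and hi = 1])
    show "graph_class (one_leg t)" by (rule graph_class_one_leg)
    show "convex_class (one_leg t)" by (rule convex_one_leg)
    show "solidity G' = solidity G" if "graph_iso p r F G G'" "one_leg t G" for p r F G G'
      by (rule iso_solidity[OF that])
    show "solidity G \<le> solidity G'" if "one_leg t G" "step G G'" for G G'
      by (rule solidity_step[OF that])
    show "0 \<le> solidity G \<and> solidity G \<le> 1" for G by (simp add: solidity_def)
    fix c
    have cls: "graph_class (\<lambda>G. one_leg t G \<and> solidity G = c)"
      unfolding graph_class_def
    proof
      show "invariant (\<lambda>G. one_leg t G \<and> solidity G = c)"
        using iso_one_leg iso_solidity by (intro invariant_predI) metis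
    qed (auto dest: one_leg_facts(1))
    have conv: "convex_class (\<lambda>G. one_leg t G \<and> solidity G = c)"
      using solidity_step by (intro convex_class_level convex_one_leg) blast
    consider "c = 0" | "c = 1" | "c \<noteq> 0" "c \<noteq> 1" by blast
    then show "exact (\<lambda>G. one_leg t G \<and> solidity G = c) v"
    proof cases
      case 1
      show ?thesis
      proof (rule exact_filtration[where f = "\<lambda>G. int (card (nonbridges G))" and lo = 0 and hi = "int (v + t)", OF cls conv])
        show "int (card (nonbridges G')) = int (card (nonbridges G))" if "graph_iso p r F G G'" for p r F G G'
          using iso_nonbridges[OF that] iso_card_edges[OF that nonbridges_subset(1)] by simp
        show "int (card (nonbridges G)) \<le> int (card (nonbridges G'))"
          if "one_leg t G \<and> solidity G = c" "one_leg t G' \<and> solidity G' = c" "step G G'" for G G'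
          using card_mono[OF finite_subset[OF nonbridges_subset(1)], of G' "nonbridges G"] one_leg_step(4)[of t G G']
            one_leg_facts(1)[of t G'] wf_finite(1) that by auto
        show "0 \<le> int (card (nonbridges G)) \<and> int (card (nonbridges G)) \<le> int (v + t)"
          if "one_leg t G \<and> solidity G = c" "card (inner G) = v" for G
          using finN that by simp
        show "exact (\<lambda>G. (one_leg t G \<and> solidity G = c) \<and> int (card (nonbridges G)) = n) v" for n
          using exact_unsolid[of t n v] t 1 by simp
      qed
    next
      case 2
      show ?thesis
      proof (rule exact_filtration[where f = "\<lambda>G. root_valence G (hd (gM G))" and lo = "- 2 * (int v + int t)" and hi = 0, OF cls conv])
        show "root_valence G' (hd (gM G')) = root_valence G (hd (gM G))"
          if "graph_iso p r F G G'" "one_leg t G \<and> solidity G = c" for p r F G G'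
          using iso_root_valence(1) that by blast
        show "root_valence G (hd (gM G)) \<le> root_valence G' (hd (gM G'))"
          if "one_leg t G \<and> solidity G = c" "step G G'" for G G'
          using one_leg_step(3) that by blast
        show "- 2 * (int v + int t) \<le> root_valence G (hd (gM G)) \<and> root_valence G (hd (gM G)) \<le> 0"
          if "one_leg t G \<and> solidity G = c" "card (inner G) = v" for G
          using card_half_edges_le[OF one_leg_facts(3,4)[of t G]] that by (simp add: root_valence_def)
        show "exact (\<lambda>G. (one_leg t G \<and> solidity G = c) \<and> root_valence G (hd (gM G)) = k) v" for k
          using exact_solid[of v' t k] t 2 Suc by simp
      qed
    next
      case 3
      then show ?thesis by (intro exact_empty) (simp add: solidity_def)
    qed
  qed
qed

text \<open>Splitting does not change the set of legs, so their number separates the complex into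
  the case of one leg and that of at least two.\<close>

theorem exact_stable:
  assumes t: "Suc v < t"
  shows "exact (\<lambda>G. stable t G \<and> outer G (gM G) \<and> legs G \<noteq> {}) v"
proof (rule exact_filtration[where f = "\<lambda>G. int (card (legs G))" and lo = 0 and hi = "int (v + t)"])
  let ?D = "\<lambda>G. stable t G \<and> outer G (gM G) \<and> legs G \<noteq> {}"
  have wfD: "well_formed G" if "?D G" for G using that by (simp add: stable_def)
  have inv: "invariant ?D"
  proof (rule invariant_predI)
    fix p r F G G' assume iso: "graph_iso p r F G G'" and G: "?D G"
    then show "?D G'"
      using invariantD[OF invariant_stable iso] iso_outer_all[OF iso] iso_legs[OF iso] by simp
  qed
  show cls: "graph_class ?D"
    using inv wfD by (auto simp: graph_class_def)
  have her: "?D G'" if G: "?D G" and st: "step G G'" for G G'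
  proof -
    obtain i S e w where s: "i \<in> inner G" "S \<in> splits G i" "fresh G e w" "G' = split_at G i S e w"
      using st unfolding step_def by blast
    interpret splitting G i S e w "split_at G i S e w"
      using splittingI[OF wfD[OF G] s(1-3)] by simp
    show ?thesis
      using G stable_split[OF s(2)] outer_split[OF marks_edges(1)[OF wfD[OF G]]] legs_split s(4) by simp
  qed
  then show "convex_class ?D" by (rule convex_classI)
  show "int (card (legs G')) = int (card (legs G))" if "graph_iso p r F G G'" for p r F G G'
    using iso_card_legs[OF that] by simp
  show "int (card (legs G)) \<le> int (card (legs G'))" if "?D G" "step G G'" for G G'
    using step_legs(1)[OF that(2) wfD[OF that(1)]] by simp
  show "0 \<le> int (card (legs G)) \<and> int (card (legs G)) \<le> int (v + t)" if "?D G" "card (inner G) = v" for G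
    using card_mono[OF finite_live[OF wfD[OF that(1)]] legs_live(1)] that by (auto simp: stable_def)
  show "exact (\<lambda>G. ?D G \<and> int (card (legs G)) = c) v" for c
  proof -
    have finl: "finite (legs G)" if "?D G" for G
      using finite_subset[OF legs_live(1) finite_live[OF wfD[OF that]]] .
    consider "2 \<le> c" | "c = 1" | "c \<le> 0" by linarith
    then show ?thesis
    proof cases
      case 1
      have "exact (\<lambda>G. hub t G \<and> int (card (legs G)) = c) v"
      proof (rule exact_restrict[OF graph_class_hub _ exact_hub[OF t]])
        show "(int (card (legs G')) = c) = (int (card (legs G)) = c)" if "graph_iso p r F G G'" for p r F G G'
          using iso_card_legs[OF that] by simp
        show "(int (card (legs G')) = c) = (int (card (legs G)) = c)" if "hub t G" "step G G'" for G G'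
          using step_legs(1)[OF that(2)] that(1) by (simp add: hub_def stable_def)
      qed
      then show ?thesis
        by (rule exact_cong) (use 1 in \<open>auto simp: hub_def\<close>)
    next
      case 2
      show ?thesis
      proof (rule exact_mark[where Mk = legs])
        show "graph_class (\<lambda>G. ?D G \<and> int (card (legs G)) = c)"
          unfolding graph_class_def
        proof
          show "invariant (\<lambda>G. ?D G \<and> int (card (legs G)) = c)"
            using invariantD[OF inv] iso_card_legs by (intro invariant_predI) metis
        qed (use wfD in blast)
        show "legs G \<subseteq> gE G" for G using legs_live by blast
        show "legs G \<noteq> {}" if "?D G \<and> int (card (legs G)) = c" for G using that by blast
        show "legs G' = p ` legs G" if "graph_iso p r F G G'" for p r F G G' by (rule iso_legs[OF that])
        show "legs G' = legs G" if "?D G \<and> int (card (legs G)) = c" "step G G'" for G G'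
          using step_legs(1)[OF that(2)] wfD that(1) by blast
        have eq: "one_leg t G = (gM G \<noteq> [] \<and> (?D (unmark G) \<and> int (card (legs (unmark G))) = c) \<and>
            hd (gM G) \<in> legs (unmark G))" for G
        proof
          assume G: "one_leg t G"
          have "set (gM G) \<subseteq> gE G" using one_leg_facts(1)[OF G] by (simp add: well_formed_def)
          moreover have "outer G (tl (gM G))" using G set_tl[of "gM G"] by (auto simp: one_leg_def outer_def)
          ultimately show "gM G \<noteq> [] \<and> (?D (unmark G) \<and> int (card (legs (unmark G))) = c) \<and> hd (gM G) \<in> legs (unmark G)"
            using G 2 by (simp add: one_leg_def stable_unmark outer_unmark legs_unmark unmark_simps)
        next
          assume G: "gM G \<noteq> [] \<and> (?D (unmark G) \<and> int (card (legs (unmark G))) = c) \<and> hd (gM G) \<in> legs (unmark G)"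
          have M: "gM G = hd (gM G) # tl (gM G)" using G by simp
          have k: "hd (gM G) \<in> legs G" using G by (simp add: legs_unmark)
          have "set (tl (gM G)) \<subseteq> gE G"
            using G by (simp add: stable_def well_formed_def unmark_def)
          then have "set (gM G) \<subseteq> gE G" using k legs_live[of G] by (subst M) auto
          moreover have "outer G (gM G)"
          proof -
            have "outer G (tl (gM G))" using G by (simp add: outer_unmark unmark_simps)
            then have "outer G (hd (gM G) # tl (gM G))" using leg_outer[OF k] by (simp add: outer_def)
            then show ?thesis using M by simp
          qed
          moreover have "card (legs G) = 1" using G 2 by (simp add: legs_unmark)
          then have "legs G = {hd (gM G)}" using k by (metis card_1_singletonE singletonD)
          ultimately show "one_leg t G" using G by (simp add: one_leg_def stable_unmark)
        qed
        show "exact (\<lambda>G. gM G \<noteq> [] \<and> (?D (unmark G) \<and> int (card (legs (unmark G))) = c) \<and>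
            hd (gM G) \<in> legs (unmark G)) v"
          using exact_one_leg[OF t] eq by (rule exact_cong)
      qed
    next
      case 3
      have "\<not> (?D G \<and> int (card (legs G)) = c)" for G
      proof
        assume G: "?D G \<and> int (card (legs G)) = c"
        then have "card (legs G) > 0" using finl[of G] by (simp add: card_gt_0_iff)
        then show False using G 3 by simp
      qed
      then show ?thesis by (rule exact_empty)
    qed
  qed
qed

end

section \<open>Labelled and named graphs\<close>

lemma pair_sign_permutes:
  assumes "finite A" "p permutes A"
  shows "pair_sign p A = of_int (sign p)"
  using assms(2,1)
proof (induction rule: permutes_induct)
  case id
  show ?case by (simp add: pair_sign_mono_on)
next
  case (swap a b p)
  have perm: "permutation p" using swap assms(1) permutation_permutes by blast
  have "pair_sign (Transposition.transpose a b \<circ> p) A = pair_sign (Transposition.transpose a b) (p ` A) * pair_sign p A"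
    unfolding comp_def using assms(1) swap permutes_inj[of p A]
    by (intro pair_sign_comp) (auto intro: inj_on_subset simp: inj_on_subset[OF inj_transpose])
  also have "\<dots> = - of_int (sign p)"
    using swap assms(1) by (simp add: permutes_image pair_sign_transpose)
  also have "\<dots> = of_int (sign (Transposition.transpose a b \<circ> p))"
    using swap perm permutation_swap_id[of a b] by (simp only: sign_compose sign_swap_id) simp
  finally show ?case .
qed

text \<open>Even and odd numbers keep the two kinds of vertices apart, and the order among the
  internal ones is preserved, so that no sign arises from the encoding.\<close>

primrec code :: "hvertex \<Rightarrow> nat" where
  "code (Internal i) = 2 * i"
| "code (Hair j) = Suc (2 * j)"

lemma code_eq [simp]: "code x = code y \<longleftrightarrow> x = y"
  by (cases x; cases y; simp) presburger+

definition end_of :: "hgraph \<Rightarrow> nat \<times> bool \<Rightarrow> hvertex" where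
  "end_of H g = (if snd g then snd (edges H ! fst g) else fst (edges H ! fst g))"

text \<open>Hair ends become frozen vertices outside \<open>gV\<close>. Their order in
  \<open>gF\<close> makes the hairs distinguishable.\<close>

definition named :: "hgraph \<Rightarrow> ngraph" where
  "named H = \<lparr>gE = {..<length (edges H)}, gV = (\<lambda>i. 2 * i) ` {..<num_internal H},
     gI = (\<lambda>g. code (end_of H g)), gF = map (\<lambda>j. Suc (2 * j)) [0..<num_hairs H], gM = []\<rparr>"

lemma named_simps [simp]:
  "gE (named H) = {..<length (edges H)}" "gV (named H) = (\<lambda>i. 2 * i) ` {..<num_internal H}"
  "gI (named H) g = code (end_of H g)" "gF (named H) = map (\<lambda>j. Suc (2 * j)) [0..<num_hairs H]"
  "gM (named H) = []"
  by (simp_all add: named_def)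

lemma names_named: "names (named H) = code ` vertices H"
  by (simp add: names_def vertices_def image_Un image_image atLeast0LessThan)

lemma inner_named: "inner (named H) = (\<lambda>i. 2 * i) ` {..<num_internal H}"
  by (auto simp: inner_def) presburger

lemma inner_named_iff: "code x \<in> inner (named H) \<longleftrightarrow> (\<exists>i < num_internal H. x = Internal i)"
  unfolding inner_named by (cases x) (auto simp: image_iff, presburger+)

lemma half_edges_named: "half_edges (named H) (code x) = half_edges_at H x"
  by (auto simp: half_edges_def half_edges_at_def end_of_def)

lemma edge_ends:
  assumes "\<forall>(x, y) \<in> set (edges H). x \<in> vertices H \<and> y \<in> vertices H" "fst g < length (edges H)"
  shows "end_of H g \<in> vertices H"
  using assms nth_mem[OF assms(2)] by (auto simp: end_of_def split_beta)

lemma well_formed_named: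
  assumes "\<forall>(x, y) \<in> set (edges H). x \<in> vertices H \<and> y \<in> vertices H"
  shows "well_formed (named H)"
  unfolding well_formed_def names_named using edge_ends[OF assms] by auto

definition edge_closed :: "hgraph \<Rightarrow> hvertex set \<Rightarrow> bool" where
  "edge_closed H U \<longleftrightarrow> (\<forall>g. fst g < length (edges H) \<longrightarrow> end_of H g \<in> U \<longrightarrow> end_of H (opp g) \<in> U)"

lemma edge_relation:
  "(x, y) \<in> set (edges H) \<union> (set (edges H))\<inverse> \<longleftrightarrow>
     (\<exists>g. fst g < length (edges H) \<and> end_of H g = x \<and> end_of H (opp g) = y)"
proof
  assume "(x, y) \<in> set (edges H) \<union> (set (edges H))\<inverse>"
  then consider k where "k < length (edges H)" "edges H ! k = (x, y)"
    | k where "k < length (edges H)" "edges H ! k = (y, x)"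
    by (auto simp: in_set_conv_nth)
  then show "\<exists>g. fst g < length (edges H) \<and> end_of H g = x \<and> end_of H (opp g) = y"
  proof cases
    case (1 k)
    then show ?thesis by (intro exI[of _ "(k, False)"]) (simp add: end_of_def)
  next
    case (2 k)
    then show ?thesis by (intro exI[of _ "(k, True)"]) (simp add: end_of_def)
  qed
next
  assume "\<exists>g. fst g < length (edges H) \<and> end_of H g = x \<and> end_of H (opp g) = y"
  then obtain g where "fst g < length (edges H)" "end_of H g = x" "end_of H (opp g) = y" by blast
  then show "(x, y) \<in> set (edges H) \<union> (set (edges H))\<inverse>"
    using nth_mem[of "fst g" "edges H"] by (cases "snd g") (auto simp: end_of_def opp_def)
qed

text \<open>The set of vertices reachable from one vertex is closed, and a closed set contains
  whatever is reachable from it. This brings connectedness into the form of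
  \<open>conn_on\<close>.\<close>

lemma connected_iff_closed:
  assumes V: "\<forall>(x, y) \<in> set (edges H). x \<in> vertices H \<and> y \<in> vertices H"
  shows "connected_hgraph H \<longleftrightarrow> (\<forall>U. U \<subseteq> vertices H \<longrightarrow> U \<noteq> {} \<longrightarrow> edge_closed H U \<longrightarrow> U = vertices H)"
proof
  assume c: "connected_hgraph H"
  show "\<forall>U. U \<subseteq> vertices H \<longrightarrow> U \<noteq> {} \<longrightarrow> edge_closed H U \<longrightarrow> U = vertices H"
  proof (intro allI impI)
    fix U assume U: "U \<subseteq> vertices H" "U \<noteq> {}" "edge_closed H U"
    then obtain x where x: "x \<in> U" by blast
    have "y \<in> U" if "(x, y) \<in> (set (edges H) \<union> (set (edges H))\<inverse>)\<^sup>*" for y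
      using that
    proof (induction rule: rtrancl_induct)
      case (step y z)
      then show ?case
        using U(3) edge_relation[of y z H] unfolding edge_closed_def by blast
    qed (rule x)
    then show "U = vertices H"
      using c U(1) x unfolding connected_hgraph_def by blast
  qed
next
  assume c: "\<forall>U. U \<subseteq> vertices H \<longrightarrow> U \<noteq> {} \<longrightarrow> edge_closed H U \<longrightarrow> U = vertices H"
  let ?R = "(set (edges H) \<union> (set (edges H))\<inverse>)\<^sup>*"
  show "connected_hgraph H"
    unfolding connected_hgraph_def
  proof (intro ballI)
    fix x y assume xy: "x \<in> vertices H" "y \<in> vertices H"
    have "edge_closed H {z \<in> vertices H. (x, z) \<in> ?R}"
      unfolding edge_closed_def
    proof (intro allI impI)
      fix g assume g: "fst g < length (edges H)" "end_of H g \<in> {z \<in> vertices H. (x, z) \<in> ?R}"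
      have e: "(end_of H g, end_of H (opp g)) \<in> set (edges H) \<union> (set (edges H))\<inverse>"
        unfolding edge_relation by (intro exI[of _ g]) (simp add: g(1))
      have "(x, end_of H g) \<in> ?R" using g(2) by blast
      then have "(x, end_of H (opp g)) \<in> ?R"
        by (rule rtrancl.rtrancl_into_rtrancl[OF _ e])
      then show "end_of H (opp g) \<in> {z \<in> vertices H. (x, z) \<in> ?R}"
        using edge_ends[OF V, of "opp g"] g(1) by simp
    qed
    moreover have "x \<in> {z \<in> vertices H. (x, z) \<in> ?R}" using xy(1) by simp
    ultimately have "{z \<in> vertices H. (x, z) \<in> ?R} = vertices H"
      using c[rule_format, of "{z \<in> vertices H. (x, z) \<in> ?R}"] by fast
    then have "y \<in> {z \<in> vertices H. (x, z) \<in> ?R}" using xy(2) by simp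
    then show "(x, y) \<in> ?R" by simp
  qed
qed

section \<open>The class of named hairy graphs\<close>

text \<open>Together with \<open>stable\<close> this describes, up to isomorphism, the named forms
  of hairy graphs with an internal vertex. Liveness of all edges rules out an edge between two hair
  ends.\<close>

definition hairy :: "nat \<Rightarrow> ngraph \<Rightarrow> bool" where
  "hairy h G \<longleftrightarrow> gM G = [] \<and> length (gF G) = h \<and> distinct (gF G) \<and> set (gF G) \<inter> gV G = {} \<and>
     (\<forall>x \<in> set (gF G). card (half_edges G x) = 1) \<and> live G = gE G"

lemma hairy_inner: "hairy h G \<Longrightarrow> inner G = gV G" "hairy h G \<Longrightarrow> names G = inner G \<union> set (gF G)"
  by (auto simp: hairy_def inner_def names_def)

lemma hairy_legs:
  assumes "hairy h G" "1 \<le> h"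
  shows "legs G \<noteq> {}"
proof -
  obtain x where x: "x \<in> set (gF G)"
    using assms by (cases "gF G") (auto simp: hairy_def)
  then have "card (half_edges G x) = 1" using assms by (simp add: hairy_def)
  then obtain g where "g \<in> half_edges G x" by (metis card_1_singletonE singletonI)
  then have g: "fst g \<in> gE G" "gI G (fst g, snd g) = x" by (auto simp: half_edges_def)
  moreover have "x \<notin> inner G" using x by (auto simp: inner_def)
  ultimately have "fst g \<in> legs G"
    using assms(1) unfolding legs_def hairy_def by blast
  then show ?thesis by blast
qed

lemma iso_hairy:
  assumes iso: "graph_iso p r F G G'" and G: "hairy h G"
  shows "hairy h G'"
proof -
  have inj: "inj_on r (names G)" and eq: "gF G' = map r (gF G)" "gV G' = r ` gV G" "gM G' = map p (gM G)"
      "gE G' = p ` gE G"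
    using iso by (auto simp: graph_iso_def)
  have sub: "set (gF G) \<subseteq> names G" "gV G \<subseteq> names G" by (auto simp: names_def)
  have "set (gF G') \<inter> gV G' = r ` (set (gF G) \<inter> gV G)"
    unfolding eq by (simp add: inj_on_image_Int[OF inj sub])
  moreover have "distinct (gF G')"
    using G inj sub unfolding eq by (auto simp: distinct_map hairy_def intro: inj_on_subset)
  moreover have "card (half_edges G' x') = 1" if "x' \<in> set (gF G')" for x'
    using that iso_card_half_edges[OF iso] sub(1) G by (auto simp: eq hairy_def)
  ultimately show ?thesis
    using G iso_live[OF iso] eq by (simp add: hairy_def)
qed

lemma (in splitting) hairy_split: "hairy h H \<longleftrightarrow> hairy h G"
proof -
  have H: "gF H = gF G" "gV H = insert w (gV G)" "gM H = gM G" by (simp_all add: H_def)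
  have x: "half_edges H x = half_edges G x" if "x \<in> set (gF G)" for x
    unfolding H_def using that i fr
    by (intro half_edges_split_other[OF wf fr S]) (auto simp: inner_def fresh_def names_def)
  have "w \<notin> set (gF G)" using w by (simp add: names_def)
  moreover have "live H = gE H \<longleftrightarrow> live G = gE G"
    unfolding live_split E_H using insert_ident[of e "live G" "gE G"] e legs_live(2)[of G] by blast
  ultimately show ?thesis
    using x by (auto simp: hairy_def H)
qed

lemma (in parity) exact_hairy:
  assumes "Suc v < t" "1 \<le> h"
  shows "exact (\<lambda>G. stable t G \<and> hairy h G) v"
proof -
  let ?D = "\<lambda>G. stable t G \<and> outer G (gM G) \<and> legs G \<noteq> {}"
  have "exact (\<lambda>G. ?D G \<and> hairy h G) v"
  proof (rule exact_restrict[OF _ _ exact_stable[OF assms(1)]])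
    show "graph_class ?D"
      unfolding graph_class_def
    proof
      show "invariant ?D"
      proof (rule invariant_predI)
        fix p r F G G' assume iso: "graph_iso p r F G G'" and "?D G"
        then show "?D G'"
          using invariantD[OF invariant_stable iso] iso_outer_all[OF iso] iso_legs[OF iso] by simp
      qed
    qed (simp add: stable_def)
    show "hairy h G' = hairy h G" if "graph_iso p r F G G'" for p r F G G'
      using iso_hairy[OF that] iso_hairy[OF iso_sym[OF that]] by blast
    show "hairy h G' = hairy h G" if D: "?D G" and st: "step G G'" for G G'
    proof -
      have wfG: "well_formed G" using D by (simp add: stable_def)
      obtain i S e w where s: "i \<in> inner G" "S \<in> splits G i" "fresh G e w" "G' = split_at G i S e w"
        using st unfolding step_def by blast
      interpret splitting G i S e w "split_at G i S e w"
        using splittingI[OF wfG s(1-3)] by simp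
      show ?thesis using hairy_split s(4) by simp
    qed
  qed
  then show ?thesis
    by (rule exact_cong) (use assms(2) hairy_legs in \<open>auto simp: hairy_def outer_def\<close>)
qed

lemma card_vertices: "card (vertices H) = num_internal H + num_hairs H"
proof -
  have "card (vertices H) = card (Internal ` {..<num_internal H}) + card (Hair ` {..<num_hairs H})"
    unfolding vertices_def by (intro card_Un_disjoint) auto
  then show ?thesis by (simp add: card_image inj_on_def)
qed

lemma hairy_graph_facts:
  assumes "is_hairy_graph H"
  shows "\<forall>(x, y) \<in> set (edges H). x \<in> vertices H \<and> y \<in> vertices H"
    "\<And>i. i < num_internal H \<Longrightarrow> 3 \<le> card (half_edges_at H (Internal i))"
    "\<And>j. j < num_hairs H \<Longrightarrow> card (half_edges_at H (Hair j)) = 1"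
    "connected_hgraph H" "1 \<le> num_hairs H"
  using assms by (auto simp: is_hairy_graph_def valence_def)

text \<open>Connectedness passes from the whole graph to its internal vertices, because a hair end
  is univalent and cannot serve as a passage. An internal vertex is required since the single edge
  between two hair ends has no inner part.\<close>

lemma named_hairy:
  assumes H: "is_hairy_graph H" and v: "1 \<le> num_internal H"
    and t: "length (edges H) = num_internal H + t"
  shows "stable t (named H)" "hairy (num_hairs H) (named H)"
proof -
  note f = hairy_graph_facts[OF H]
  have closed: "U = vertices H" if "U \<subseteq> vertices H" "U \<noteq> {}" "edge_closed H U" for U
    using f(4) that unfolding connected_iff_closed[OF f(1)] by blast
  have single: "g = g'" if "fst g < length (edges H)" "fst g' < length (edges H)"
    "end_of H g = Hair j" "end_of H g' = Hair j" for g g' j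
  proof -
    have "Hair j \<in> vertices H" using edge_ends[OF f(1) that(1)] that(3) by simp
    then have "j < num_hairs H" by (auto simp: vertices_def)
    then have "card (half_edges (named H) (code (Hair j))) = 1"
      using f(3) by (simp only: half_edges_named)
    moreover have "g \<in> half_edges (named H) (code (Hair j))" "g' \<in> half_edges (named H) (code (Hair j))"
      using that by (simp_all add: half_edges_def)
    ultimately show ?thesis by (metis card_1_singletonE singletonD)
  qed
  have internal: "end_of H g \<in> vertices H \<Longrightarrow> (\<nexists>j. end_of H g = Hair j) \<Longrightarrow> code (end_of H g) \<in> inner (named H)" for g
    unfolding inner_named_iff by (auto simp: vertices_def)
  have live: "live (named H) = gE (named H)"
  proof (rule equalityI[OF legs_live(2)], rule subsetI)
    fix k assume k: "k \<in> gE (named H)"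
    show "k \<in> live (named H)"
    proof (rule ccontr)
      assume "k \<notin> live (named H)"
      then have no: "code (end_of H (k, b)) \<notin> inner (named H)" for b
        using k by (auto simp: live_def)
      have vb: "end_of H (k, b) \<in> vertices H" for b
        using edge_ends[OF f(1), of "(k, b)"] k by simp
      have hb: "\<exists>j. end_of H (k, b) = Hair j" for b
        using internal[OF vb] no by blast
      let ?U = "range (\<lambda>b. end_of H (k, b))"
      have "edge_closed H ?U"
        unfolding edge_closed_def
      proof (intro allI impI)
        fix g assume g: "fst g < length (edges H)" "end_of H g \<in> ?U"
        then obtain b where b: "end_of H g = end_of H (k, b)" by blast
        obtain j where "end_of H (k, b) = Hair j" using hb by blast
        then have "g = (k, b)" using single[of g "(k, b)" j] g(1) b k by simp
        then show "end_of H (opp g) \<in> ?U" by simp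
      qed
      moreover have "?U \<subseteq> vertices H" "?U \<noteq> {}" using vb by auto
      ultimately have "?U = vertices H" using closed by blast
      moreover have "Internal 0 \<in> vertices H" using v by (auto simp: vertices_def)
      ultimately obtain b where "end_of H (k, b) = Internal 0" by (metis imageE)
      then show False using hb[of b] by simp
    qed
  qed
  have wf: "well_formed (named H)" by (rule well_formed_named[OF f(1)])
  have ci: "card (inner (named H)) = num_internal H"
    unfolding inner_named by (simp add: card_image inj_on_def)
  have conn: "conn_on (gE (named H)) (named H) (inner (named H))"
    unfolding conn_on_def
  proof (intro allI impI)
    fix U assume U: "U \<subseteq> inner (named H)" "U \<noteq> {}" "adj_closed (gE (named H)) (named H) (inner (named H)) U"
    \<comment> \<open>A closed set of internal vertices is completed to a closed set of the whole
      graph by the hair ends attached to it.\<close>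
    let ?A = "{x \<in> vertices H. code x \<in> U}"
    let ?B = "{x \<in> vertices H. (\<exists>j. x = Hair j) \<and> (\<exists>g. fst g < length (edges H) \<and> end_of H g = x \<and> code (end_of H (opp g)) \<in> U)}"
    have Uhair: "code (Hair j) \<notin> U" for j using U(1) inner_named_iff[of "Hair j" H] by blast
    have "edge_closed H (?A \<union> ?B)"
      unfolding edge_closed_def
    proof (intro allI impI)
      fix g assume g: "fst g < length (edges H)" "end_of H g \<in> ?A \<union> ?B"
      have v': "end_of H (opp g) \<in> vertices H" using edge_ends[OF f(1), of "opp g"] g(1) by simp
      show "end_of H (opp g) \<in> ?A \<union> ?B"
      proof (cases "end_of H g \<in> ?A")
        case True
        show ?thesis
        proof (cases "\<exists>j. end_of H (opp g) = Hair j")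
          case hair: True
          have "\<exists>g'. fst g' < length (edges H) \<and> end_of H g' = end_of H (opp g) \<and> code (end_of H (opp g')) \<in> U"
            using True g(1) by (intro exI[of _ "opp g"]) auto
          then show ?thesis using hair v' by blast
        next
          case False
          then have "gI (named H) (opp g) \<in> U"
            using internal[OF v'] True g(1) by (intro adj_closedD[OF U(3)]) auto
          then show ?thesis using v' by simp
        qed
      next
        case False
        then obtain j g' where g': "end_of H g = Hair j" "fst g' < length (edges H)" "end_of H g' = Hair j"
          "code (end_of H (opp g')) \<in> U"
          using g(2) by auto
        then have "g = g'" using single g(1) by blast
        then show ?thesis using g'(4) v' by simp
      qed
    qed
    moreover have "?A \<noteq> {}"
    proof -
      obtain y where "y \<in> U" using U by blast
      then obtain i where "i < num_internal H" "y = code (Internal i)"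
        using U(1) unfolding inner_named by auto
      then have "Internal i \<in> ?A" using \<open>y \<in> U\<close> by (auto simp: vertices_def)
      then show ?thesis by blast
    qed
    ultimately have all: "?A \<union> ?B = vertices H" by (intro closed) auto
    have "inner (named H) \<subseteq> U"
    proof
      fix y assume "y \<in> inner (named H)"
      then obtain i where i: "i < num_internal H" "y = code (Internal i)" unfolding inner_named by auto
      then have "Internal i \<in> ?A \<union> ?B" unfolding all by (auto simp: vertices_def)
      then show "y \<in> U" using i by auto
    qed
    then show "U = inner (named H)" using U(1) by blast
  qed
  have "3 \<le> card (half_edges (named H) z)" if z: "z \<in> inner (named H)" for z
  proof -
    obtain i where "i < num_internal H" "z = code (Internal i)" using z unfolding inner_named by auto
    then show ?thesis using f(2) by (simp only: half_edges_named)
  qed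
  moreover have "inner (named H) \<noteq> {}"
    using v unfolding inner_named by (auto simp: lessThan_empty_iff)
  ultimately show "stable t (named H)"
    using wf conn live ci t by (simp add: stable_def)
  have "card (half_edges (named H) x) = 1" if x: "x \<in> set (gF (named H))" for x
  proof -
    obtain j where "j < num_hairs H" "x = code (Hair j)" using x by auto
    then show ?thesis using f(3) by (simp only: half_edges_named)
  qed
  moreover have "set (gF (named H)) \<inter> gV (named H) = {}"
    by auto presburger
  moreover have "distinct (gF (named H))"
    by (simp add: distinct_map inj_on_def)
  ultimately show "hairy (num_hairs H) (named H)"
    using live by (simp add: hairy_def)
qed

text \<open>Edges and inner vertices are numbered arbitrarily, hair ends by their position in
  \<open>gF\<close>. The directions of the edges are taken over, so the isomorphism reverses
  none.\<close>

lemma hairy_is_named: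
  assumes st: "stable t G" and G: "hairy h G" and h: "1 \<le> h"
  obtains H p r where "is_hairy_graph H" "num_hairs H = h" "num_internal H = card (inner G)"
    "length (edges H) = num_internal H + t" "graph_iso p r {} (named H) G"
proof -
  let ?v = "card (inner G)" and ?n = "card (gE G)"
  have wf: "well_formed G" and val: "\<And>z. z \<in> inner G \<Longrightarrow> 3 \<le> card (half_edges G z)"
    and conn: "conn_on (gE G) G (inner G)" and ne: "inner G \<noteq> {}"
    and lv: "card (live G) = ?v + t"
    using st unfolding stable_def by blast+
  have gF: "length (gF G) = h" "distinct (gF G)" "gM G = []" "live G = gE G"
    and val1: "\<And>x. x \<in> set (gF G) \<Longrightarrow> card (half_edges G x) = 1"
    using G unfolding hairy_def by blast+
  obtain p where p: "bij_betw p {..<?n} (gE G)"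
    using ex_bij_betw_nat_finite[OF wf_finite(1)[OF wf]] by (auto simp: atLeast0LessThan)
  obtain r0 where r0: "bij_betw r0 {..<?v} (inner G)"
    using ex_bij_betw_nat_finite[OF wf_finite(4)[OF wf]] by (auto simp: atLeast0LessThan)
  define vname where "vname x = (case x of Internal i \<Rightarrow> r0 i | Hair j \<Rightarrow> gF G ! j)" for x
  let ?V = "Internal ` {..<?v} \<union> Hair ` {..<h}"
  have r0i: "r0 i \<in> inner G" if "i < ?v" for i using r0 that by (auto simp: bij_betw_def)
  have fnot: "gF G ! j \<notin> inner G" if "j < h" for j
    using that gF(1) nth_mem[of j "gF G"] by (auto simp: inner_def)
  have vin: "x \<in> Internal ` {..<?v}" if x: "x \<in> ?V" "vname x \<in> inner G" for x
  proof (cases x)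
    case (Hair j)
    then have "j < h" "gF G ! j \<in> inner G" using x by (auto simp: vname_def)
    then show ?thesis using fnot by blast
  qed (use x in auto)
  have bij: "bij_betw vname ?V (names G)"
  proof -
    have "bij_betw vname (Internal ` {..<?v}) (inner G)"
      using r0 by (auto simp: bij_betw_def inj_on_def vname_def image_image)
    moreover have "bij_betw vname (Hair ` {..<h}) (set (gF G))"
      using gF(1,2) by (auto simp: bij_betw_def inj_on_def vname_def image_image nth_eq_iff_index_eq set_conv_nth)
    moreover have "inner G \<inter> set (gF G) = {}" by (auto simp: inner_def)
    ultimately have "bij_betw vname ?V (inner G \<union> set (gF G))" by (rule bij_betw_combine)
    then show ?thesis using hairy_inner(2)[OF G] by simp
  qed
  define vx where "vx = inv_into ?V vname"
  have vx: "vx y \<in> ?V" "vname (vx y) = y" if "y \<in> names G" for y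
    using inv_into_into[of y vname ?V] f_inv_into_f[of y vname ?V] bij that
    unfolding vx_def bij_betw_def by blast+
  define H where "H = HGraph ?v h (map (\<lambda>k. (vx (gI G (p k, False)), vx (gI G (p k, True)))) [0..<?n])"
  have Hs: "num_internal H = ?v" "num_hairs H = h" "length (edges H) = ?n" "vertices H = ?V"
    by (simp_all add: H_def vertices_def)
  have endH: "end_of H (k, b) = vx (gI G (p k, b))" if "k < ?n" for k b
    using that by (simp add: end_of_def H_def)
  have pE: "p k \<in> gE G" if "k < ?n" for k using p that by (auto simp: bij_betw_def)
  have inN: "gI G (p k, b) \<in> names G" if "k < ?n" for k b
    using well_formed_gI[OF wf, of "(p k, b)"] pE[OF that] by simp
  have f1: "\<forall>(x, y) \<in> set (edges H). x \<in> vertices H \<and> y \<in> vertices H"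
    using vx(1)[OF inN] unfolding Hs(4) by (auto simp: H_def)
  define r where "r y = (if even y then r0 (y div 2) else gF G ! (y div 2))" for y
  have r2: "r (2 * i) = r0 i" for i by (simp add: r_def)
  have rc: "r (code x) = vname x" for x
    by (cases x) (simp_all add: r_def vname_def)
  have iso: "graph_iso p r {} (named H) G"
    unfolding graph_iso_def
  proof (intro conjI allI impI)
    show "well_formed (named H)" by (rule well_formed_named[OF f1])
    show "inj_on p (gE (named H))" "gE G = p ` gE (named H)"
      using p Hs(3) by (auto simp: bij_betw_def)
    show "inj_on r (names (named H))"
    proof (rule inj_onI)
      fix y y' assume y: "y \<in> names (named H)" "y' \<in> names (named H)" "r y = r y'"
      then obtain x x' where x: "x \<in> ?V" "x' \<in> ?V" "y = code x" "y' = code x'"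
        unfolding names_named Hs(4) by blast
      then have "vname x = vname x'" using y(3) rc by simp
      then show "y = y'" using inj_onD[OF bij_betw_imp_inj_on[OF bij] _ x(1,2)] x(3,4) by simp
    qed
    show "gV G = r ` gV (named H)"
    proof -
      have "r ` gV (named H) = r0 ` {..<?v}" by (simp add: Hs(1) image_image r2)
      then show ?thesis using r0 hairy_inner(1)[OF G] by (simp add: bij_betw_def)
    qed
    show "gF G = map r (gF (named H))"
      using gF(1) Hs(2) by (intro nth_equalityI) (auto simp: r_def)
    show "gM G = map p (gM (named H))" using gF(3) by simp
    show "gI G (p (fst g), snd g \<noteq> (fst g \<in> {})) = r (gI (named H) g)" if "fst g \<in> gE (named H)" for g
    proof -
      have k: "fst g < ?n" using that Hs(3) by simp
      have "end_of H g = vx (gI G (p (fst g), snd g))"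
        using endH[OF k, of "snd g"] by simp
      then show ?thesis using rc vx(2)[OF inN[OF k]] by simp
    qed
  qed auto
  have card_half: "card (half_edges_at H x) = card (half_edges G (vname x))" if "x \<in> ?V" for x
  proof -
    have "code x \<in> names (named H)" using that names_named Hs(4) by auto
    then have "card (half_edges G (r (code x))) = card (half_edges (named H) (code x))"
      by (rule iso_card_half_edges[OF iso])
    then show ?thesis by (simp add: half_edges_named rc)
  qed
  \<comment> \<open>As all edges are live, every hair is attached to an internal vertex;
    connectedness of the inner part therefore extends to the hair ends.\<close>
  have hair_end: "\<exists>g. fst g < length (edges H) \<and> end_of H g = Hair j \<and> (\<exists>i. end_of H (opp g) = Internal i)" if j: "j < h" for j
  proof -
    have "card (half_edges_at H (Hair j)) = 1"
      using card_half[of "Hair j"] val1[of "gF G ! j"] j gF(1) by (simp add: vname_def)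
    then obtain g where "g \<in> half_edges_at H (Hair j)" by (metis card_1_singletonE singletonI)
    then have g: "fst g < length (edges H)" "end_of H g = Hair j"
      by (auto simp: half_edges_at_def end_of_def)
    have "p (fst g) \<in> live G" using pE[of "fst g"] g(1) Hs(3) gF(4) by simp
    then obtain b where b: "gI G (p (fst g), b) \<in> inner G" by (auto simp: live_def)
    have e: "vname (end_of H (fst g, c)) = gI G (p (fst g), c)" for c
      using endH[of "fst g" c] vx(2)[OF inN[of "fst g" c]] g(1) Hs(3) by simp
    have "b \<noteq> snd g"
    proof
      assume "b = snd g"
      then have "gI G (p (fst g), b) = gF G ! j" using e[of "snd g"] g(2) by (simp add: vname_def)
      then show False using b fnot[OF j] by simp
    qed
    then have "(fst g, b) = opp g" by (simp add: opp_def)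
    then have vo: "vname (end_of H (opp g)) \<in> inner G" using e[of b] b by simp
    have "end_of H (opp g) \<in> ?V"
      using edge_ends[OF f1, of "opp g"] g(1) Hs(4) by simp
    then have "\<exists>i. end_of H (opp g) = Internal i"
      using vo fnot by (auto simp: vname_def)
    then show ?thesis using g by blast
  qed
  have "connected_hgraph H"
    unfolding connected_iff_closed[OF f1]
  proof (intro allI impI)
    fix U assume U: "U \<subseteq> vertices H" "U \<noteq> {}" "edge_closed H U"
    have sym: "end_of H g \<in> U \<longleftrightarrow> end_of H (opp g) \<in> U" if "fst g < length (edges H)" for g
      using U(3) that unfolding edge_closed_def by (metis opp_simps(1,2))
    let ?A = "vname ` (U \<inter> Internal ` {..<?v})"
    have mem: "vname x \<in> ?A \<longleftrightarrow> x \<in> U" if "x \<in> Internal ` {..<?v}" for x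
    proof -
      have "vname x \<in> ?A \<longleftrightarrow> x \<in> U \<inter> Internal ` {..<?v}"
        using that U(1) Hs(4) by (intro inj_on_image_mem_iff[OF bij_betw_imp_inj_on[OF bij]]) auto
      then show ?thesis using that by blast
    qed
    have "?A = inner G"
    proof (rule conn_onD[OF conn])
      show "?A \<subseteq> inner G" using r0i by (auto simp: vname_def)
      show "?A \<noteq> {}"
      proof -
        obtain x where x: "x \<in> U" using U by blast
        show ?thesis
        proof (cases x)
          case (Internal i)
          then show ?thesis using x U(1) Hs(4) by auto
        next
          case (Hair j)
          then have "j < h" using x U(1) Hs(4) by auto
          then obtain g i where g: "fst g < length (edges H)" "end_of H g = Hair j" "end_of H (opp g) = Internal i"
            using hair_end by blast
          then have "Internal i \<in> U" using sym[OF g(1)] x Hair by simp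
          then show ?thesis using U(1) Hs(4) by auto
        qed
      qed
      show "adj_closed (gE G) G (inner G) ?A"
      proof (rule adj_closedI)
        fix g assume g: "fst g \<in> gE G" "gI G g \<in> ?A" "gI G (opp g) \<in> inner G"
        obtain k where k: "k < ?n" "fst g = p k" using g(1) p by (auto simp: bij_betw_def)
        let ?g = "(k, snd g)"
        have e: "vname (end_of H (k, c)) = gI G (p k, c)" for c
          using endH[OF k(1), of c] vx(2)[OF inN[OF k(1), of c]] by simp
        have eV: "end_of H (k, c) \<in> ?V" for c
          using edge_ends[OF f1, of "(k, c)"] k(1) Hs by simp
        have int: "end_of H (k, c) \<in> Internal ` {..<?v}" if "gI G (p k, c) \<in> inner G" for c
          using vin[OF eV[of c]] e[of c] that by simp
        have gs: "(p k, snd g) = g" "(p k, \<not> snd g) = opp g"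
          using k(2) by (simp_all add: prod_eq_iff opp_def)
        have Ain: "gI G g \<in> inner G" using g(2) r0i by (auto simp: vname_def)
        have "end_of H ?g \<in> U"
          using mem[OF int[of "snd g"]] e[of "snd g"] g(2) Ain gs(1) by simp
        then have "end_of H (k, \<not> snd g) \<in> U"
          using sym[of ?g] k(1) Hs(3) by simp
        then show "gI G (opp g) \<in> ?A"
          using mem[OF int[of "\<not> snd g"]] e[of "\<not> snd g"] g(3) gs(2) by simp
      qed
    qed
    then have inU: "Internal i \<in> U" if "i < ?v" for i
      using mem[of "Internal i"] r0i[OF that] that by (simp add: vname_def)
    have "Hair j \<in> U" if j: "j < h" for j
    proof -
      obtain g i where g: "fst g < length (edges H)" "end_of H g = Hair j" "end_of H (opp g) = Internal i"
        using hair_end[OF j] by blast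
      have "Internal i \<in> vertices H" using edge_ends[OF f1, of "opp g"] g by simp
      then have "Internal i \<in> U" using inU Hs(4) by auto
      then show ?thesis using sym[OF g(1)] g(2,3) by simp
    qed
    then show "U = vertices H" using inU U(1) Hs(4) by auto
  qed
  then have "is_hairy_graph H"
    unfolding is_hairy_graph_def valence_def Hs(1,2)
    using h f1 card_half val val1 r0i gF(1) by (auto simp: vname_def)
  moreover have "length (edges H) = num_internal H + t"
    using lv gF(4) Hs by simp
  ultimately show thesis using Hs iso by (intro that) auto
qed

section \<open>Reorientation, splitting and valence of numbered graphs\<close>

lemma hgraph_eqI:
  assumes "num_internal H = num_internal H'" "num_hairs H = num_hairs H'"
    "length (edges H) = length (edges H')"
    "\<And>k b. k < length (edges H) \<Longrightarrow> end_of H (k, b) = end_of H' (k, b)"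
  shows "H = H'"
proof -
  have "edges H = edges H'"
  proof (rule nth_equalityI)
    fix k assume "k < length (edges H)"
    then show "edges H ! k = edges H' ! k"
      using assms(4)[of k True] assms(4)[of k False] by (simp add: end_of_def prod_eq_iff)
  qed (rule assms(3))
  then show ?thesis using assms(1,2) by (cases H; cases H') simp
qed

lemma half_edges_at_end: "half_edges_at H x = {g. fst g < length (edges H) \<and> end_of H g = x}"
  by (auto simp: half_edges_at_def end_of_def)

lemma hairy_graph_iff:
  "is_hairy_graph H \<longleftrightarrow> 1 \<le> num_hairs H \<and>
     (\<forall>g. fst g < length (edges H) \<longrightarrow> end_of H g \<in> vertices H) \<and>
     (\<forall>i < num_internal H. 3 \<le> card (half_edges_at H (Internal i))) \<and>
     (\<forall>j < num_hairs H. card (half_edges_at H (Hair j)) = 1) \<and>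
     (\<forall>U. U \<subseteq> vertices H \<longrightarrow> U \<noteq> {} \<longrightarrow> edge_closed H U \<longrightarrow> U = vertices H)"
proof -
  have ends: "(\<forall>g. fst g < length (edges H) \<longrightarrow> end_of H g \<in> vertices H) \<longleftrightarrow>
      (\<forall>(x, y) \<in> set (edges H). x \<in> vertices H \<and> y \<in> vertices H)" (is "?A \<longleftrightarrow> ?B")
  proof
    assume A: ?A
    show ?B
    proof
      fix e assume "e \<in> set (edges H)"
      then obtain k where k: "k < length (edges H)" "edges H ! k = e" by (auto simp: in_set_conv_nth)
      then show "case e of (x, y) \<Rightarrow> x \<in> vertices H \<and> y \<in> vertices H"
        using A[rule_format, of "(k, True)"] A[rule_format, of "(k, False)"]
        by (simp add: end_of_def split_beta)
    qed
  qed (use edge_ends in blast)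
  show ?thesis
  proof (cases "\<forall>(x, y) \<in> set (edges H). x \<in> vertices H \<and> y \<in> vertices H")
    case True
    show ?thesis
      unfolding is_hairy_graph_def valence_def ends connected_iff_closed[OF True] by (rule refl)
  next
    case False
    then show ?thesis unfolding is_hairy_graph_def ends by (simp only: simp_thms)
  qed
qed

lemma hairy_graphD:
  assumes "is_hairy_graph H"
  shows "1 \<le> num_hairs H" "\<And>g. fst g < length (edges H) \<Longrightarrow> end_of H g \<in> vertices H"
    "\<And>i. i < num_internal H \<Longrightarrow> 3 \<le> card (half_edges_at H (Internal i))"
    "\<And>j. j < num_hairs H \<Longrightarrow> card (half_edges_at H (Hair j)) = 1"
    "\<And>U. U \<subseteq> vertices H \<Longrightarrow> U \<noteq> {} \<Longrightarrow> edge_closed H U \<Longrightarrow> U = vertices H"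
proof -
  note h = assms[unfolded hairy_graph_iff]
  show "1 \<le> num_hairs H" by (rule h[THEN conjunct1])
  note h = h[THEN conjunct2]
  show "end_of H g \<in> vertices H" if "fst g < length (edges H)" for g
    using that by (rule h[THEN conjunct1, rule_format])
  note h = h[THEN conjunct2]
  show "3 \<le> card (half_edges_at H (Internal i))" if "i < num_internal H" for i
    using that by (rule h[THEN conjunct1, rule_format])
  note h = h[THEN conjunct2]
  show "card (half_edges_at H (Hair j)) = 1" if "j < num_hairs H" for j
    using that by (rule h[THEN conjunct1, rule_format])
  show "U = vertices H" if "U \<subseteq> vertices H" "U \<noteq> {}" "edge_closed H U" for U
    using that by (rule h[THEN conjunct2, rule_format])
qed

lemma reorient_simps [simp]:
  "num_internal (reorient p q r F H) = num_internal H"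
  "num_hairs (reorient p q r F H) = num_hairs H"
  "length (edges (reorient p q r F H)) = length (edges H)"
  by (simp_all add: reorient_def flip_edges_def)

lemma end_of_reorient:
  assumes "p permutes {..<length (edges H)}" "k < length (edges H)"
  shows "end_of (reorient p q r F H) (k, b) = relabel q r (end_of H (p k, b \<noteq> (k \<in> F)))"
proof -
  have "p k < length (edges H)" using permutes_in_image[OF assms(1)] assms(2) by auto
  then show ?thesis
    using assms by (cases b) (auto simp: end_of_def reorient_def flip_edges_def permute_list_nth)
qed

lemma split_vertex_simps [simp]:
  "num_internal (split_vertex i S H) = Suc (num_internal H)"
  "num_hairs (split_vertex i S H) = num_hairs H"
  "length (edges (split_vertex i S H)) = Suc (length (edges H))"
  by (simp_all add: split_vertex_def Let_def)

lemma end_of_split_vertex: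
  "end_of (split_vertex i S H) (0, b) = Internal (if b then num_internal H else i)"
  "k < length (edges H) \<Longrightarrow> end_of (split_vertex i S H) (Suc k, b) =
     (if (k, b) \<in> S then Internal (num_internal H) else end_of H (k, b))"
  by (auto simp: end_of_def split_vertex_def Let_def)

lemma vertices_iff: "Internal i \<in> vertices H \<longleftrightarrow> i < num_internal H"
    "Hair j \<in> vertices H \<longleftrightarrow> j < num_hairs H"
  by (auto simp: vertices_def)

lemma relabel_inj: "inj q \<Longrightarrow> inj r \<Longrightarrow> relabel q r x = relabel q r y \<longleftrightarrow> x = y"
  by (cases x; cases y) (auto simp: inj_eq)

lemma relabel_comp: "relabel q r (relabel q' r' x) = relabel (q \<circ> q') (r \<circ> r') x"
  by (cases x) auto

text \<open>The half-edge of the reoriented graph that comes from \<open>g\<close>. The inverse of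
  \<open>p\<close> appears because \<open>permute_list p\<close> puts the old edge
  \<open>p k\<close> into position \<open>k\<close>, and \<open>F\<close> refers to the new
  positions.\<close>

definition hedge_map :: "(nat \<Rightarrow> nat) \<Rightarrow> nat set \<Rightarrow> nat \<times> bool \<Rightarrow> nat \<times> bool" where
  "hedge_map p F g = (inv_into UNIV p (fst g), snd g \<noteq> (inv_into UNIV p (fst g) \<in> F))"

lemma hedge_map:
  assumes p: "p permutes {..<length (edges H)}"
  shows "inj (hedge_map p F)"
    "fst g < length (edges H) \<Longrightarrow>
      end_of (reorient p q r F H) (hedge_map p F g) = relabel q r (end_of H g)"
    "fst (hedge_map p F g) < length (edges H) \<longleftrightarrow> fst g < length (edges H)"
    "hedge_map p F (p k, b \<noteq> (k \<in> F)) = (k, b)"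
    "opp (hedge_map p F g) = hedge_map p F (opp g)"
proof -
  note inv_simps = permutes_inverses[OF p]
  show "inj (hedge_map p F)"
  proof (rule injI)
    fix g g' assume eq: "hedge_map p F g = hedge_map p F g'"
    then have "fst g = fst g'"
      using inv_simps(1) by (metis hedge_map_def fst_conv)
    then show "g = g'" using eq by (auto simp: hedge_map_def prod_eq_iff)
  qed
  show lt: "fst (hedge_map p F g) < length (edges H) \<longleftrightarrow> fst g < length (edges H)" for g
    using permutes_in_image[OF permutes_inv[OF p], of "fst g"] by (simp add: hedge_map_def)
  show "end_of (reorient p q r F H) (hedge_map p F g) = relabel q r (end_of H g)"
    if "fst g < length (edges H)"
  proof -
    have "inv_into UNIV p (fst g) < length (edges H)" using lt[of g] that by (simp add: hedge_map_def)
    moreover have "(fst g, (snd g \<noteq> (inv_into UNIV p (fst g) \<in> F)) \<noteq> (inv_into UNIV p (fst g) \<in> F)) = g"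
      by (auto simp: prod_eq_iff)
    ultimately show ?thesis
      using inv_simps(1) unfolding hedge_map_def by (simp add: end_of_reorient[OF p])
  qed
  show "hedge_map p F (p k, b \<noteq> (k \<in> F)) = (k, b)"
    using inv_simps(2) by (auto simp: hedge_map_def)
  show "opp (hedge_map p F g) = hedge_map p F (opp g)"
    by (auto simp: hedge_map_def opp_def)
qed

lemma hedge_map_cases:
  assumes p: "p permutes {..<length (edges H)}" and g: "fst g < length (edges H)"
  obtains g' where "fst g' < length (edges H)" "g = hedge_map p F g'"
proof
  let ?g = "(p (fst g), snd g \<noteq> (fst g \<in> F))"
  show "g = hedge_map p F ?g" using hedge_map(4)[OF p] by simp
  then show "fst ?g < length (edges H)" using hedge_map(3)[OF p, of F ?g] g by simp
qed

lemma half_edges_reorient: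
  assumes "p permutes {..<length (edges H)}" "inj q" "inj r"
  shows "half_edges_at (reorient p q r F H) (relabel q r x) = hedge_map p F ` half_edges_at H x"
proof (intro equalityI subsetI)
  fix g assume "g \<in> half_edges_at (reorient p q r F H) (relabel q r x)"
  then have g: "fst g < length (edges H)" "end_of (reorient p q r F H) g = relabel q r x"
    by (auto simp: half_edges_at_end)
  obtain g' where g': "fst g' < length (edges H)" "g = hedge_map p F g'"
    by (rule hedge_map_cases[OF assms(1) g(1)])
  then have "end_of H g' = x"
    using g(2) hedge_map(2)[OF assms(1) g'(1)] relabel_inj[OF assms(2,3)] by simp
  then show "g \<in> hedge_map p F ` half_edges_at H x" using g' by (auto simp: half_edges_at_end)
next
  fix g assume "g \<in> hedge_map p F ` half_edges_at H x"
  then obtain g' where g': "fst g' < length (edges H)" "end_of H g' = x" "g = hedge_map p F g'"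
    by (auto simp: half_edges_at_end)
  then show "g \<in> half_edges_at (reorient p q r F H) (relabel q r x)"
    using hedge_map(2,3)[OF assms(1)] by (simp add: half_edges_at_end)
qed

lemma reorient_hairy:
  assumes H: "is_hairy_graph H" and p: "p permutes {..<length (edges H)}"
    and q: "q permutes {..<num_internal H}" and r: "r permutes {..<num_hairs H}"
  shows "is_hairy_graph (reorient p q r F H)"
proof -
  let ?R = "reorient p q r F H"
  note inj = permutes_inj[OF q] permutes_inj[OF r]
  note f = hairy_graphD[OF H]
  have V: "vertices ?R = vertices H" by (simp add: vertices_def)
  have relV: "relabel q r x \<in> vertices H \<longleftrightarrow> x \<in> vertices H" for x
    using permutes_in_image[OF q] permutes_in_image[OF r] by (cases x) (simp_all add: vertices_iff)
  have surj: "\<exists>x. y = relabel q r x" for y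
  proof (cases y)
    case (Internal i)
    then show ?thesis using permutes_inverses(1)[OF q] by (intro exI[of _ "Internal (inv_into UNIV q i)"]) simp
  next
    case (Hair j)
    then show ?thesis using permutes_inverses(1)[OF r] by (intro exI[of _ "Hair (inv_into UNIV r j)"]) simp
  qed
  have cd: "card (half_edges_at ?R (relabel q r x)) = card (half_edges_at H x)" for x
    unfolding half_edges_reorient[OF p inj]
    by (rule card_image) (rule inj_on_subset[OF hedge_map(1)[OF p]], simp)
  have ends: "end_of ?R g \<in> vertices H" if g: "fst g < length (edges H)" for g
  proof -
    obtain g' where g': "fst g' < length (edges H)" "g = hedge_map p F g'"
      by (rule hedge_map_cases[OF p g])
    then show ?thesis using hedge_map(2)[OF p g'(1)] f(2)[OF g'(1)] relV by simp
  qed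
  have "3 \<le> card (half_edges_at ?R (Internal i))" if "i < num_internal H" for i
  proof -
    obtain x where x: "Internal i = relabel q r x" using surj by blast
    then obtain i' where "x = Internal i'" by (cases x) auto
    then show ?thesis using x relV[of x] that f(3,4) cd[of x] by (simp add: vertices_iff)
  qed
  moreover have "card (half_edges_at ?R (Hair j)) = 1" if "j < num_hairs H" for j
  proof -
    obtain x where x: "Hair j = relabel q r x" using surj by blast
    then obtain i' where "x = Hair i'" by (cases x) auto
    then show ?thesis using x relV[of x] that f(3,4) cd[of x] by (simp add: vertices_iff)
  qed
  moreover have "U = vertices H" if U: "U \<subseteq> vertices H" "U \<noteq> {}" "edge_closed ?R U" for U
  proof -
    let ?U = "{x. relabel q r x \<in> U}"
    have "?U = vertices H"
    proof -
      have "?U \<subseteq> vertices H" using U(1) relV by auto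
      moreover have "?U \<noteq> {}"
      proof -
        obtain y where "y \<in> U" using U(2) by blast
        moreover obtain x where "y = relabel q r x" using surj by blast
        ultimately show ?thesis by blast
      qed
      moreover have "edge_closed H ?U"
        unfolding edge_closed_def
      proof (intro allI impI)
        fix g assume g: "fst g < length (edges H)" "end_of H g \<in> ?U"
        have "end_of ?R (hedge_map p F g) \<in> U" using g hedge_map(2)[OF p g(1)] by simp
        then have "end_of ?R (hedge_map p F (opp g)) \<in> U"
          using U(3) hedge_map(3,5)[OF p] g(1) unfolding edge_closed_def by (metis reorient_simps(3))
        then show "end_of H (opp g) \<in> ?U" using hedge_map(2)[OF p, of "opp g"] g(1) by simp
      qed
      ultimately show ?thesis by (rule f(5))
    qed
    have "y \<in> U" if "y \<in> vertices H" for y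
    proof -
      obtain x where x: "y = relabel q r x" using surj by blast
      then have "x \<in> ?U" using that relV \<open>?U = vertices H\<close> by blast
      then show ?thesis using x by simp
    qed
    then show ?thesis using U(1) by blast
  qed
  ultimately show ?thesis
    unfolding hairy_graph_iff V using ends f(1) by (simp del: split_paired_All)
qed

lemma finite_half_edges_at: "finite (half_edges_at H x)"
proof (rule finite_subset)
  show "half_edges_at H x \<subseteq> {..<length (edges H)} \<times> UNIV" by (auto simp: half_edges_at_end)
qed simp

lemma split_vertex_hairy:
  assumes H: "is_hairy_graph H" and i: "i < num_internal H" and S: "S \<in> splittings H i"
  shows "is_hairy_graph (split_vertex i S H)"
proof -
  let ?G = "split_vertex i S H" and ?w = "Internal (num_internal H)"
  \<comment> \<open>Old edges are shifted by one, since the connecting edge is numbered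
    first.\<close>
  let ?s = "\<lambda>g :: nat \<times> bool. (Suc (fst g), snd g)"
  note f = hairy_graphD[OF H]
  have Sh: "S \<subseteq> half_edges_at H (Internal i)" "2 \<le> card S" "2 \<le> card (half_edges_at H (Internal i) - S)"
    using S by (auto simp: splittings_def)
  have V: "vertices ?G = insert ?w (vertices H)" by (auto simp: vertices_def lessThan_Suc)
  have wn: "?w \<notin> vertices H" by (simp add: vertices_iff)
  have e0: "end_of ?G (0, b) = (if b then ?w else Internal i)" for b
    by (simp add: end_of_split_vertex)
  have e1: "end_of ?G (?s g) = (if g \<in> S then ?w else end_of H g)" if "fst g < length (edges H)" for g
    using end_of_split_vertex(2)[OF that, of i S "snd g"] by simp
  have gcases: "(\<exists>b. g = (0, b)) \<or> (\<exists>g'. fst g' < length (edges H) \<and> g = ?s g')"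
    if "fst g < Suc (length (edges H))" for g
    using that by (cases g; cases "fst g") auto
  have injs: "inj_on ?s A" for A by (rule inj_onI) (simp add: prod_eq_iff)
  have hx: "half_edges_at ?G x = (if x = ?w then insert (0, True) (?s ` S)
      else if x = Internal i then insert (0, False) (?s ` (half_edges_at H x - S))
      else ?s ` half_edges_at H x)" if x: "x \<in> vertices ?G" for x
  proof (rule Set.set_eqI)
    fix g
    show "g \<in> half_edges_at ?G x \<longleftrightarrow> g \<in> (if x = ?w then insert (0, True) (?s ` S)
      else if x = Internal i then insert (0, False) (?s ` (half_edges_at H x - S))
      else ?s ` half_edges_at H x)"
    proof (cases "fst g < Suc (length (edges H))")
      case False
      then have "g \<notin> ?s ` half_edges_at H y" for y by (auto simp: half_edges_at_end)
      then show ?thesis using False Sh(1) by (auto simp: half_edges_at_end)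
    next
      case True
      consider b where "g = (0, b)" | g' where "fst g' < length (edges H)" "g = ?s g'"
        using gcases[OF True] by blast
      then show ?thesis
      proof cases
        case (1 b)
        then show ?thesis using i by (auto simp: half_edges_at_end e0)
      next
        case (2 g')
        have ins: "?s g' \<in> ?s ` A \<longleftrightarrow> g' \<in> A" for A using inj_image_mem_iff[OF injs, of g' A] by simp
        have "end_of H g' \<noteq> ?w" using f(2)[OF 2(1)] wn by metis
        moreover have "g' \<in> S \<Longrightarrow> end_of H g' = Internal i" using Sh(1) by (auto simp: half_edges_at_end)
        moreover have "?s g' \<noteq> (0, b)" for b by simp
        moreover have "g \<in> half_edges_at ?G x \<longleftrightarrow> (if g' \<in> S then ?w else end_of H g') = x"
          using e1[OF 2(1)] 2 by (simp add: half_edges_at_end)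
        ultimately show ?thesis
          using 2 i by (simp only: ins insert_iff if_distrib[of "\<lambda>A. ?s g' \<in> A"] Diff_iff)
            (auto simp: half_edges_at_end)
      qed
    qed
  qed
  have cs: "card (?s ` A) = card A" for A by (rule card_image[OF injs])
  have fin: "finite S" using Sh(1) finite_half_edges_at finite_subset by blast
  have ends: "end_of ?G g \<in> vertices ?G" if g: "fst g < Suc (length (edges H))" for g
  proof -
    consider b where "g = (0, b)" | g' where "fst g' < length (edges H)" "g = ?s g'"
      using gcases[OF g] by blast
    then show ?thesis
    proof cases
      case (1 b)
      then show ?thesis using i e0[of b] unfolding V by (simp add: vertices_iff)
    next
      case (2 g')
      then show ?thesis using e1[OF 2(1)] f(2)[OF 2(1)] unfolding V by simp
    qed
  qed
  have v3: "3 \<le> card (half_edges_at ?G (Internal j))" if j: "j < Suc (num_internal H)" for j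
  proof -
    have jV: "Internal j \<in> vertices ?G" using j by (simp add: vertices_iff)
    consider "j = num_internal H" | "j = i" "j \<noteq> num_internal H" | "j < num_internal H" "j \<noteq> i"
      using j by linarith
    then show ?thesis
    proof cases
      case 1
      have "(0, True) \<notin> ?s ` S" by auto
      then show ?thesis using hx[OF jV] 1 Sh(2) fin cs[of S] by (simp add: card_insert_if)
    next
      case 2
      have "(0, False) \<notin> ?s ` (half_edges_at H (Internal j) - S)" by auto
      then show ?thesis
        using hx[OF jV] 2 Sh(3) finite_half_edges_at[of H] cs[of "half_edges_at H (Internal j) - S"]
        by (simp add: card_insert_if)
    next
      case 3
      then show ?thesis using hx[OF jV] f(3) cs[of "half_edges_at H (Internal j)"] by simp
    qed
  qed
  have v1: "card (half_edges_at ?G (Hair j)) = 1" if j: "j < num_hairs H" for j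
  proof -
    have "half_edges_at ?G (Hair j) = ?s ` half_edges_at H (Hair j)"
      using hx[of "Hair j"] j by (simp add: vertices_iff)
    then show ?thesis using cs[of "half_edges_at H (Hair j)"] f(4) j by simp
  qed
  have conn: "U = vertices ?G" if U: "U \<subseteq> vertices ?G" "U \<noteq> {}" "edge_closed ?G U" for U
  proof -
    have "end_of ?G (0, False) \<in> U \<longleftrightarrow> end_of ?G (0, True) \<in> U"
      using U(3)[unfolded edge_closed_def, rule_format, of "(0, False)"]
        U(3)[unfolded edge_closed_def, rule_format, of "(0, True)"] by (auto simp: opp_def)
    then have iw: "Internal i \<in> U \<longleftrightarrow> ?w \<in> U" by (simp add: e0)
    have mem: "end_of ?G (?s g) \<in> U \<longleftrightarrow> end_of H g \<in> U" if "fst g < length (edges H)" for g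
      using e1[OF that] iw Sh(1) by (auto simp: half_edges_at_end)
    have "edge_closed H (U \<inter> vertices H)"
      unfolding edge_closed_def
    proof (intro allI impI)
      fix g assume g: "fst g < length (edges H)" "end_of H g \<in> U \<inter> vertices H"
      then have "end_of ?G (opp (?s g)) \<in> U"
        using U(3)[unfolded edge_closed_def, rule_format, of "?s g"] mem[OF g(1)] by simp
      moreover have "opp (?s g) = ?s (opp g)" by (simp add: opp_def)
      ultimately show "end_of H (opp g) \<in> U \<inter> vertices H"
        using mem[of "opp g"] g(1) f(2)[of "opp g"] by simp
    qed
    moreover have "U \<inter> vertices H \<noteq> {}"
      using U(1,2) iw i unfolding V by (auto simp: vertices_iff)
    ultimately have "U \<inter> vertices H = vertices H" by (intro f(5)) auto
    moreover have "Internal i \<in> vertices H" using i by (simp add: vertices_iff)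
    ultimately have "insert ?w (vertices H) \<subseteq> U" using iw by blast
    then show ?thesis using U(1) unfolding V by blast
  qed
  show ?thesis
    unfolding hairy_graph_iff[of ?G] using ends v3 v1 conn f(1) by (simp del: split_paired_All)
qed

text \<open>Half-edges are counted by the vertices at which they sit. The inequality will bound the
  number of internal vertices from above; the equation takes care of graphs without internal
  vertices.\<close>

lemma valence_count:
  assumes H: "is_hairy_graph H"
  shows "3 * num_internal H + num_hairs H \<le> 2 * length (edges H)"
    "num_internal H = 0 \<Longrightarrow> 2 * length (edges H) = num_hairs H"
proof -
  note f = hairy_graphD[OF H]
  have "{..<length (edges H)} \<times> (UNIV :: bool set) = (\<Union>x \<in> vertices H. half_edges_at H x)"
    using f(2) by (auto simp: half_edges_at_end)
  then have "2 * length (edges H) = card (\<Union>x \<in> vertices H. half_edges_at H x)"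
    by (metis card_UNIV_bool card_cartesian_product card_lessThan mult.commute)
  also have "\<dots> = (\<Sum>x \<in> vertices H. card (half_edges_at H x))"
    by (rule card_UN_disjoint) (auto simp: vertices_def finite_half_edges_at[unfolded half_edges_at_end] half_edges_at_end)
  also have "\<dots> = (\<Sum>x \<in> Internal ` {..<num_internal H}. card (half_edges_at H x)) +
      (\<Sum>x \<in> Hair ` {..<num_hairs H}. card (half_edges_at H x))"
    unfolding vertices_def by (rule sum.union_disjoint) auto
  also have "(\<Sum>x \<in> Hair ` {..<num_hairs H}. card (half_edges_at H x)) = num_hairs H"
    using f(4) by (subst sum.reindex) (auto simp: inj_on_def)
  also have "(\<Sum>x \<in> Internal ` {..<num_internal H}. card (half_edges_at H x)) =
      (\<Sum>i < num_internal H. card (half_edges_at H (Internal i)))"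
    by (subst sum.reindex) (auto simp: inj_on_def)
  finally have eq: "2 * length (edges H) =
      (\<Sum>i < num_internal H. card (half_edges_at H (Internal i))) + num_hairs H" .
  show "3 * num_internal H + num_hairs H \<le> 2 * length (edges H)"
    using sum_mono[of "{..<num_internal H}" "\<lambda>_. 3" "\<lambda>i. card (half_edges_at H (Internal i))"] f(3) eq by simp
  show "2 * length (edges H) = num_hairs H" if "num_internal H = 0" using eq that by simp
qed

text \<open>The connecting edge keeps position zero, so a reorientation acts on the splittings of a
  graph by this shifted permutation. The pairs with zero keep their order and contribute no
  sign.\<close>

lemma sign_shift:
  assumes p: "p permutes {..<n}"
  defines "p' \<equiv> (\<lambda>k. case k of 0 \<Rightarrow> 0 | Suc j \<Rightarrow> Suc (p j))"
  shows "p' permutes {..<Suc n}" "sign p' = sign p"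
proof -
  have eq: "{..<Suc n} = insert 0 (Suc ` {..<n})" by (simp add: lessThan_Suc_eq_insert_0)
  have Sp: "p' (Suc k) = Suc (p k)" "p' 0 = 0" for k by (simp_all add: p'_def)
  show perm: "p' permutes {..<Suc n}"
  proof (rule bij_imp_permutes)
    have "inj_on p' (Suc ` {..<n})"
      by (rule inj_onI) (auto simp: Sp inj_eq[OF permutes_inj[OF p]])
    then have "inj_on p' {..<Suc n}" unfolding eq by (auto simp: Sp)
    moreover have "p' ` {..<Suc n} = {..<Suc n}"
    proof -
      have "p' ` {..<Suc n} = insert 0 (Suc ` p ` {..<n})" unfolding eq by (simp add: Sp image_image)
      then show ?thesis by (simp only: permutes_image[OF p] eq)
    qed
    ultimately show "bij_betw p' {..<Suc n} {..<Suc n}" by (simp add: bij_betw_def)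
    show "p' k = k" if "k \<notin> {..<Suc n}" for k
      using that permutes_not_in[OF p] by (cases k) (auto simp: Sp)
  qed
  have injp: "inj p'" by (rule permutes_inj[OF perm])
  have "pair_sign p' {..<Suc n} = pair_sign p' (Suc ` {..<n}) *
      (\<Prod>j \<in> Suc ` {..<n}. if (j < 0) = (p' j < p' 0) then 1 else - 1)"
    unfolding eq
    by (rule pair_sign_insert) (simp, simp, rule inj_on_subset[OF injp subset_UNIV])
  also have "(\<Prod>j \<in> Suc ` {..<n}. if (j < 0) = (p' j < p' 0) then 1 else - 1) = (1 :: rat)"
    by (intro prod.neutral) (simp add: Sp)
  also have "pair_sign p' (Suc ` {..<n}) = pair_sign (\<lambda>k. p' (Suc k)) {..<n}"
    using pair_sign_comp[of "{..<n}" Suc p'] pair_sign_mono_on[of "{..<n}" Suc]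
      inj_on_subset[OF injp subset_UNIV] by simp
  also have "\<dots> = pair_sign p {..<n}"
    using pair_sign_comp[of "{..<n}" p Suc] pair_sign_mono_on[of "p ` {..<n}" Suc]
      inj_on_subset[OF permutes_inj[OF p] subset_UNIV] by (simp add: Sp)
  finally show "sign p' = sign p"
    using pair_sign_permutes[OF _ perm] pair_sign_permutes[OF _ p] by simp
qed

lemma splittings_reorient:
  assumes p: "p permutes {..<length (edges H)}" and "inj q" "inj r"
  shows "splittings (reorient p q r F H) (q i) = (`) (hedge_map p F) ` splittings H i"
proof -
  let ?f = "hedge_map p F" and ?A = "half_edges_at H (Internal i)"
  have inj: "inj ?f" by (rule hedge_map(1)[OF p])
  have A: "half_edges_at (reorient p q r F H) (Internal (q i)) = ?f ` ?A"
    using half_edges_reorient[OF assms, of F "Internal i"] by simp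
  have c: "card (?f ` B) = card B" for B by (rule card_image[OF inj_on_subset[OF inj]]) simp
  show ?thesis
  proof (intro equalityI subsetI)
    fix S' assume S': "S' \<in> splittings (reorient p q r F H) (q i)"
    then obtain S where S: "S \<subseteq> ?A" "S' = ?f ` S" unfolding splittings_def A by (auto elim: subset_imageE)
    then have "S \<in> splittings H i"
      using S' unfolding splittings_def A by (simp add: image_set_diff[OF inj, symmetric] c)
    then show "S' \<in> (`) ?f ` splittings H i" using S(2) by blast
  next
    fix S' assume "S' \<in> (`) ?f ` splittings H i"
    then obtain S where "S \<in> splittings H i" "S' = ?f ` S" by blast
    then show "S' \<in> splittings (reorient p q r F H) (q i)"
      unfolding splittings_def A by (simp add: image_set_diff[OF inj, symmetric] c image_mono)
  qed
qed

lemma split_reorient: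
  assumes p: "p permutes {..<length (edges H)}" and q: "q permutes {..<num_internal H}"
    and S: "S \<subseteq> half_edges_at H (Internal i)"
  shows "split_vertex (q i) (hedge_map p F ` S) (reorient p q r F H) =
    reorient (\<lambda>k. case k of 0 \<Rightarrow> 0 | Suc j \<Rightarrow> Suc (p j)) q r (Suc ` F) (split_vertex i S H)"
    (is "?L = reorient ?p q r ?F ?G")
proof (rule hgraph_eqI)
  fix k b assume k: "k < length (edges ?L)"
  have R: "end_of (reorient ?p q r ?F ?G) (k, b) = relabel q r (end_of ?G (?p k, b \<noteq> (k \<in> ?F)))"
    using k sign_shift(1)[OF p] by (intro end_of_reorient) simp_all
  show "end_of ?L (k, b) = end_of (reorient ?p q r ?F ?G) (k, b)"
  proof (cases k)
    case 0
    have "q (num_internal H) = num_internal H" using permutes_not_in[OF q] by simp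
    then show ?thesis unfolding R using 0 by (auto simp: end_of_split_vertex)
  next
    case (Suc j)
    then have j: "j < length (edges H)" using k by simp
    let ?g = "(p j, b \<noteq> (j \<in> F))"
    have "hedge_map p F ?g = (j, b)" by (rule hedge_map(4)[OF p])
    then have "(j, b) \<in> hedge_map p F ` S \<longleftrightarrow> ?g \<in> S"
      using inj_image_mem_iff[OF hedge_map(1)[OF p, of F], of ?g S] by simp
    moreover have "p j < length (edges H)" using permutes_in_image[OF p] j by auto
    moreover have "q (num_internal H) = num_internal H" using permutes_not_in[OF q] by simp
    moreover have "Suc j \<in> ?F \<longleftrightarrow> j \<in> F" by auto
    ultimately show ?thesis
      unfolding R using Suc j end_of_split_vertex(2)[of "p j" H i S] end_of_reorient[OF p j, of q r F b]
      by (auto simp: end_of_split_vertex)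
  qed
qed simp_all

section \<open>Isomorphisms of named graphs as reorientations\<close>

definition hgraphs :: "nat \<Rightarrow> nat \<Rightarrow> nat \<Rightarrow> hgraph set" where
  "hgraphs h t v = {H. is_hairy_graph H \<and> num_hairs H = h \<and> num_internal H = v \<and>
     length (edges H) = v + t}"

lemma hgraphsD:
  assumes "H \<in> hgraphs h t v"
  shows "is_hairy_graph H" "num_hairs H = h" "num_internal H = v" "length (edges H) = v + t"
  using assms by (simp_all add: hgraphs_def)

lemma numbered_reorient:
  assumes H: "H \<in> hgraphs h t v" and "p permutes {..<length (edges H)}"
    "q permutes {..<num_internal H}" "r permutes {..<num_hairs H}"
  shows "reorient p q r F H \<in> hgraphs h t v"
  using hgraphsD[OF H] reorient_hairy[OF hgraphsD(1)[OF H] assms(2-4)]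
  by (simp add: hgraphs_def)

lemma numbered_split:
  assumes H: "H \<in> hgraphs h t v" and "i < num_internal H" "S \<in> splittings H i"
  shows "split_vertex i S H \<in> hgraphs h t (Suc v)"
  using hgraphsD[OF H] split_vertex_hairy[OF hgraphsD(1)[OF H] assms(2,3)]
  by (simp add: hgraphs_def)

lemma koszul_sign_mult: "koszul_sign k (a * b) = koszul_sign k a * koszul_sign k b"
  by (simp add: koszul_sign_def)

lemma koszul_sign_one [simp]: "koszul_sign k 1 = 1"
  by (simp add: koszul_sign_def)

lemma koszul_sign_square: "koszul_sign k (sign p) * koszul_sign k (sign p) = 1"
proof -
  have "sign p * sign p = 1" by (simp add: sign_def)
  then show ?thesis unfolding koszul_sign_mult[symmetric] by simp
qed

lemma orientation_sign_hairs:
  "orientation_sign m n p q r F = orientation_sign m n p q id F * koszul_sign (- m) (sign r)"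
  by (simp add: orientation_sign_def sign_id)

lemma orientation_sign_inverse:
  assumes "p permutes {..<k :: nat}"
  shows "orientation_sign m n (inv_into UNIV p) q r (p ` F) = orientation_sign m n p q r F"
proof -
  have "permutation p" using assms permutation_permutes by blast
  moreover have "card (p ` F) = card F"
    by (rule card_image[OF inj_on_subset[OF permutes_inj[OF assms] subset_UNIV]])
  ultimately show ?thesis by (simp add: orientation_sign_def sign_inverse)
qed

lemma iso_sign_named:
  assumes P: "P permutes {..<length (edges H)}" and Q: "Q permutes {..<num_internal H}"
    and p: "\<And>k. k < length (edges H) \<Longrightarrow> p k = P k"
    and r: "\<And>i. i < num_internal H \<Longrightarrow> r (2 * i) = 2 * Q i"
  shows "parity.iso_sign (even n) p r F (named H) = orientation_sign m n P Q id F"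
proof -
  let ?v = "num_internal H" and ?E = "length (edges H)"
  have dbl: "pair_sign (\<lambda>i. 2 * i) A = 1" for A
    by (rule pair_sign_mono_on) simp
  have "pair_sign p {..<?E} = pair_sign P {..<?E}"
    by (rule pair_sign_cong) (simp add: p)
  then have 1: "pair_sign p {..<?E} = of_int (sign P)"
    using pair_sign_permutes[OF _ P] by simp
  have injr: "inj_on r ((\<lambda>i. 2 * i) ` {..<?v})"
    by (rule inj_onI) (auto simp: r inj_eq[OF permutes_inj[OF Q]])
  have "pair_sign r ((\<lambda>i. 2 * i) ` {..<?v}) = pair_sign (\<lambda>i. r (2 * i)) {..<?v}"
    using pair_sign_comp[of "{..<?v}" "\<lambda>i. 2 * i" r] injr dbl[of "{..<?v}"] by (simp add: inj_on_def)
  also have "\<dots> = pair_sign (\<lambda>i. 2 * Q i) {..<?v}"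
    by (rule pair_sign_cong) (simp add: r)
  also have "\<dots> = pair_sign Q {..<?v}"
  proof -
    have "inj_on Q {..<?v}" by (rule inj_on_subset[OF permutes_inj[OF Q] subset_UNIV])
    then have "pair_sign (\<lambda>i. 2 * Q i) {..<?v} = pair_sign (\<lambda>i. 2 * i) (Q ` {..<?v}) * pair_sign Q {..<?v}"
      by (intro pair_sign_comp) (simp_all add: inj_on_def)
    then show ?thesis by (simp only: dbl mult_1)
  qed
  also have "\<dots> = of_int (sign Q)" using pair_sign_permutes[OF _ Q] by simp
  finally have 2: "pair_sign r ((\<lambda>i. 2 * i) ` {..<?v}) = of_int (sign Q)" .
  show ?thesis
    using 1 2 by (cases "even n") (simp_all add: parity.iso_sign_def orientation_sign_def koszul_sign_def sign_id)
qed

lemma reorient_iso_named: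
  assumes wf: "well_formed (named H)" and P: "P permutes {..<length (edges H)}"
    and Q: "Q permutes {..<num_internal H}" and F: "F \<subseteq> {..<length (edges H)}"
  obtains p r F' where "graph_iso p r F' (named H) (named (reorient P Q id F H))"
    "parity.iso_sign (even n) p r F' (named H) = orientation_sign m n P Q id F"
proof -
  let ?p = "inv_into UNIV P" and ?r = "\<lambda>y. if even y then 2 * Q (y div 2) else y"
  let ?R = "reorient P Q id F H"
  note invP = permutes_inv[OF P]
  have mem: "k \<in> P ` F \<longleftrightarrow> ?p k \<in> F" for k
    using permutes_inverses[OF P] by (metis imageE imageI)
  have rc: "?r (code x) = code (relabel Q id x)" for x by (cases x) simp_all
  have "graph_iso ?p ?r (P ` F) (named H) (named ?R)"
    unfolding graph_iso_def
  proof (intro conjI allI impI)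
    show "inj_on ?p (gE (named H))"
      by (rule inj_on_subset[OF permutes_inj[OF invP] subset_UNIV])
    show "inj_on ?r (names (named H))"
    proof (rule inj_onI)
      fix y y' assume y: "y \<in> names (named H)" "y' \<in> names (named H)" "?r y = ?r y'"
      then obtain x x' where x: "y = code x" "y' = code x'" unfolding names_named by blast
      have "code (relabel Q id x) = code (relabel Q id x')" using y(3) unfolding x rc .
      then show "y = y'" using relabel_inj[OF permutes_inj[OF Q] inj_on_id] x by simp
    qed
    show "P ` F \<subseteq> gE (named H)" using F permutes_image[OF P] by auto
    show "gE (named ?R) = ?p ` gE (named H)" by (simp add: permutes_image[OF invP])
    have "?r ` (\<lambda>i. 2 * i) ` {..<num_internal H} = (\<lambda>i. 2 * i) ` Q ` {..<num_internal H}"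
      unfolding image_image by (rule image_cong) simp_all
    then show "gV (named ?R) = ?r ` gV (named H)" by (simp only: named_simps reorient_simps permutes_image[OF Q])
    show "gF (named ?R) = map ?r (gF (named H))" by simp
    show "gM (named ?R) = map ?p (gM (named H))" by simp
    show "gI (named ?R) (?p (fst g), snd g \<noteq> (fst g \<in> P ` F)) = ?r (gI (named H) g)"
      if "fst g \<in> gE (named H)" for g
    proof -
      have "end_of ?R (hedge_map P F g) = relabel Q id (end_of H g)"
        using that by (intro hedge_map(2)[OF P]) simp
      then show ?thesis unfolding mem hedge_map_def[symmetric] named_simps rc by simp
    qed
  qed (rule wf)
  moreover have "parity.iso_sign (even n) ?p ?r (P ` F) (named H) = orientation_sign m n P Q id F"
    using iso_sign_named[OF invP Q, of ?p ?r n "P ` F" m] orientation_sign_inverse[OF P, of m n Q id F] by simp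
  ultimately show thesis by (rule that)
qed

text \<open>The isomorphism keeps the list of hair ends, hence fixes each of them. It permutes the
  edge numbers and the even codes of the internal vertices, which gives back a reorientation with
  \<open>id\<close> on the hairs.\<close>

lemma iso_named_reorient:
  assumes iso: "graph_iso p r F (named H) (named H')"
  obtains P Q F' where "P permutes {..<length (edges H)}" "Q permutes {..<num_internal H}"
    "F' \<subseteq> {..<length (edges H)}" "H' = reorient P Q id F' H"
    "parity.iso_sign (even n) p r F (named H) = orientation_sign m n P Q id F'"
proof -
  let ?E = "length (edges H)" and ?v = "num_internal H"
  have wf: "well_formed (named H)" and injp: "inj_on p {..<?E}" and injr: "inj_on r (names (named H))"
    and F: "F \<subseteq> {..<?E}" and pE: "{..<length (edges H')} = p ` {..<?E}"
    and rV: "(\<lambda>i. 2 * i) ` {..<num_internal H'} = r ` (\<lambda>i. 2 * i) ` {..<?v}"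
    and rF: "map (\<lambda>j. Suc (2 * j)) [0..<num_hairs H'] = map r (map (\<lambda>j. Suc (2 * j)) [0..<num_hairs H])"
    and inc: "\<And>g. fst g < ?E \<Longrightarrow> code (end_of H' (p (fst g), snd g \<noteq> (fst g \<in> F))) = r (code (end_of H g))"
    using iso unfolding graph_iso_def named_simps by (blast, blast, blast, blast, blast, blast, blast, simp)
  have E': "length (edges H') = ?E"
    using arg_cong[OF pE, of card] card_image[OF injp] by simp
  have c2: "card ((\<lambda>i. 2 * i) ` {..<k}) = k" for k :: nat by (simp add: card_image inj_on_def)
  have injr2: "inj_on r ((\<lambda>i. 2 * i) ` {..<?v})"
    by (rule inj_on_subset[OF injr]) (simp add: names_def)
  have v': "num_internal H' = ?v"
    using arg_cong[OF rV, of card] card_image[OF injr2] by (simp only: c2)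
  have h': "num_hairs H' = num_hairs H" using arg_cong[OF rF, of length] by simp
  define Q where "Q i = (if i < ?v then r (2 * i) div 2 else i)" for i
  have r2: "r (2 * i) = 2 * Q i \<and> Q i < ?v" if "i < ?v" for i
  proof -
    have "r (2 * i) \<in> (\<lambda>i. 2 * i) ` {..<num_internal H'}" unfolding rV using that by blast
    then show ?thesis using that v' by (auto simp: Q_def)
  qed
  have Q: "Q permutes {..<?v}"
  proof (rule bij_imp_permutes)
    have inj: "inj_on Q {..<?v}"
    proof (rule inj_onI)
      fix i j assume ij: "i \<in> {..<?v}" "j \<in> {..<?v}" "Q i = Q j"
      then have e: "r (2 * i) = r (2 * j)" using r2[of i] r2[of j] by simp
      have "2 * i = 2 * j" by (rule inj_onD[OF injr2 e]) (use ij in auto)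
      then show "i = j" by simp
    qed
    have "Q ` {..<?v} = {..<?v}" by (rule endo_inj_surj[OF _ _ inj]) (use r2 in auto)
    then show "bij_betw Q {..<?v} {..<?v}" using inj by (simp add: bij_betw_def)
  qed (simp add: Q_def)
  define P where "P k = (if k < ?E then p k else k)" for k
  have P: "P permutes {..<?E}"
  proof (rule bij_imp_permutes)
    have "bij_betw p {..<?E} {..<?E}" using injp pE E' by (simp add: bij_betw_def)
    then show "bij_betw P {..<?E} {..<?E}" by (rule bij_betw_cong[THEN iffD1, rotated]) (simp add: P_def)
  qed (simp add: P_def)
  let ?P = "inv_into UNIV P"
  note invP = permutes_inv[OF P]
  have rh: "r (Suc (2 * j)) = Suc (2 * j)" if "j < num_hairs H" for j
    using arg_cong[OF rF, of "\<lambda>xs. xs ! j"] that h' by simp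
  have rc: "r (code x) = code (relabel Q id x)" if "x \<in> vertices H" for x
    using that r2 rh by (cases x) (simp_all add: vertices_iff)
  have ends: "end_of H g \<in> vertices H" if "fst g < ?E" for g
    using well_formed_gI[OF wf, of g] that unfolding names_named by auto
  have "H' = reorient ?P Q id (P ` F) H"
  proof (rule hgraph_eqI)
    fix k b assume "k < length (edges H')"
    then have k: "k < ?E" using E' by simp
    define j where "j = ?P k"
    have j: "j < ?E" using permutes_in_image[OF invP, of k] k by (simp add: j_def)
    have Pj: "P j = k" using permutes_inverses(1)[OF P] by (simp add: j_def)
    then have pj: "p j = k" using j by (simp add: P_def)
    have mem: "k \<in> P ` F \<longleftrightarrow> j \<in> F" using inj_image_mem_iff[OF permutes_inj[OF P], of j F] Pj by simp
    have b: "((b \<noteq> (j \<in> F)) \<noteq> (j \<in> F)) = b" by blast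
    have "code (end_of H' (k, b)) = r (code (end_of H (j, b \<noteq> (j \<in> F))))"
      using inc[of "(j, b \<noteq> (j \<in> F))"] j pj unfolding fst_conv snd_conv b by blast
    also have "\<dots> = code (relabel Q id (end_of H (j, b \<noteq> (j \<in> F))))"
      using ends[of "(j, b \<noteq> (j \<in> F))"] j by (intro rc) simp
    also have "\<dots> = code (end_of (reorient ?P Q id (P ` F) H) (k, b))"
      unfolding end_of_reorient[OF invP k] mem j_def ..
    finally show "end_of H' (k, b) = end_of (reorient ?P Q id (P ` F) H) (k, b)" by simp
  qed (simp_all add: E' v' h')
  moreover have "P ` F \<subseteq> {..<?E}" using F permutes_image[OF P] by auto
  moreover have "parity.iso_sign (even n) p r F (named H) = orientation_sign m n ?P Q id (P ` F)"
    using iso_sign_named[OF P Q, of p r n F m] r2 orientation_sign_inverse[OF P, of m n Q id F]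
    by (simp add: P_def)
  ultimately show thesis using invP Q by (intro that)
qed

lemma splits_named: "splits (named H) (2 * i) = splittings H i"
proof -
  have "half_edges (named H) (2 * i) = half_edges_at H (Internal i)"
    using half_edges_named[of H "Internal i"] by simp
  then show ?thesis by (simp add: splits_def splittings_def numeral_3_eq_3 numeral_2_eq_2)
qed

context parity
begin

text \<open>The new edge is named last here, and the sign of moving it to position zero is the
  coefficient \<open>coef\<close>. The new vertex comes last on both sides.\<close>

lemma split_term_named:
  assumes f: "equivariant f" and wf: "well_formed (named H)" and i: "i < num_internal H"
    and S: "S \<in> splittings H i"
  shows "split_term f (named H) (2 * i) S (length (edges H)) (2 * num_internal H) =
    f (named (split_vertex i S H))"
proof -
  let ?E = "length (edges H)" and ?v = "num_internal H"
  let ?G = "split_at (named H) (2 * i) S ?E (2 * ?v)" and ?H = "split_vertex i S H"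
  let ?p = "\<lambda>k. if k = ?E then 0 else Suc k"
  have Sh: "S \<subseteq> half_edges_at H (Internal i)" using S by (simp add: splittings_def)
  have injp: "inj_on ?p {..?E}" by (auto simp: inj_on_def)
  have iso: "graph_iso ?p id {} ?G (named ?H)"
    unfolding graph_iso_def
  proof (intro conjI allI impI)
    show "well_formed ?G" using i by (intro wf_split[OF wf]) (simp add: names_def)
    show "inj_on ?p (gE ?G)" by (rule inj_on_subset[OF injp]) auto
    have "?p ` {..<?E} = Suc ` {..<?E}" by (rule image_cong) auto
    then have "?p ` insert ?E {..<?E} = insert 0 (Suc ` {..<?E})" by (simp only: image_insert simp_thms if_True)
    then show "gE (named ?H) = ?p ` gE ?G"
      by (simp only: split_simps named_simps split_vertex_simps lessThan_Suc_eq_insert_0)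
    show "gV (named ?H) = id ` gV ?G" by (simp add: lessThan_Suc)
    show "gI (named ?H) (?p (fst g), snd g \<noteq> (fst g \<in> {})) = id (gI ?G g)" if g: "fst g \<in> gE ?G" for g
    proof (cases "fst g = ?E")
      case True
      then show ?thesis by (simp add: end_of_split_vertex)
    next
      case False
      then have "fst g < ?E" using g by simp
      then show ?thesis using False end_of_split_vertex(2)[of "fst g" H i S "snd g"] by simp
    qed
  qed simp_all
  have "iso_sign ?p id {} ?G = coef (named H) ?E (2 * ?v)"
  proof (cases ev)
    case True
    have "pair_sign ?p (insert ?E {..<?E}) = pair_sign ?p {..<?E} *
        (\<Prod>j \<in> {..<?E}. if (j < ?E) = (?p j < ?p ?E) then 1 else - 1)"
      by (rule pair_sign_insert) (simp, simp, rule inj_on_subset[OF injp], auto)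
    also have "pair_sign ?p {..<?E} = 1" by (rule pair_sign_mono_on) simp
    also have "(\<Prod>j \<in> {..<?E}. if (j < ?E) = (?p j < ?p ?E) then 1 else - 1) =
        (\<Prod>j \<in> {..<?E}. if ?E < j then 1 else - 1 :: rat)"
      by (rule prod.cong) auto
    finally show ?thesis unfolding iso_sign_def coef_def using True by simp
  next
    case False
    have "(\<Prod>j \<in> gV (named H). if j < 2 * ?v then 1 else - 1) = (1 :: rat)"
      by (rule prod.neutral) auto
    moreover have "pair_sign id A = 1" for A by (rule pair_sign_mono_on) simp
    ultimately show ?thesis unfolding iso_sign_def coef_def using False by simp
  qed
  then show ?thesis
    using equivariantD[OF f iso] by (simp add: split_term_def)
qed

lemma d_named:
  assumes f: "equivariant f" and wf: "well_formed (named H)"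
  shows "d f (named H) = (\<Sum>i < num_internal H. \<Sum>S \<in> splittings H i. f (named (split_vertex i S H)))"
proof -
  have fr: "fresh (named H) (length (edges H)) (2 * num_internal H)"
    by (auto simp: fresh_def names_def) presburger
  have "d f (named H) = (\<Sum>i < num_internal H. d_at f (named H) (2 * i))"
    unfolding d_def inner_named by (subst sum.reindex) (auto simp: inj_on_def)
  also have "\<dots> = (\<Sum>i < num_internal H. \<Sum>S \<in> splittings H i. f (named (split_vertex i S H)))"
  proof (rule sum.cong[OF refl])
    fix i assume i: "i \<in> {..<num_internal H}"
    have nm: "2 * i \<in> names (named H)" using i by (simp add: names_def)
    show "d_at f (named H) (2 * i) = (\<Sum>S \<in> splittings H i. f (named (split_vertex i S H)))"
      unfolding d_at_fresh[OF f wf nm fr] splits_named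
      by (intro sum.cong refl split_term_named[OF f wf]) (use i in auto)
  qed
  finally show ?thesis .
qed

end

section \<open>Oriented functions on numbered graphs and averaging over the hairs\<close>

definition split_sum :: "(hgraph \<Rightarrow> rat) \<Rightarrow> hgraph \<Rightarrow> rat" where
  "split_sum f H = (\<Sum>i < num_internal H. \<Sum>S \<in> splittings H i. f (split_vertex i S H))"

text \<open>The condition that the linear extension of \<open>f\<close> vanishes on the relations
  coming from graphs in \<open>A\<close>.\<close>

definition oriented :: "int \<Rightarrow> int \<Rightarrow> hgraph set \<Rightarrow> (hgraph \<Rightarrow> rat) \<Rightarrow> bool" where
  "oriented m n A f \<longleftrightarrow> (\<forall>H p q r F. H \<in> A \<and> p permutes {..<length (edges H)} \<and>
     q permutes {..<num_internal H} \<and> r permutes {..<num_hairs H} \<and> F \<subseteq> {..<length (edges H)} \<longrightarrow>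
     f (reorient p q r F H) = orientation_sign m n p q r F * f H)"

lemma orientedD:
  assumes "oriented m n A f" "H \<in> A" "p permutes {..<length (edges H)}" "q permutes {..<num_internal H}"
    "r permutes {..<num_hairs H}" "F \<subseteq> {..<length (edges H)}"
  shows "f (reorient p q r F H) = orientation_sign m n p q r F * f H"
  using assms unfolding oriented_def by blast

lemma reorient_hairs:
  assumes p: "p permutes {..<length (edges H)}"
  shows "reorient id id s {} (reorient p q r F H) = reorient p q id F (reorient id id (s \<circ> r) {} H)"
proof (rule hgraph_eqI)
  fix k b assume "k < length (edges (reorient id id s {} (reorient p q r F H)))"
  then have k: "k < length (edges H)" by simp
  have pk: "p k < length (edges H)" using permutes_in_image[OF p] k by auto
  have "end_of (reorient id id s {} (reorient p q r F H)) (k, b) =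
      relabel q (s \<circ> r) (end_of H (p k, b \<noteq> (k \<in> F)))"
    using k by (subst end_of_reorient) (simp_all add: permutes_id end_of_reorient[OF p k] relabel_comp)
  also have "\<dots> = relabel q id (end_of (reorient id id (s \<circ> r) {} H) (p k, b \<noteq> (k \<in> F)))"
    using pk by (subst end_of_reorient) (simp_all add: permutes_id relabel_comp)
  also have "\<dots> = end_of (reorient p q id F (reorient id id (s \<circ> r) {} H)) (k, b)"
    using p k by (subst (2) end_of_reorient) simp_all
  finally show "end_of (reorient id id s {} (reorient p q r F H)) (k, b) =
      end_of (reorient p q id F (reorient id id (s \<circ> r) {} H)) (k, b)" .
qed simp_all

lemma splittings_hairs: "inj r \<Longrightarrow> splittings (reorient id id r {} H) i = splittings H i"
proof -
  assume r: "inj r"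
  have "hedge_map id {} = id" by (rule ext) (simp add: hedge_map_def)
  then show ?thesis
    using splittings_reorient[OF permutes_id permutes_inj[OF permutes_id] r, where H = H and F = "{}" and i = i] by simp
qed

lemma split_hairs:
  assumes "S \<subseteq> half_edges_at H (Internal i)"
  shows "split_vertex i S (reorient id id r {} H) = reorient id id r {} (split_vertex i S H)"
proof -
  have 1: "hedge_map id {} = id" by (rule ext) (simp add: hedge_map_def)
  have 2: "(\<lambda>k. case k of 0 \<Rightarrow> 0 | Suc j \<Rightarrow> Suc (id j)) = id" by (rule ext) (simp split: nat.split)
  show ?thesis
    using split_reorient[OF permutes_id permutes_id assms, of "{}" r] unfolding 1 2 by (simp add: id_def)
qed

lemma splittings_sub: "S \<in> splittings H i \<Longrightarrow> S \<subseteq> half_edges_at H (Internal i)"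
  by (simp add: splittings_def)

context
  fixes m n :: int
begin

interpretation parity "even n" .

lemma iso_values:
  assumes f: "oriented m n A f" and H: "H \<in> A" and iso: "graph_iso p r F (named H) (named H')"
  shows "f H' = iso_sign p r F (named H) * f H"
proof -
  obtain P Q F' where "P permutes {..<length (edges H)}" "Q permutes {..<num_internal H}"
    "F' \<subseteq> {..<length (edges H)}" "H' = reorient P Q id F' H"
    "iso_sign p r F (named H) = orientation_sign m n P Q id F'"
    by (rule iso_named_reorient[OF iso])
  then show ?thesis using orientedD[OF f H _ _ permutes_id] by metis
qed

text \<open>Two numberings of the same named graph differ by an isomorphism, for which the
  orientation rule prescribes the change of \<open>f\<close>. This makes the extension in
  \<open>extend_to_named\<close> well defined.\<close>

lemma iso_values_unique:
  assumes f: "oriented m n A f" and H: "H \<in> A" "H' \<in> A"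
    and iso: "graph_iso p r F (named H) G" "graph_iso p' r' F' (named H') G"
  shows "iso_sign p r F (named H) * f H = iso_sign p' r' F' (named H') * f H'"
proof -
  note bk = iso_sym[OF iso(2)]
  let ?s = "iso_sign (inv_into (gE (named H')) p') (inv_into (names (named H')) r') (p' ` F') G"
  have "f H' = iso_sign p r F (named H) * ?s * f H"
    using iso_values[OF f H(1) iso_trans[OF iso(1) bk]] iso_sign_trans[OF iso(1) bk] by simp
  moreover have "f H' = iso_sign p' r' F' (named H') * ?s * f H'"
    using iso_values[OF f H(2) iso_trans[OF iso(2) bk]] iso_sign_trans[OF iso(2) bk] by simp
  moreover have "?s * ?s = 1" by (rule iso_sign_square)
  moreover have "a * x = b * y" if "y = a * s * x" "y = b * s * y" "s * s = 1" for a b s x y :: rat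
  proof -
    have "a * x = s * (a * s * x)" using that(3) by (simp add: algebra_simps)
    also have "\<dots> = s * (b * s * y)" using that(1,2) by simp
    also have "\<dots> = b * y" using that(3) by (simp add: algebra_simps)
    finally show ?thesis .
  qed
  ultimately show ?thesis by blast
qed

lemma hairy_class: "graph_class (\<lambda>G. stable t G \<and> hairy h G)"
  unfolding graph_class_def
proof
  show "invariant (\<lambda>G. stable t G \<and> hairy h G)"
    using invariantD[OF invariant_stable] iso_hairy by (intro invariant_predI) blast
qed (simp add: stable_def)

lemma named_in_class:
  assumes "H \<in> hgraphs h t v" "1 \<le> v"
  shows "stable t (named H) \<and> hairy h (named H)" "card (inner (named H)) = v"
    "well_formed (named H)"
proof -
  note H = hgraphsD[OF assms(1)]
  show st: "stable t (named H) \<and> hairy h (named H)"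
    using named_hairy[OF H(1), of t] H assms(2) by simp
  show "card (inner (named H)) = v" unfolding inner_named using H by (simp add: card_image inj_on_def)
  show "well_formed (named H)" using st by (simp add: stable_def)
qed

lemma class_is_named:
  assumes "stable t G \<and> hairy h G" "1 \<le> h"
  obtains H p r where "H \<in> hgraphs h t (card (inner G))" "graph_iso p r {} (named H) G"
  by (rule hairy_is_named[of t G h]) (use assms in \<open>auto simp: hgraphs_def\<close>)

text \<open>The value at a named graph is transported from any numbering of it in the given set.
  Graphs without such a numbering get the default \<open>0\<close>, which is consistent since having
  one is invariant under isomorphism.\<close>

lemma extend_to_named:
  assumes f: "oriented m n (hgraphs h t v) f" and h: "1 \<le> h" and v: "1 \<le> v"
  obtains f' where "equivariant f'" "\<And>H. H \<in> hgraphs h t v \<Longrightarrow> f' (named H) = f H"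
proof -
  let ?A = "hgraphs h t v"
  let ?P = "\<lambda>G. stable t G \<and> hairy h G"
  define R where "R G c \<longleftrightarrow> (\<exists>H p r F. H \<in> ?A \<and> graph_iso p r F (named H) G \<and> c = iso_sign p r F (named H) * f H)" for G c
  define f' where "f' G = (if \<exists>c. R G c then SOME c. R G c else 0)" for G
  have f'_eq: "f' G = iso_sign p r F (named H) * f H" if H: "H \<in> ?A" "graph_iso p r F (named H) G" for G p r F H
  proof -
    have "R G (iso_sign p r F (named H) * f H)" using H unfolding R_def by blast
    then have "R G (f' G)" unfolding f'_def by (metis someI_ex)
    then obtain H' p' r' F' where "H' \<in> ?A" "graph_iso p' r' F' (named H') G"
      "f' G = iso_sign p' r' F' (named H') * f H'"
      unfolding R_def by blast
    then show ?thesis using iso_values_unique[OF f _ H(1) _ H(2)] by simp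
  qed
  have "equivariant f'"
    unfolding equivariant_def
  proof (intro allI impI)
    fix p r F G G' assume iso: "graph_iso p r F G G'"
    show "f' G' = iso_sign p r F G * f' G"
    proof (cases "\<exists>H q s D. H \<in> ?A \<and> graph_iso q s D (named H) G")
      case True
      then obtain H q s D where H: "H \<in> ?A" "graph_iso q s D (named H) G" by blast
      show ?thesis
        using f'_eq[OF H] f'_eq[OF H(1) iso_trans[OF H(2) iso]] iso_sign_trans[OF H(2) iso] by simp
    next
      case False
      then have "\<nexists>H q s D. H \<in> ?A \<and> graph_iso q s D (named H) G'"
        using iso_trans[OF _ iso_sym[OF iso]] by blast
      then have "\<not> (\<exists>c. R G c)" "\<not> (\<exists>c. R G' c)" using False unfolding R_def by blast+
      then show ?thesis by (simp add: f'_def)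
    qed
  qed
  moreover have "f' (named H) = f H" if "H \<in> ?A" for H
  proof -
    have "pair_sign id B = 1" for B by (rule pair_sign_mono_on) simp
    then show ?thesis
      using f'_eq[OF that iso_id[OF named_in_class(3)[OF that v]]] by (simp add: iso_sign_def)
  qed
  ultimately show thesis by (rule that)
qed

text \<open>The primitive found on named graphs need not transform correctly under permutations of
  the hairs. Averaging over them with the sign prescribed by \<open>m\<close> repairs this and keeps
  the equation, because \<open>f\<close> itself transforms correctly and splitting commutes with
  permuting the hairs.\<close>

theorem exact_numbered:
  assumes vt: "Suc v < t" and h: "1 \<le> h" and v: "1 \<le> v"
    and f: "oriented m n (hgraphs h t v) f"
    and cl: "\<And>w H. Suc w = v \<Longrightarrow> H \<in> hgraphs h t w \<Longrightarrow> split_sum f H = 0"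
  obtains g where "oriented m n (hgraphs h t (Suc v)) g"
    "\<And>H. H \<in> hgraphs h t v \<Longrightarrow> split_sum g H = f H"
proof -
  let ?P = "\<lambda>G. stable t G \<and> hairy h G"
  have inv: "invariant ?P" using hairy_class unfolding graph_class_def by blast
  obtain f' where f': "equivariant f'" "\<And>H. H \<in> hgraphs h t v \<Longrightarrow> f' (named H) = f H"
    using extend_to_named[OF f h v] by blast
  note rf = equivariant_restr[OF inv f'(1)]
  have "d (restr ?P f') G = 0" if G: "?P G" "Suc (card (inner G)) = v" for G
  proof -
    obtain H p r where H: "H \<in> hgraphs h t (card (inner G))" "graph_iso p r {} (named H) G"
      using class_is_named[OF G(1) h] by blast
    have wf: "well_formed (named H)" using H(2) by (simp add: graph_iso_def)
    have "d (restr ?P f') (named H) = split_sum f H"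
      unfolding d_named[OF rf wf] split_sum_def
    proof (intro sum.cong refl)
      fix i S assume i: "i \<in> {..<num_internal H}" "S \<in> splittings H i"
      have "split_vertex i S H \<in> hgraphs h t v"
        using numbered_split[OF H(1) _ i(2)] i(1) G(2) by simp
      then show "restr ?P f' (named (split_vertex i S H)) = f (split_vertex i S H)"
        using named_in_class(1)[OF _ v] f'(2) unfolding restr_def by simp
    qed
    then have "d (restr ?P f') (named H) = 0" using cl[OF G(2) H(1)] by simp
    then show ?thesis using equivariantD[OF equivariant_d[OF rf] H(2)] by simp
  qed
  then obtain g' where g': "equivariant g'" "\<And>G. ?P G \<Longrightarrow> card (inner G) = v \<Longrightarrow> d (restr ?P g') G = f' G"
    using exactD[OF exact_hairy[OF vt h] f'(1)] by blast
  note rg = equivariant_restr[OF inv g'(1)]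
  define g1 where "g1 H = restr ?P g' (named H)" for H
  \<comment> \<open>Only reorientations with \<open>id\<close> on the hairs are covered, since
    isomorphisms of named graphs keep the hairs in order.\<close>
  have g1: "g1 (reorient p q id F H) = orientation_sign m n p q id F * g1 H"
    if H: "H \<in> hgraphs h t (Suc v)" "p permutes {..<length (edges H)}" "q permutes {..<num_internal H}"
      "F \<subseteq> {..<length (edges H)}" for p q F H
  proof -
    have "well_formed (named H)" using named_in_class(3)[OF H(1)] by simp
    then obtain p' r' F' where "graph_iso p' r' F' (named H) (named (reorient p q id F H))"
      "iso_sign p' r' F' (named H) = orientation_sign m n p q id F"
      using reorient_iso_named[OF _ H(2-4), of n m] by blast
    then show ?thesis using equivariantD[OF rg] unfolding g1_def by metis
  qed
  define K :: "(nat \<Rightarrow> nat) \<Rightarrow> rat" where "K s = koszul_sign (- m) (sign s)" for s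
  define X where "X = {s. s permutes {..<h}}"
  define g where "g H = (\<Sum>s \<in> X. K s * g1 (reorient id id s {} H)) / of_nat (fact h)" for H
  have cX: "card X = fact h" "finite X"
    unfolding X_def by (simp_all add: card_permutations finite_permutations)
  have KK: "K s * K s = 1" for s unfolding K_def by (rule koszul_sign_square)
  have "oriented m n (hgraphs h t (Suc v)) g"
    unfolding oriented_def
  proof (intro allI impI, elim conjE)
    fix H p q r F assume H: "H \<in> hgraphs h t (Suc v)" and p: "p permutes {..<length (edges H)}"
      and q: "q permutes {..<num_internal H}" and r: "r permutes {..<num_hairs H}"
      and F: "F \<subseteq> {..<length (edges H)}"
    let ?o = "orientation_sign m n p q id F"
    have rX: "r permutes {..<h}" using r hgraphsD(2)[OF H] by simp
    have prm: "permutation s" if "s permutes {..<h}" for s using that permutation_permutes by blast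
    have "(\<Sum>s \<in> X. K s * g1 (reorient id id s {} (reorient p q r F H))) =
        (\<Sum>s \<in> X. ?o * K r * (K (s \<circ> r) * g1 (reorient id id (s \<circ> r) {} H)))"
    proof (rule sum.cong[OF refl])
      fix s assume "s \<in> X"
      then have s: "s permutes {..<h}" by (simp add: X_def)
      have "s \<circ> r permutes {..<num_hairs H}"
        using permutes_compose[OF rX s] hgraphsD(2)[OF H] by simp
      then have "reorient id id (s \<circ> r) {} H \<in> hgraphs h t (Suc v)"
        by (intro numbered_reorient[OF H]) (simp_all add: permutes_id)
      then have e: "g1 (reorient id id s {} (reorient p q r F H)) = ?o * g1 (reorient id id (s \<circ> r) {} H)"
        unfolding reorient_hairs[OF p] using p q F by (intro g1) simp_all
      have "K (s \<circ> r) = K s * K r"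
        unfolding K_def sign_compose[OF prm[OF s] prm[OF rX]] by (rule koszul_sign_mult)
      then have "K s = K r * K (s \<circ> r)" using KK[of r] by (simp add: algebra_simps)
      then show "K s * g1 (reorient id id s {} (reorient p q r F H)) =
          ?o * K r * (K (s \<circ> r) * g1 (reorient id id (s \<circ> r) {} H))"
        unfolding e by (simp add: algebra_simps)
    qed
    also have "\<dots> = ?o * K r * (\<Sum>s \<in> X. K s * g1 (reorient id id s {} H))"
      unfolding X_def sum_distrib_left[symmetric]
      by (subst sum_permutations_compose_right[OF rX, symmetric]) (rule refl)
    finally show "g (reorient p q r F H) = orientation_sign m n p q r F * g H"
      unfolding g_def orientation_sign_hairs[of m n p q r] K_def[symmetric] by simp
  qed
  moreover have "split_sum g H = f H" if H: "H \<in> hgraphs h t v" for H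
  proof -
    have sum1: "split_sum (\<lambda>H'. g1 (reorient id id s {} H')) H = K s * f H" if s: "s \<in> X" for s
    proof -
      have sh: "s permutes {..<num_hairs H}" using s hgraphsD(2)[OF H] by (simp add: X_def)
      let ?H = "reorient id id s {} H"
      have Hs: "?H \<in> hgraphs h t v"
        using sh by (intro numbered_reorient[OF H]) (simp_all add: permutes_id)
      have "split_sum (\<lambda>H'. g1 (reorient id id s {} H')) H = split_sum g1 ?H"
        unfolding split_sum_def splittings_hairs[OF permutes_inj[OF sh]] reorient_simps
        by (intro sum.cong refl arg_cong[where f = g1] split_hairs[symmetric] splittings_sub)
      also have "\<dots> = d (restr ?P g') (named ?H)"
        unfolding d_named[OF rg named_in_class(3)[OF Hs v]] split_sum_def g1_def ..
      also have "\<dots> = f ?H"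
        using g'(2)[OF named_in_class(1,2)[OF Hs v]] f'(2)[OF Hs] by simp
      also have "\<dots> = orientation_sign m n id id s {} * f H"
        by (rule orientedD[OF f H _ _ sh]) (simp_all add: permutes_id)
      also have "orientation_sign m n id id s {} = K s"
        by (simp add: orientation_sign_def K_def sign_id)
      finally show ?thesis .
    qed
    have "split_sum g H = (\<Sum>s \<in> X. K s * split_sum (\<lambda>H'. g1 (reorient id id s {} H')) H) / of_nat (fact h)"
    proof -
      have "split_sum g H = (\<Sum>i < num_internal H. \<Sum>S \<in> splittings H i. \<Sum>s \<in> X.
          K s * g1 (reorient id id s {} (split_vertex i S H))) / of_nat (fact h)"
        unfolding split_sum_def g_def sum_divide_distrib ..
      also have "(\<Sum>i < num_internal H. \<Sum>S \<in> splittings H i. \<Sum>s \<in> X.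
          K s * g1 (reorient id id s {} (split_vertex i S H))) =
        (\<Sum>i < num_internal H. \<Sum>s \<in> X. \<Sum>S \<in> splittings H i.
          K s * g1 (reorient id id s {} (split_vertex i S H)))"
        by (rule sum.cong[OF refl]) (rule sum.swap)
      also have "\<dots> = (\<Sum>s \<in> X. \<Sum>i < num_internal H. \<Sum>S \<in> splittings H i.
          K s * g1 (reorient id id s {} (split_vertex i S H)))"
        by (rule sum.swap)
      finally show ?thesis unfolding split_sum_def sum_distrib_left .
    qed
    also have "\<dots> = (\<Sum>s \<in> X. f H) / of_nat (fact h)"
      using sum1 KK by (intro arg_cong2[where f = "(/)"] sum.cong refl) (simp add: mult.assoc[symmetric])
    also have "\<dots> = f H" using cX by simp
    finally show ?thesis .
  qed
  ultimately show thesis by (rule that)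
qed

end

text \<open>Loop number and number of hairs fix the number of edges as \<open>v + g + h - 1\<close>.
  The degree is then a constant minus \<open>v\<close>: lowering the degree by one adds a
  vertex.\<close>

lemma hairy_graphs_iff:
  assumes "1 \<le> h"
  shows "H \<in> hairy_graphs m n g h d \<longleftrightarrow> H \<in> hgraphs h (g + h - 1) (num_internal H) \<and>
     int (num_internal H) = (n - 1) * (int g + int h - 1) - m * (int h - 1) - d"
proof -
  have "loop_number H = int g \<longleftrightarrow> length (edges H) = num_internal H + (g + h - 1)" if "num_hairs H = h"
    using that assms by (auto simp: loop_number_def card_vertices)
  moreover have "hdegree m n H = d \<longleftrightarrow>
      int (num_internal H) = (n - 1) * (int g + int h - 1) - m * (int h - 1) - d"
    if "num_hairs H = h" "length (edges H) = num_internal H + (g + h - 1)"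
  proof -
    have e: "int (length (edges H)) = int (num_internal H) + (int g + int h - 1)"
      using that(2) assms by simp
    have "hdegree m n H = (n - 1) * (int g + int h - 1) - int (num_internal H) - m * (int h - 1)"
      unfolding hdegree_def e that(1) by (simp add: algebra_simps)
    then show ?thesis by linarith
  qed
  ultimately show ?thesis by (auto simp: hairy_graphs_def hgraphs_def)
qed

lemma hairy_graphs_numbered:
  assumes "1 \<le> h" "int v = (n - 1) * (int g + int h - 1) - m * (int h - 1) - d"
  shows "hairy_graphs m n g h d = hgraphs h (g + h - 1) v"
  using hairy_graphs_iff[OF assms(1)] assms(2) by (auto simp: hgraphs_def)

section \<open>Chains and homology\<close>

definition extend :: "(hgraph \<Rightarrow> rat) \<Rightarrow> hchain \<Rightarrow> rat" where
  "extend f x = (\<Sum>G \<in> Poly_Mapping.keys x. Poly_Mapping.lookup x G * f G)"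

lemma extend_superset:
  assumes "finite K" "Poly_Mapping.keys x \<subseteq> K"
  shows "extend f x = (\<Sum>G \<in> K. Poly_Mapping.lookup x G * f G)"
  unfolding extend_def using assms by (intro sum.mono_neutral_left) (auto simp: in_keys_iff)

lemma diff_chain_superset:
  assumes "finite K" "Poly_Mapping.keys x \<subseteq> K"
  shows "diff_chain x = (\<Sum>G \<in> K. chain_scale (Poly_Mapping.lookup x G) (diff_graph G))"
  unfolding diff_chain_def using assms by (intro sum.mono_neutral_left) (auto simp: in_keys_iff)

lemma keys_chain_scale: "Poly_Mapping.keys (chain_scale c x) \<subseteq> Poly_Mapping.keys x"
  by (auto simp: in_keys_iff lookup_chain_scale)

lemma module_rat: "module ((*) :: rat \<Rightarrow> rat \<Rightarrow> rat)"
  by unfold_locales (auto simp: algebra_simps)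

lemma extend_hom: "module_hom chain_scale (*) (extend f)"
proof -
  interpret rat: module "(*) :: rat \<Rightarrow> rat \<Rightarrow> rat" by (rule module_rat)
  show ?thesis
  proof unfold_locales
    fix x y :: hchain and c :: rat
    let ?K = "Poly_Mapping.keys x \<union> Poly_Mapping.keys y"
    have "extend f (x + y) = (\<Sum>G \<in> ?K. Poly_Mapping.lookup (x + y) G * f G)"
      by (rule extend_superset) (use keys_add[of x y] in auto)
    also have "\<dots> = extend f x + extend f y"
      by (simp add: extend_superset[of ?K] lookup_add distrib_right sum.distrib)
    finally show "extend f (x + y) = extend f x + extend f y" .
    have "extend f (chain_scale c x) = (\<Sum>G \<in> Poly_Mapping.keys x. Poly_Mapping.lookup (chain_scale c x) G * f G)"
      using keys_chain_scale by (intro extend_superset) auto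
    also have "\<dots> = c * extend f x"
      unfolding extend_def lookup_chain_scale sum_distrib_left mult.assoc ..
    finally show "extend f (chain_scale c x) = c * extend f x" .
  qed
qed

lemma diff_hom: "module_hom chain_scale chain_scale diff_chain"
proof unfold_locales
  fix x y :: hchain and c :: rat
  let ?K = "Poly_Mapping.keys x \<union> Poly_Mapping.keys y"
  have "diff_chain (x + y) = (\<Sum>G \<in> ?K. chain_scale (Poly_Mapping.lookup (x + y) G) (diff_graph G))"
    by (rule diff_chain_superset) (use keys_add[of x y] in auto)
  also have "\<dots> = diff_chain x + diff_chain y"
    by (simp add: diff_chain_superset[of ?K] lookup_add hchain.scale_left_distrib sum.distrib)
  finally show "diff_chain (x + y) = diff_chain x + diff_chain y" .
  have "diff_chain (chain_scale c x) =
      (\<Sum>G \<in> Poly_Mapping.keys x. chain_scale (Poly_Mapping.lookup (chain_scale c x) G) (diff_graph G))"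
    using keys_chain_scale by (intro diff_chain_superset) auto
  also have "\<dots> = chain_scale c (diff_chain x)"
    unfolding diff_chain_def lookup_chain_scale hchain.scale_sum_right by simp
  finally show "diff_chain (chain_scale c x) = chain_scale c (diff_chain x)" .
qed

interpretation diff: module_hom chain_scale chain_scale diff_chain
  by (rule diff_hom)

lemma single_scale: "chain_scale c (Poly_Mapping.single G a) = Poly_Mapping.single G (c * a)"
  by (rule poly_mapping_eqI) (simp add: lookup_chain_scale lookup_single when_def)

lemma extend_single: "extend f (Poly_Mapping.single G c) = c * f G"
  by (cases "c = 0") (simp_all add: extend_def)

lemma diff_single: "diff_chain (Poly_Mapping.single G c) = chain_scale c (diff_graph G)"
  by (cases "c = 0") (simp_all add: diff_chain_def)

lemma chain_sum: "x = (\<Sum>G \<in> Poly_Mapping.keys x. chain_scale (Poly_Mapping.lookup x G) (Poly_Mapping.single G 1))"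
proof (rule poly_mapping_eqI)
  fix k
  have "Poly_Mapping.lookup (\<Sum>G \<in> Poly_Mapping.keys x. chain_scale (Poly_Mapping.lookup x G) (Poly_Mapping.single G 1)) k =
      (\<Sum>G \<in> Poly_Mapping.keys x. if G = k then Poly_Mapping.lookup x G else 0)"
    unfolding lookup_sum by (intro sum.cong refl) (simp add: lookup_chain_scale lookup_single when_def)
  also have "\<dots> = Poly_Mapping.lookup x k"
    by (simp add: in_keys_iff)
  finally show "Poly_Mapping.lookup x k = Poly_Mapping.lookup
      (\<Sum>G \<in> Poly_Mapping.keys x. chain_scale (Poly_Mapping.lookup x G) (Poly_Mapping.single G 1)) k" by simp
qed

lemma hom_determined:
  assumes "module_hom chain_scale (*) f"
  shows "f x = extend (\<lambda>G. f (Poly_Mapping.single G 1)) x"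
proof -
  interpret f: module_hom chain_scale "(*)" f by (rule assms)
  show ?thesis
    by (subst chain_sum) (simp add: f.sum f.scale extend_def)
qed

text \<open>The factor \<open>1 / 2\<close> of \<open>diff_graph\<close> reappears, because
  \<open>split_sum\<close> counts each way of splitting twice.\<close>

lemma extend_diff_graph: "extend f (diff_graph G) = split_sum f G / 2"
proof -
  interpret f: module_hom chain_scale "(*)" "extend f" by (rule extend_hom)
  show ?thesis
    unfolding diff_graph_def split_sum_def f.sum extend_single by (simp add: sum_divide_distrib)
qed

section \<open>From exactness of cochains to cycles and boundaries\<close>

text \<open>A basis of \<open>B\<close> together with \<open>x\<close> is independent, so a linear
  functional can be prescribed on it. This is what allows the return from the dual complex to
  chains.\<close>

lemma separating_functional:
  assumes B: "hchain.subspace B" and x: "x \<notin> B"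
  obtains f where "module_hom chain_scale (*) f" "\<And>b. b \<in> B \<Longrightarrow> f b = (0 :: rat)" "f x = 1"
proof -
  interpret rat: vector_space "(*) :: rat \<Rightarrow> rat \<Rightarrow> rat"
    by unfold_locales (auto simp: algebra_simps)
  interpret pair: vector_space_pair chain_scale "(*) :: rat \<Rightarrow> rat \<Rightarrow> rat" ..
  obtain C where C: "C \<subseteq> B" "hchain.independent C" "B \<subseteq> hchain.span C"
    using hchain.maximal_independent_subset .
  have "hchain.span C \<subseteq> B" by (rule hchain.span_minimal[OF C(1) B])
  then have "hchain.independent (insert x C)"
    using x C(2) by (intro hchain.independent_insertI) auto
  then obtain f where f: "Vector_Spaces.linear chain_scale (*) f"
    "\<forall>y \<in> insert x C. f y = (if y = x then 1 else 0 :: rat)"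
    using pair.linear_independent_extend[of "insert x C" "\<lambda>y. if y = x then 1 else 0"] by blast
  have hom: "module_hom chain_scale (*) f" using f(1) by (simp add: Vector_Spaces.linear_def)
  interpret f: module_hom chain_scale "(*)" f by (rule hom)
  have "hchain.span C \<subseteq> {y. f y = 0}"
  proof (rule hchain.span_minimal)
    show "C \<subseteq> {y. f y = 0}" using f(2) x C(1) by auto
    show "hchain.subspace {y. f y = 0}" by (rule f.subspace_kernel)
  qed
  then show thesis using C(3) f(2) by (intro that[OF hom]) auto
qed

lemma relation_mem:
  assumes "G \<in> hairy_graphs m n g h d" "p permutes {..<length (edges G)}" "q permutes {..<num_internal G}"
    "r permutes {..<num_hairs G}" "F \<subseteq> {..<length (edges G)}"
  shows "Poly_Mapping.single (reorient p q r F G) 1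
    - Poly_Mapping.single G (orientation_sign m n p q r F) \<in> relations m n g h d"
  unfolding relations_def using assms by (intro hchain.span_base) blast

lemma relations_minimal:
  assumes "hchain.subspace V"
    "\<And>p q r F G. G \<in> hairy_graphs m n g h d \<Longrightarrow> p permutes {..<length (edges G)} \<Longrightarrow>
      q permutes {..<num_internal G} \<Longrightarrow> r permutes {..<num_hairs G} \<Longrightarrow> F \<subseteq> {..<length (edges G)} \<Longrightarrow>
      Poly_Mapping.single (reorient p q r F G) 1 - Poly_Mapping.single G (orientation_sign m n p q r F) \<in> V"
  shows "relations m n g h d \<subseteq> V"
  unfolding relations_def by (rule hchain.span_minimal[OF _ assms(1)]) (use assms(2) in blast)

lemma relations_subspace: "hchain.subspace (relations m n g h d)"
  unfolding relations_def by (rule hchain.subspace_span)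

text \<open>Splitting a reoriented graph gives reoriented splittings, with the connecting edge and
  the new vertex left in place. The sign is therefore the same, and each summand of the difference
  is half of a relation.\<close>

lemma diff_relations:
  assumes h: "1 \<le> h" and x: "x \<in> relations m n g h (d + 1)"
  shows "diff_chain x \<in> relations m n g h d"
proof -
  let ?R = "relations m n g h d"
  have "relations m n g h (d + 1) \<subseteq> {x. diff_chain x \<in> ?R}"
  proof (rule relations_minimal)
    show "hchain.subspace {x. diff_chain x \<in> ?R}"
      using diff.subspace_vimage[OF relations_subspace[of m n g h d]] by (simp add: vimage_def)
    fix p q r F G
    assume G: "G \<in> hairy_graphs m n g h (d + 1)" and p: "p permutes {..<length (edges G)}"
      and q: "q permutes {..<num_internal G}" and r: "r permutes {..<num_hairs G}"
      and F: "F \<subseteq> {..<length (edges G)}"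
    let ?s = "orientation_sign m n p q r F" and ?G = "reorient p q r F G"
    let ?p = "\<lambda>k. case k of 0 \<Rightarrow> 0 | Suc j \<Rightarrow> Suc (p j)" and ?f = "hedge_map p F"
    let ?v = "num_internal G"
    have num: "G \<in> hgraphs h (g + h - 1) ?v"
      and v: "int (Suc ?v) = (n - 1) * (int g + int h - 1) - m * (int h - 1) - d"
      using G unfolding hairy_graphs_iff[OF h] by auto
    have sgn: "orientation_sign m n ?p q r (Suc ` F) = ?s"
      unfolding orientation_sign_def sign_shift(2)[OF p] by (simp add: card_image)
    have "inj_on ((`) ?f) A" for A
      by (rule inj_onI) (simp add: inj_image_eq_iff[OF hedge_map(1)[OF p]])
    then have "diff_graph ?G = (\<Sum>i < ?v. \<Sum>S \<in> splittings G i.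
        Poly_Mapping.single (split_vertex (q i) (?f ` S) ?G) (1 / 2))"
      unfolding diff_graph_def reorient_simps
      by (subst sum.permute[OF q])
        (simp add: splittings_reorient[OF p permutes_inj[OF q] permutes_inj[OF r]] sum.reindex)
    also have "\<dots> = (\<Sum>i < ?v. \<Sum>S \<in> splittings G i.
        Poly_Mapping.single (reorient ?p q r (Suc ` F) (split_vertex i S G)) (1 / 2))"
      using split_reorient[OF p q splittings_sub] by (intro sum.cong refl) simp
    finally have "diff_chain (Poly_Mapping.single ?G 1 - Poly_Mapping.single G ?s) =
        (\<Sum>i < ?v. \<Sum>S \<in> splittings G i.
          Poly_Mapping.single (reorient ?p q r (Suc ` F) (split_vertex i S G)) (1 / 2)
          - Poly_Mapping.single (split_vertex i S G) (?s / 2))"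
      by (simp add: diff.diff diff_single diff_graph_def[of G] hchain.scale_sum_right single_scale sum_subtractf)
    also have "\<dots> \<in> ?R"
    proof (intro hchain.subspace_sum[OF relations_subspace])
      fix i S assume i: "i \<in> {..<?v}" and S: "S \<in> splittings G i"
      have "split_vertex i S G \<in> hairy_graphs m n g h d"
        unfolding hairy_graphs_numbered[OF h v] using numbered_split[OF num _ S] i by simp
      then have "Poly_Mapping.single (reorient ?p q r (Suc ` F) (split_vertex i S G)) 1
          - Poly_Mapping.single (split_vertex i S G) ?s \<in> ?R"
        unfolding sgn[symmetric]
        using sign_shift(1)[OF p] permutes_subset[OF q, of "{..<Suc ?v}"] r F
        by (intro relation_mem) auto
      then have "chain_scale (1 / 2) (Poly_Mapping.single (reorient ?p q r (Suc ` F) (split_vertex i S G)) 1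
          - Poly_Mapping.single (split_vertex i S G) ?s) \<in> ?R"
        by (rule hchain.subspace_scale[OF relations_subspace])
      then show "Poly_Mapping.single (reorient ?p q r (Suc ` F) (split_vertex i S G)) (1 / 2)
          - Poly_Mapping.single (split_vertex i S G) (?s / 2) \<in> ?R"
        by (simp add: hchain.scale_right_diff_distrib single_scale)
    qed
    finally show "Poly_Mapping.single ?G 1 - Poly_Mapping.single G ?s \<in> {x. diff_chain x \<in> ?R}" by simp
  qed
  then show ?thesis using x by blast
qed

lemma hchains_subspace: "hchain.subspace (hchains m n g h d)"
proof (rule hchain.subspaceI)
  show "x + y \<in> hchains m n g h d" if "x \<in> hchains m n g h d" "y \<in> hchains m n g h d" for x y
    using that keys_add[of x y] by (auto simp: hchains_def)
  show "chain_scale c x \<in> hchains m n g h d" if "x \<in> hchains m n g h d" for c x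
    using that keys_chain_scale[of c x] by (auto simp: hchains_def)
qed (simp add: hchains_def)

text \<open>Suppose that \<open>z\<close> lies outside the sum of relations and boundaries. A
  functional that vanishes on this sum with value \<open>1\<close> at \<open>z\<close> is an
  oriented cocycle, hence equals \<open>split_sum k\<close> on graphs with \<open>v\<close> vertices
  for an oriented \<open>k\<close>. Since \<open>k\<close> vanishes on relations, it vanishes at
  \<open>diff_chain z\<close>; but its value there is half of the functional at
  \<open>z\<close>.\<close>

lemma cycles_are_boundaries:
  assumes h: "1 \<le> h" and v: "int v = (n - 1) * (int g + int h - 1) - m * (int h - 1) - d"
    and v1: "1 \<le> v" and vt: "Suc v < g + h - 1"
    and z: "z \<in> hchains m n g h d" "diff_chain z \<in> relations m n g h (d - 1)"
  obtains a x where "a \<in> relations m n g h d" "x \<in> hchains m n g h (d + 1)" "z = a + diff_chain x"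
proof -
  let ?R = "relations m n g h d" and ?t = "g + h - 1"
  define B where "B = {a + b | a b. a \<in> ?R \<and> b \<in> diff_chain ` hchains m n g h (d + 1)}"
  have sB: "hchain.subspace B"
    unfolding B_def
    by (rule hchain.subspace_sums[OF relations_subspace diff.subspace_image[OF hchains_subspace]])
  have RB: "?R \<subseteq> B"
  proof
    fix a assume "a \<in> ?R"
    moreover have "0 \<in> diff_chain ` hchains m n g h (d + 1)"
      using hchain.subspace_0[OF hchains_subspace] diff.zero by (metis image_eqI)
    ultimately show "a \<in> B" unfolding B_def by force
  qed
  have DB: "diff_chain ` hchains m n g h (d + 1) \<subseteq> B"
    using hchain.subspace_0[OF relations_subspace] unfolding B_def by force
  have "z \<in> B"
  proof (rule ccontr)
    assume "z \<notin> B"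
    then obtain f where f: "module_hom chain_scale (*) f" "\<And>b. b \<in> B \<Longrightarrow> f b = (0 :: rat)" "f z = 1"
      using separating_functional[OF sB] by blast
    interpret f: module_hom chain_scale "(*)" f by (rule f(1))
    define f1 where "f1 G = f (Poly_Mapping.single G 1)" for G
    have fs: "f (Poly_Mapping.single G c) = c * f1 G" for G c
      using f.scale[of c "Poly_Mapping.single G 1"] by (simp add: single_scale f1_def)
    have fe: "f x = extend f1 x" for x
      using hom_determined[OF f(1)] unfolding f1_def .
    note graphs = hairy_graphs_numbered[OF h v]
    have or: "oriented m n (hgraphs h ?t v) f1"
      unfolding oriented_def
    proof (intro allI impI, elim conjE)
      fix H p q r F assume "H \<in> hgraphs h ?t v" "p permutes {..<length (edges H)}"
        "q permutes {..<num_internal H}" "r permutes {..<num_hairs H}" "F \<subseteq> {..<length (edges H)}"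
      then have "f (Poly_Mapping.single (reorient p q r F H) 1
          - Poly_Mapping.single H (orientation_sign m n p q r F)) = 0"
        using RB by (intro f(2)) (auto simp: graphs intro!: relation_mem)
      then show "f1 (reorient p q r F H) = orientation_sign m n p q r F * f1 H"
        by (simp add: f.diff fs)
    qed
    have cl: "split_sum f1 H = 0" if "Suc w = v" "H \<in> hgraphs h ?t w" for w H
    proof -
      have "int w = (n - 1) * (int g + int h - 1) - m * (int h - 1) - (d + 1)" using that(1) v by simp
      then have "Poly_Mapping.single H 1 \<in> hchains m n g h (d + 1)"
        using that(2) by (simp add: hchains_def hairy_graphs_numbered[OF h])
      then have "f (diff_chain (Poly_Mapping.single H 1)) = 0" using DB by (intro f(2)) blast
      then show ?thesis by (simp add: diff_single fe extend_diff_graph)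
    qed
    have "\<exists>k. oriented m n (hgraphs h ?t (Suc v)) k \<and>
        (\<forall>H \<in> hgraphs h ?t v. split_sum k H = f1 H)"
      by (rule exact_numbered[OF vt h v1 or]) (use cl in blast)+
    then obtain k where k: "oriented m n (hgraphs h ?t (Suc v)) k"
      "\<And>H. H \<in> hgraphs h ?t v \<Longrightarrow> split_sum k H = f1 H"
      by blast
    interpret k: module_hom chain_scale "(*)" "extend k" by (rule extend_hom)
    have v': "int (Suc v) = (n - 1) * (int g + int h - 1) - m * (int h - 1) - (d - 1)" using v by simp
    have "relations m n g h (d - 1) \<subseteq> {x. extend k x = 0}"
    proof (rule relations_minimal)
      show "hchain.subspace {x. extend k x = 0}" by (rule k.subspace_kernel)
      show "Poly_Mapping.single (reorient p q r F G) 1 - Poly_Mapping.single G (orientation_sign m n p q r F)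
          \<in> {x. extend k x = 0}"
        if "G \<in> hairy_graphs m n g h (d - 1)" "p permutes {..<length (edges G)}"
          "q permutes {..<num_internal G}" "r permutes {..<num_hairs G}" "F \<subseteq> {..<length (edges G)}"
        for p q r F G
        using that orientedD[OF k(1), of G p q r F] hairy_graphs_numbered[OF h v']
        by (simp add: k.diff extend_single)
    qed
    then have "0 = extend k (diff_chain z)" using z(2) by auto
    also have "\<dots> = (\<Sum>G \<in> Poly_Mapping.keys z. Poly_Mapping.lookup z G * (split_sum k G / 2))"
      unfolding diff_chain_def k.sum k.scale extend_diff_graph ..
    also have "\<dots> = (\<Sum>G \<in> Poly_Mapping.keys z. Poly_Mapping.lookup z G * f1 G / 2)"
      using z(1) k(2) unfolding hchains_def graphs by (intro sum.cong refl) auto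
    also have "\<dots> = f z / 2" unfolding fe extend_def by (simp add: sum_divide_distrib)
    finally show False using f(3) by simp
  qed
  then show thesis using that unfolding B_def by blast
qed

section \<open>Triviality of the homology group\<close>

text \<open>The quotients are sets of cosets and are computed by hand: every cycle is a boundary,
  and the set of boundaries absorbs products with each of its members, so only one coset
  remains.\<close>

lemma homology_trivial:
  assumes h: "1 \<le> h"
    and ex: "\<And>z. z \<in> hchains m n g h d \<Longrightarrow> diff_chain z \<in> relations m n g h (d - 1) \<Longrightarrow>
      \<exists>a \<in> relations m n g h d. \<exists>x \<in> hchains m n g h (d + 1). z = a + diff_chain x"
  shows "trivial_group (HGC_homology m n g h d)"
proof -
  define R where "R = relations m n g h"
  define C where "C = hchains m n g h"
  define coset where "coset d' a = R d' #>\<^bsub>hchain_group m n g h d'\<^esub> a" for d' a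
  have sR: "hchain.subspace (R d')" and sC: "hchain.subspace (C d')" for d'
    unfolding R_def C_def by (rule relations_subspace hchains_subspace)+
  have mem: "y \<in> coset d' a \<longleftrightarrow> y - a \<in> R d'" for d' y a
    unfolding coset_def r_coset_def hchain_group_def
    by (auto simp: algebra_simps intro!: bexI[of _ "y - a"])
  have coset_eq: "coset d' a = coset d' b" if "a - b \<in> R d'" for d' a b
  proof (rule Set.set_eqI)
    fix y
    show "y \<in> coset d' a \<longleftrightarrow> y \<in> coset d' b"
      unfolding mem
      using hchain.subspace_add[OF sR _ that, of "y - a"] hchain.subspace_diff[OF sR _ that, of "y - b"]
      by auto
  qed
  have coset_0: "coset d' 0 = R d'" for d' by (rule Set.set_eqI) (simp add: mem)
  have self: "a \<in> coset d' a" for d' a using hchain.subspace_0[OF sR] by (simp add: mem)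
  have mult: "coset d a <#>\<^bsub>hchain_group m n g h d\<^esub> coset d b = coset d (a + b)" for a b
  proof (rule Set.set_eqI)
    fix y
    have "y \<in> coset d a <#>\<^bsub>hchain_group m n g h d\<^esub> coset d b \<longleftrightarrow>
        (\<exists>u v. u - a \<in> R d \<and> v - b \<in> R d \<and> y = u + v)"
      by (auto simp: set_mult_def hchain_group_def Bex_def mem)
    also have "\<dots> \<longleftrightarrow> y - (a + b) \<in> R d"
    proof
      assume "\<exists>u v. u - a \<in> R d \<and> v - b \<in> R d \<and> y = u + v"
      then obtain u v where "u - a \<in> R d" "v - b \<in> R d" "y = u + v" by blast
      then show "y - (a + b) \<in> R d"
        using hchain.subspace_add[OF sR, of "u - a" d "v - b"] by (simp add: algebra_simps)
    next
      assume "y - (a + b) \<in> R d"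
      then show "\<exists>u v. u - a \<in> R d \<and> v - b \<in> R d \<and> y = u + v"
        using hchain.subspace_0[OF sR]
        by (intro exI[of _ "y - b"] exI[of _ b]) (simp add: algebra_simps)
    qed
    finally show "y \<in> coset d a <#>\<^bsub>hchain_group m n g h d\<^esub> coset d b \<longleftrightarrow> y \<in> coset d (a + b)"
      by (simp add: mem)
  qed
  have carrier: "carrier (HGC m n g h d') = coset d' ` C d'" "\<one>\<^bsub>HGC m n g h d'\<^esub> = R d'" for d'
    unfolding HGC_def FactGroup_def RCOSETS_def coset_def R_def C_def by (auto simp: hchain_group_def)
  have HGC_mult: "mult (HGC m n g h d) = set_mult (hchain_group m n g h d)"
    by (simp add: HGC_def FactGroup_def)
  have diff_coset: "HGC_diff m n g h (d' + 1) (coset (d' + 1) a) = coset d' (diff_chain a)" for d' a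
  proof -
    have "coset d' (diff_chain y) = coset d' (diff_chain a)" if "y \<in> coset (d' + 1) a" for y
      using that diff_relations[OF h, of "y - a" m n g d'] unfolding mem R_def
      by (intro coset_eq) (simp add: R_def diff.diff)
    then have "(\<Union>y \<in> coset (d' + 1) a. coset d' (diff_chain y)) =
        (\<Union>y \<in> coset (d' + 1) a. coset d' (diff_chain a))"
      by (intro SUP_cong refl)
    also have "\<dots> = coset d' (diff_chain a)" using self[of a "d' + 1"] by blast
    finally show ?thesis unfolding HGC_diff_def coset_def R_def by simp
  qed
  define Bd where "Bd = (\<lambda>x. coset d (diff_chain x)) ` C (d + 1)"
  have bd: "HGC_boundaries m n g h d = Bd"
    unfolding HGC_boundaries_def carrier Bd_def image_image diff_coset ..
  have cyc: "X \<in> Bd" if X: "X \<in> HGC_cycles m n g h d" for X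
  proof -
    obtain z where z: "z \<in> C d" "X = coset d z" and "HGC_diff m n g h d X = R (d - 1)"
      using X unfolding HGC_cycles_def kernel_def carrier by auto
    then have "coset (d - 1) (diff_chain z) = R (d - 1)"
      using diff_coset[of "d - 1" z] by simp
    then have "diff_chain z \<in> R (d - 1)" using self by blast
    then obtain a x where "a \<in> R d" "x \<in> C (d + 1)" "z = a + diff_chain x"
      using ex z(1) unfolding R_def C_def by blast
    then show ?thesis unfolding Bd_def z(2) by (auto intro!: image_eqI[of _ _ x] coset_eq)
  qed
  \<comment> \<open>The class of zero is a cycle, so the quotient has at least one element.\<close>
  have ne: "coset d 0 \<in> HGC_cycles m n g h d"
    using diff_coset[of "d - 1" 0] imageI[OF hchain.subspace_0[OF sC[of d]], of "coset d"]
    unfolding HGC_cycles_def kernel_def carrier by (simp add: coset_0)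
  let ?Z = "(HGC m n g h d)\<lparr>carrier := HGC_cycles m n g h d\<rparr>"
  have Zmult: "mult ?Z = set_mult (hchain_group m n g h d)" using HGC_mult by simp
  have absorb: "(\<lambda>b. b <#>\<^bsub>hchain_group m n g h d\<^esub> X) ` Bd = Bd" if "X \<in> Bd" for X
  proof -
    obtain y where y: "y \<in> C (d + 1)" "X = coset d (diff_chain y)" using \<open>X \<in> Bd\<close> unfolding Bd_def by blast
    have "(\<lambda>b. b <#>\<^bsub>hchain_group m n g h d\<^esub> X) ` Bd = (\<lambda>x. coset d (diff_chain (x + y))) ` C (d + 1)"
      unfolding Bd_def y(2) image_image mult diff.add ..
    also have "\<dots> = Bd"
    proof (intro equalityI subsetI)
      fix b assume "b \<in> (\<lambda>x. coset d (diff_chain (x + y))) ` C (d + 1)"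
      then show "b \<in> Bd" unfolding Bd_def using hchain.subspace_add[OF sC _ y(1)] by blast
    next
      fix b assume "b \<in> Bd"
      then obtain x where x: "x \<in> C (d + 1)" "b = coset d (diff_chain x)" unfolding Bd_def by blast
      then show "b \<in> (\<lambda>x. coset d (diff_chain (x + y))) ` C (d + 1)"
        using hchain.subspace_diff[OF sC x(1) y(1)] by (intro image_eqI[of _ _ "x - y"]) simp_all
    qed
    finally show ?thesis .
  qed
  have rc: "Bd #>\<^bsub>?Z\<^esub> X = Bd" if "X \<in> Bd" for X
  proof -
    have "Bd #>\<^bsub>?Z\<^esub> X = (\<lambda>b. b <#>\<^bsub>hchain_group m n g h d\<^esub> X) ` Bd"
      unfolding r_coset_def Zmult by blast
    then show ?thesis using absorb[OF that] by simp
  qed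
  have car: "carrier (HGC_homology m n g h d) = {Bd}"
  proof -
    have "carrier (HGC_homology m n g h d) = (\<lambda>X. Bd #>\<^bsub>?Z\<^esub> X) ` HGC_cycles m n g h d"
      unfolding HGC_homology_def FactGroup_def RCOSETS_def bd by auto
    also have "\<dots> = (\<lambda>X. Bd) ` HGC_cycles m n g h d"
      by (rule image_cong[OF refl]) (rule rc[OF cyc])
    also have "\<dots> = {Bd}" using ne by blast
    finally show ?thesis .
  qed
  have one: "\<one>\<^bsub>HGC_homology m n g h d\<^esub> = Bd"
    unfolding HGC_homology_def FactGroup_def bd by simp
  have mul: "Bd \<otimes>\<^bsub>HGC_homology m n g h d\<^esub> Bd = Bd"
  proof -
    have "Bd \<otimes>\<^bsub>HGC_homology m n g h d\<^esub> Bd = (\<Union>X \<in> Bd. (\<lambda>b. b <#>\<^bsub>hchain_group m n g h d\<^esub> X) ` Bd)"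
      unfolding HGC_homology_def FactGroup_def set_mult_def[of ?Z] Zmult by auto
    also have "\<dots> = (\<Union>X \<in> Bd. Bd)" using absorb by simp
    also have "\<dots> = Bd" using cyc[OF ne] by blast
    finally show ?thesis .
  qed
  have "group (HGC_homology m n g h d)"
    by (rule groupI) (simp_all add: car one mul)
  then show ?thesis unfolding trivial_group_def car one by simp
qed

section \<open>Translation between degrees and numbers of internal vertices\<close>

theorem lemma1p2:
  fixes m n d :: int and g h :: nat
  assumes "1 \<le> m" and "m \<le> n" and "2 \<le> n" and "1 \<le> h"
    and "\<not> ((n - m - 2) * (int g + int h - 1) + (m - 1) * int g + 1 \<le> d \<and>
            d \<le> (n - m - 2) * (int g + int h - 1) + m * int g + 1)"
  shows "trivial_group (HGC_homology m n g h d)"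
proof (rule homology_trivial)
  show h: "1 \<le> h" by (rule assms)
  let ?t = "g + h - 1"
  let ?T = "int g + int h - 1"
  \<comment> \<open>The number of internal vertices that the degree \<open>d\<close> forces; it may
    be negative.\<close>
  define w where "w = (n - 1) * ?T - m * (int h - 1) - d"
  have w: "w = (n - m - 1) * ?T + m * int g - d"
    unfolding w_def by (simp add: algebra_simps)
  \<comment> \<open>In terms of \<open>w\<close> the range of degrees is the interval from
    \<open>?T - 1\<close> to \<open>?T + int g - 1\<close>, with the order reversed.\<close>
  have range: "w < ?T - 1 \<or> ?T + int g - 1 < w"
    using assms(5) unfolding w by (auto simp: algebra_simps)
  fix z assume z: "z \<in> hchains m n g h d" "diff_chain z \<in> relations m n g h (d - 1)"
  show "\<exists>a \<in> relations m n g h d. \<exists>x \<in> hchains m n g h (d + 1). z = a + diff_chain x"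
  \<comment> \<open>For \<open>w\<close> between \<open>1\<close> and \<open>?T - 2\<close>
    exactness applies. For every other \<open>w\<close> outside the range there are no graphs at
    all.\<close>
  proof (cases "1 \<le> w \<and> w < ?T - 1")
    case True
    obtain a x where "a \<in> relations m n g h d" "x \<in> hchains m n g h (d + 1)" "z = a + diff_chain x"
      by (rule cycles_are_boundaries[OF h _ _ _ z, of "nat w"]) (use True in \<open>auto simp: w_def\<close>)
    then show ?thesis by blast
  next
    case False
    have "hairy_graphs m n g h d = {}"
    proof (rule ccontr)
      assume "hairy_graphs m n g h d \<noteq> {}"
      then obtain H where "H \<in> hairy_graphs m n g h d" by blast
      then have H: "H \<in> hgraphs h ?t (num_internal H)" "int (num_internal H) = w"
        unfolding hairy_graphs_iff[OF h] w_def by auto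
      note N = hgraphsD[OF H(1)]
      have E: "int (length (edges H)) = w + ?T" using N(4) H(2) h by simp
      have "int (3 * num_internal H + num_hairs H) \<le> int (2 * length (edges H))"
        using valence_count(1)[OF N(1)] by (simp only: of_nat_le_iff)
      \<comment> \<open>Cancelling \<open>2 * w\<close> leaves
        \<open>w \<le> 2 * ?T - int h\<close>, and the right-hand side is
        \<open>?T + int g - 1\<close>.\<close>
      then have "3 * w + int h \<le> 2 * (w + ?T)" using N(2) H(2) E by simp
      \<comment> \<open>A graph without internal vertices has \<open>g = 0\<close> and
        \<open>h = 2\<close>, so it is the single edge; then \<open>w = 0 = ?T - 1\<close> lies in
        the range.\<close>
      moreover have "2 * ?T = int h" if "w = 0"
      proof -
        have "int (2 * length (edges H)) = int (num_hairs H)"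
          using valence_count(2)[OF N(1)] H(2) that by simp
        then show ?thesis using N(2) E that by simp
      qed
      ultimately show False using False range H(2) h by (cases "w = 0") auto
    qed
    then have "z = 0" using z(1) by (simp add: hchains_def)
    then have "z = 0 + diff_chain 0" by (simp add: diff.zero)
    then show ?thesis
      using hchain.subspace_0[OF relations_subspace] hchain.subspace_0[OF hchains_subspace] by blast
  qed
qed

end
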